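(* Let $n\ge 4$ and let $S^{\lambda,\mu}$ be an irreducible representation of $B_{n-2}$, where $\lambda,\mu$ are partitions with $|\lambda|+|\mu|=n-2$. Then: 1. $\mathrm{ind}^{B_n}_{B_{n-2}\times B_2}S^{\lambda,\mu}\boxtimes S^{(2),\emptyset}=\bigoplus_{\tau\in\bar{\bar{\lambda}}}S^{\tau,\mu}$; 2. $\mathrm{ind}^{B_n}_{B_{n-2}\times B_2}S^{\lambda,\mu}\boxtimes S^{(1^2),\emptyset}=\bigoplus_{\tau\in\tilde{\bar{\lambda}}}S^{\tau,\mu}$; 3. $\mathrm{ind}^{B_n}_{B_{n-2}\times B_2}S^{\lambda,\mu}\boxtimes S^{(1),(1)}=\bigoplus_{\tau\in\bar{\lambda},\,\rho\in\bar{\mu}}S^{\tau,\rho}$; 4. $\mathrm{ind}^{B_n}_{B_{n-2}\times B_2}S^{\lambda,\mu}\boxtimes S^{\emptyset,(1^2)}=\bigoplus_{\rho\in\tilde{\bar{\mu}}}S^{\lambda,\rho}$; 5. $\mathrm{ind}^{B_n}_{B_{n-2}\times B_2}S^{\lambda,\mu}\boxtimes S^{\emptyset,(2)}=\bigoplus_{\rho\in\bar{\bar{\mu}}}S^{\lambda,\rho}$.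
   Context: All representations are finite-dimensional over $\mathbb{C}$. Let $F=\mathbb{Z}/2$ and $B_m=F\wr S_m=F^m\rtimes S_m$, where $S_m$ permutes the coordinates of $F^m$. $B_{m-k}\times B_k$ is identified with $F\wr(S_{m-k}\times S_k)\leqslant B_m$. $\mathbf 1$ denotes the trivial and $\epsilon$ the sign (nontrivial one-dimensional) representation of $F$. For $D\in\{\mathbf 1,\epsilon\}$ and a representation $E$ of $S_m$, $(D;E)$ is the representation of $B_m$ on the space of $E$ in which $(f,\sigma)$ acts as $D(f_1)\cdots D(f_m)$ times the action of $\sigma$. For partitions $\lambda\vdash m-k$, $\mu\vdash k$, with Specht modules $S^\lambda,S^\mu$, set $S^{\lambda,\mu}:=\mathrm{ind}^{B_m}_{B_{m-k}\times B_k}(\mathbf 1;S^\lambda)\boxtimes(\epsilon;S^\mu)$; these are the irreducible representations of $B_m$. For a partition $\lambda$ of $m$: $\bar\lambda$ is the set of $\tau\vdash m+1$ such that $S^\tau$ is a summand of $\mathrm{ind}^{S_{m+1}}_{S_m\times S_1}S^\lambda\boxtimes\mathbf 1$; $\bar{\bar\lambda}$ is the set of $\tau\vdash m+2$ such that $S^\tau$ is a summand of $\mathrm{ind}^{S_{m+2}}_{S_m\times S_2}S^\lambda\boxtimes\mathbf 1_{S_2}$; $\tilde{\bar\lambda}$ is the set of $\tau\vdash m+2$ such that $S^\tau$ is a summand of $\mathrm{ind}^{S_{m+2}}_{S_m\times S_2}S^\lambda\boxtimes\epsilon_{S_2}$, where $\epsilon_{S_2}$ is the sign representation of $S_2$.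 *)

theory Defs
  imports
    Complex_Main
    "HOL-Library.Function_Algebras"
    "HOL-Algebra.Algebra"
begin

section \<open>Finite-dimensional complex representations\<close>

text \<open>
  Every vector space below is a subspace of a space \<open>'x \<Rightarrow> complex\<close> of complex-valued functions,
  with pointwise addition and scalar multiplication.  This ambient space is what makes tensor
  products, induced representations and direct sums available as concrete functions on products
  of index types.
\<close>

definition cscale :: "complex \<Rightarrow> ('x \<Rightarrow> complex) \<Rightarrow> 'x \<Rightarrow> complex"
  where "cscale c v = (\<lambda>x. c * v x)"

global_interpretation cfun: vector_space "cscale :: complex \<Rightarrow> ('x \<Rightarrow> complex) \<Rightarrow> 'x \<Rightarrow> complex"
  by unfold_locales (simp_all add: cscale_def fun_eq_iff algebra_simps)

record ('g, 'x) rep =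
  rep_space :: "('x \<Rightarrow> complex) set"
  rep_act :: "'g \<Rightarrow> ('x \<Rightarrow> complex) \<Rightarrow> 'x \<Rightarrow> complex"

definition linear_on :: "('x \<Rightarrow> complex) set \<Rightarrow> (('x \<Rightarrow> complex) \<Rightarrow> 'y \<Rightarrow> complex) \<Rightarrow> bool"
  where "linear_on V f \<longleftrightarrow>
    (\<forall>u\<in>V. \<forall>v\<in>V. f (u + v) = f u + f v) \<and> (\<forall>c. \<forall>v\<in>V. f (cscale c v) = cscale c (f v))"

definition representation :: "('g, 'm) monoid_scheme \<Rightarrow> ('g, 'x) rep \<Rightarrow> bool"
  where "representation G R \<longleftrightarrow>
    group G \<and>
    cfun.subspace (rep_space R) \<and>
    (\<exists>B. finite B \<and> cfun.span B = rep_space R) \<and>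
    (\<forall>g\<in>carrier G. linear_on (rep_space R) (rep_act R g) \<and>
        (\<forall>v\<in>rep_space R. rep_act R g v \<in> rep_space R)) \<and>
    (\<forall>v\<in>rep_space R. rep_act R \<one>\<^bsub>G\<^esub> v = v) \<and>
    (\<forall>g\<in>carrier G. \<forall>h\<in>carrier G. \<forall>v\<in>rep_space R.
        rep_act R (g \<otimes>\<^bsub>G\<^esub> h) v = rep_act R g (rep_act R h v))"

definition rep_iso :: "('g, 'm) monoid_scheme \<Rightarrow> ('g, 'x) rep \<Rightarrow> ('g, 'y) rep \<Rightarrow> bool"
  where "rep_iso G R Q \<longleftrightarrow>
    representation G R \<and> representation G Q \<and>
    (\<exists>\<phi>. linear_on (rep_space R) \<phi> \<and> bij_betw \<phi> (rep_space R) (rep_space Q) \<and>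
        (\<forall>g\<in>carrier G. \<forall>v\<in>rep_space R. \<phi> (rep_act R g v) = rep_act Q g (\<phi> v)))"

text \<open>\<open>R\<close> is (isomorphic to) a direct summand of \<open>W\<close>.\<close>

definition summand :: "('g, 'm) monoid_scheme \<Rightarrow> ('g, 'x) rep \<Rightarrow> ('g, 'y) rep \<Rightarrow> bool"
  where "summand G R W \<longleftrightarrow> representation G W \<and>
    (\<exists>U U'. representation G (W\<lparr>rep_space := U\<rparr>) \<and> representation G (W\<lparr>rep_space := U'\<rparr>) \<and>
        rep_space W = {u + u' | u u'. u \<in> U \<and> u' \<in> U'} \<and> U \<inter> U' = {0} \<and>
        rep_iso G R (W\<lparr>rep_space := U\<rparr>))"

definition one_dim :: "('g \<Rightarrow> complex) \<Rightarrow> ('g, unit) rep"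
  where "one_dim \<chi> = \<lparr>rep_space = UNIV, rep_act = (\<lambda>g. cscale (\<chi> g))\<rparr>"

text \<open>
  Direct sum over an index set \<open>I\<close>, to be used for finite \<open>I\<close> only: an element is the function
  \<open>(i, x) \<mapsto> F (i, x)\<close> whose slice at \<open>i\<close> is the \<open>i\<close>-th component.
\<close>

definition direct_sum :: "'i set \<Rightarrow> ('i \<Rightarrow> ('g, 'x) rep) \<Rightarrow> ('g, 'i \<times> 'x) rep"
  where "direct_sum I R =
    \<lparr>rep_space = {F. (\<forall>i\<in>I. (\<lambda>x. F (i, x)) \<in> rep_space (R i)) \<and> (\<forall>i x. i \<notin> I \<longrightarrow> F (i, x) = 0)},
     rep_act = (\<lambda>g F (i, x). if i \<in> I then rep_act (R i) g (\<lambda>x'. F (i, x')) x else 0)\<rparr>"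

text \<open>
  External tensor product: the pure tensor of \<open>v\<close> and \<open>w\<close> is the function
  \<open>(x, y) \<mapsto> v x * w y\<close>, and \<open>(g, h)\<close> acts by applying \<open>g\<close> in the first variable and then \<open>h\<close> in the
  second; on a pure tensor this gives \<open>(g v) x * (h w) y\<close>.
\<close>

definition ext_tensor :: "('g, 'x) rep \<Rightarrow> ('h, 'y) rep \<Rightarrow> ('g \<times> 'h, 'x \<times> 'y) rep"  (infixr "\<boxtimes>" 75)
  where "R \<boxtimes> Q =
    \<lparr>rep_space = cfun.span {(\<lambda>(x, y). v x * w y) | v w. v \<in> rep_space R \<and> w \<in> rep_space Q},
     rep_act = (\<lambda>(g, h) F (x, y).
        rep_act Q h (\<lambda>y'. rep_act R g (\<lambda>x'. F (x', y')) x) y)\<rparr>"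

text \<open>
  Induction along an injective homomorphism \<open>\<iota>\<close> from \<open>H\<close> to a finite group \<open>G\<close>, which identifies
  \<open>H\<close> with a subgroup of \<open>G\<close>: the functions \<open>F\<close> from \<open>G\<close> to the space of \<open>R\<close> with
  \<open>F (g h) = h\<inverse> (F g)\<close>, where \<open>a \<in> G\<close> acts by \<open>(a F) g = F (a\<inverse> g)\<close>.  The vector \<open>F g\<close> is the slice
  \<open>x \<mapsto> F (g, x)\<close>, and \<open>F\<close> is made to vanish outside the carrier of \<open>G\<close>.
\<close>

definition induced ::
    "('g, 'm) monoid_scheme \<Rightarrow> ('h, 'n) monoid_scheme \<Rightarrow> ('h \<Rightarrow> 'g) \<Rightarrow> ('h, 'x) rep \<Rightarrow> ('g, 'g \<times> 'x) rep"
  where "induced G H \<iota> R =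
    \<lparr>rep_space = {F.
        (\<forall>g\<in>carrier G. (\<lambda>x. F (g, x)) \<in> rep_space R) \<and>
        (\<forall>g x. g \<notin> carrier G \<longrightarrow> F (g, x) = 0) \<and>
        (\<forall>g\<in>carrier G. \<forall>h\<in>carrier H.
            (\<lambda>x. F (g \<otimes>\<^bsub>G\<^esub> \<iota> h, x)) = rep_act R (inv\<^bsub>H\<^esub> h) (\<lambda>x. F (g, x)))},
     rep_act = (\<lambda>a F (g, x). if g \<in> carrier G then F (inv\<^bsub>G\<^esub> a \<otimes>\<^bsub>G\<^esub> g, x) else 0)\<rparr>"


section \<open>Specht modules\<close>

definition is_partition :: "nat list \<Rightarrow> bool"
  where "is_partition \<alpha> \<longleftrightarrow> sorted_wrt (\<ge>) \<alpha> \<and> 0 \<notin> set \<alpha>"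

text \<open>Boxes are pairs (row, column), both counted from 0.\<close>

definition young_diagram :: "nat list \<Rightarrow> (nat \<times> nat) set"
  where "young_diagram \<alpha> = {(i, j). i < length \<alpha> \<and> j < \<alpha> ! i}"

definition tableau :: "nat list \<Rightarrow> (nat \<times> nat \<Rightarrow> nat) \<Rightarrow> bool"
  where "tableau \<alpha> t \<longleftrightarrow> bij_betw t (young_diagram \<alpha>) {1..sum_list \<alpha>}"

text \<open>The tabloid of a tableau is recorded as the sequence of the sets of entries of its rows.\<close>

definition tabloid_of :: "nat list \<Rightarrow> (nat \<times> nat \<Rightarrow> nat) \<Rightarrow> nat \<Rightarrow> nat set"
  where "tabloid_of \<alpha> t = (\<lambda>i. t ` {b \<in> young_diagram \<alpha>. fst b = i})"

definition column_stabilizer :: "nat list \<Rightarrow> (nat \<times> nat \<Rightarrow> nat) \<Rightarrow> (nat \<Rightarrow> nat) set"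
  where "column_stabilizer \<alpha> t = {\<pi>. \<pi> permutes {1..sum_list \<alpha>} \<and>
    (\<forall>j. \<pi> ` t ` {b \<in> young_diagram \<alpha>. snd b = j} = t ` {b \<in> young_diagram \<alpha>. snd b = j})}"

definition polytabloid :: "nat list \<Rightarrow> (nat \<times> nat \<Rightarrow> nat) \<Rightarrow> (nat \<Rightarrow> nat set) \<Rightarrow> complex"
  where "polytabloid \<alpha> t = (\<lambda>T. \<Sum>\<pi>\<in>column_stabilizer \<alpha> t.
    of_int (sign \<pi>) * (if T = tabloid_of \<alpha> (\<pi> \<circ> t) then 1 else 0))"

text \<open>
  The Specht module inside the permutation module on tabloids, realised as functions on tabloids;
  \<open>\<sigma>\<close> sends the indicator function of \<open>T\<close> to that of \<open>\<sigma> T\<close>.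
\<close>

definition specht :: "nat list \<Rightarrow> (nat \<Rightarrow> nat, nat \<Rightarrow> nat set) rep"
  where "specht \<alpha> =
    \<lparr>rep_space = cfun.span {polytabloid \<alpha> t | t. tableau \<alpha> t},
     rep_act = (\<lambda>\<sigma> v T. v (\<lambda>i. inv' \<sigma> ` T i))\<rparr>"


section \<open>Adding boxes by induction from Young subgroups\<close>

text \<open>The embedding of \<open>S\<^sub>a \<times> S\<^sub>b\<close> in \<open>S\<^bsub>a+b\<^esub>\<close>, the second factor permuting \<open>{a+1..a+b}\<close>.\<close>

definition sym_embed :: "nat \<Rightarrow> nat \<Rightarrow> (nat \<Rightarrow> nat) \<times> (nat \<Rightarrow> nat) \<Rightarrow> nat \<Rightarrow> nat"
  where "sym_embed a b = (\<lambda>(\<sigma>, \<tau>) i.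
    if i \<in> {1..a} then \<sigma> i else if i \<in> {a+1..a+b} then a + \<tau> (i - a) else i)"

definition ind_summands :: "nat \<Rightarrow> ((nat \<Rightarrow> nat) \<Rightarrow> complex) \<Rightarrow> nat list \<Rightarrow> nat list set"
  where "ind_summands k \<chi> \<alpha> = (let m = sum_list \<alpha> in
    {\<tau>. is_partition \<tau> \<and> sum_list \<tau> = m + k \<and>
        summand (sym_group (m + k)) (specht \<tau>)
          (induced (sym_group (m + k)) (sym_group m \<times>\<times> sym_group k) (sym_embed m k)
            (specht \<alpha> \<boxtimes> one_dim \<chi>))})"

text \<open>
  For \<open>\<alpha>\<close> a partition of \<open>m\<close>: the Specht constituents of the module induced from
  \<open>S\<^sub>m \<times> S\<^sub>1\<close> with the trivial character of \<open>S\<^sub>1\<close>, and from \<open>S\<^sub>m \<times> S\<^sub>2\<close> with the trivial,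
  respectively the sign, character of \<open>S\<^sub>2\<close>.
\<close>

definition bar :: "nat list \<Rightarrow> nat list set"
  where "bar = ind_summands 1 (\<lambda>_. 1)"

definition bar_bar :: "nat list \<Rightarrow> nat list set"
  where "bar_bar = ind_summands 2 (\<lambda>_. 1)"

definition tilde_bar :: "nat list \<Rightarrow> nat list set"
  where "tilde_bar = ind_summands 2 (\<lambda>\<sigma>. of_int (sign \<sigma>))"


section \<open>The hyperoctahedral groups\<close>

text \<open>
  The wreath product of \<open>F\<close> with \<open>S\<^sub>m\<close>: \<open>\<sigma>\<close> acts on \<open>F\<^sup>m\<close> by \<open>(\<sigma> f) i = f (\<sigma>\<inverse> i)\<close>, so that
  \<open>(f, \<sigma>) (g, \<tau>) = (f \<cdot> \<sigma> g, \<sigma> \<tau>)\<close>.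
\<close>

definition wreath :: "('f, 'm) monoid_scheme \<Rightarrow> nat \<Rightarrow> ((nat \<Rightarrow> 'f) \<times> (nat \<Rightarrow> nat)) monoid"
  where "wreath F m = (let P = product_group {1..m} (\<lambda>_. F) in
    \<lparr>carrier = carrier P \<times> carrier (sym_group m),
     monoid.mult = (\<lambda>(f, \<sigma>) (g, \<tau>).
        (f \<otimes>\<^bsub>P\<^esub> (\<lambda>i\<in>{1..m}. g (inv' \<sigma> i)), \<sigma> \<otimes>\<^bsub>sym_group m\<^esub> \<tau>)),
     one = (\<one>\<^bsub>P\<^esub>, \<one>\<^bsub>sym_group m\<^esub>)\<rparr>)"

definition hyperoctahedral :: "nat \<Rightarrow> ((nat \<Rightarrow> int) \<times> (nat \<Rightarrow> nat)) monoid"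
  where "hyperoctahedral m = wreath (integer_mod_group 2) m"

definition wreath_embed :: "nat \<Rightarrow> nat \<Rightarrow>
    ((nat \<Rightarrow> 'f) \<times> (nat \<Rightarrow> nat)) \<times> ((nat \<Rightarrow> 'f) \<times> (nat \<Rightarrow> nat)) \<Rightarrow> (nat \<Rightarrow> 'f) \<times> (nat \<Rightarrow> nat)"
  where "wreath_embed a b = (\<lambda>((f, \<sigma>), (g, \<tau>)).
    (\<lambda>i\<in>{1..a+b}. if i \<le> a then f i else g (i - a), sym_embed a b (\<sigma>, \<tau>)))"

definition ind_hyp :: "nat \<Rightarrow> nat \<Rightarrow>
    ((nat \<Rightarrow> int) \<times> (nat \<Rightarrow> nat), 'x) rep \<Rightarrow> ((nat \<Rightarrow> int) \<times> (nat \<Rightarrow> nat), 'y) rep \<Rightarrow>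
    ((nat \<Rightarrow> int) \<times> (nat \<Rightarrow> nat), ((nat \<Rightarrow> int) \<times> (nat \<Rightarrow> nat)) \<times> 'x \<times> 'y) rep"
  where "ind_hyp a b R Q =
    induced (hyperoctahedral (a + b)) (hyperoctahedral a \<times>\<times> hyperoctahedral b) (wreath_embed a b)
      (R \<boxtimes> Q)"

text \<open>The characters of the two one-dimensional representations of \<open>\<int>/2 = {0, 1}\<close>.\<close>

definition triv_char :: "int \<Rightarrow> complex"
  where "triv_char a = 1"

definition sign_char :: "int \<Rightarrow> complex"
  where "sign_char a = (if a = 0 then 1 else - 1)"

text \<open>The representation \<open>(D; E)\<close> of the wreath product, \<open>D\<close> being given by its character.\<close>

definition wreath_rep :: "nat \<Rightarrow> ('f \<Rightarrow> complex) \<Rightarrow> (nat \<Rightarrow> nat, 'x) rep \<Rightarrow>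
    ((nat \<Rightarrow> 'f) \<times> (nat \<Rightarrow> nat), 'x) rep"
  where "wreath_rep m D E =
    \<lparr>rep_space = rep_space E,
     rep_act = (\<lambda>(f, \<sigma>) v. cscale (\<Prod>i=1..m. D (f i)) (rep_act E \<sigma> v))\<rparr>"

text \<open>The module \<open>S\<^bsup>\<alpha>,\<beta>\<^esup>\<close>.\<close>

definition bispecht :: "nat list \<Rightarrow> nat list \<Rightarrow>
    ((nat \<Rightarrow> int) \<times> (nat \<Rightarrow> nat),
     ((nat \<Rightarrow> int) \<times> (nat \<Rightarrow> nat)) \<times> (nat \<Rightarrow> nat set) \<times> (nat \<Rightarrow> nat set)) rep"
  where "bispecht \<alpha> \<beta> = ind_hyp (sum_list \<alpha>) (sum_list \<beta>)
    (wreath_rep (sum_list \<alpha>) triv_char (specht \<alpha>))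
    (wreath_rep (sum_list \<beta>) sign_char (specht \<beta>))"


section \<open>The wreath product is a group and the embeddings are injective homomorphisms\<close>

lemma sym_embed_permutes:
  assumes "\<sigma> permutes {1..a}" "\<tau> permutes {1..b}"
  shows "sym_embed a b (\<sigma>, \<tau>) permutes {1..a+b}"
proof (rule bij_imp_permutes)
  have s: "\<sigma> i \<in> {1..a} \<longleftrightarrow> i \<in> {1..a}" for i using permutes_in_image[OF assms(1)] .
  have t: "\<tau> i \<in> {1..b} \<longleftrightarrow> i \<in> {1..b}" for i using permutes_in_image[OF assms(2)] .
  have injs: "inj \<sigma>" "inj \<tau>" using assms permutes_inj by auto
  have into: "sym_embed a b (\<sigma>, \<tau>) i \<in> {1..a+b}" if "i \<in> {1..a+b}" for i
    using that s[of i] t[of "i-a"] by (auto simp: sym_embed_def)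
  have inj: "inj_on (sym_embed a b (\<sigma>, \<tau>)) {1..a+b}"
  proof (rule inj_onI)
    fix i j assume ij: "i \<in> {1..a+b}" "j \<in> {1..a+b}"
      and e: "sym_embed a b (\<sigma>, \<tau>) i = sym_embed a b (\<sigma>, \<tau>) j"
    have "\<sigma> i = \<sigma> j \<Longrightarrow> i = j" "\<tau> (i - a) = \<tau> (j - a) \<Longrightarrow> i - a = j - a"
      using injs by (auto dest: injD)
    with ij e s[of i] s[of j] t[of "i-a"] t[of "j-a"] show "i = j"
      by (auto simp: sym_embed_def split: if_splits)
  qed
  show "bij_betw (sym_embed a b (\<sigma>, \<tau>)) {1..a+b} {1..a+b}"
    unfolding bij_betw_def using inj into
    by (metis endo_inj_surj finite_atLeastAtMost image_subsetI)
qed (auto simp: sym_embed_def)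

lemma sym_embed_comp:
  assumes "\<sigma>' permutes {1..a}" "\<tau>' permutes {1..b}"
  shows "sym_embed a b (\<sigma> \<circ> \<sigma>', \<tau> \<circ> \<tau>') = sym_embed a b (\<sigma>, \<tau>) \<circ> sym_embed a b (\<sigma>', \<tau>')"
proof
  fix i
  have s: "\<sigma>' i \<in> {1..a} \<longleftrightarrow> i \<in> {1..a}" using permutes_in_image[OF assms(1)] .
  have t: "\<tau>' (i-a) \<in> {1..b} \<longleftrightarrow> i-a \<in> {1..b}" using permutes_in_image[OF assms(2)] .
  show "sym_embed a b (\<sigma> \<circ> \<sigma>', \<tau> \<circ> \<tau>') i = (sym_embed a b (\<sigma>, \<tau>) \<circ> sym_embed a b (\<sigma>', \<tau>')) i"
    using s t by (auto simp: sym_embed_def)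
qed

lemma sym_embed_inv:
  assumes "\<sigma> permutes {1..a}" "\<tau> permutes {1..b}"
  shows "inv' (sym_embed a b (\<sigma>, \<tau>)) = sym_embed a b (inv' \<sigma>, inv' \<tau>)"
proof -
  have "sym_embed a b (inv' \<sigma>, inv' \<tau>) \<circ> sym_embed a b (\<sigma>, \<tau>) = sym_embed a b (id, id)"
    using sym_embed_comp[OF assms, of "inv' \<sigma>" "inv' \<tau>"] assms by (simp add: permutes_inv_o)
  also have "\<dots> = id" by (auto simp: sym_embed_def fun_eq_iff)
  finally have "sym_embed a b (inv' \<sigma>, inv' \<tau>) \<circ> sym_embed a b (\<sigma>, \<tau>) = id" .
  moreover have "bij (sym_embed a b (\<sigma>, \<tau>))" using sym_embed_permutes[OF assms] permutes_bij by blast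
  ultimately show ?thesis
    by (metis bij_is_surj comp_assoc comp_id id_comp surj_iff)
qed

lemma wreath_group:
  assumes "group F" shows "group (wreath F m)"
proof -
  interpret F: group F by fact
  have perm: "inv' \<sigma> i \<in> {1..m} \<longleftrightarrow> i \<in> {1..m}" if "\<sigma> permutes {1..m}" for \<sigma> i
    using permutes_in_image[OF permutes_inv[OF that]] .
  show ?thesis
  proof (rule groupI, goal_cases)
    case (1 x y)
    then show ?case using perm
      by (auto simp: wreath_def sym_group_def Let_def permutes_compose PiE_iff split: prod.splits)
  next
    case 2
    show ?case by (auto simp: wreath_def sym_group_def Let_def permutes_id)
  next
    case (3 x y z)
    then show ?case using perm
      by (auto simp: wreath_def sym_group_def Let_def PiE_iff o_assoc o_inv_distrib permutes_bij F.m_assoc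
          intro!: restrict_ext split: prod.splits)
  next
    case (4 x)
    then show ?case
      by (auto simp: wreath_def sym_group_def Let_def PiE_iff extensional_def fun_eq_iff split: prod.splits)
  next
    case (5 x)
    obtain f \<sigma> where x: "x = (f, \<sigma>)" by force
    with 5 have fs: "\<forall>i\<in>{1..m}. f i \<in> carrier F" "\<sigma> permutes {1..m}"
      by (auto simp: wreath_def sym_group_def Let_def)
    let ?y = "(\<lambda>i\<in>{1..m}. inv\<^bsub>F\<^esub> f (\<sigma> i), inv' \<sigma>)"
    have s: "\<sigma> i \<in> {1..m} \<longleftrightarrow> i \<in> {1..m}" for i using permutes_in_image[OF fs(2)] .
    have "?y \<in> carrier (wreath F m)" using fs s
      by (auto simp: wreath_def sym_group_def Let_def permutes_inv)
    moreover have "?y \<otimes>\<^bsub>wreath F m\<^esub> x = \<one>\<^bsub>wreath F m\<^esub>" using fs s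
      by (auto simp: wreath_def sym_group_def Let_def x permutes_inv_o permutes_inv_inv intro!: restrict_ext)
    ultimately show ?case by blast
  qed
qed

lemma wreath_embed_inj_hom:
  assumes "group F"
  shows "wreath_embed a b \<in> hom (wreath F a \<times>\<times> wreath F b) (wreath F (a + b))"
    and "inj_on (wreath_embed a b) (carrier (wreath F a \<times>\<times> wreath F b))"
proof -
  interpret F: group F by fact
  show "wreath_embed a b \<in> hom (wreath F a \<times>\<times> wreath F b) (wreath F (a + b))"
  proof (rule homI, goal_cases)
    case (1 x)
    then show ?case
      using sym_embed_permutes
      by (auto simp: wreath_def sym_group_def Let_def wreath_embed_def PiE_iff Suc_le_eq)
  next
    case (2 x y)
    obtain f \<sigma> g \<tau> f' \<sigma>' g' \<tau>' where xy: "x = ((f,\<sigma>),(g,\<tau>))" "y = ((f',\<sigma>'),(g',\<tau>'))"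
      by (metis surj_pair)
    from 2 have p: "\<sigma> permutes {1..a}" "\<sigma>' permutes {1..a}" "\<tau> permutes {1..b}" "\<tau>' permutes {1..b}"
      by (auto simp: xy wreath_def sym_group_def Let_def)
    have s: "inv' \<sigma> i \<in> {1..a} \<longleftrightarrow> i \<in> {1..a}" for i
      using permutes_in_image[OF permutes_inv[OF p(1)]] .
    have t: "inv' \<tau> i \<in> {1..b} \<longleftrightarrow> i \<in> {1..b}" for i
      using permutes_in_image[OF permutes_inv[OF p(3)]] .
    define k where "k = (\<lambda>i. if i \<le> a then f' i else g' (i - a))"
    have "(\<lambda>i\<in>{1..a+b}. if i \<le> a
              then (\<lambda>i\<in>{1..a}. f i \<otimes>\<^bsub>F\<^esub> (\<lambda>i\<in>{1..a}. f' (inv' \<sigma> i)) i) i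
              else (\<lambda>i\<in>{1..b}. g i \<otimes>\<^bsub>F\<^esub> (\<lambda>i\<in>{1..b}. g' (inv' \<tau> i)) i) (i - a)) =
          (\<lambda>i\<in>{1..a+b}. (\<lambda>i\<in>{1..a+b}. if i \<le> a then f i else g (i - a)) i \<otimes>\<^bsub>F\<^esub>
             (\<lambda>i\<in>{1..a+b}. (\<lambda>i\<in>{1..a+b}. k i) (sym_embed a b (inv' \<sigma>, inv' \<tau>) i)) i)"
    proof (rule restrict_ext, goal_cases)
      case (1 i)
      show ?case
      proof (cases "i \<le> a")
        case True
        with 1 s[of i] show ?thesis by (simp add: sym_embed_def k_def)
      next
        case False
        with 1 have "i - a \<in> {1..b}" by auto
        with False t[of "i - a"] 1 show ?thesis by (simp add: sym_embed_def k_def)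
      qed
    qed
    then show ?case
      unfolding k_def xy using p
      by (simp only: wreath_def sym_group_def Let_def wreath_embed_def DirProd_def split
          mult_product_group monoid.simps partial_object.simps sym_embed_comp sym_embed_inv)
  qed
  show "inj_on (wreath_embed a b) (carrier (wreath F a \<times>\<times> wreath F b))"
  proof (rule inj_onI, goal_cases)
    case (1 x y)
    obtain f \<sigma> g \<tau> f' \<sigma>' g' \<tau>' where xy: "x = ((f,\<sigma>),(g,\<tau>))" "y = ((f',\<sigma>'),(g',\<tau>'))"
      by (metis surj_pair)
    from 1 have p: "\<sigma> permutes {1..a}" "\<sigma>' permutes {1..a}" "\<tau> permutes {1..b}" "\<tau>' permutes {1..b}"
        "f \<in> extensional {1..a}" "f' \<in> extensional {1..a}"
        "g \<in> extensional {1..b}" "g' \<in> extensional {1..b}"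
      by (auto simp: xy wreath_def sym_group_def Let_def PiE_iff)
    from 1(3) have e: "sym_embed a b (\<sigma>,\<tau>) i = sym_embed a b (\<sigma>',\<tau>') i"
      and r: "(\<lambda>i\<in>{1..a+b}. if i \<le> a then f i else g (i - a)) i =
              (\<lambda>i\<in>{1..a+b}. if i \<le> a then f' i else g' (i - a)) i" for i
      by (simp_all only: xy wreath_embed_def split prod.inject)
    have "\<sigma> i = \<sigma>' i" for i
    proof (cases "i \<in> {1..a}")
      case True
      with e[of i] show ?thesis by (simp add: sym_embed_def)
    qed (use p(1,2) in \<open>simp add: permutes_not_in\<close>)
    moreover have "\<tau> i = \<tau>' i" for i
    proof (cases "i \<in> {1..b}")
      case True
      with e[of "a + i"] show ?thesis by (simp add: sym_embed_def)
    qed (use p(3,4) in \<open>simp add: permutes_not_in\<close>)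
    moreover have "f i = f' i" if "i \<in> {1..a}" for i
      using r[of i] that by simp
    then have "f = f'" by (rule extensionalityI[OF p(5,6)])
    moreover have "g i = g' i" if "i \<in> {1..b}" for i
      using r[of "a + i"] that by simp
    then have "g = g'" by (rule extensionalityI[OF p(7,8)])
    ultimately show ?case by (simp add: xy fun_eq_iff)
  qed
qed

end

theory Submission
  imports Defs
begin

text \<open>
  By transitivity of induction the left-hand side is induced from \<open>B\<^sub>a \<times> B\<^sub>b \<times> B\<^sub>k \<times> B\<^sub>l\<close>, where
  \<open>S\<^bsup>\<gamma>,\<delta>\<^esup>\<close> is the second factor, with \<open>\<gamma>\<close> of size \<open>k\<close> and \<open>\<delta>\<close> of size \<open>l\<close>.  Conjugation by the permutation that
  exchanges the two middle blocks turns it into the module induced from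
  \<open>(1; ind S\<^sup>\<alpha> \<boxtimes> S\<^sup>\<gamma>) \<boxtimes> (\<epsilon>; ind S\<^sup>\<beta> \<boxtimes> S\<^sup>\<delta>)\<close>, because \<open>(D; -)\<close> commutes with induction.  Both steps are
  formal consequences of the universal property of induction from a subgroup of a finite group, used
  here in its coinduced form.

  It remains to see that \<open>ind S\<^sup>\<alpha> \<boxtimes> \<chi>\<close>, for a character \<open>\<chi>\<close> of \<open>S\<^sub>k\<close> with \<open>k \<le> 2\<close>, is the sum of its Specht
  summands, each taken once.  The Specht modules are irreducible, pairwise non-isomorphic and exhaust
  the irreducible representations.  No multiplicities occur because every permutation of \<open>m + k\<close> points
  is conjugate to its inverse under \<open>S\<^sub>m \<times> S\<^sub>k\<close>.
\<close>

section \<open>Generalities on representations\<close>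

text \<open>The index sets are themselves defined as sets of Specht summands. So the content beyond
  the formal isomorphisms is that the modules induced from symmetric groups have only Specht
  constituents and none of them twice. Modules induced in several steps and in one step are
  functions on different index types and can never be equal as sets. Hence \<open>coinduced\<close>
  and \<open>is_sum\<close> describe a module only through its evaluation map or its projections,
  and every comparison becomes an instance of uniqueness; since both properties determine a vector
  by prescribed values, they commute formally. The bound k \<le> 2 comes from the reversal of the
  cycles of a permutation: it can be made to preserve one prescribed set of at most two points, and
  this set is taken to be the second block. The form on functions of tabloids is bilinear and not
  Hermitian, because complex combinations of symmetric operators have to stay symmetric; positivity
  is regained from the fact that polytabloids have real values.\<close>

definition findim :: "('x \<Rightarrow> complex) set \<Rightarrow> bool"
  where "findim V \<longleftrightarrow> (\<exists>B. finite B \<and> V \<subseteq> cfun.span B)"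

lemma findim_subset: "findim V \<Longrightarrow> U \<subseteq> V \<Longrightarrow> findim U"
  unfolding findim_def by blast

lemma findim_basis:
  assumes "cfun.subspace V" "findim V"
  obtains B where "finite B" "cfun.independent B" "B \<subseteq> V" "cfun.span B = V"
proof -
  obtain B where B: "B \<subseteq> V" "cfun.independent B" "V \<subseteq> cfun.span B"
    using cfun.maximal_independent_subset[of V] by blast
  obtain T where T: "finite T" "V \<subseteq> cfun.span T" using assms(2) unfolding findim_def by blast
  have "finite B" using cfun.independent_span_bound[OF T(1) B(2)] B(1) T(2) by blast
  moreover have "cfun.span B = V"
    using B(1,3) assms(1) cfun.span_minimal by blast
  ultimately show ?thesis using that B by blast
qed

text \<open>As simplification rules these two laws eta-expand sums of functions below other functions.\<close>

declare plus_fun_apply [simp del] zero_fun_apply [simp del]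

lemma cfun_sum_apply: "(\<Sum>i\<in>A. f i) x = (\<Sum>i\<in>A. (f i :: 'x \<Rightarrow> complex) x)"
  by (induction A rule: infinite_finite_induct) (auto simp: plus_fun_apply zero_fun_apply)

lemmas pointwise = fun_eq_iff cscale_def plus_fun_apply zero_fun_apply cfun_sum_apply

lemma cscale_simps [simp]:
  "cscale 0 v = 0" "cscale c 0 = 0" "cscale a (cscale b v) = cscale (a * b) v"
  by (simp_all add: pointwise)

lemma cscale_sum: "cscale c (\<Sum>i\<in>A. f i) = (\<Sum>i\<in>A. cscale c (f i))"
  by (simp add: pointwise sum_distrib_left)

lemma linear_on_add: "linear_on V f \<Longrightarrow> u \<in> V \<Longrightarrow> v \<in> V \<Longrightarrow> f (u + v) = f u + f v"
  and linear_on_scale: "linear_on V f \<Longrightarrow> v \<in> V \<Longrightarrow> f (cscale c v) = cscale c (f v)"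
  by (simp_all add: linear_on_def)

lemma linear_on_zero: "linear_on V f \<Longrightarrow> cfun.subspace V \<Longrightarrow> f 0 = 0"
  using linear_on_scale[of V f 0 0] cfun.subspace_0 by fastforce

lemma linear_on_sum:
  assumes "linear_on V f" "cfun.subspace V" "\<And>i. i \<in> A \<Longrightarrow> u i \<in> V"
  shows "f (\<Sum>i\<in>A. u i) = (\<Sum>i\<in>A. f (u i))"
  using assms(3)
proof (induction A rule: infinite_finite_induct)
  case (insert i A)
  then show ?case
    using assms(2) linear_on_add[OF assms(1), of "u i" "sum u A"] by (simp add: cfun.subspace_sum)
qed (use assms linear_on_zero in auto)

lemma linear_on_diff:
  assumes "linear_on V f" "cfun.subspace V" "u \<in> V" "v \<in> V"
  shows "f (u - v) = f u - f v"
proof -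
  have "f (u + cscale (-1) v) = f u + cscale (-1) (f v)"
    using linear_on_add[OF assms(1,3), of "cscale (-1) v"] linear_on_scale[OF assms(1,4)]
      cfun.subspace_scale[OF assms(2,4)] by metis
  moreover have "u + cscale (-1) v = u - v" "f u + cscale (-1) (f v) = f u - f v"
    by (simp_all add: pointwise)
  ultimately show ?thesis by simp
qed

lemma linear_on_subset: "linear_on V f \<Longrightarrow> U \<subseteq> V \<Longrightarrow> linear_on U f"
  unfolding linear_on_def by blast

lemma linear_on_comp:
  "linear_on V f \<Longrightarrow> f ` V \<subseteq> W \<Longrightarrow> linear_on W g \<Longrightarrow> linear_on V (\<lambda>v. g (f v))"
  unfolding linear_on_def by (simp add: image_subset_iff)

text \<open>Maps here are linear only on a subspace, so the induction step must also know that each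
  partial combination lies in the span.\<close>

lemma span_induct_member [consumes 1, case_names zero step]:
  assumes "x \<in> cfun.span S" "P 0"
    and "\<And>c x y. x \<in> S \<Longrightarrow> x \<in> cfun.span S \<Longrightarrow> cscale c x \<in> cfun.span S \<Longrightarrow>
      y \<in> cfun.span S \<Longrightarrow> P y \<Longrightarrow> P (cscale c x + y)"
  shows "P x"
proof -
  have "x \<in> cfun.span S \<and> P x"
    using assms(1)
  proof (induction rule: cfun.span_induct_alt)
    case base
    then show ?case using assms(2) cfun.span_zero by blast
  next
    case (step c x y)
    then show ?case using assms(3) cfun.span_base cfun.span_scale cfun.span_add by metis
  qed
  then show ?thesis ..
qed

lemma linear_on_eq_span:
  assumes f: "linear_on (cfun.span B) f" and g: "linear_on (cfun.span B) g"
    and e: "\<And>b. b \<in> B \<Longrightarrow> f b = g b" and v: "v \<in> cfun.span B"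
  shows "f v = g v"
  using v
proof (induction rule: span_induct_member)
  case zero
  then show ?case using linear_on_zero[OF f] linear_on_zero[OF g] cfun.subspace_span by metis
next
  case (step c x y)
  then show ?case
    using e linear_on_add[OF f step(3,4)] linear_on_add[OF g step(3,4)]
      linear_on_scale[OF f step(2)] linear_on_scale[OF g step(2)] by simp
qed

text \<open>Extension from a basis of V gives a map linear on the whole function space, for which
  one-sided inverses are available; the lemmas on right and left inverses below carry these back to
  V.\<close>

lemma linear_on_extend:
  assumes "linear_on V f" "cfun.subspace V"
  obtains F where "Vector_Spaces.linear cscale cscale F" "\<And>v. v \<in> V \<Longrightarrow> F v = f v"
proof -
  interpret p: vector_space_pair "cscale :: complex \<Rightarrow> ('a \<Rightarrow> complex) \<Rightarrow> _"
    "cscale :: complex \<Rightarrow> ('b \<Rightarrow> complex) \<Rightarrow> _" by unfold_locales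
  obtain B where B: "B \<subseteq> V" "cfun.independent B" "V \<subseteq> cfun.span B"
    using cfun.maximal_independent_subset[of V] by blast
  have V: "V = cfun.span B" using B assms(2) cfun.span_minimal by blast
  obtain F where F: "Vector_Spaces.linear cscale cscale F" "\<forall>x\<in>B. F x = f x"
    using p.linear_independent_extend[OF B(2)] by blast
  interpret F: Vector_Spaces.linear cscale cscale F by fact
  have "linear_on V F" unfolding linear_on_def using F.add F.scale by blast
  then have "F v = f v" if "v \<in> V" for v
    using linear_on_eq_span[of B F f v] F(2) assms(1) that V by auto
  with F(1) show ?thesis using that by blast
qed

lemma linear_imp_linear_on: "Vector_Spaces.linear cscale cscale F \<Longrightarrow> linear_on V F"
proof -
  assume "Vector_Spaces.linear cscale cscale F"
  then interpret F: Vector_Spaces.linear cscale cscale F .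
  show ?thesis unfolding linear_on_def using F.add F.scale by blast
qed

lemma linear_on_right_inverse:
  assumes "linear_on V f" "cfun.subspace V"
  obtains s where "linear_on (f ` V) s" "s ` f ` V \<subseteq> V" "\<And>w. w \<in> f ` V \<Longrightarrow> f (s w) = w"
proof -
  interpret p: vector_space_pair "cscale :: complex \<Rightarrow> ('a \<Rightarrow> complex) \<Rightarrow> _"
    "cscale :: complex \<Rightarrow> ('b \<Rightarrow> complex) \<Rightarrow> _" by unfold_locales
  obtain F where F: "Vector_Spaces.linear cscale cscale F" "\<And>v. v \<in> V \<Longrightarrow> F v = f v"
    using linear_on_extend[OF assms] by blast
  obtain g where g: "g ` UNIV \<subseteq> V" "Vector_Spaces.linear cscale cscale g" "\<forall>v\<in>F ` V. F (g v) = v"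
    using p.linear_exists_right_inverse_on[OF F(1) assms(2)] by blast
  have "g x \<in> V" for x using g(1) by blast
  moreover have "f (g (f v)) = f v" if "v \<in> V" for v
    using g(3) F(2) that calculation by (metis imageI)
  ultimately show ?thesis
    by (intro that[of g]) (use linear_imp_linear_on[OF g(2)] in auto)
qed

lemma linear_on_left_inverse:
  assumes "linear_on V f" "cfun.subspace V" "inj_on f V"
  obtains r where "linear_on UNIV r" "range r \<subseteq> V" "\<And>v. v \<in> V \<Longrightarrow> r (f v) = v"
proof -
  interpret p: vector_space_pair "cscale :: complex \<Rightarrow> ('a \<Rightarrow> complex) \<Rightarrow> _"
    "cscale :: complex \<Rightarrow> ('b \<Rightarrow> complex) \<Rightarrow> _" by unfold_locales
  obtain F where F: "Vector_Spaces.linear cscale cscale F" "\<And>v. v \<in> V \<Longrightarrow> F v = f v"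
    using linear_on_extend[OF assms(1,2)] by blast
  have "inj_on F V" using assms(3) F(2) by (simp add: inj_on_def)
  then obtain g where "g ` UNIV \<subseteq> V" "Vector_Spaces.linear cscale cscale g" "\<forall>v\<in>V. g (F v) = v"
    using p.linear_exists_left_inverse_on[OF F(1) assms(2)] by blast
  then show ?thesis
    using that[of g] F(2) linear_imp_linear_on[of g UNIV] by metis
qed

lemma subspace_image:
  assumes "linear_on V f" "cfun.subspace V" shows "cfun.subspace (f ` V)"
proof (rule cfun.subspaceI)
  show "0 \<in> f ` V" using linear_on_zero[OF assms] cfun.subspace_0[OF assms(2)] by (metis imageI)
next
  fix x y assume "x \<in> f ` V" "y \<in> f ` V"
  then obtain u v where "u \<in> V" "v \<in> V" "x = f u" "y = f v" by blast
  then show "x + y \<in> f ` V"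
    using cfun.subspace_add[OF assms(2), of u v] linear_on_add[OF assms(1), of u v] by force
next
  fix c x assume "x \<in> f ` V"
  then obtain u where "u \<in> V" "x = f u" by blast
  then show "cscale c x \<in> f ` V"
    using cfun.subspace_scale[OF assms(2), of u c] linear_on_scale[OF assms(1), of u c] by force
qed

text \<open>\<open>findim\<close> asks only for containment in a finite span, so it passes to
  subsets without a new choice of basis. For a subspace, \<open>findim_basis\<close> turns
  containment back into equality.\<close>

lemma representation_iff:
  "representation G R \<longleftrightarrow>
    group G \<and> cfun.subspace (rep_space R) \<and> findim (rep_space R) \<and>
    (\<forall>g\<in>carrier G. linear_on (rep_space R) (rep_act R g) \<and>
        (\<forall>v\<in>rep_space R. rep_act R g v \<in> rep_space R)) \<and>
    (\<forall>v\<in>rep_space R. rep_act R \<one>\<^bsub>G\<^esub> v = v) \<and>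
    (\<forall>g\<in>carrier G. \<forall>h\<in>carrier G. \<forall>v\<in>rep_space R.
        rep_act R (g \<otimes>\<^bsub>G\<^esub> h) v = rep_act R g (rep_act R h v))"
proof -
  have "(\<exists>B. finite B \<and> cfun.span B = rep_space R) \<longleftrightarrow> findim (rep_space R)"
    if "cfun.subspace (rep_space R)"
    using findim_basis[OF that] unfolding findim_def by (metis subset_refl)
  then show ?thesis unfolding representation_def by blast
qed

lemma
  assumes "representation G R"
  shows rep_group: "group G"
    and rep_subspace: "cfun.subspace (rep_space R)"
    and rep_findim: "findim (rep_space R)"
    and rep_linear: "g \<in> carrier G \<Longrightarrow> linear_on (rep_space R) (rep_act R g)"
    and rep_closed: "g \<in> carrier G \<Longrightarrow> v \<in> rep_space R \<Longrightarrow> rep_act R g v \<in> rep_space R"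
    and rep_one: "v \<in> rep_space R \<Longrightarrow> rep_act R \<one>\<^bsub>G\<^esub> v = v"
    and rep_mult: "g \<in> carrier G \<Longrightarrow> h \<in> carrier G \<Longrightarrow> v \<in> rep_space R \<Longrightarrow>
        rep_act R (g \<otimes>\<^bsub>G\<^esub> h) v = rep_act R g (rep_act R h v)"
  using assms unfolding representation_iff by blast+

lemma rep_inv_act:
  assumes "representation G R" "g \<in> carrier G" "v \<in> rep_space R"
  shows "rep_act R (inv\<^bsub>G\<^esub> g) (rep_act R g v) = v" "rep_act R g (rep_act R (inv\<^bsub>G\<^esub> g) v) = v"
proof -
  interpret group G using rep_group[OF assms(1)] .
  show "rep_act R (inv\<^bsub>G\<^esub> g) (rep_act R g v) = v" "rep_act R g (rep_act R (inv\<^bsub>G\<^esub> g) v) = v"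
    using rep_mult[OF assms(1) _ _ assms(3), of "inv\<^bsub>G\<^esub> g" g]
      rep_mult[OF assms(1) _ _ assms(3), of g "inv\<^bsub>G\<^esub> g"] rep_one[OF assms(1,3)] assms(2) by auto
qed

section \<open>Homomorphisms and isomorphisms of representations\<close>

definition ghom :: "('g, 'm) monoid_scheme \<Rightarrow> ('g, 'x) rep \<Rightarrow> ('g, 'y) rep \<Rightarrow>
    (('x \<Rightarrow> complex) \<Rightarrow> 'y \<Rightarrow> complex) \<Rightarrow> bool"
  where "ghom G R Q f \<longleftrightarrow> linear_on (rep_space R) f \<and> (\<forall>v\<in>rep_space R. f v \<in> rep_space Q) \<and>
    (\<forall>g\<in>carrier G. \<forall>v\<in>rep_space R. f (rep_act R g v) = rep_act Q g (f v))"

lemma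
  assumes "ghom G R Q f"
  shows ghom_linear: "linear_on (rep_space R) f"
    and ghom_closed: "v \<in> rep_space R \<Longrightarrow> f v \<in> rep_space Q"
    and ghom_act: "g \<in> carrier G \<Longrightarrow> v \<in> rep_space R \<Longrightarrow> f (rep_act R g v) = rep_act Q g (f v)"
  using assms unfolding ghom_def by blast+

lemma ghom_comp: "ghom G R Q f \<Longrightarrow> ghom G Q S k \<Longrightarrow> ghom G R S (\<lambda>v. k (f v))"
  unfolding ghom_def using linear_on_comp[of "rep_space R" f "rep_space Q" k] by auto

lemma rep_iso_iff:
  "rep_iso G R Q \<longleftrightarrow> representation G R \<and> representation G Q \<and>
     (\<exists>f. ghom G R Q f \<and> bij_betw f (rep_space R) (rep_space Q))"
proof -
  have "bij_betw f (rep_space R) (rep_space Q) \<Longrightarrow> \<forall>v\<in>rep_space R. f v \<in> rep_space Q" for f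
    using bij_betwE by blast
  then show ?thesis unfolding rep_iso_def ghom_def by blast
qed

lemma ghom_inverse:
  assumes "ghom G R Q f" "bij_betw f (rep_space R) (rep_space Q)" "representation G R"
  shows "ghom G Q R (the_inv_into (rep_space R) f)"
    "bij_betw (the_inv_into (rep_space R) f) (rep_space Q) (rep_space R)"
proof -
  let ?k = "the_inv_into (rep_space R) f"
  show b: "bij_betw ?k (rep_space Q) (rep_space R)" using assms(2) bij_betw_the_inv_into by blast
  have k: "\<And>w. w \<in> rep_space Q \<Longrightarrow> ?k w \<in> rep_space R" using b bij_betwE by blast
  have fk: "\<And>w. w \<in> rep_space Q \<Longrightarrow> f (?k w) = w"
    using assms(2) f_the_inv_into_f_bij_betw by metis
  have kf: "\<And>v. v \<in> rep_space R \<Longrightarrow> ?k (f v) = v"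
    using assms(2) by (metis bij_betw_imp_inj_on the_inv_into_f_f)
  note s = rep_subspace[OF assms(3)]
  show "ghom G Q R ?k"
    unfolding ghom_def linear_on_def
  proof (intro conjI ballI allI)
    fix u v assume "u \<in> rep_space Q" "v \<in> rep_space Q"
    then have "f (?k u + ?k v) = u + v" "?k u + ?k v \<in> rep_space R"
      using k fk linear_on_add[OF ghom_linear[OF assms(1)]] cfun.subspace_add[OF s] by auto
    then show "?k (u + v) = ?k u + ?k v" using kf by metis
  next
    fix c v assume "v \<in> rep_space Q"
    then have "f (cscale c (?k v)) = cscale c v" "cscale c (?k v) \<in> rep_space R"
      using k fk linear_on_scale[OF ghom_linear[OF assms(1)]] cfun.subspace_scale[OF s] by auto
    then show "?k (cscale c v) = cscale c (?k v)" using kf by metis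
  next
    fix g v assume g: "g \<in> carrier G" and "v \<in> rep_space Q"
    then have "f (rep_act R g (?k v)) = rep_act Q g v" "rep_act R g (?k v) \<in> rep_space R"
      using k fk ghom_act[OF assms(1) g] rep_closed[OF assms(3) g] by auto
    then show "?k (rep_act Q g v) = rep_act R g (?k v)" using kf by metis
  qed (use k in auto)
qed

lemma rep_iso_sym: "rep_iso G R Q \<Longrightarrow> rep_iso G Q R"
  unfolding rep_iso_iff using ghom_inverse by blast

lemma rep_iso_trans:
  assumes "rep_iso G R Q" "rep_iso G Q S" shows "rep_iso G R S"
proof -
  obtain f k where "ghom G R Q f" "bij_betw f (rep_space R) (rep_space Q)"
    "ghom G Q S k" "bij_betw k (rep_space Q) (rep_space S)"
    using assms unfolding rep_iso_iff by blast
  then have "ghom G R S (\<lambda>v. k (f v))" "bij_betw (\<lambda>v. k (f v)) (rep_space R) (rep_space S)"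
    using ghom_comp bij_betw_trans[of f _ _ k] by (auto simp: comp_def)
  then show ?thesis using assms unfolding rep_iso_iff by blast
qed

section \<open>Averaging over a finite group\<close>

text \<open>Summing the conjugates g s g^-1 makes any linear map equivariant. This serves twice: for
  sections and retractions in Maschke's theorem, and for rank-one operators in the orthogonality
  relations.\<close>

lemma ghom_average:
  assumes V: "representation G V" and W: "representation G W" and fin: "finite (carrier G)"
    and s: "linear_on (rep_space W) s" and sV: "s ` rep_space W \<subseteq> rep_space V"
  defines "a \<equiv> \<lambda>w. \<Sum>g\<in>carrier G. rep_act V g (s (rep_act W (inv\<^bsub>G\<^esub> g) w))"
  shows "ghom G W V a"
proof -
  interpret group G using rep_group[OF V] .
  have l: "linear_on (rep_space W) (\<lambda>w. rep_act V g (s (rep_act W (inv\<^bsub>G\<^esub> g) w)))"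
    if "g \<in> carrier G" for g
  proof -
    have 1: "linear_on (rep_space W) (\<lambda>w. s (rep_act W (inv\<^bsub>G\<^esub> g) w))"
      by (rule linear_on_comp[OF rep_linear[OF W] _ s]) (use that rep_closed[OF W] in auto)
    show ?thesis
      by (rule linear_on_comp[OF 1 _ rep_linear[OF V]]) (use that sV rep_closed[OF W] in auto)
  qed
  have c: "rep_act V g (s (rep_act W (inv\<^bsub>G\<^esub> g) w)) \<in> rep_space V" if "g \<in> carrier G" "w \<in> rep_space W" for g w
    by (rule rep_closed[OF V that(1)]) (use that sV rep_closed[OF W] in auto)
  show ?thesis
    unfolding ghom_def
  proof (intro conjI ballI)
    show "linear_on (rep_space W) a"
      using l unfolding a_def linear_on_def by (simp add: sum.distrib cscale_sum)
  next
    fix w assume "w \<in> rep_space W"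
    then show "a w \<in> rep_space V"
      unfolding a_def using c by (intro cfun.subspace_sum[OF rep_subspace[OF V]]) auto
  next
    fix h w assume h: "h \<in> carrier G" and w: "w \<in> rep_space W"
    have "a (rep_act W h w) = (\<Sum>g\<in>carrier G. rep_act V g (s (rep_act W (inv\<^bsub>G\<^esub> g \<otimes>\<^bsub>G\<^esub> h) w)))"
      unfolding a_def using h w by (intro sum.cong) (auto simp: rep_mult[OF W])
    \<comment> \<open>Substitute h g for g; the inverse of h g then cancels the h to its
      right.\<close>
    also have "\<dots> = (\<Sum>g\<in>carrier G. rep_act V (h \<otimes>\<^bsub>G\<^esub> g) (s (rep_act W (inv\<^bsub>G\<^esub> (h \<otimes>\<^bsub>G\<^esub> g) \<otimes>\<^bsub>G\<^esub> h) w)))"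
      by (rule sum.reindex_bij_witness[of _ "\<lambda>g. h \<otimes>\<^bsub>G\<^esub> g" "\<lambda>g. inv\<^bsub>G\<^esub> h \<otimes>\<^bsub>G\<^esub> g"])
        (use h in \<open>auto simp: m_assoc[symmetric]\<close>)
    also have "\<dots> = (\<Sum>g\<in>carrier G. rep_act V h (rep_act V g (s (rep_act W (inv\<^bsub>G\<^esub> g) w))))"
    proof (intro sum.cong refl)
      fix g assume g: "g \<in> carrier G"
      then have "inv\<^bsub>G\<^esub> (h \<otimes>\<^bsub>G\<^esub> g) \<otimes>\<^bsub>G\<^esub> h = inv\<^bsub>G\<^esub> g" using h by (simp add: inv_mult_group m_assoc)
      moreover have "s (rep_act W (inv\<^bsub>G\<^esub> g) w) \<in> rep_space V" using g w sV rep_closed[OF W] by auto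
      ultimately show "rep_act V (h \<otimes>\<^bsub>G\<^esub> g) (s (rep_act W (inv\<^bsub>G\<^esub> (h \<otimes>\<^bsub>G\<^esub> g) \<otimes>\<^bsub>G\<^esub> h) w)) =
          rep_act V h (rep_act V g (s (rep_act W (inv\<^bsub>G\<^esub> g) w)))"
        using rep_mult[OF V h g] by simp
    qed
    also have "\<dots> = rep_act V h (a w)"
      unfolding a_def using c w
      by (intro linear_on_sum[OF rep_linear[OF V h] rep_subspace[OF V], symmetric]) auto
    finally show "a (rep_act W h w) = rep_act V h (a w)" .
  qed
qed

lemma ghom_scale:
  assumes "representation G V" "ghom G W V f"
  shows "ghom G W V (\<lambda>w. cscale c (f w))"
  using assms(2) rep_linear[OF assms(1)] cfun.subspace_scale[OF rep_subspace[OF assms(1)]]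
  unfolding ghom_def linear_on_def
  by (auto simp: algebra_simps cfun.scale_right_distrib)

lemma ghom_diff:
  assumes "representation G V" "ghom G W V f" "ghom G W V k"
  shows "ghom G W V (\<lambda>w. f w - k w)"
proof -
  note s = rep_subspace[OF assms(1)]
  have "rep_act V g (f w - k w) = rep_act V g (f w) - rep_act V g (k w)"
    if "g \<in> carrier G" "w \<in> rep_space W" for g w
    using that assms linear_on_diff[OF rep_linear[OF assms(1)] s] unfolding ghom_def by auto
  then show ?thesis
    using assms(2,3) cfun.subspace_diff[OF s]
    unfolding ghom_def linear_on_def
    by (auto simp: algebra_simps cfun.scale_right_diff_distrib)
qed

text \<open>Maschke's theorem: a linear section exists, and as f is equivariant, each of its |G|
  conjugates is again a section, so their sum is |G| times one.\<close>

lemma ghom_section: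
  assumes V: "representation G V" and W: "representation G W" and fin: "finite (carrier G)"
    and f: "ghom G V W f" and surj: "f ` rep_space V = rep_space W"
  obtains s where "ghom G W V s" "\<And>w. w \<in> rep_space W \<Longrightarrow> f (s w) = w"
proof -
  interpret group G using rep_group[OF V] .
  obtain s where s: "linear_on (rep_space W) s" "s ` rep_space W \<subseteq> rep_space V"
    "\<And>w. w \<in> rep_space W \<Longrightarrow> f (s w) = w"
    using linear_on_right_inverse[OF ghom_linear[OF f] rep_subspace[OF V]] surj by metis
  define a where "a = (\<lambda>w. \<Sum>g\<in>carrier G. rep_act V g (s (rep_act W (inv\<^bsub>G\<^esub> g) w)))"
  define n where "n = (of_nat (card (carrier G)) :: complex)"
  have n: "n \<noteq> 0" unfolding n_def using fin one_closed by auto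
  have a: "ghom G W V a" unfolding a_def by (rule ghom_average[OF V W fin s(1,2)])
  have "f (a w) = cscale n w" if w: "w \<in> rep_space W" for w
  proof -
    have c: "s (rep_act W (inv\<^bsub>G\<^esub> g) w) \<in> rep_space V" if "g \<in> carrier G" for g
      using that w s(2) rep_closed[OF W] by auto
    have "f (a w) = (\<Sum>g\<in>carrier G. f (rep_act V g (s (rep_act W (inv\<^bsub>G\<^esub> g) w))))"
      unfolding a_def using c rep_closed[OF V]
      by (intro linear_on_sum[OF ghom_linear[OF f] rep_subspace[OF V]]) auto
    also have "\<dots> = (\<Sum>g\<in>carrier G. w)"
      using c w by (intro sum.cong) (auto simp: ghom_act[OF f] s(3) rep_closed[OF W] rep_inv_act[OF W])
    also have "\<dots> = cscale n w" by (simp add: pointwise n_def)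
    finally show ?thesis .
  qed
  moreover have "f (cscale (1 / n) (a w)) = cscale (1 / n) (f (a w))" if "w \<in> rep_space W" for w
    using linear_on_scale[OF ghom_linear[OF f]] ghom_closed[OF a that] by blast
  ultimately show ?thesis
    using that[OF ghom_scale[OF V a, of "1 / n"]] n by simp
qed

text \<open>The dual form of Maschke's theorem. It yields complements of subrepresentations and
  homomorphisms in the reverse direction.\<close>

lemma ghom_retraction:
  assumes V: "representation G V" and W: "representation G W" and fin: "finite (carrier G)"
    and f: "ghom G V W f" and inj: "inj_on f (rep_space V)"
  obtains r where "ghom G W V r" "\<And>v. v \<in> rep_space V \<Longrightarrow> r (f v) = v"
proof -
  interpret group G using rep_group[OF V] .
  obtain r where r: "linear_on UNIV r" "range r \<subseteq> rep_space V"
    "\<And>w. w \<in> rep_space V \<Longrightarrow> r (f w) = w"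
    using linear_on_left_inverse[OF ghom_linear[OF f] rep_subspace[OF V] inj] by metis
  define a where "a = (\<lambda>w. \<Sum>g\<in>carrier G. rep_act V g (r (rep_act W (inv\<^bsub>G\<^esub> g) w)))"
  define n where "n = (of_nat (card (carrier G)) :: complex)"
  have n: "n \<noteq> 0" unfolding n_def using fin one_closed by auto
  have a: "ghom G W V a" unfolding a_def
    by (rule ghom_average[OF V W fin]) (use r linear_on_subset in blast)+
  have "a (f v) = cscale n v" if v: "v \<in> rep_space V" for v
  proof -
    have "rep_act V g (r (rep_act W (inv\<^bsub>G\<^esub> g) (f v))) = v" if g: "g \<in> carrier G" for g
    proof -
      have "rep_act W (inv\<^bsub>G\<^esub> g) (f v) = f (rep_act V (inv\<^bsub>G\<^esub> g) v)" using g v ghom_act[OF f] by auto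
      then show ?thesis using r(3) rep_closed[OF V] g v rep_inv_act[OF V] by auto
    qed
    then have "a (f v) = (\<Sum>g\<in>carrier G. v)" unfolding a_def by simp
    also have "\<dots> = cscale n v" by (simp add: pointwise n_def)
    finally show ?thesis .
  qed
  then show ?thesis
    using that[OF ghom_scale[OF V a, of "1 / n"]] n by simp
qed

section \<open>Coinduction and direct sums by universal properties\<close>

definition res_rep :: "('h \<Rightarrow> 'g) \<Rightarrow> ('g, 'x) rep \<Rightarrow> ('h, 'x) rep"
  where "res_rep \<iota> W = \<lparr>rep_space = rep_space W, rep_act = (\<lambda>h. rep_act W (\<iota> h))\<rparr>"

lemma res_rep_simps [simp]:
  "rep_space (res_rep \<iota> W) = rep_space W" "rep_act (res_rep \<iota> W) h = rep_act W (\<iota> h)"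
  by (simp_all add: res_rep_def)

text \<open>
  \<open>W\<close> is coinduced from \<open>V\<close> when the \<open>H\<close>-equivariant maps \<open>G \<rightarrow> V\<close> are exactly the maps
  \<open>g \<mapsto> e (g w)\<close>, for unique \<open>w \<in> W\<close>.
\<close>

definition equivariant :: "('g, 'm) monoid_scheme \<Rightarrow> ('h, 'n) monoid_scheme \<Rightarrow> ('h \<Rightarrow> 'g) \<Rightarrow>
    ('h, 'x) rep \<Rightarrow> ('g \<Rightarrow> 'x \<Rightarrow> complex) \<Rightarrow> bool"
  where "equivariant G H \<iota> V \<phi> \<longleftrightarrow> (\<forall>g\<in>carrier G. \<phi> g \<in> rep_space V) \<and>
    (\<forall>h\<in>carrier H. \<forall>g\<in>carrier G. \<phi> (\<iota> h \<otimes>\<^bsub>G\<^esub> g) = rep_act V h (\<phi> g))"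

definition coinduced :: "('g, 'm) monoid_scheme \<Rightarrow> ('h, 'n) monoid_scheme \<Rightarrow> ('h \<Rightarrow> 'g) \<Rightarrow>
    ('h, 'x) rep \<Rightarrow> ('g, 'y) rep \<Rightarrow> (('y \<Rightarrow> complex) \<Rightarrow> 'x \<Rightarrow> complex) \<Rightarrow> bool"
  where "coinduced G H \<iota> V W e \<longleftrightarrow> representation G W \<and> representation H V \<and> \<iota> \<in> hom H G \<and>
    ghom H (res_rep \<iota> W) V e \<and>
    (\<forall>\<phi>. equivariant G H \<iota> V \<phi> \<longrightarrow>
      (\<exists>!w. w \<in> rep_space W \<and> (\<forall>g\<in>carrier G. e (rep_act W g w) = \<phi> g)))"

lemma
  assumes "coinduced G H \<iota> V W e"
  shows coind_rep: "representation G W" "representation H V"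
    and coind_hom: "\<iota> \<in> hom H G"
    and coind_ghom: "ghom H (res_rep \<iota> W) V e"
    and coind_ex1: "equivariant G H \<iota> V \<phi> \<Longrightarrow>
      \<exists>!w. w \<in> rep_space W \<and> (\<forall>g\<in>carrier G. e (rep_act W g w) = \<phi> g)"
    and coind_linear: "linear_on (rep_space W) e"
    and coind_closed: "w \<in> rep_space W \<Longrightarrow> e w \<in> rep_space V"
    and coind_act: "h \<in> carrier H \<Longrightarrow> w \<in> rep_space W \<Longrightarrow> e (rep_act W (\<iota> h) w) = rep_act V h (e w)"
    and coind_carrier: "h \<in> carrier H \<Longrightarrow> \<iota> h \<in> carrier G"
  using assms unfolding coinduced_def ghom_def by (auto simp: hom_def)

lemma coind_equivariant:
  assumes "coinduced G H \<iota> V W e" "w \<in> rep_space W"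
  shows "equivariant G H \<iota> V (\<lambda>g. e (rep_act W g w))"
  unfolding equivariant_def
  using coind_closed[OF assms(1)] coind_act[OF assms(1)] rep_closed[OF coind_rep(1)[OF assms(1)]]
    rep_mult[OF coind_rep(1)[OF assms(1)] coind_carrier[OF assms(1)]] assms(2) by simp

lemma coind_unique:
  assumes "coinduced G H \<iota> V W e" "v \<in> rep_space W" "w \<in> rep_space W"
    "\<And>g. g \<in> carrier G \<Longrightarrow> e (rep_act W g v) = e (rep_act W g w)"
  shows "v = w"
  using coind_ex1[OF assms(1) coind_equivariant[OF assms(1,3)]] assms(2-4) by blast

lemma coind_obtain:
  assumes "coinduced G H \<iota> V W e" "equivariant G H \<iota> V \<phi>"
  obtains w where "w \<in> rep_space W" "\<And>g. g \<in> carrier G \<Longrightarrow> e (rep_act W g w) = \<phi> g"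
  using coind_ex1[OF assms] by blast

lemma coinducedI:
  assumes "representation G W" "representation H V" "\<iota> \<in> hom H G" "ghom H (res_rep \<iota> W) V e"
    and "\<And>\<phi>. equivariant G H \<iota> V \<phi> \<Longrightarrow> \<exists>w\<in>rep_space W. \<forall>g\<in>carrier G. e (rep_act W g w) = \<phi> g"
    and "\<And>v w. v \<in> rep_space W \<Longrightarrow> w \<in> rep_space W \<Longrightarrow>
      (\<And>g. g \<in> carrier G \<Longrightarrow> e (rep_act W g v) = e (rep_act W g w)) \<Longrightarrow> v = w"
  shows "coinduced G H \<iota> V W e"
  unfolding coinduced_def using assms by (metis (no_types, lifting))

text \<open>Frobenius reciprocity: the image of u is the vector of W whose equivariant function is g
  |-> f (g u).\<close>

lemma coind_lift:
  assumes W: "coinduced G H \<iota> V W e" and U: "representation G U"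
    and f: "linear_on (rep_space U) f" "\<And>u. u \<in> rep_space U \<Longrightarrow> f u \<in> rep_space V"
    and fh: "\<And>h u. h \<in> carrier H \<Longrightarrow> u \<in> rep_space U \<Longrightarrow> f (rep_act U (\<iota> h) u) = rep_act V h (f u)"
  obtains k where "ghom G U W k"
    "\<And>g u. g \<in> carrier G \<Longrightarrow> u \<in> rep_space U \<Longrightarrow> e (rep_act W g (k u)) = f (rep_act U g u)"
proof -
  note rW = coind_rep(1)[OF W]
  have eq: "equivariant G H \<iota> V (\<lambda>g. f (rep_act U g u))" if "u \<in> rep_space U" for u
    unfolding equivariant_def
    using f(2) fh rep_closed[OF U] rep_mult[OF U coind_carrier[OF W]] that by simp
  define k where "k = (\<lambda>u. THE w. w \<in> rep_space W \<and> (\<forall>g\<in>carrier G. e (rep_act W g w) = f (rep_act U g u)))"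
  have k: "k u \<in> rep_space W \<and> (\<forall>g\<in>carrier G. e (rep_act W g (k u)) = f (rep_act U g u))"
    if "u \<in> rep_space U" for u
    unfolding k_def using theI'[OF coind_ex1[OF W eq[OF that]]] .
  \<comment> \<open>A vector of W is pinned down by its function on G, so additivity, homogeneity
    and equivariance of k are all checked on values.\<close>
  have un: "k u = w" if "u \<in> rep_space U" "w \<in> rep_space W"
    "\<And>g. g \<in> carrier G \<Longrightarrow> e (rep_act W g w) = f (rep_act U g u)" for u w
    using coind_unique[OF W _ that(2), of "k u"] k[OF that(1)] that(3) by metis
  have "ghom G U W k"
    unfolding ghom_def linear_on_def
  proof (intro conjI ballI allI)
    fix u v assume uv: "u \<in> rep_space U" "v \<in> rep_space U"
    show "k (u + v) = k u + k v"
    proof (rule un)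
      show "u + v \<in> rep_space U" using uv cfun.subspace_add[OF rep_subspace[OF U]] by auto
      show "k u + k v \<in> rep_space W" using uv k cfun.subspace_add[OF rep_subspace[OF rW]] by auto
      fix g assume g: "g \<in> carrier G"
      have "e (rep_act W g (k u + k v)) = e (rep_act W g (k u)) + e (rep_act W g (k v))"
        using g uv k rep_closed[OF rW g] linear_on_add[OF rep_linear[OF rW g]]
          linear_on_add[OF coind_linear[OF W]] by simp
      also have "\<dots> = f (rep_act U g (u + v))"
        using g uv k rep_closed[OF U g] linear_on_add[OF rep_linear[OF U g]]
          linear_on_add[OF f(1)] by simp
      finally show "e (rep_act W g (k u + k v)) = f (rep_act U g (u + v))" .
    qed
  next
    fix c u assume u: "u \<in> rep_space U"
    show "k (cscale c u) = cscale c (k u)"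
    proof (rule un)
      show "cscale c u \<in> rep_space U" using u cfun.subspace_scale[OF rep_subspace[OF U]] by auto
      show "cscale c (k u) \<in> rep_space W" using u k cfun.subspace_scale[OF rep_subspace[OF rW]] by auto
      fix g assume g: "g \<in> carrier G"
      have "e (rep_act W g (cscale c (k u))) = cscale c (e (rep_act W g (k u)))"
        using g u k rep_closed[OF rW g] linear_on_scale[OF rep_linear[OF rW g]]
          linear_on_scale[OF coind_linear[OF W]] by simp
      also have "\<dots> = f (rep_act U g (cscale c u))"
        using g u k rep_closed[OF U g] linear_on_scale[OF rep_linear[OF U g]]
          linear_on_scale[OF f(1)] by simp
      finally show "e (rep_act W g (cscale c (k u))) = f (rep_act U g (cscale c u))" .
    qed
  next
    fix u assume "u \<in> rep_space U"
    then show "k u \<in> rep_space W" using k by blast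
  next
    fix a u assume a: "a \<in> carrier G" and u: "u \<in> rep_space U"
    interpret group G using rep_group[OF U] .
    show "k (rep_act U a u) = rep_act W a (k u)"
    proof (rule un)
      show "rep_act U a u \<in> rep_space U" using a u rep_closed[OF U] by auto
      show "rep_act W a (k u) \<in> rep_space W" using a u k rep_closed[OF rW] by auto
      fix g assume g: "g \<in> carrier G"
      show "e (rep_act W g (rep_act W a (k u))) = f (rep_act U g (rep_act U a u))"
        using k[OF u] rep_mult[OF rW g a, of "k u", symmetric] rep_mult[OF U g a u, symmetric] g a by simp
    qed
  qed
  then show ?thesis using that k by blast
qed

text \<open>Conjugate subgroups give isomorphic inductions: c intertwines \<iota> with \<iota>'
  after \<theta>, and the function \<phi> of a vector goes to g |-> \<psi> (\<phi> (c g)).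
  Uniqueness of the coinduced module and the exchange of the middle blocks are both
  instances.\<close>

lemma coind_iso:
  assumes W: "coinduced G H \<iota> V W e" and W': "coinduced G H' \<iota>' V' W' e'"
    and c: "c \<in> carrier G" and \<theta>: "\<theta> ` carrier H = carrier H'"
    and conj: "\<And>h. h \<in> carrier H \<Longrightarrow> \<iota> h \<otimes>\<^bsub>G\<^esub> c = c \<otimes>\<^bsub>G\<^esub> \<iota>' (\<theta> h)"
    and \<psi>: "linear_on (rep_space V) \<psi>" "bij_betw \<psi> (rep_space V) (rep_space V')"
    and \<psi>h: "\<And>h v. h \<in> carrier H \<Longrightarrow> v \<in> rep_space V \<Longrightarrow> \<psi> (rep_act V h v) = rep_act V' (\<theta> h) (\<psi> v)"
  shows "rep_iso G W W'"
proof -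
  note rW = coind_rep(1)[OF W] and rW' = coind_rep(1)[OF W']
  interpret group G using rep_group[OF rW] .
  have cc: "c \<otimes>\<^bsub>G\<^esub> (inv\<^bsub>G\<^esub> c \<otimes>\<^bsub>G\<^esub> x) = x" if "x \<in> carrier G" for x
    using c that by (simp add: m_assoc[symmetric])
  have \<psi>V: "\<And>v. v \<in> rep_space V \<Longrightarrow> \<psi> v \<in> rep_space V'" using \<psi>(2) bij_betwE by blast
  define f where "f = (\<lambda>w. \<psi> (e (rep_act W c w)))"
  have cl: "rep_act W g w \<in> rep_space W" if "g \<in> carrier G" "w \<in> rep_space W" for g w
    using rep_closed[OF rW that] .
  have lf: "linear_on (rep_space W) f"
  proof -
    have "linear_on (rep_space W) (\<lambda>w. e (rep_act W c w))"
      by (rule linear_on_comp[OF rep_linear[OF rW c] _ coind_linear[OF W]]) (use cl c in auto)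
    then show ?thesis unfolding f_def
      by (rule linear_on_comp[OF _ _ \<psi>(1)]) (use cl c coind_closed[OF W] in auto)
  qed
  have fV: "f w \<in> rep_space V'" if "w \<in> rep_space W" for w
    unfolding f_def using that cl c coind_closed[OF W] \<psi>V by auto
  have fh: "f (rep_act W (\<iota>' k) w) = rep_act V' k (f w)" if k: "k \<in> carrier H'" and w: "w \<in> rep_space W" for k w
  proof -
    obtain h where h: "h \<in> carrier H" "k = \<theta> h" using k unfolding \<theta>[symmetric] by auto
    have ik: "\<iota>' k \<in> carrier G" using coind_carrier[OF W' k] .
    have ih: "\<iota> h \<in> carrier G" using coind_carrier[OF W h(1)] .
    have "rep_act W c (rep_act W (\<iota>' k) w) = rep_act W (\<iota> h) (rep_act W c w)"
      using rep_mult[OF rW c ik w] rep_mult[OF rW ih c w] conj[OF h(1)] h(2) by simp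
    then show ?thesis
      unfolding f_def using coind_act[OF W h(1)] \<psi>h[OF h(1)] h(2) cl[OF c w] coind_closed[OF W] by simp
  qed
  obtain k where k: "ghom G W W' k"
    "\<And>g u. g \<in> carrier G \<Longrightarrow> u \<in> rep_space W \<Longrightarrow> e' (rep_act W' g (k u)) = f (rep_act W g u)"
    using coind_lift[OF W' rW lf fV fh] by blast
  have inj: "inj_on k (rep_space W)"
  proof (rule inj_onI)
    fix u v assume u: "u \<in> rep_space W" and v: "v \<in> rep_space W" and uv: "k u = k v"
    show "u = v"
    proof (rule coind_unique[OF W u v])
      fix g assume g: "g \<in> carrier G"
      have g': "inv\<^bsub>G\<^esub> c \<otimes>\<^bsub>G\<^esub> g \<in> carrier G" using g c by auto
      have "f (rep_act W (inv\<^bsub>G\<^esub> c \<otimes>\<^bsub>G\<^esub> g) u) = f (rep_act W (inv\<^bsub>G\<^esub> c \<otimes>\<^bsub>G\<^esub> g) v)"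
        using k(2)[OF g' u] k(2)[OF g' v] uv by simp
      moreover have "rep_act W c (rep_act W (inv\<^bsub>G\<^esub> c \<otimes>\<^bsub>G\<^esub> g) u) = rep_act W g u" if "u \<in> rep_space W" for u
        using rep_mult[OF rW c g' that] g c by (simp add: m_assoc[symmetric])
      ultimately have "\<psi> (e (rep_act W g u)) = \<psi> (e (rep_act W g v))"
        unfolding f_def using u v by simp
      then show "e (rep_act W g u) = e (rep_act W g v)"
        using \<psi>(2) u v coind_closed[OF W] cl[OF g] by (meson bij_betw_imp_inj_on inj_onD)
    qed
  qed
  have surj: "k ` rep_space W = rep_space W'"
  proof (intro subset_antisym subsetI)
    fix x assume "x \<in> k ` rep_space W" then show "x \<in> rep_space W'" using ghom_closed[OF k(1)] by blast
  next
    fix w' assume w': "w' \<in> rep_space W'"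
    let ?i = "the_inv_into (rep_space V) \<psi>"
    \<comment> \<open>Obtained by solving \<psi> (\<phi> (c g)) = e' (g w') for \<phi>.\<close>
    define \<phi> where "\<phi> = (\<lambda>g. ?i (e' (rep_act W' (inv\<^bsub>G\<^esub> c \<otimes>\<^bsub>G\<^esub> g) w')))"
    have i1: "?i v \<in> rep_space V" "\<psi> (?i v) = v" if "v \<in> rep_space V'" for v
      using \<psi>(2) that bij_betwE[OF bij_betw_the_inv_into[OF \<psi>(2)]] f_the_inv_into_f_bij_betw[OF \<psi>(2)] by auto
    have i2: "?i (\<psi> v) = v" if "v \<in> rep_space V" for v
      using \<psi>(2) that by (metis bij_betw_imp_inj_on the_inv_into_f_f)
    have in': "e' (rep_act W' g w') \<in> rep_space V'" if "g \<in> carrier G" for g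
      using coind_closed[OF W'] rep_closed[OF rW' that w'] by auto
    have "equivariant G H \<iota> V \<phi>"
      unfolding equivariant_def
    proof (intro conjI ballI)
      fix g assume g: "g \<in> carrier G"
      then show "\<phi> g \<in> rep_space V" unfolding \<phi>_def using i1 in' c by auto
      fix h assume h: "h \<in> carrier H"
      have th: "\<theta> h \<in> carrier H'" using h \<theta> by auto
      note C = coind_carrier[OF W h] coind_carrier[OF W' th]
      \<comment> \<open>Insert c c^-1 behind \<iota> h, so that the intertwining relation
        applies.\<close>
      have "inv\<^bsub>G\<^esub> c \<otimes>\<^bsub>G\<^esub> (\<iota> h \<otimes>\<^bsub>G\<^esub> g) = inv\<^bsub>G\<^esub> c \<otimes>\<^bsub>G\<^esub> (\<iota> h \<otimes>\<^bsub>G\<^esub> c) \<otimes>\<^bsub>G\<^esub> (inv\<^bsub>G\<^esub> c \<otimes>\<^bsub>G\<^esub> g)"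
        using C g c cc by (simp add: m_assoc)
      also have "\<dots> = \<iota>' (\<theta> h) \<otimes>\<^bsub>G\<^esub> (inv\<^bsub>G\<^esub> c \<otimes>\<^bsub>G\<^esub> g)"
        unfolding conj[OF h] using C g c by (simp add: m_assoc[symmetric])
      finally have "e' (rep_act W' (inv\<^bsub>G\<^esub> c \<otimes>\<^bsub>G\<^esub> (\<iota> h \<otimes>\<^bsub>G\<^esub> g)) w') = rep_act V' (\<theta> h) (\<psi> (\<phi> g))"
        unfolding \<phi>_def using i1 in' g c rep_mult[OF rW' C(2) _ w'] coind_act[OF W' th] rep_closed[OF rW' _ w']
        by simp
      also have "\<dots> = \<psi> (rep_act V h (\<phi> g))"
        using \<psi>h[OF h] \<open>\<phi> g \<in> rep_space V\<close> by simp
      finally show "\<phi> (\<iota> h \<otimes>\<^bsub>G\<^esub> g) = rep_act V h (\<phi> g)"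
        unfolding \<phi>_def[THEN fun_cong, of "\<iota> h \<otimes>\<^bsub>G\<^esub> g"]
        using i2 rep_closed[OF coind_rep(2)[OF W] h \<open>\<phi> g \<in> rep_space V\<close>] by simp
    qed
    then obtain w where w: "w \<in> rep_space W" "\<And>g. g \<in> carrier G \<Longrightarrow> e (rep_act W g w) = \<phi> g"
      using coind_obtain[OF W] by blast
    have "k w = w'"
    proof (rule coind_unique[OF W' _ w'])
      show "k w \<in> rep_space W'" using ghom_closed[OF k(1) w(1)] .
      fix g assume g: "g \<in> carrier G"
      have "e' (rep_act W' g (k w)) = \<psi> (e (rep_act W c (rep_act W g w)))"
        using k(2)[OF g w(1)] unfolding f_def .
      also have "\<dots> = \<psi> (\<phi> (c \<otimes>\<^bsub>G\<^esub> g))" using rep_mult[OF rW c g w(1), symmetric] w(2)[of "c \<otimes>\<^bsub>G\<^esub> g"] c g by simp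
      also have "\<dots> = e' (rep_act W' g w')"
        unfolding \<phi>_def using i1 in' c g by (simp add: m_assoc[symmetric])
      finally show "e' (rep_act W' g (k w)) = e' (rep_act W' g w')" .
    qed
    then show "w' \<in> k ` rep_space W" using w(1) by blast
  qed
  show ?thesis unfolding rep_iso_iff bij_betw_def using rW rW' k(1) inj surj by blast
qed

lemma coind_same:
  assumes "coinduced G H \<iota> V W e" "coinduced G H \<iota> V W' e'"
  shows "rep_iso G W W'"
  using assms
proof (rule coind_iso)
  interpret group G using rep_group[OF coind_rep(1)[OF assms(1)]] .
  show "\<one>\<^bsub>G\<^esub> \<in> carrier G" by simp
  show "id ` carrier H = carrier H" by simp
  show "\<iota> h \<otimes>\<^bsub>G\<^esub> \<one>\<^bsub>G\<^esub> = \<one>\<^bsub>G\<^esub> \<otimes>\<^bsub>G\<^esub> \<iota> (id h)" if "h \<in> carrier H" for h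
    using coind_carrier[OF assms(1) that] by simp
  show "linear_on (rep_space V) (\<lambda>v. v)" by (simp add: linear_on_def)
qed (simp_all add: bij_betw_def inj_on_def)

text \<open>An isomorphism counts as coinduction from G to itself. This lets a tensor factor be
  replaced by an isomorphic one with the lemmas on coinduction from products.\<close>

lemma coind_ghom_bij:
  assumes r: "representation G Q" "representation G Q'"
    and f: "ghom G Q Q' f" "bij_betw f (rep_space Q) (rep_space Q')"
  shows "coinduced G G (\<lambda>g. g) Q' Q f"
proof (rule coinducedI[OF r])
  interpret group G using rep_group[OF r(1)] .
  show "(\<lambda>g. g) \<in> hom G G" by (simp add: hom_def)
  show "ghom G (res_rep (\<lambda>g. g) Q) Q' f" using f(1) by (simp add: ghom_def)
  {
    fix \<phi> assume \<phi>: "equivariant G G (\<lambda>g. g) Q' \<phi>"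
    then have "\<phi> \<one>\<^bsub>G\<^esub> \<in> rep_space Q'" by (simp add: equivariant_def)
    then obtain w where w: "w \<in> rep_space Q" "f w = \<phi> \<one>\<^bsub>G\<^esub>"
      using f(2) unfolding bij_betw_def by (metis imageE)
    have "f (rep_act Q g w) = \<phi> g" if g: "g \<in> carrier G" for g
    proof -
      have "\<phi> (g \<otimes>\<^bsub>G\<^esub> \<one>\<^bsub>G\<^esub>) = rep_act Q' g (\<phi> \<one>\<^bsub>G\<^esub>)" using \<phi> g one_closed unfolding equivariant_def by blast
      then show ?thesis using ghom_act[OF f(1) g w(1)] w(2) g by simp
    qed
    then show "\<exists>w\<in>rep_space Q. \<forall>g\<in>carrier G. f (rep_act Q g w) = \<phi> g" using w(1) by blast
  next
    fix v w assume vw: "v \<in> rep_space Q" "w \<in> rep_space Q"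
      and eq: "\<And>g. g \<in> carrier G \<Longrightarrow> f (rep_act Q g v) = f (rep_act Q g w)"
    have "f v = f w" using eq[OF one_closed] vw by (simp add: rep_one[OF r(1)])
    then show "v = w" using f(2) vw unfolding bij_betw_def inj_on_def by blast
  }
qed

text \<open>An H-equivariant function \<phi> on G is read as a family, indexed by g, of functions k
  |-> \<phi> (\<iota> k g) on K. Each of them is a vector of V1, and these vectors form a
  K-equivariant function on G.\<close>

lemma coind_trans:
  assumes W: "coinduced G K \<iota> V1 W e1" and V: "coinduced K H \<kappa> V V1 e2"
  shows "coinduced G H (\<lambda>h. \<iota> (\<kappa> h)) V W (\<lambda>w. e2 (e1 w))"
proof (rule coinducedI)
  note rW = coind_rep(1)[OF W] and rV1 = coind_rep(2)[OF W]
  show "representation G W" "representation H V" using rW coind_rep[OF V] by auto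
  show "(\<lambda>h. \<iota> (\<kappa> h)) \<in> hom H G"
    using coind_hom[OF W] coind_hom[OF V] unfolding hom_def by auto
  show "ghom H (res_rep (\<lambda>h. \<iota> (\<kappa> h)) W) V (\<lambda>w. e2 (e1 w))"
    unfolding ghom_def res_rep_simps
  proof (intro conjI ballI)
    show "linear_on (rep_space W) (\<lambda>w. e2 (e1 w))"
      by (rule linear_on_comp[OF coind_linear[OF W] _ coind_linear[OF V]]) (use coind_closed[OF W] in auto)
  qed (use coind_closed[OF V] coind_closed[OF W] coind_act[OF W] coind_act[OF V] coind_carrier[OF V] in auto)
next
  note rW = coind_rep(1)[OF W] and rV1 = coind_rep(2)[OF W]
  interpret G: group G using rep_group[OF rW] .
  interpret K: group K using rep_group[OF rV1] .
  {
    fix \<phi> assume \<phi>: "equivariant G H (\<lambda>h. \<iota> (\<kappa> h)) V \<phi>"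
    have "equivariant K H \<kappa> V (\<lambda>k. \<phi> (\<iota> k \<otimes>\<^bsub>G\<^esub> g))" if g: "g \<in> carrier G" for g
      unfolding equivariant_def
    proof (intro conjI ballI)
      fix k assume k: "k \<in> carrier K"
      show "\<phi> (\<iota> k \<otimes>\<^bsub>G\<^esub> g) \<in> rep_space V"
        using \<phi> g coind_carrier[OF W k] unfolding equivariant_def by auto
      fix h assume h: "h \<in> carrier H"
      have "\<iota> (\<kappa> h \<otimes>\<^bsub>K\<^esub> k) \<otimes>\<^bsub>G\<^esub> g = \<iota> (\<kappa> h) \<otimes>\<^bsub>G\<^esub> (\<iota> k \<otimes>\<^bsub>G\<^esub> g)"
        using g k coind_carrier[OF V h] coind_carrier[OF W] coind_hom[OF W]
        by (simp add: hom_def G.m_assoc Pi_iff)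
      then show "\<phi> (\<iota> (\<kappa> h \<otimes>\<^bsub>K\<^esub> k) \<otimes>\<^bsub>G\<^esub> g) = rep_act V h (\<phi> (\<iota> k \<otimes>\<^bsub>G\<^esub> g))"
        using \<phi> h g coind_carrier[OF W k] unfolding equivariant_def by auto
    qed
    then have "\<exists>v\<in>rep_space V1. \<forall>k\<in>carrier K. e2 (rep_act V1 k v) = \<phi> (\<iota> k \<otimes>\<^bsub>G\<^esub> g)"
      if "g \<in> carrier G" for g using coind_obtain[OF V] that by metis
    then obtain \<psi> where \<psi>: "\<And>g. g \<in> carrier G \<Longrightarrow> \<psi> g \<in> rep_space V1"
      "\<And>g k. g \<in> carrier G \<Longrightarrow> k \<in> carrier K \<Longrightarrow> e2 (rep_act V1 k (\<psi> g)) = \<phi> (\<iota> k \<otimes>\<^bsub>G\<^esub> g)"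
      by metis
    have "equivariant G K \<iota> V1 \<psi>"
      unfolding equivariant_def
    proof (intro conjI ballI)
      fix g assume g: "g \<in> carrier G"
      then show "\<psi> g \<in> rep_space V1" using \<psi> by auto
      fix k assume k: "k \<in> carrier K"
      note ik = coind_carrier[OF W k]
      show "\<psi> (\<iota> k \<otimes>\<^bsub>G\<^esub> g) = rep_act V1 k (\<psi> g)"
      proof (rule coind_unique[OF V])
        show "\<psi> (\<iota> k \<otimes>\<^bsub>G\<^esub> g) \<in> rep_space V1" using \<psi>(1) ik g by auto
        show "rep_act V1 k (\<psi> g) \<in> rep_space V1" using \<psi>(1) k g rep_closed[OF rV1] by auto
        fix l assume l: "l \<in> carrier K"
        have "\<iota> (l \<otimes>\<^bsub>K\<^esub> k) \<otimes>\<^bsub>G\<^esub> g = \<iota> l \<otimes>\<^bsub>G\<^esub> (\<iota> k \<otimes>\<^bsub>G\<^esub> g)"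
          using g k l coind_carrier[OF W] coind_hom[OF W] by (simp add: hom_def G.m_assoc Pi_iff)
        then show "e2 (rep_act V1 l (\<psi> (\<iota> k \<otimes>\<^bsub>G\<^esub> g))) = e2 (rep_act V1 l (rep_act V1 k (\<psi> g)))"
          using \<psi> g k l ik rep_mult[OF rV1 l k] by (metis G.m_closed K.m_closed)
      qed
    qed
    then obtain w where w: "w \<in> rep_space W" "\<And>g. g \<in> carrier G \<Longrightarrow> e1 (rep_act W g w) = \<psi> g"
      using coind_obtain[OF W] by blast
    have "e2 (e1 (rep_act W g w)) = \<phi> g" if g: "g \<in> carrier G" for g
    proof -
      \<comment> \<open>The value of \<phi> at g is the member of the family at g, taken at k =
        1.\<close>
      have "\<iota> \<one>\<^bsub>K\<^esub> = \<one>\<^bsub>G\<^esub>"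
        using coind_hom[OF W] hom_one K.group_axioms G.group_axioms by blast
      then show ?thesis using \<psi>(2)[OF g K.one_closed] w(2)[OF g] rep_one[OF rV1 \<psi>(1)[OF g]] g by simp
    qed
    then show "\<exists>w\<in>rep_space W. \<forall>g\<in>carrier G. e2 (e1 (rep_act W g w)) = \<phi> g" using w(1) by blast
  next
    fix v w assume v: "v \<in> rep_space W" and w: "w \<in> rep_space W"
      and e: "\<And>g. g \<in> carrier G \<Longrightarrow> e2 (e1 (rep_act W g v)) = e2 (e1 (rep_act W g w))"
    show "v = w"
    proof (rule coind_unique[OF W v w])
      fix g assume g: "g \<in> carrier G"
      have "e2 (rep_act V1 k (e1 (rep_act W g u))) = e2 (e1 (rep_act W (\<iota> k \<otimes>\<^bsub>G\<^esub> g) u))"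
        if "k \<in> carrier K" "u \<in> rep_space W" for k u
        using coind_act[OF W that(1)] rep_mult[OF rW coind_carrier[OF W that(1)] g that(2)]
          rep_closed[OF rW g that(2)] by simp
      then show "e1 (rep_act W g v) = e1 (rep_act W g w)"
        using e v w g coind_carrier[OF W] rep_closed[OF rW g] coind_closed[OF W]
        by (intro coind_unique[OF V]) auto
    qed
  }
qed

text \<open>The universal property of a product, through projections instead of inclusions: like
  coinduction it determines a vector by prescribed values, which is why the two commute. Finiteness
  of I enters when V is compared with \<open>direct_sum\<close>.\<close>

definition is_sum :: "('g, 'm) monoid_scheme \<Rightarrow> 'i set \<Rightarrow> ('i \<Rightarrow> ('g, 'x) rep) \<Rightarrow> ('g, 'y) rep \<Rightarrow>
    ('i \<Rightarrow> ('y \<Rightarrow> complex) \<Rightarrow> 'x \<Rightarrow> complex) \<Rightarrow> bool"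
  where "is_sum G I R V p \<longleftrightarrow> representation G V \<and> (\<forall>i\<in>I. representation G (R i) \<and> ghom G V (R i) (p i)) \<and>
    (\<forall>r. (\<forall>i\<in>I. r i \<in> rep_space (R i)) \<longrightarrow> (\<exists>!v. v \<in> rep_space V \<and> (\<forall>i\<in>I. p i v = r i)))"

lemma
  assumes "is_sum G I R V p"
  shows is_sum_rep: "representation G V" "\<And>i. i \<in> I \<Longrightarrow> representation G (R i)"
    and is_sum_ghom: "\<And>i. i \<in> I \<Longrightarrow> ghom G V (R i) (p i)"
    and is_sum_ex1: "(\<And>i. i \<in> I \<Longrightarrow> r i \<in> rep_space (R i)) \<Longrightarrow>
      \<exists>!v. v \<in> rep_space V \<and> (\<forall>i\<in>I. p i v = r i)"
  using assms unfolding is_sum_def by blast+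

lemma is_sum_unique:
  assumes "is_sum G I R V p" "u \<in> rep_space V" "v \<in> rep_space V" "\<And>i. i \<in> I \<Longrightarrow> p i u = p i v"
  shows "u = v"
  using is_sum_ex1[OF assms(1), of "\<lambda>i. p i v"] ghom_closed[OF is_sum_ghom[OF assms(1)] assms(3)] assms
  by blast

lemma is_sumI:
  assumes "representation G V" "\<And>i. i \<in> I \<Longrightarrow> representation G (R i)" "\<And>i. i \<in> I \<Longrightarrow> ghom G V (R i) (p i)"
    "\<And>r. (\<And>i. i \<in> I \<Longrightarrow> r i \<in> rep_space (R i)) \<Longrightarrow> \<exists>v\<in>rep_space V. \<forall>i\<in>I. p i v = r i"
    "\<And>u v. u \<in> rep_space V \<Longrightarrow> v \<in> rep_space V \<Longrightarrow> (\<And>i. i \<in> I \<Longrightarrow> p i u = p i v) \<Longrightarrow> u = v"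
  shows "is_sum G I R V p"
  unfolding is_sum_def using assms by (metis (no_types, lifting))

lemma is_sum_iso:
  assumes V: "is_sum G I R V p" and U: "rep_iso G U V"
  obtains q where "is_sum G I R U q"
proof -
  obtain f where f: "ghom G U V f" "bij_betw f (rep_space U) (rep_space V)" and rU: "representation G U"
    using U unfolding rep_iso_iff by blast
  have "is_sum G I R U (\<lambda>i u. p i (f u))"
  proof (rule is_sumI[OF rU])
    fix i assume "i \<in> I"
    then show "representation G (R i)" "ghom G U (R i) (\<lambda>u. p i (f u))"
      using is_sum_rep(2)[OF V] ghom_comp[OF f(1) is_sum_ghom[OF V]] by auto
  next
    fix r assume "\<And>i. i \<in> I \<Longrightarrow> r i \<in> rep_space (R i)"
    then obtain v where "v \<in> rep_space V" "\<forall>i\<in>I. p i v = r i" using is_sum_ex1[OF V] by blast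
    then show "\<exists>v\<in>rep_space U. \<forall>i\<in>I. p i (f v) = r i"
      using f(2) by (metis bij_betw_imp_surj_on imageE)
  next
    fix u v assume "u \<in> rep_space U" "v \<in> rep_space U" "\<And>i. i \<in> I \<Longrightarrow> p i (f u) = p i (f v)"
    then have "f u = f v" using is_sum_unique[OF V] ghom_closed[OF f(1)] by blast
    then show "u = v" using f(2) \<open>u \<in> _\<close> \<open>v \<in> _\<close> by (meson bij_betw_imp_inj_on inj_onD)
  qed
  then show ?thesis using that by blast
qed

lemma is_sum_trans:
  assumes V: "is_sum G I R V p" and R: "\<And>i. i \<in> I \<Longrightarrow> is_sum G J (S i) (R i) (q i)"
  shows "is_sum G (I \<times> J) (\<lambda>(i, j). S i j) V (\<lambda>(i, j) v. q i j (p i v))"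
proof (rule is_sumI[OF is_sum_rep(1)[OF V]])
  fix x assume "x \<in> I \<times> J"
  then obtain i j where x: "x = (i, j)" "i \<in> I" "j \<in> J" by blast
  show "representation G ((\<lambda>(i, j). S i j) x)" using x is_sum_rep(2)[OF R] by auto
  show "ghom G V ((\<lambda>(i, j). S i j) x) ((\<lambda>(i, j) v. q i j (p i v)) x)"
    using x ghom_comp[OF is_sum_ghom[OF V] is_sum_ghom[OF R]] by auto
next
  fix r assume r: "\<And>x. x \<in> I \<times> J \<Longrightarrow> r x \<in> rep_space ((\<lambda>(i, j). S i j) x)"
  have "\<exists>v\<in>rep_space (R i). \<forall>j\<in>J. q i j v = r (i, j)" if i: "i \<in> I" for i
    using is_sum_ex1[OF R[OF i], of "\<lambda>j. r (i, j)"] r i by force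
  then obtain s where s: "\<And>i. i \<in> I \<Longrightarrow> s i \<in> rep_space (R i)" "\<And>i j. i \<in> I \<Longrightarrow> j \<in> J \<Longrightarrow> q i j (s i) = r (i, j)"
    by metis
  obtain v where "v \<in> rep_space V" "\<forall>i\<in>I. p i v = s i" using is_sum_ex1[OF V s(1)] by blast
  then show "\<exists>v\<in>rep_space V. \<forall>x\<in>I \<times> J. (\<lambda>(i, j) v. q i j (p i v)) x v = r x"
    using s(2) by (intro bexI[of _ v]) auto
next
  fix u v assume u: "u \<in> rep_space V" and v: "v \<in> rep_space V"
    and e: "\<And>x. x \<in> I \<times> J \<Longrightarrow> (\<lambda>(i, j) v. q i j (p i v)) x u = (\<lambda>(i, j) v. q i j (p i v)) x v"
  show "u = v"
  proof (rule is_sum_unique[OF V u v])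
    fix i assume i: "i \<in> I"
    show "p i u = p i v"
      by (rule is_sum_unique[OF R[OF i]])
        (use e i ghom_closed[OF is_sum_ghom[OF V i]] u v in force)+
  qed
qed

text \<open>The projection q i is the lift of p i after e. A family of vectors r i is glued by
  gluing the values of their equivariant functions at each g separately.\<close>

lemma coind_is_sum:
  assumes W: "coinduced G H \<iota> V W e" and V: "is_sum H I R V p"
    and Wi: "\<And>i. i \<in> I \<Longrightarrow> coinduced G H \<iota> (R i) (W' i) (e' i)"
  obtains q where "is_sum G I W' W q"
proof -
  note rW = coind_rep(1)[OF W]
  have "\<exists>q. ghom G W (W' i) q \<and> (\<forall>g\<in>carrier G. \<forall>u\<in>rep_space W. e' i (rep_act (W' i) g (q u)) = p i (e (rep_act W g u)))"
    if i: "i \<in> I" for i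
  proof -
    note pi = is_sum_ghom[OF V i]
    have 1: "linear_on (rep_space W) (\<lambda>w. p i (e w))"
      by (rule linear_on_comp[OF coind_linear[OF W] _ ghom_linear[OF pi]]) (use coind_closed[OF W] in auto)
    have 2: "p i (e u) \<in> rep_space (R i)" if "u \<in> rep_space W" for u
      using that ghom_closed[OF pi] coind_closed[OF W] by auto
    have 3: "p i (e (rep_act W (\<iota> h) u)) = rep_act (R i) h (p i (e u))"
      if "h \<in> carrier H" "u \<in> rep_space W" for h u
      using that ghom_act[OF pi] coind_act[OF W] coind_closed[OF W] by auto
    show ?thesis using coind_lift[OF Wi[OF i] rW 1 2 3] by metis
  qed
  then obtain q where q: "\<And>i. i \<in> I \<Longrightarrow> ghom G W (W' i) (q i)"
    "\<And>i g u. i \<in> I \<Longrightarrow> g \<in> carrier G \<Longrightarrow> u \<in> rep_space W \<Longrightarrow>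
      e' i (rep_act (W' i) g (q i u)) = p i (e (rep_act W g u))"
    by metis
  have "is_sum G I W' W q"
  proof (rule is_sumI[OF rW coind_rep(1)[OF Wi] q(1)])
    fix r assume r: "\<And>i. i \<in> I \<Longrightarrow> r i \<in> rep_space (W' i)"
    have eq: "\<And>i. i \<in> I \<Longrightarrow> equivariant G H \<iota> (R i) (\<lambda>g. e' i (rep_act (W' i) g (r i)))"
      using coind_equivariant[OF Wi] r by blast
    have "\<exists>v\<in>rep_space V. \<forall>i\<in>I. p i v = e' i (rep_act (W' i) g (r i))" if "g \<in> carrier G" for g
      using is_sum_ex1[OF V, of "\<lambda>i. e' i (rep_act (W' i) g (r i))"] eq that unfolding equivariant_def by blast
    then obtain \<phi> where \<phi>: "\<And>g. g \<in> carrier G \<Longrightarrow> \<phi> g \<in> rep_space V"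
      "\<And>g i. g \<in> carrier G \<Longrightarrow> i \<in> I \<Longrightarrow> p i (\<phi> g) = e' i (rep_act (W' i) g (r i))" by metis
    interpret group G using rep_group[OF rW] .
    have "equivariant G H \<iota> V \<phi>"
      unfolding equivariant_def
    proof (intro conjI ballI)
      fix g h assume g: "g \<in> carrier G" and h: "h \<in> carrier H"
      note ih = coind_carrier[OF W h]
      show "\<phi> (\<iota> h \<otimes>\<^bsub>G\<^esub> g) = rep_act V h (\<phi> g)"
      proof (rule is_sum_unique[OF V])
        show "\<phi> (\<iota> h \<otimes>\<^bsub>G\<^esub> g) \<in> rep_space V" "rep_act V h (\<phi> g) \<in> rep_space V"
          using \<phi>(1) g h ih rep_closed[OF is_sum_rep(1)[OF V]] by auto
        fix i assume i: "i \<in> I"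
        show "p i (\<phi> (\<iota> h \<otimes>\<^bsub>G\<^esub> g)) = p i (rep_act V h (\<phi> g))"
          using \<phi> g h i ih eq[OF i] ghom_act[OF is_sum_ghom[OF V i] h] unfolding equivariant_def by simp
      qed
    qed (use \<phi> in auto)
    then obtain w where w: "w \<in> rep_space W" "\<And>g. g \<in> carrier G \<Longrightarrow> e (rep_act W g w) = \<phi> g"
      using coind_obtain[OF W] by blast
    have "q i w = r i" if i: "i \<in> I" for i
      by (rule coind_unique[OF Wi[OF i]]) (use i r q w \<phi> ghom_closed[OF q(1)] in auto)
    then show "\<exists>v\<in>rep_space W. \<forall>i\<in>I. q i v = r i" using w(1) by blast
  next
    fix u v assume u: "u \<in> rep_space W" and v: "v \<in> rep_space W" and e: "\<And>i. i \<in> I \<Longrightarrow> q i u = q i v"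
    show "u = v"
    proof (rule coind_unique[OF W u v])
      fix g assume g: "g \<in> carrier G"
      show "e (rep_act W g u) = e (rep_act W g v)"
      proof (rule is_sum_unique[OF V])
        fix i assume "i \<in> I"
        then show "p i (e (rep_act W g u)) = p i (e (rep_act W g v))"
          using q(2)[OF _ g u] q(2)[OF _ g v] e by metis
      qed (use u v g rep_closed[OF rW] coind_closed[OF W] in auto)
    qed
  qed
  then show ?thesis using that by blast
qed

section \<open>Direct sums and induced representations\<close>

text \<open>Slices of functions on a product are lambda terms, so closure and linearity are restated
  in that form.\<close>

lemma
  assumes "cfun.subspace V"
  shows subspace_zero_pw: "(\<lambda>x. 0) \<in> V"
    and subspace_add_pw: "f \<in> V \<Longrightarrow> g \<in> V \<Longrightarrow> (\<lambda>x. f x + g x) \<in> V"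
    and subspace_scale_pw: "f \<in> V \<Longrightarrow> (\<lambda>x. c * f x) \<in> V"
  using cfun.subspace_0[OF assms] cfun.subspace_add[OF assms, of f g] cfun.subspace_scale[OF assms, of f c]
  by (simp_all add: zero_fun_def plus_fun_def cscale_def)

lemma
  assumes "linear_on V F"
  shows linear_on_add_pw: "f \<in> V \<Longrightarrow> g \<in> V \<Longrightarrow> F (\<lambda>x. f x + g x) = (\<lambda>x. F f x + F g x)"
    and linear_on_scale_pw: "f \<in> V \<Longrightarrow> F (\<lambda>x. c * f x) = (\<lambda>x. c * F f x)"
    and linear_on_zero_pw: "cfun.subspace V \<Longrightarrow> F (\<lambda>x. 0) = (\<lambda>x. 0)"
  using linear_on_add[OF assms, of f g] linear_on_scale[OF assms, of f c] linear_on_zero[OF assms]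
  by (simp_all add: zero_fun_def plus_fun_def cscale_def)

text \<open>Besides direct sums this covers induced modules, whose elements are families of slices
  indexed by the finite carrier of G.\<close>

lemma direct_sum_findim:
  fixes V :: "'i \<Rightarrow> ('x \<Rightarrow> complex) set"
  assumes "finite I" "\<And>i. i \<in> I \<Longrightarrow> findim (V i)"
  shows "findim {F. (\<forall>i\<in>I. (\<lambda>x. F (i, x)) \<in> V i) \<and> (\<forall>i x. i \<notin> I \<longrightarrow> F (i, x) = 0)}"
proof -
  obtain B where B: "\<And>i. i \<in> I \<Longrightarrow> finite (B i) \<and> V i \<subseteq> cfun.span (B i)"
    using assms(2) unfolding findim_def by metis
  define em where "em = (\<lambda>(i :: 'i) (b :: 'x \<Rightarrow> complex) (j, x). if j = i then b x else 0)"
  define C where "C = (\<Union>i\<in>I. em i ` B i)"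
  have "finite C" unfolding C_def using assms(1) B by auto
  have em: "em i v \<in> cfun.span C" if i: "i \<in> I" and "v \<in> cfun.span (B i)" for i v
    using that(2)
  proof (induction rule: span_induct_member)
    case zero
    have "em i 0 = 0" unfolding em_def by (auto simp: pointwise)
    then show ?case using cfun.span_zero by simp
  next
    case (step c x y)
    have "em i (cscale c x + y) = cscale c (em i x) + em i y" unfolding em_def by (auto simp: pointwise)
    moreover have "em i x \<in> cfun.span C" using step(1) i C_def by (intro cfun.span_base) auto
    ultimately show ?case using step by (simp add: cfun.span_add cfun.span_scale)
  qed
  have "F \<in> cfun.span C" if F: "\<forall>i\<in>I. (\<lambda>x. F (i, x)) \<in> V i" "\<forall>i x. i \<notin> I \<longrightarrow> F (i, x) = 0" for F
  proof -
    have "F = (\<Sum>i\<in>I. em i (\<lambda>x. F (i, x)))"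
      unfolding em_def using F(2) assms(1) by (auto simp: pointwise sum.delta if_distrib cong: if_cong)
    also have "\<dots> \<in> cfun.span C" using em B F(1) by (intro cfun.span_sum) blast
    finally show ?thesis .
  qed
  then show ?thesis unfolding findim_def using \<open>finite C\<close> by blast
qed

lemma direct_sum_rep:
  assumes "finite I" "\<And>i. i \<in> I \<Longrightarrow> representation G (R i)" "group G"
  shows "representation G (direct_sum I R)"
proof -
  have sub: "cfun.subspace (rep_space (direct_sum I R))"
    using subspace_zero_pw[OF rep_subspace[OF assms(2)]] subspace_add_pw[OF rep_subspace[OF assms(2)]]
      subspace_scale_pw[OF rep_subspace[OF assms(2)]]
    unfolding direct_sum_def by (intro cfun.subspaceI) (auto simp: pointwise)
  show ?thesis
    unfolding representation_iff
  proof (intro conjI ballI sub assms(3))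
    show "findim (rep_space (direct_sum I R))"
      using direct_sum_findim[of I "\<lambda>i. rep_space (R i)"] assms(1) rep_findim[OF assms(2)] by (simp add: direct_sum_def)
  next
    fix g assume g: "g \<in> carrier G"
    show "linear_on (rep_space (direct_sum I R)) (rep_act (direct_sum I R) g)"
      unfolding linear_on_def
      using linear_on_add_pw[OF rep_linear[OF assms(2) g]] linear_on_scale_pw[OF rep_linear[OF assms(2) g]]
      by (auto simp: direct_sum_def pointwise)
  next
    fix g v assume g: "g \<in> carrier G" and v: "v \<in> rep_space (direct_sum I R)"
    then show "rep_act (direct_sum I R) g v \<in> rep_space (direct_sum I R)"
      using rep_closed[OF assms(2) g] by (simp add: direct_sum_def)
  next
    fix v assume "v \<in> rep_space (direct_sum I R)"
    then show "rep_act (direct_sum I R) \<one>\<^bsub>G\<^esub> v = v"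
      using rep_one[OF assms(2)] by (auto simp: direct_sum_def fun_eq_iff)
  next
    fix g h v assume "g \<in> carrier G" "h \<in> carrier G" "v \<in> rep_space (direct_sum I R)"
    then show "rep_act (direct_sum I R) (g \<otimes>\<^bsub>G\<^esub> h) v =
        rep_act (direct_sum I R) g (rep_act (direct_sum I R) h v)"
      using rep_mult[OF assms(2)] by (auto simp: direct_sum_def fun_eq_iff)
  qed
qed

lemma is_sum_direct_sum:
  assumes V: "is_sum G I R V p" and fin: "finite I"
  shows "rep_iso G V (direct_sum I R)"
proof -
  define f where "f = (\<lambda>v (i, x). if i \<in> I then p i v x else 0)"
  note rV = is_sum_rep(1)[OF V]
  have 1: "ghom G V (direct_sum I R) f"
    unfolding ghom_def
  proof (intro conjI ballI)
    show "linear_on (rep_space V) f"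
      unfolding linear_on_def f_def
      using linear_on_add[OF ghom_linear[OF is_sum_ghom[OF V]]] linear_on_scale[OF ghom_linear[OF is_sum_ghom[OF V]]]
      by (auto simp: pointwise)
  qed (use ghom_closed[OF is_sum_ghom[OF V]] ghom_act[OF is_sum_ghom[OF V]] in
      \<open>auto simp: direct_sum_def f_def fun_eq_iff\<close>)
  have "inj_on f (rep_space V)"
  proof (rule inj_onI)
    fix u v assume u: "u \<in> rep_space V" and v: "v \<in> rep_space V" and e: "f u = f v"
    have "p i u = p i v" if "i \<in> I" for i
    proof
      fix x show "p i u x = p i v x" using that fun_cong[OF e, of "(i, x)"] by (simp add: f_def)
    qed
    then show "u = v" using is_sum_unique[OF V u v] by blast
  qed
  moreover have "F \<in> f ` rep_space V" if F: "F \<in> rep_space (direct_sum I R)" for F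
  proof -
    obtain v where "v \<in> rep_space V" "\<forall>i\<in>I. p i v = (\<lambda>x. F (i, x))"
      using is_sum_ex1[OF V, of "\<lambda>i x. F (i, x)"] F by (auto simp: direct_sum_def)
    then show ?thesis using F by (intro image_eqI[of _ _ v]) (auto simp: f_def direct_sum_def fun_eq_iff)
  qed
  ultimately have "bij_betw f (rep_space V) (rep_space (direct_sum I R))"
    unfolding bij_betw_def using ghom_closed[OF 1] by blast
  then show ?thesis
    unfolding rep_iso_iff using 1 rV direct_sum_rep[OF fin _ rep_group[OF rV], of R] is_sum_rep(2)[OF V] by blast
qed

lemma induced_rep:
  assumes R: "representation H R" and G: "group G" and fin: "finite (carrier G)" and \<iota>: "\<iota> \<in> hom H G"
  shows "representation G (induced G H \<iota> R)"
proof -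
  interpret G: group G by fact
  interpret H: group H using rep_group[OF R] .
  have ic: "\<And>h. h \<in> carrier H \<Longrightarrow> \<iota> h \<in> carrier G" using \<iota> by (auto simp: hom_def)
  have sub: "cfun.subspace (rep_space (induced G H \<iota> R))"
    using subspace_zero_pw[OF rep_subspace[OF R]] subspace_add_pw[OF rep_subspace[OF R]]
      subspace_scale_pw[OF rep_subspace[OF R]] linear_on_add_pw[OF rep_linear[OF R]]
      linear_on_scale_pw[OF rep_linear[OF R]] linear_on_zero_pw[OF rep_linear[OF R] rep_subspace[OF R]]
    unfolding induced_def
    by (intro cfun.subspaceI) (auto simp: pointwise)
  show ?thesis
    unfolding representation_iff
  proof (intro conjI ballI sub G)
    show "findim (rep_space (induced G H \<iota> R))"
      by (rule findim_subset[OF direct_sum_findim[OF fin, of "\<lambda>_. rep_space R"]])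
        (use rep_findim[OF R] in \<open>auto simp: induced_def\<close>)
  next
    fix g assume g: "g \<in> carrier G"
    show "linear_on (rep_space (induced G H \<iota> R)) (rep_act (induced G H \<iota> R) g)"
      unfolding linear_on_def by (auto simp: induced_def pointwise)
  next
    fix a v assume a: "a \<in> carrier G" and v: "v \<in> rep_space (induced G H \<iota> R)"
    have "(\<lambda>x. v (inv\<^bsub>G\<^esub> a \<otimes>\<^bsub>G\<^esub> (g \<otimes>\<^bsub>G\<^esub> \<iota> h), x)) = rep_act R (inv\<^bsub>H\<^esub> h) (\<lambda>x. v (inv\<^bsub>G\<^esub> a \<otimes>\<^bsub>G\<^esub> g, x))"
      if "g \<in> carrier G" "h \<in> carrier H" for g h
    proof -
      have "inv\<^bsub>G\<^esub> a \<otimes>\<^bsub>G\<^esub> (g \<otimes>\<^bsub>G\<^esub> \<iota> h) = (inv\<^bsub>G\<^esub> a \<otimes>\<^bsub>G\<^esub> g) \<otimes>\<^bsub>G\<^esub> \<iota> h" using that a ic by (simp add: G.m_assoc)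
      then show ?thesis using v a that by (simp add: induced_def)
    qed
    then show "rep_act (induced G H \<iota> R) a v \<in> rep_space (induced G H \<iota> R)"
      using v a ic by (simp add: induced_def)
  next
    fix v assume "v \<in> rep_space (induced G H \<iota> R)"
    then show "rep_act (induced G H \<iota> R) \<one>\<^bsub>G\<^esub> v = v"
      by (auto simp: induced_def fun_eq_iff)
  next
    fix g h v assume "g \<in> carrier G" "h \<in> carrier G" "v \<in> rep_space (induced G H \<iota> R)"
    then show "rep_act (induced G H \<iota> R) (g \<otimes>\<^bsub>G\<^esub> h) v =
        rep_act (induced G H \<iota> R) g (rep_act (induced G H \<iota> R) h v)"
      by (auto simp: induced_def fun_eq_iff G.inv_mult_group G.m_assoc)
  qed
qed

text \<open>The definition uses functions with F (g h) = h^-1 (F g), whereas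
  \<open>coinduced\<close> asks for equivariance on the left. The passage is \<phi> g = F (g^-1),
  which is the value of g F at 1.\<close>

lemma induced_coind:
  assumes R: "representation H R" and G: "group G" and fin: "finite (carrier G)" and \<iota>: "\<iota> \<in> hom H G"
  shows "coinduced G H \<iota> R (induced G H \<iota> R) (\<lambda>F x. F (\<one>\<^bsub>G\<^esub>, x))"
proof (rule coinducedI[OF induced_rep[OF assms] R \<iota>])
  interpret G: group G by fact
  interpret H: group H using rep_group[OF R] .
  have ic: "\<And>h. h \<in> carrier H \<Longrightarrow> \<iota> h \<in> carrier G" using \<iota> by (auto simp: hom_def)
  have iinv: "inv\<^bsub>G\<^esub> (\<iota> h) = \<iota> (inv\<^bsub>H\<^esub> h)" if "h \<in> carrier H" for h
    using group_hom.hom_inv[of H G \<iota> h] that \<iota> by (simp add: group_hom_def group_hom_axioms_def G.group_axioms H.group_axioms)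
  let ?W = "induced G H \<iota> R"
  have act: "(\<lambda>x. rep_act ?W g w (\<one>\<^bsub>G\<^esub>, x)) = (\<lambda>x. w (inv\<^bsub>G\<^esub> g, x))" if "g \<in> carrier G" for g w
    using that by (simp add: induced_def)
  show "ghom H (res_rep \<iota> ?W) R (\<lambda>F x. F (\<one>\<^bsub>G\<^esub>, x))"
    unfolding ghom_def res_rep_simps
  proof (intro conjI ballI)
    fix h w assume h: "h \<in> carrier H" and w: "w \<in> rep_space ?W"
    have "(\<lambda>x. w (\<one>\<^bsub>G\<^esub> \<otimes>\<^bsub>G\<^esub> \<iota> (inv\<^bsub>H\<^esub> h), x)) = rep_act R (inv\<^bsub>H\<^esub> (inv\<^bsub>H\<^esub> h)) (\<lambda>x. w (\<one>\<^bsub>G\<^esub>, x))"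
      using w h unfolding induced_def by (simp del: G.l_one)
    then show "(\<lambda>x. rep_act ?W (\<iota> h) w (\<one>\<^bsub>G\<^esub>, x)) = rep_act R h (\<lambda>x. w (\<one>\<^bsub>G\<^esub>, x))"
      using act[OF ic[OF h], of w] iinv[OF h] h ic by simp
  qed (auto simp: linear_on_def pointwise induced_def)
  {
    fix \<phi> assume \<phi>: "equivariant G H \<iota> R \<phi>"
    define w where "w = (\<lambda>(g, x). if g \<in> carrier G then \<phi> (inv\<^bsub>G\<^esub> g) x else 0)"
    have "\<phi> (inv\<^bsub>G\<^esub> (g \<otimes>\<^bsub>G\<^esub> \<iota> h)) = rep_act R (inv\<^bsub>H\<^esub> h) (\<phi> (inv\<^bsub>G\<^esub> g))"
      if "g \<in> carrier G" "h \<in> carrier H" for g h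
      using that \<phi> ic iinv unfolding equivariant_def by (simp add: G.inv_mult_group)
    then have "w \<in> rep_space ?W"
      using \<phi> ic unfolding induced_def w_def equivariant_def by simp
    moreover have "(\<lambda>x. rep_act ?W g w (\<one>\<^bsub>G\<^esub>, x)) = \<phi> g" if "g \<in> carrier G" for g
      using act[OF that, of w] that by (simp add: w_def)
    ultimately show "\<exists>w\<in>rep_space ?W. \<forall>g\<in>carrier G. (\<lambda>x. rep_act ?W g w (\<one>\<^bsub>G\<^esub>, x)) = \<phi> g" by blast
  next
    fix v w assume v: "v \<in> rep_space ?W" and w: "w \<in> rep_space ?W"
      and e: "\<And>g. g \<in> carrier G \<Longrightarrow> (\<lambda>x. rep_act ?W g v (\<one>\<^bsub>G\<^esub>, x)) = (\<lambda>x. rep_act ?W g w (\<one>\<^bsub>G\<^esub>, x))"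
    have "v (g, x) = w (g, x)" for g x
    proof (cases "g \<in> carrier G")
      case True
      then have "(\<lambda>x. v (g, x)) = (\<lambda>x. w (g, x))"
        using e[of "inv\<^bsub>G\<^esub> g"] act[of "inv\<^bsub>G\<^esub> g"] by simp
      then show ?thesis by meson
    qed (use v w in \<open>simp add: induced_def\<close>)
    then show "v = w" by auto
  }
qed

section \<open>External tensor products\<close>

text \<open>The normal form for elements of a tensor product: with d a basis of the right factor, c
  is the family of coefficients.\<close>

definition tsum :: "'i set \<Rightarrow> ('i \<Rightarrow> 'x \<Rightarrow> complex) \<Rightarrow> ('i \<Rightarrow> 'y \<Rightarrow> complex) \<Rightarrow> 'x \<times> 'y \<Rightarrow> complex"
  where "tsum A c d = (\<lambda>(x, y). \<Sum>i\<in>A. c i x * d i y)"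

text \<open>The operator f \<otimes> id. It acts slice by slice, so f only has to behave well on the
  slices that occur.\<close>

definition tmap1 :: "(('x \<Rightarrow> complex) \<Rightarrow> 'z \<Rightarrow> complex) \<Rightarrow> ('x \<times> 'y \<Rightarrow> complex) \<Rightarrow> 'z \<times> 'y \<Rightarrow> complex"
  where "tmap1 f F = (\<lambda>(x, y). f (\<lambda>x'. F (x', y)) x)"

definition tmap2 :: "(('y \<Rightarrow> complex) \<Rightarrow> 'z \<Rightarrow> complex) \<Rightarrow> ('x \<times> 'y \<Rightarrow> complex) \<Rightarrow> 'x \<times> 'z \<Rightarrow> complex"
  where "tmap2 f F = (\<lambda>(x, y). f (\<lambda>y'. F (x, y')) y)"

definition ptensor :: "('x \<Rightarrow> complex) \<Rightarrow> ('y \<Rightarrow> complex) \<Rightarrow> 'x \<times> 'y \<Rightarrow> complex"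
  where "ptensor v w = (\<lambda>(x, y). v x * w y)"

lemma ext_tensor_space:
  "rep_space (R \<boxtimes> Q) = cfun.span {ptensor v w | v w. v \<in> rep_space R \<and> w \<in> rep_space Q}"
  by (simp add: ext_tensor_def ptensor_def)

lemma ext_tensor_act: "rep_act (R \<boxtimes> Q) (g, h) F = tmap2 (rep_act Q h) (tmap1 (rep_act R g) F)"
  by (simp add: ext_tensor_def tmap1_def tmap2_def)

lemma ext_tensor_subspace: "cfun.subspace (rep_space (R \<boxtimes> Q))"
  by (simp add: ext_tensor_space)

lemma tsum_eq_sum: "tsum A c d = (\<Sum>i\<in>A. ptensor (c i) (d i))"
  by (auto simp: tsum_def ptensor_def pointwise)

lemma tsum_cong: "(\<And>i. i \<in> A \<Longrightarrow> c i = c' i) \<Longrightarrow> (\<And>i. i \<in> A \<Longrightarrow> d i = d' i) \<Longrightarrow> tsum A c d = tsum A c' d'"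
  unfolding tsum_def by (auto intro!: ext sum.cong)

lemma ptensor_mem: "v \<in> rep_space R \<Longrightarrow> w \<in> rep_space Q \<Longrightarrow> ptensor v w \<in> rep_space (R \<boxtimes> Q)"
  unfolding ext_tensor_space by (rule cfun.span_base) blast

lemma tsum_mem:
  "(\<And>i. i \<in> A \<Longrightarrow> c i \<in> rep_space R) \<Longrightarrow> (\<And>i. i \<in> A \<Longrightarrow> d i \<in> rep_space Q) \<Longrightarrow>
    tsum A c d \<in> rep_space (R \<boxtimes> Q)"
  unfolding tsum_eq_sum by (intro cfun.subspace_sum ext_tensor_subspace ptensor_mem) auto

lemma tensor_slice1:
  assumes "cfun.subspace (rep_space R)" "F \<in> rep_space (R \<boxtimes> Q)"
  shows "(\<lambda>x. F (x, y)) \<in> rep_space R"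
  using assms(2) unfolding ext_tensor_space
proof (induction rule: span_induct_member)
  case zero
  show ?case using subspace_zero_pw[OF assms(1)] by (simp add: zero_fun_apply)
next
  case (step c F F')
  then obtain v w where "F = ptensor v w" "v \<in> rep_space R" by blast
  then have "(\<lambda>x. (c * w y) * v x) \<in> rep_space R" using subspace_scale_pw[OF assms(1)] by blast
  from subspace_add_pw[OF assms(1) this step(5)] show ?case
    by (simp add: \<open>F = _\<close> ptensor_def pointwise mult_ac)
qed

lemma tensor_slice2:
  assumes "cfun.subspace (rep_space Q)" "F \<in> rep_space (R \<boxtimes> Q)"
  shows "(\<lambda>y. F (x, y)) \<in> rep_space Q"
  using assms(2) unfolding ext_tensor_space
proof (induction rule: span_induct_member)
  case zero
  show ?case using subspace_zero_pw[OF assms(1)] by (simp add: zero_fun_apply)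
next
  case (step c F F')
  then obtain v w where "F = ptensor v w" "w \<in> rep_space Q" by blast
  then have "(\<lambda>y. (c * v x) * w y) \<in> rep_space Q" using subspace_scale_pw[OF assms(1)] by blast
  from subspace_add_pw[OF assms(1) this step(5)] show ?case
    by (simp add: \<open>F = _\<close> ptensor_def pointwise mult_ac)
qed

text \<open>Over a finite spanning set of the right factor an element becomes a family of
  coefficients in R. Together with \<open>tsum_unique\<close> for a basis, this reduces questions on
  tensor products to one coefficient at a time.\<close>

lemma tensor_expand:
  assumes R: "cfun.subspace (rep_space R)" and B: "finite B" "cfun.span B = rep_space Q"
    and F: "F \<in> rep_space (R \<boxtimes> Q)"
  obtains c where "\<And>b. b \<in> B \<Longrightarrow> c b \<in> rep_space R" "F = tsum B c (\<lambda>b. b)"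
proof -
  have "\<exists>c. (\<forall>b\<in>B. c b \<in> rep_space R) \<and> F = tsum B c (\<lambda>b. b)"
    using F unfolding ext_tensor_space
  proof (induction rule: span_induct_member)
    case zero
    show ?case
      by (rule exI[of _ "\<lambda>_. 0"]) (auto simp: cfun.subspace_0[OF R], simp add: tsum_def pointwise)
  next
    case (step a F F')
    then obtain v w where F: "F = ptensor v w" "v \<in> rep_space R" "w \<in> rep_space Q" by blast
    then obtain u where u: "w = (\<Sum>b\<in>B. cscale (u b) b)"
      using cfun.span_finite[OF B(1)] B(2) by auto
    obtain c where c: "\<forall>b\<in>B. c b \<in> rep_space R" "F' = tsum B c (\<lambda>b. b)" using step by blast
    show ?case
    proof (intro exI[of _ "\<lambda>b. cscale (a * u b) v + c b"] conjI ballI)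
      fix b assume "b \<in> B"
      then show "cscale (a * u b) v + c b \<in> rep_space R"
        using c(1) F(2) R by (simp add: cfun.subspace_add cfun.subspace_scale)
    next
      show "cscale a F + F' = tsum B (\<lambda>b. cscale (a * u b) v + c b) (\<lambda>b. b)"
        unfolding F(1) c(2) u
        by (auto simp: pointwise tsum_def ptensor_def sum_distrib_left sum_distrib_right algebra_simps
            sum.distrib)
    qed
  qed
  then show ?thesis using that by blast
qed

text \<open>For each fixed x the difference of the two sides is a linear relation among the
  functions b.\<close>

lemma tsum_unique:
  assumes B: "cfun.independent B" "finite B" and e: "tsum B c (\<lambda>b. b) = tsum B d (\<lambda>b. b)" and b: "b \<in> B"
  shows "c b = d b"
proof
  fix x
  have "(\<Sum>b\<in>B. cscale (c b x - d b x) b) = 0"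
    using fun_cong[OF e, of "(x, _)"] by (auto simp: tsum_def pointwise algebra_simps sum_subtractf)
  then have "c b x - d b x = 0"
    using cfun.independentD[OF B(1,2) subset_refl, of "\<lambda>b. c b x - d b x" b] b by simp
  then show "c b x = d b x" by simp
qed

lemma tmap1_tsum:
  assumes f: "linear_on V f" and V: "cfun.subspace V" and c: "\<And>i. i \<in> A \<Longrightarrow> c i \<in> V"
  shows "tmap1 f (tsum A c d) = tsum A (\<lambda>i. f (c i)) d"
proof -
  have "f (\<lambda>x. \<Sum>i\<in>A. c i x * d i y) = (\<lambda>x. \<Sum>i\<in>A. f (c i) x * d i y)" for y
  proof -
    have "(\<lambda>x. \<Sum>i\<in>A. c i x * d i y) = (\<Sum>i\<in>A. cscale (d i y) (c i))"
      by (simp add: pointwise mult.commute)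
    then have "f (\<lambda>x. \<Sum>i\<in>A. c i x * d i y) = f (\<Sum>i\<in>A. cscale (d i y) (c i))" by simp
    also have "\<dots> = (\<Sum>i\<in>A. f (cscale (d i y) (c i)))"
      using c cfun.subspace_scale[OF V] by (intro linear_on_sum[OF f V]) auto
    also have "\<dots> = (\<Sum>i\<in>A. cscale (d i y) (f (c i)))"
      using c by (intro sum.cong refl linear_on_scale[OF f]) auto
    finally show ?thesis by (simp add: pointwise mult.commute)
  qed
  then show ?thesis by (simp add: tmap1_def tsum_def fun_eq_iff)
qed

lemma tmap2_tsum:
  assumes f: "linear_on V f" and V: "cfun.subspace V" and d: "\<And>i. i \<in> A \<Longrightarrow> d i \<in> V"
  shows "tmap2 f (tsum A c d) = tsum A c (\<lambda>i. f (d i))"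
proof -
  have "f (\<lambda>y. \<Sum>i\<in>A. c i x * d i y) = (\<lambda>y. \<Sum>i\<in>A. c i x * f (d i) y)" for x
  proof -
    have "(\<lambda>y. \<Sum>i\<in>A. c i x * d i y) = (\<Sum>i\<in>A. cscale (c i x) (d i))"
      by (simp add: pointwise)
    then have "f (\<lambda>y. \<Sum>i\<in>A. c i x * d i y) = f (\<Sum>i\<in>A. cscale (c i x) (d i))" by simp
    also have "\<dots> = (\<Sum>i\<in>A. f (cscale (c i x) (d i)))"
      using d cfun.subspace_scale[OF V] by (intro linear_on_sum[OF f V]) auto
    also have "\<dots> = (\<Sum>i\<in>A. cscale (c i x) (f (d i)))"
      using d by (intro sum.cong refl linear_on_scale[OF f]) auto
    finally show ?thesis by (simp add: pointwise)
  qed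
  then show ?thesis by (simp add: tmap2_def tsum_def fun_eq_iff)
qed

lemma tmap1_linear:
  assumes "linear_on (rep_space R) f" "cfun.subspace (rep_space R)"
  shows "linear_on (rep_space (R \<boxtimes> Q)) (tmap1 f)"
  unfolding linear_on_def tmap1_def
  using linear_on_add_pw[OF assms(1)] linear_on_scale_pw[OF assms(1)] tensor_slice1[OF assms(2), where Q = Q]
  by (auto simp: pointwise)

lemma tmap2_linear:
  assumes "linear_on (rep_space Q) f" "cfun.subspace (rep_space Q)"
  shows "linear_on (rep_space (R \<boxtimes> Q)) (tmap2 f)"
  unfolding linear_on_def tmap2_def
  using linear_on_add_pw[OF assms(1)] linear_on_scale_pw[OF assms(1)] tensor_slice2[OF assms(2), where R = R]
  by (auto simp: pointwise)

lemma act_tsum: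
  assumes "representation G R" "representation H Q" "g \<in> carrier G" "h \<in> carrier H"
    "\<And>i. i \<in> A \<Longrightarrow> c i \<in> rep_space R" "\<And>i. i \<in> A \<Longrightarrow> d i \<in> rep_space Q"
  shows "rep_act (R \<boxtimes> Q) (g, h) (tsum A c d) = tsum A (\<lambda>i. rep_act R g (c i)) (\<lambda>i. rep_act Q h (d i))"
  unfolding ext_tensor_act
  using tmap1_tsum[OF rep_linear[OF assms(1,3)] rep_subspace[OF assms(1)], of A c d]
    tmap2_tsum[OF rep_linear[OF assms(2,4)] rep_subspace[OF assms(2)], of A d "\<lambda>i. rep_act R g (c i)"]
    assms(5,6) by simp

lemma tensor_rep_expand:
  assumes "representation G R" "representation H Q" "F \<in> rep_space (R \<boxtimes> Q)"
  obtains B c where "finite B" "cfun.independent B" "cfun.span B = rep_space Q" "B \<subseteq> rep_space Q"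
    "\<And>b. b \<in> B \<Longrightarrow> c b \<in> rep_space R" "F = tsum B c (\<lambda>b. b)"
proof -
  obtain B where B: "finite B" "cfun.independent B" "B \<subseteq> rep_space Q" "cfun.span B = rep_space Q"
    using findim_basis[OF rep_subspace[OF assms(2)] rep_findim[OF assms(2)]] .
  then show ?thesis
    using tensor_expand[OF rep_subspace[OF assms(1)] B(1,4) assms(3)] that by metis
qed

lemma tensor_rep:
  fixes R :: "('g, 'x) rep"
  assumes R: "representation G R" and Q: "representation H Q"
  shows "representation (G \<times>\<times> H) (R \<boxtimes> Q)"
  unfolding representation_iff
proof (intro conjI ballI ext_tensor_subspace)
  show "group (G \<times>\<times> H)" using DirProd_group rep_group[OF R] rep_group[OF Q] by blast
next
  obtain B where B: "finite B" "B \<subseteq> rep_space R" "cfun.span B = rep_space R"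
    using findim_basis[OF rep_subspace[OF R] rep_findim[OF R]] by metis
  obtain C where C: "finite C" "C \<subseteq> rep_space Q" "cfun.span C = rep_space Q"
    using findim_basis[OF rep_subspace[OF Q] rep_findim[OF Q]] by metis
  define D where "D = (\<lambda>(b, c). ptensor b c) ` (B \<times> C)"
  have 1: "ptensor v c \<in> cfun.span D" if "c \<in> C" and "v \<in> cfun.span B" for c v
    using that(2)
  proof (induction rule: span_induct_member)
    case zero
    have "ptensor (0 :: 'x \<Rightarrow> complex) c = 0" by (auto simp: ptensor_def pointwise)
    then show ?case using cfun.span_zero by simp
  next
    case (step a x y)
    have "ptensor (cscale a x + y) c = cscale a (ptensor x c) + ptensor y c"
      by (auto simp: ptensor_def pointwise algebra_simps)
    moreover have "ptensor x c \<in> cfun.span D" using step that(1) unfolding D_def by (intro cfun.span_base) auto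
    ultimately show ?case using step by (simp add: cfun.span_add cfun.span_scale)
  qed
  have "F \<in> cfun.span D" if F: "F \<in> rep_space (R \<boxtimes> Q)" for F
  proof -
    obtain c where c: "\<And>b. b \<in> C \<Longrightarrow> c b \<in> rep_space R" "F = tsum C c (\<lambda>b. b)"
      using tensor_expand[OF rep_subspace[OF R] C(1,3) F] by metis
    then show ?thesis using 1 B(3) unfolding c(2) tsum_eq_sum by (intro cfun.span_sum) auto
  qed
  then show "findim (rep_space (R \<boxtimes> Q))"
    unfolding findim_def using B(1) C(1) by (intro exI[of _ D]) (auto simp: D_def)
next
  fix x assume "x \<in> carrier (G \<times>\<times> H)"
  then obtain g h where x: "x = (g, h)" "g \<in> carrier G" "h \<in> carrier H" by auto
  show cl: "rep_act (R \<boxtimes> Q) x F \<in> rep_space (R \<boxtimes> Q)" if F: "F \<in> rep_space (R \<boxtimes> Q)" for F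
  proof -
    obtain B c where B: "B \<subseteq> rep_space Q" "\<And>b. b \<in> B \<Longrightarrow> c b \<in> rep_space R" "F = tsum B c (\<lambda>b. b)"
      using tensor_rep_expand[OF R Q F] by metis
    have "rep_act (R \<boxtimes> Q) x F = tsum B (\<lambda>i. rep_act R g (c i)) (\<lambda>i. rep_act Q h i)"
      unfolding B(3) x(1) by (rule act_tsum[OF R Q x(2,3)]) (use B in auto)
    then show ?thesis
      using tsum_mem[of B "\<lambda>i. rep_act R g (c i)" R "\<lambda>i. rep_act Q h i" Q] B(1,2)
        rep_closed[OF R x(2)] rep_closed[OF Q x(3)] by auto
  qed
  have m: "tmap1 (rep_act R g) F \<in> rep_space (R \<boxtimes> Q)" if F: "F \<in> rep_space (R \<boxtimes> Q)" for F
  proof -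
    obtain B c where B: "B \<subseteq> rep_space Q" "\<And>b. b \<in> B \<Longrightarrow> c b \<in> rep_space R" "F = tsum B c (\<lambda>b. b)"
      using tensor_rep_expand[OF R Q F] by metis
    have "tmap1 (rep_act R g) F = tsum B (\<lambda>i. rep_act R g (c i)) (\<lambda>i. i)"
      unfolding B(3) by (rule tmap1_tsum[OF rep_linear[OF R x(2)] rep_subspace[OF R]]) (use B in auto)
    then show ?thesis
      using tsum_mem[of B "\<lambda>i. rep_act R g (c i)" R "\<lambda>i. i" Q] B(1,2) rep_closed[OF R x(2)] by auto
  qed
  show "linear_on (rep_space (R \<boxtimes> Q)) (rep_act (R \<boxtimes> Q) x)"
    unfolding x(1) ext_tensor_act[abs_def]
    by (rule linear_on_comp[OF tmap1_linear[OF rep_linear[OF R x(2)] rep_subspace[OF R]] _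
          tmap2_linear[OF rep_linear[OF Q x(3)] rep_subspace[OF Q]]]) (use m in blast)
next
  fix F assume F: "F \<in> rep_space (R \<boxtimes> Q)"
  interpret G: group G using rep_group[OF R] .
  interpret H: group H using rep_group[OF Q] .
  obtain B c where B: "B \<subseteq> rep_space Q" "\<And>b. b \<in> B \<Longrightarrow> c b \<in> rep_space R" "F = tsum B c (\<lambda>b. b)"
    using tensor_rep_expand[OF R Q F] by metis
  have "rep_act (R \<boxtimes> Q) (\<one>\<^bsub>G\<^esub>, \<one>\<^bsub>H\<^esub>) F = tsum B (\<lambda>i. rep_act R \<one>\<^bsub>G\<^esub> (c i)) (\<lambda>i. rep_act Q \<one>\<^bsub>H\<^esub> i)"
    unfolding B(3) by (rule act_tsum[OF R Q]) (use B in auto)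
  also have "\<dots> = F" unfolding B(3) by (rule tsum_cong) (use B rep_one[OF R] rep_one[OF Q] in auto)
  finally show "rep_act (R \<boxtimes> Q) \<one>\<^bsub>G \<times>\<times> H\<^esub> F = F" by simp
  fix x y assume "x \<in> carrier (G \<times>\<times> H)" "y \<in> carrier (G \<times>\<times> H)"
  then obtain g h g' h' where xy: "x = (g, h)" "y = (g', h')"
    and c: "g \<in> carrier G" "h \<in> carrier H" "g' \<in> carrier G" "h' \<in> carrier H" by auto
  have 1: "rep_act (R \<boxtimes> Q) (g', h') F = tsum B (\<lambda>i. rep_act R g' (c i)) (\<lambda>i. rep_act Q h' i)"
    unfolding B(3) by (rule act_tsum[OF R Q c(3,4)]) (use B in auto)
  have 2: "rep_act (R \<boxtimes> Q) (g, h) (rep_act (R \<boxtimes> Q) (g', h') F) =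
      tsum B (\<lambda>i. rep_act R g (rep_act R g' (c i))) (\<lambda>i. rep_act Q h (rep_act Q h' i))"
    unfolding 1 by (rule act_tsum[OF R Q c(1,2)]) (use B c rep_closed[OF R] rep_closed[OF Q] in auto)
  have 3: "rep_act (R \<boxtimes> Q) (g \<otimes>\<^bsub>G\<^esub> g', h \<otimes>\<^bsub>H\<^esub> h') F =
      tsum B (\<lambda>i. rep_act R (g \<otimes>\<^bsub>G\<^esub> g') (c i)) (\<lambda>i. rep_act Q (h \<otimes>\<^bsub>H\<^esub> h') i)"
    unfolding B(3) by (rule act_tsum[OF R Q]) (use B c in auto)
  show "rep_act (R \<boxtimes> Q) (x \<otimes>\<^bsub>G \<times>\<times> H\<^esub> y) F = rep_act (R \<boxtimes> Q) x (rep_act (R \<boxtimes> Q) y F)"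
    unfolding xy mult_DirProd 2 3
    by (rule tsum_cong) (use B c rep_mult[OF R] rep_mult[OF Q] in auto)
qed

lemma tmap1_mem:
  assumes "representation G R" "representation H Q" and f: "linear_on (rep_space R) f"
    "\<And>v. v \<in> rep_space R \<Longrightarrow> f v \<in> rep_space R'" and F: "F \<in> rep_space (R \<boxtimes> Q)"
  shows "tmap1 f F \<in> rep_space (R' \<boxtimes> Q)"
proof -
  obtain B c where B: "B \<subseteq> rep_space Q" "\<And>b. b \<in> B \<Longrightarrow> c b \<in> rep_space R" "F = tsum B c (\<lambda>b. b)"
    using tensor_rep_expand[OF assms(1,2) F] by metis
  then have "tmap1 f F = tsum B (\<lambda>b. f (c b)) (\<lambda>b. b)"
    using tmap1_tsum[OF f(1) rep_subspace[OF assms(1)], of B c] by auto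
  then show ?thesis using tsum_mem[of B "\<lambda>b. f (c b)" R' "\<lambda>b. b" Q] B f(2) by auto
qed

lemma tmap1_act:
  assumes R: "representation G R" and Q: "representation H Q" and R': "representation K R'"
    and f: "linear_on (rep_space R) f" "\<And>v. v \<in> rep_space R \<Longrightarrow> f v \<in> rep_space R'"
      "\<And>v. v \<in> rep_space R \<Longrightarrow> f (rep_act R g v) = rep_act R' k (f v)"
    and g: "g \<in> carrier G" and k: "k \<in> carrier K" and h: "h \<in> carrier H" and F: "F \<in> rep_space (R \<boxtimes> Q)"
  shows "tmap1 f (rep_act (R \<boxtimes> Q) (g, h) F) = rep_act (R' \<boxtimes> Q) (k, h) (tmap1 f F)"
proof -
  obtain B c where B: "B \<subseteq> rep_space Q" "\<And>b. b \<in> B \<Longrightarrow> c b \<in> rep_space R" "F = tsum B c (\<lambda>b. b)"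
    using tensor_rep_expand[OF R Q F] by metis
  have 1: "rep_act (R \<boxtimes> Q) (g, h) F = tsum B (\<lambda>i. rep_act R g (c i)) (\<lambda>i. rep_act Q h i)"
    unfolding B(3) by (rule act_tsum[OF R Q g h]) (use B in auto)
  have 2: "tmap1 f (rep_act (R \<boxtimes> Q) (g, h) F) = tsum B (\<lambda>i. f (rep_act R g (c i))) (\<lambda>i. rep_act Q h i)"
    unfolding 1 by (rule tmap1_tsum[OF f(1) rep_subspace[OF R]]) (use B rep_closed[OF R g] in auto)
  have 3: "tmap1 f F = tsum B (\<lambda>i. f (c i)) (\<lambda>i. i)"
    unfolding B(3) by (rule tmap1_tsum[OF f(1) rep_subspace[OF R]]) (use B in auto)
  have 4: "rep_act (R' \<boxtimes> Q) (k, h) (tmap1 f F) = tsum B (\<lambda>i. rep_act R' k (f (c i))) (\<lambda>i. rep_act Q h i)"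
    unfolding 3 by (rule act_tsum[OF R' Q k h]) (use B f(2) in auto)
  show ?thesis unfolding 2 4 by (rule tsum_cong) (use B f(3) in auto)
qed

text \<open>Only the first factor is induced. Equivariance under K determines \<phi> by its values
  \<phi> (g, 1), and when these are expanded in a basis of U, each coefficient is an H-equivariant
  function of g.\<close>

lemma coind_tensor:
  assumes W: "coinduced G H \<iota> V W e" and U: "representation K U"
  shows "coinduced (G \<times>\<times> K) (H \<times>\<times> K) (\<lambda>(h, k). (\<iota> h, k)) (V \<boxtimes> U) (W \<boxtimes> U) (tmap1 e)"
proof (rule coinducedI)
  note rW = coind_rep(1)[OF W] and rV = coind_rep(2)[OF W]
  show "representation (G \<times>\<times> K) (W \<boxtimes> U)" "representation (H \<times>\<times> K) (V \<boxtimes> U)"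
    using tensor_rep rW rV U by blast+
  show "(\<lambda>(h, k). (\<iota> h, k)) \<in> hom (H \<times>\<times> K) (G \<times>\<times> K)"
    using coind_hom[OF W] by (auto simp: hom_def)
  show "ghom (H \<times>\<times> K) (res_rep (\<lambda>(h, k). (\<iota> h, k)) (W \<boxtimes> U)) (V \<boxtimes> U) (tmap1 e)"
    unfolding ghom_def res_rep_simps
  proof (intro conjI ballI)
    show "linear_on (rep_space (W \<boxtimes> U)) (tmap1 e)"
      by (rule tmap1_linear[OF coind_linear[OF W] rep_subspace[OF rW]])
  next
    fix F assume F: "F \<in> rep_space (W \<boxtimes> U)"
    show "tmap1 e F \<in> rep_space (V \<boxtimes> U)"
      by (rule tmap1_mem[OF rW U coind_linear[OF W] coind_closed[OF W] F])
    fix x assume "x \<in> carrier (H \<times>\<times> K)"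
    then obtain h k where x: "x = (h, k)" "h \<in> carrier H" "k \<in> carrier K" by auto
    show "tmap1 e (rep_act (W \<boxtimes> U) ((\<lambda>(h, k). (\<iota> h, k)) x) F) = rep_act (V \<boxtimes> U) x (tmap1 e F)"
      unfolding x(1) split
      by (rule tmap1_act[OF rW U rV coind_linear[OF W] coind_closed[OF W] coind_act[OF W x(2)]
            coind_carrier[OF W x(2)] x(2,3) F])
  qed
next
  note rW = coind_rep(1)[OF W] and rV = coind_rep(2)[OF W]
  interpret G: group G using rep_group[OF rW] .
  interpret H: group H using rep_group[OF rV] .
  interpret K: group K using rep_group[OF U] .
  obtain B where B: "finite B" "cfun.independent B" "B \<subseteq> rep_space U" "cfun.span B = rep_space U"
    using findim_basis[OF rep_subspace[OF U] rep_findim[OF U]] .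
  have eact: "tmap1 e (rep_act (W \<boxtimes> U) (g, k) (tsum B w (\<lambda>b. b))) =
      tsum B (\<lambda>b. e (rep_act W g (w b))) (\<lambda>b. rep_act U k b)"
    if g: "g \<in> carrier G" and k: "k \<in> carrier K" and w: "\<And>b. b \<in> B \<Longrightarrow> w b \<in> rep_space W" for g k w
  proof -
    have "rep_act (W \<boxtimes> U) (g, k) (tsum B w (\<lambda>b. b)) = tsum B (\<lambda>b. rep_act W g (w b)) (\<lambda>b. rep_act U k b)"
      by (rule act_tsum[OF rW U g k]) (use w B in auto)
    then show ?thesis
      using tmap1_tsum[OF coind_linear[OF W] rep_subspace[OF rW], of B "\<lambda>b. rep_act W g (w b)"]
        rep_closed[OF rW g] w by simp
  qed
  have idB: "tsum B c (\<lambda>b. rep_act U \<one>\<^bsub>K\<^esub> b) = tsum B c (\<lambda>b. b)" for c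
    by (rule tsum_cong) (use B rep_one[OF U] in auto)
  {
    fix \<phi> assume \<phi>: "equivariant (G \<times>\<times> K) (H \<times>\<times> K) (\<lambda>(h, k). (\<iota> h, k)) (V \<boxtimes> U) \<phi>"
    have \<phi>h: "\<phi> (\<iota> h \<otimes>\<^bsub>G\<^esub> g, l \<otimes>\<^bsub>K\<^esub> k) = rep_act (V \<boxtimes> U) (h, l) (\<phi> (g, k))"
      if "h \<in> carrier H" "l \<in> carrier K" "g \<in> carrier G" "k \<in> carrier K" for h l g k
      using \<phi> that unfolding equivariant_def by auto
    have "\<exists>c. (\<forall>b\<in>B. c b \<in> rep_space V) \<and> \<phi> (g, \<one>\<^bsub>K\<^esub>) = tsum B c (\<lambda>b. b)" if "g \<in> carrier G" for g
    proof -
      have "\<phi> (g, \<one>\<^bsub>K\<^esub>) \<in> rep_space (V \<boxtimes> U)" using \<phi> that unfolding equivariant_def by simp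
      then show ?thesis using tensor_expand[OF rep_subspace[OF rV] B(1,4)] by metis
    qed
    then obtain c where c: "\<And>g b. g \<in> carrier G \<Longrightarrow> b \<in> B \<Longrightarrow> c g b \<in> rep_space V"
      "\<And>g. g \<in> carrier G \<Longrightarrow> \<phi> (g, \<one>\<^bsub>K\<^esub>) = tsum B (c g) (\<lambda>b. b)" by metis
    have "equivariant G H \<iota> V (\<lambda>g. c g b)" if b: "b \<in> B" for b
      unfolding equivariant_def
    proof (intro conjI ballI)
      fix g h assume g: "g \<in> carrier G" and h: "h \<in> carrier H"
      have ig: "\<iota> h \<otimes>\<^bsub>G\<^esub> g \<in> carrier G" using g coind_carrier[OF W h] by auto
      have "tsum B (c (\<iota> h \<otimes>\<^bsub>G\<^esub> g)) (\<lambda>b. b) = rep_act (V \<boxtimes> U) (h, \<one>\<^bsub>K\<^esub>) (tsum B (c g) (\<lambda>b. b))"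
        using \<phi>h[OF h K.one_closed g K.one_closed] c(2)[OF ig] c(2)[OF g] by simp
      also have "\<dots> = tsum B (\<lambda>b. rep_act V h (c g b)) (\<lambda>b. rep_act U \<one>\<^bsub>K\<^esub> b)"
        by (rule act_tsum[OF rV U h]) (use c(1)[OF g] B in auto)
      finally show "c (\<iota> h \<otimes>\<^bsub>G\<^esub> g) b = rep_act V h (c g b)"
        unfolding idB using tsum_unique[OF B(2,1) _ b] by blast
    qed (use c b in auto)
    then have "\<exists>w\<in>rep_space W. \<forall>g\<in>carrier G. e (rep_act W g w) = c g b" if "b \<in> B" for b
      using coind_obtain[OF W] that by metis
    then obtain w where w: "\<And>b. b \<in> B \<Longrightarrow> w b \<in> rep_space W"
      "\<And>g b. b \<in> B \<Longrightarrow> g \<in> carrier G \<Longrightarrow> e (rep_act W g (w b)) = c g b" by metis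
    have "tmap1 e (rep_act (W \<boxtimes> U) (g, k) (tsum B w (\<lambda>b. b))) = \<phi> (g, k)"
      if g: "g \<in> carrier G" and k: "k \<in> carrier K" for g k
    proof -
      have "tmap1 e (rep_act (W \<boxtimes> U) (g, k) (tsum B w (\<lambda>b. b))) = tsum B (c g) (\<lambda>b. rep_act U k b)"
        using eact[OF g k, of w] w tsum_cong[of B "\<lambda>b. e (rep_act W g (w b))" "c g" "rep_act U k" "rep_act U k"] g by simp
      also have "\<dots> = tsum B (\<lambda>b. rep_act V \<one>\<^bsub>H\<^esub> (c g b)) (\<lambda>b. rep_act U k b)"
        by (rule tsum_cong) (use rep_one[OF rV] c(1)[OF g] in auto)
      also have "\<dots> = rep_act (V \<boxtimes> U) (\<one>\<^bsub>H\<^esub>, k) (tsum B (c g) (\<lambda>b. b))"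
        by (rule act_tsum[OF rV U _ k, symmetric]) (use c(1)[OF g] B in auto)
      also have "\<dots> = \<phi> (\<iota> \<one>\<^bsub>H\<^esub> \<otimes>\<^bsub>G\<^esub> g, k \<otimes>\<^bsub>K\<^esub> \<one>\<^bsub>K\<^esub>)"
        using \<phi>h[OF H.one_closed k g K.one_closed] c(2)[OF g] by simp
      also have "\<iota> \<one>\<^bsub>H\<^esub> = \<one>\<^bsub>G\<^esub>"
        using coind_hom[OF W] hom_one H.group_axioms G.group_axioms by blast
      finally show ?thesis using g k by simp
    qed
    moreover have "tsum B w (\<lambda>b. b) \<in> rep_space (W \<boxtimes> U)" by (rule tsum_mem) (use w B in auto)
    ultimately show "\<exists>F\<in>rep_space (W \<boxtimes> U). \<forall>x\<in>carrier (G \<times>\<times> K). tmap1 e (rep_act (W \<boxtimes> U) x F) = \<phi> x"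
      by (intro bexI[of _ "tsum B w (\<lambda>b. b)"]) auto
  next
    fix F F' assume F: "F \<in> rep_space (W \<boxtimes> U)" "F' \<in> rep_space (W \<boxtimes> U)"
      and e: "\<And>x. x \<in> carrier (G \<times>\<times> K) \<Longrightarrow> tmap1 e (rep_act (W \<boxtimes> U) x F) = tmap1 e (rep_act (W \<boxtimes> U) x F')"
    obtain w w' where w: "\<And>b. b \<in> B \<Longrightarrow> w b \<in> rep_space W" "F = tsum B w (\<lambda>b. b)"
      and w': "\<And>b. b \<in> B \<Longrightarrow> w' b \<in> rep_space W" "F' = tsum B w' (\<lambda>b. b)"
      using tensor_expand[OF rep_subspace[OF rW] B(1,4)] F by metis
    have "e (rep_act W g (w b)) = e (rep_act W g (w' b))" if g: "g \<in> carrier G" and b: "b \<in> B" for g b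
    proof -
      have "tsum B (\<lambda>b. e (rep_act W g (w b))) (\<lambda>b. b) = tsum B (\<lambda>b. e (rep_act W g (w' b))) (\<lambda>b. b)"
        using e[of "(g, \<one>\<^bsub>K\<^esub>)"] eact[OF g K.one_closed w(1)] eact[OF g K.one_closed w'(1)] g
        unfolding w(2) w'(2) idB by simp
      from tsum_unique[OF B(2,1) this b] show ?thesis .
    qed
    then have "w b = w' b" if "b \<in> B" for b
      using coind_unique[OF W w(1) w'(1)] that by blast
    then show "F = F'" unfolding w(2) w'(2) by (intro tsum_cong) auto
  }
qed

text \<open>The projections act on the coefficients over a basis of U, so a vector with given
  projections is assembled coefficient by coefficient.\<close>

lemma is_sum_tensor:
  assumes V: "is_sum G I R V p" and U: "representation K U"
  shows "is_sum (G \<times>\<times> K) I (\<lambda>i. R i \<boxtimes> U) (V \<boxtimes> U) (\<lambda>i. tmap1 (p i))"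
proof (rule is_sumI)
  note rV = is_sum_rep(1)[OF V] and rR = is_sum_rep(2)[OF V] and pi = is_sum_ghom[OF V]
  show "representation (G \<times>\<times> K) (V \<boxtimes> U)" using tensor_rep[OF rV U] .
  obtain B where B: "finite B" "cfun.independent B" "B \<subseteq> rep_space U" "cfun.span B = rep_space U"
    using findim_basis[OF rep_subspace[OF U] rep_findim[OF U]] .
  {
    fix i assume i: "i \<in> I"
    show "representation (G \<times>\<times> K) (R i \<boxtimes> U)" using tensor_rep[OF rR[OF i] U] .
    show "ghom (G \<times>\<times> K) (V \<boxtimes> U) (R i \<boxtimes> U) (tmap1 (p i))"
      unfolding ghom_def
    proof (intro conjI ballI)
      show "linear_on (rep_space (V \<boxtimes> U)) (tmap1 (p i))"
        by (rule tmap1_linear[OF ghom_linear[OF pi[OF i]] rep_subspace[OF rV]])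
    next
      fix F assume F: "F \<in> rep_space (V \<boxtimes> U)"
      show "tmap1 (p i) F \<in> rep_space (R i \<boxtimes> U)"
        by (rule tmap1_mem[OF rV U ghom_linear[OF pi[OF i]] ghom_closed[OF pi[OF i]] F])
      fix x assume "x \<in> carrier (G \<times>\<times> K)"
      then obtain g k where x: "x = (g, k)" "g \<in> carrier G" "k \<in> carrier K" by auto
      show "tmap1 (p i) (rep_act (V \<boxtimes> U) x F) = rep_act (R i \<boxtimes> U) x (tmap1 (p i) F)"
        unfolding x(1)
        by (rule tmap1_act[OF rV U rR[OF i] ghom_linear[OF pi[OF i]] ghom_closed[OF pi[OF i]]
              ghom_act[OF pi[OF i] x(2)] x(2,2,3) F])
    qed
  next
    fix r assume r: "\<And>i. i \<in> I \<Longrightarrow> r i \<in> rep_space (R i \<boxtimes> U)"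
    have "\<exists>c. (\<forall>b\<in>B. c b \<in> rep_space (R i)) \<and> r i = tsum B c (\<lambda>b. b)" if "i \<in> I" for i
      using tensor_expand[OF rep_subspace[OF rR[OF that]] B(1,4) r[OF that]] by metis
    then obtain c where c: "\<And>i b. i \<in> I \<Longrightarrow> b \<in> B \<Longrightarrow> c i b \<in> rep_space (R i)"
      "\<And>i. i \<in> I \<Longrightarrow> r i = tsum B (c i) (\<lambda>b. b)" by metis
    have "\<exists>v\<in>rep_space V. \<forall>i\<in>I. p i v = c i b" if "b \<in> B" for b
      using is_sum_ex1[OF V, of "\<lambda>i. c i b"] c(1) that by blast
    then obtain v where v: "\<And>b. b \<in> B \<Longrightarrow> v b \<in> rep_space V" "\<And>b i. b \<in> B \<Longrightarrow> i \<in> I \<Longrightarrow> p i (v b) = c i b"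
      by metis
    have "tmap1 (p i) (tsum B v (\<lambda>b. b)) = r i" if i: "i \<in> I" for i
    proof -
      have "tmap1 (p i) (tsum B v (\<lambda>b. b)) = tsum B (\<lambda>b. p i (v b)) (\<lambda>b. b)"
        by (rule tmap1_tsum[OF ghom_linear[OF pi[OF i]] rep_subspace[OF rV] v(1)])
      also have "\<dots> = r i" unfolding c(2)[OF i] by (rule tsum_cong) (use v(2) i in auto)
      finally show ?thesis .
    qed
    moreover have "tsum B v (\<lambda>b. b) \<in> rep_space (V \<boxtimes> U)" by (rule tsum_mem) (use v B in auto)
    ultimately show "\<exists>F\<in>rep_space (V \<boxtimes> U). \<forall>i\<in>I. tmap1 (p i) F = r i" by blast
  next
    fix F F' assume F: "F \<in> rep_space (V \<boxtimes> U)" "F' \<in> rep_space (V \<boxtimes> U)"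
      and e: "\<And>i. i \<in> I \<Longrightarrow> tmap1 (p i) F = tmap1 (p i) F'"
    obtain w w' where w: "\<And>b. b \<in> B \<Longrightarrow> w b \<in> rep_space V" "F = tsum B w (\<lambda>b. b)"
      and w': "\<And>b. b \<in> B \<Longrightarrow> w' b \<in> rep_space V" "F' = tsum B w' (\<lambda>b. b)"
      using tensor_expand[OF rep_subspace[OF rV] B(1,4)] F by metis
    have "p i (w b) = p i (w' b)" if i: "i \<in> I" and b: "b \<in> B" for i b
    proof -
      have "tsum B (\<lambda>b. p i (w b)) (\<lambda>b. b) = tsum B (\<lambda>b. p i (w' b)) (\<lambda>b. b)"
        using e[OF i] tmap1_tsum[OF ghom_linear[OF pi[OF i]] rep_subspace[OF rV], of B w "\<lambda>b. b"]
          tmap1_tsum[OF ghom_linear[OF pi[OF i]] rep_subspace[OF rV], of B w' "\<lambda>b. b"] w(1) w'(1)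
        unfolding w(2) w'(2) by simp
      from tsum_unique[OF B(2,1) this b] show ?thesis .
    qed
    then have "w b = w' b" if "b \<in> B" for b
      using is_sum_unique[OF V w(1) w'(1)] that by blast
    then show "F = F'" unfolding w(2) w'(2) by (intro tsum_cong) auto
  }
qed

section \<open>Changing the representation that is induced\<close>

text \<open>The pair (H, V) is exchanged for (H', V'). Surjectivity of \<theta> ensures that
  equivariance under H' already gives equivariance under H.\<close>

lemma coind_replace:
  assumes W: "coinduced G H \<iota> V W e" and V': "representation H' V'"
    and \<theta>: "\<theta> \<in> hom H' H" "\<theta> ` carrier H' = carrier H"
    and \<psi>: "linear_on (rep_space V) \<psi>" "bij_betw \<psi> (rep_space V) (rep_space V')"
    and \<psi>h: "\<And>h v. h \<in> carrier H' \<Longrightarrow> v \<in> rep_space V \<Longrightarrow> \<psi> (rep_act V (\<theta> h) v) = rep_act V' h (\<psi> v)"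
  shows "coinduced G H' (\<lambda>h. \<iota> (\<theta> h)) V' W (\<lambda>w. \<psi> (e w))"
proof (rule coinducedI[OF coind_rep(1)[OF W] V'])
  have \<psi>V: "\<And>v. v \<in> rep_space V \<Longrightarrow> \<psi> v \<in> rep_space V'" using \<psi>(2) bij_betwE by blast
  have \<theta>c: "\<And>h. h \<in> carrier H' \<Longrightarrow> \<theta> h \<in> carrier H" using \<theta>(1) by (auto simp: hom_def)
  show "(\<lambda>h. \<iota> (\<theta> h)) \<in> hom H' G" using \<theta>(1) coind_hom[OF W] by (auto simp: hom_def Pi_iff)
  show "ghom H' (res_rep (\<lambda>h. \<iota> (\<theta> h)) W) V' (\<lambda>w. \<psi> (e w))"
    unfolding ghom_def res_rep_simps
  proof (intro conjI ballI)
    show "linear_on (rep_space W) (\<lambda>w. \<psi> (e w))"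
      by (rule linear_on_comp[OF coind_linear[OF W] _ \<psi>(1)]) (use coind_closed[OF W] in auto)
  qed (use \<psi>V coind_closed[OF W] coind_act[OF W] \<theta>c \<psi>h in auto)
  have inj: "inj_on \<psi> (rep_space V)" using \<psi>(2) by (rule bij_betw_imp_inj_on)
  let ?i = "the_inv_into (rep_space V) \<psi>"
  have i: "?i v \<in> rep_space V" "\<psi> (?i v) = v" if "v \<in> rep_space V'" for v
    using \<psi>(2) that bij_betwE[OF bij_betw_the_inv_into[OF \<psi>(2)]] f_the_inv_into_f_bij_betw[OF \<psi>(2)] by auto
  {
    fix \<phi> assume \<phi>: "equivariant G H' (\<lambda>h. \<iota> (\<theta> h)) V' \<phi>"
    have "equivariant G H \<iota> V (\<lambda>g. ?i (\<phi> g))"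
      unfolding equivariant_def
    proof (intro conjI ballI)
      fix g assume g: "g \<in> carrier G"
      show ig: "?i (\<phi> g) \<in> rep_space V" using \<phi> g i unfolding equivariant_def by auto
      fix h assume "h \<in> carrier H"
      then obtain h' where h': "h' \<in> carrier H'" "h = \<theta> h'" unfolding \<theta>(2)[symmetric] by auto
      have "\<phi> (\<iota> h \<otimes>\<^bsub>G\<^esub> g) = rep_act V' h' (\<psi> (?i (\<phi> g)))"
        using \<phi> g h' i unfolding equivariant_def by auto
      also have "\<dots> = \<psi> (rep_act V h (?i (\<phi> g)))" using \<psi>h[OF h'(1) ig] h'(2) by simp
      finally show "?i (\<phi> (\<iota> h \<otimes>\<^bsub>G\<^esub> g)) = rep_act V h (?i (\<phi> g))"
        using the_inv_into_f_f[OF inj rep_closed[OF coind_rep(2)[OF W] _ ig]] \<theta>c[OF h'(1)] h'(2) by simp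
    qed
    then obtain w where w: "w \<in> rep_space W" "\<And>g. g \<in> carrier G \<Longrightarrow> e (rep_act W g w) = ?i (\<phi> g)"
      using coind_obtain[OF W] by blast
    then show "\<exists>w\<in>rep_space W. \<forall>g\<in>carrier G. \<psi> (e (rep_act W g w)) = \<phi> g"
      using i \<phi> unfolding equivariant_def by (intro bexI[of _ w]) auto
  next
    fix v w assume "v \<in> rep_space W" "w \<in> rep_space W"
      "\<And>g. g \<in> carrier G \<Longrightarrow> \<psi> (e (rep_act W g v)) = \<psi> (e (rep_act W g w))"
    then show "v = w"
      using inj_onD[OF inj] coind_closed[OF W] rep_closed[OF coind_rep(1)[OF W]]
      by (intro coind_unique[OF W]) auto
  }
qed

definition tswap :: "('x \<times> 'y \<Rightarrow> complex) \<Rightarrow> 'y \<times> 'x \<Rightarrow> complex"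
  where "tswap F = (\<lambda>(y, x). F (x, y))"

lemma tswap_tswap [simp]: "tswap (tswap F) = F"
  by (simp add: tswap_def)

lemma tswap_tsum: "tswap (tsum A c d) = tsum A d c"
  by (auto simp: tswap_def tsum_def mult.commute)

lemma tswap_mem:
  fixes R :: "('g, 'x) rep" and Q :: "('h, 'y) rep"
  assumes "F \<in> rep_space (R \<boxtimes> Q)" shows "tswap F \<in> rep_space (Q \<boxtimes> R)"
  using assms unfolding ext_tensor_space[of R Q]
proof (induction rule: span_induct_member)
  case zero
  have "tswap (0 :: 'x \<times> 'y \<Rightarrow> complex) = 0" by (auto simp: tswap_def pointwise)
  then show ?case using cfun.subspace_0[OF ext_tensor_subspace] by simp
next
  case (step c F F')
  then obtain v w where F: "F = ptensor v w" "v \<in> rep_space R" "w \<in> rep_space Q" by blast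
  have "tswap (cscale c F + F') = cscale c (ptensor w v) + tswap F'"
    by (auto simp: tswap_def F(1) ptensor_def pointwise mult.commute)
  then show ?case
    using cfun.subspace_add[OF ext_tensor_subspace cfun.subspace_scale[OF ext_tensor_subspace
          ptensor_mem[OF F(3,2)]] step(5)] by simp
qed

text \<open>Turns statements about inducing or splitting the first tensor factor into statements
  about the second.\<close>

lemma coind_swap:
  assumes W: "coinduced G (H \<times>\<times> K) \<iota> (V \<boxtimes> U) W e" and V: "representation H V" and U: "representation K U"
  shows "coinduced G (K \<times>\<times> H) (\<lambda>(k, h). \<iota> (h, k)) (U \<boxtimes> V) W (\<lambda>w. tswap (e w))"
proof -
  have "coinduced G (K \<times>\<times> H) (\<lambda>x. \<iota> (prod.swap x)) (U \<boxtimes> V) W (\<lambda>w. tswap (e w))"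
  proof (rule coind_replace[OF W tensor_rep[OF U V]])
    show "prod.swap \<in> hom (K \<times>\<times> H) (H \<times>\<times> K)" by (auto simp: hom_def)
    show "prod.swap ` carrier (K \<times>\<times> H) = carrier (H \<times>\<times> K)" by (simp add: product_swap)
    show "linear_on (rep_space (V \<boxtimes> U)) tswap" by (auto simp: linear_on_def tswap_def pointwise)
    show "bij_betw tswap (rep_space (V \<boxtimes> U)) (rep_space (U \<boxtimes> V))"
      by (rule bij_betw_byWitness[of _ tswap]) (use tswap_mem in auto)
  next
    fix x F assume "x \<in> carrier (K \<times>\<times> H)" and F: "F \<in> rep_space (V \<boxtimes> U)"
    then obtain k h where x: "x = (k, h)" "h \<in> carrier H" "k \<in> carrier K" by auto
    obtain B c where B: "B \<subseteq> rep_space U" "\<And>b. b \<in> B \<Longrightarrow> c b \<in> rep_space V" "F = tsum B c (\<lambda>b. b)"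
      using tensor_rep_expand[OF V U F] by metis
    have 1: "rep_act (V \<boxtimes> U) (h, k) F = tsum B (\<lambda>b. rep_act V h (c b)) (\<lambda>b. rep_act U k b)"
      unfolding B(3) by (rule act_tsum[OF V U x(2,3)]) (use B in auto)
    have 2: "rep_act (U \<boxtimes> V) (k, h) (tsum B (\<lambda>b. b) c) = tsum B (\<lambda>b. rep_act U k b) (\<lambda>b. rep_act V h (c b))"
      by (rule act_tsum[OF U V x(3,2)]) (use B in auto)
    show "tswap (rep_act (V \<boxtimes> U) (prod.swap x) F) = rep_act (U \<boxtimes> V) x (tswap F)"
      unfolding x(1) swap_simp 1 tswap_tsum using 2 B(3) tswap_tsum by metis
  qed
  then show ?thesis by (simp add: case_prod_beta' prod.swap_def)
qed

section \<open>A criterion for multiplicity one\<close>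

text \<open>Bilinear, without complex conjugation, so that complex combinations of symmetric
  operators remain symmetric. That a vector pairs nontrivially with itself must therefore be
  supplied separately.\<close>

definition dotp :: "'x set \<Rightarrow> ('x \<Rightarrow> complex) \<Rightarrow> ('x \<Rightarrow> complex) \<Rightarrow> complex"
  where "dotp Y u w = (\<Sum>x\<in>Y. u x * w x)"

lemma dotp_commute: "dotp Y u w = dotp Y w u"
  by (simp add: dotp_def mult.commute)

lemma dotp_add: "dotp Y (u + v) w = dotp Y u w + dotp Y v w" "dotp Y w (u + v) = dotp Y w u + dotp Y w v"
  by (simp_all add: dotp_def plus_fun_apply algebra_simps sum.distrib)

lemma dotp_scale: "dotp Y (cscale c u) w = c * dotp Y u w" "dotp Y w (cscale c u) = c * dotp Y w u"
  by (simp_all add: dotp_def cscale_def sum_distrib_left mult_ac)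

lemma dotp_zero [simp]: "dotp Y 0 w = 0" "dotp Y w 0 = 0"
  by (simp_all add: dotp_def zero_fun_apply)

lemma dotp_sum: "dotp Y (\<Sum>i\<in>A. u i) w = (\<Sum>i\<in>A. dotp Y (u i) w)" "dotp Y w (\<Sum>i\<in>A. u i) = (\<Sum>i\<in>A. dotp Y w (u i))"
  by (induction A rule: infinite_finite_induct) (simp_all add: dotp_add)

lemma res_rep_representation:
  assumes V: "representation G V" and H: "group H" and \<iota>: "\<iota> \<in> hom H G"
  shows "representation H (res_rep \<iota> V)"
proof -
  have 1: "\<iota> \<one>\<^bsub>H\<^esub> = \<one>\<^bsub>G\<^esub>" using \<iota> hom_one H rep_group[OF V] by blast
  have "\<And>h. h \<in> carrier H \<Longrightarrow> \<iota> h \<in> carrier G"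
    "\<And>h k. h \<in> carrier H \<Longrightarrow> k \<in> carrier H \<Longrightarrow> \<iota> (h \<otimes>\<^bsub>H\<^esub> k) = \<iota> h \<otimes>\<^bsub>G\<^esub> \<iota> k"
    using \<iota> by (auto simp: hom_def)
  then show ?thesis using V H 1 unfolding representation_iff by simp
qed

text \<open>
  If every element of \<open>G\<close> is conjugate to its inverse under \<open>H\<close>, every \<open>H\<close>-endomorphism of an
  irreducible orthogonal representation of \<open>G\<close> is a combination of the symmetric operators
  \<open>\<Sum>h. h g h\<inverse>\<close> and hence symmetric.  Two independent homomorphisms onto an irreducible \<open>W\<close> would give
  a projection \<open>E\<close> and an \<open>N\<close> with \<open>E N = N\<close> and \<open>N E = 0\<close>, which is impossible for symmetric operators.
\<close>

locale real_type =
  fixes G :: "('g, 'm) monoid_scheme" and V :: "('g, 'x) rep" and Y :: "'x set" and w0 :: "'x \<Rightarrow> complex"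
  assumes V: "representation G V" and finG: "finite (carrier G)"
    and inv: "\<And>g x y. g \<in> carrier G \<Longrightarrow> x \<in> rep_space V \<Longrightarrow> y \<in> rep_space V \<Longrightarrow>
      dotp Y (rep_act V g x) (rep_act V g y) = dotp Y x y"
    and nondeg: "\<And>x. x \<in> rep_space V \<Longrightarrow> (\<And>y. y \<in> rep_space V \<Longrightarrow> dotp Y x y = 0) \<Longrightarrow> x = 0"
    and schur: "\<And>f. ghom G V V f \<Longrightarrow> \<exists>c. \<forall>v\<in>rep_space V. f v = cscale c v"
    and w0: "w0 \<in> rep_space V" "dotp Y w0 w0 \<noteq> 0"
      "(\<Sum>g\<in>carrier G. dotp Y w0 (rep_act V g w0) ^ 2) \<noteq> 0"
begin

sublocale group G using rep_group[OF V] .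

lemma inv_left:
  assumes "g \<in> carrier G" "x \<in> rep_space V" "y \<in> rep_space V"
  shows "dotp Y (rep_act V (inv\<^bsub>G\<^esub> g) x) y = dotp Y x (rep_act V g y)"
  using inv[OF assms(1) rep_closed[OF V _ assms(2)] assms(3), of "inv\<^bsub>G\<^esub> g"] rep_inv_act[OF V assms(1,2)]
    assms(1) by simp

text \<open>By Schur's lemma the sum over G of the conjugates of the rank-one operator v |-> <v, y>
  x is a scalar; this is that scalar.\<close>

definition schur_scalar :: "('x \<Rightarrow> complex) \<Rightarrow> ('x \<Rightarrow> complex) \<Rightarrow> complex"
  where "schur_scalar x y = (SOME c. \<forall>w\<in>rep_space V.
    (\<Sum>g\<in>carrier G. cscale (dotp Y (rep_act V (inv\<^bsub>G\<^esub> g) w) y) (rep_act V g x)) = cscale c w)"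

lemma schur_scalar:
  assumes x: "x \<in> rep_space V" and y: "y \<in> rep_space V" and w: "w \<in> rep_space V"
  shows "(\<Sum>g\<in>carrier G. cscale (dotp Y (rep_act V (inv\<^bsub>G\<^esub> g) w) y) (rep_act V g x)) = cscale (schur_scalar x y) w"
proof -
  let ?a = "\<lambda>w. \<Sum>g\<in>carrier G. rep_act V g (cscale (dotp Y (rep_act V (inv\<^bsub>G\<^esub> g) w) y) x)"
  have "ghom G V V ?a"
    by (rule ghom_average[OF V V finG, of "\<lambda>v. cscale (dotp Y v y) x"])
      (use x cfun.subspace_scale[OF rep_subspace[OF V]] in
        \<open>auto simp: linear_on_def dotp_add dotp_scale cfun.scale_left_distrib\<close>)
  from schur[OF this] obtain c where c: "\<forall>w\<in>rep_space V. ?a w = cscale c w" by blast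
  have "?a w = (\<Sum>g\<in>carrier G. cscale (dotp Y (rep_act V (inv\<^bsub>G\<^esub> g) w) y) (rep_act V g x))" for w
    by (intro sum.cong refl linear_on_scale[OF rep_linear[OF V] x])
  with c have "\<exists>c. \<forall>w\<in>rep_space V.
      (\<Sum>g\<in>carrier G. cscale (dotp Y (rep_act V (inv\<^bsub>G\<^esub> g) w) y) (rep_act V g x)) = cscale c w" by auto
  from someI_ex[OF this] show ?thesis using w unfolding schur_scalar_def by blast
qed

lemma matrix_coeff_sum:
  assumes "x \<in> rep_space V" "y \<in> rep_space V" "w \<in> rep_space V"
  shows "(\<Sum>g\<in>carrier G. dotp Y (rep_act V (inv\<^bsub>G\<^esub> g) w) y * dotp Y (rep_act V g x) z) = schur_scalar x y * dotp Y w z"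
  using arg_cong[OF schur_scalar[OF assms], of "\<lambda>v. dotp Y v z"] by (simp add: dotp_sum dotp_scale)

lemma sum_inv: "(\<Sum>g\<in>carrier G. f (inv\<^bsub>G\<^esub> g)) = (\<Sum>g\<in>carrier G. f g)"
  by (rule sum.reindex_bij_witness[of _ "\<lambda>g. inv\<^bsub>G\<^esub> g" "\<lambda>g. inv\<^bsub>G\<^esub> g"]) auto

text \<open>Replacing g by g^-1 exchanges the pairs (x, y) and (z, w) in the sum of matrix
  coefficients. With w and z equal to w0 it shows that the scalar is a fixed multiple of <x,
  y>.\<close>

lemma schur_scalar_swap:
  assumes "x \<in> rep_space V" "y \<in> rep_space V" "w \<in> rep_space V" "z \<in> rep_space V"
  shows "schur_scalar x y * dotp Y w z = schur_scalar z w * dotp Y x y"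
proof -
  have "schur_scalar z w * dotp Y y x = (\<Sum>g\<in>carrier G. dotp Y (rep_act V (inv\<^bsub>G\<^esub> g) y) w * dotp Y (rep_act V g z) x)"
    using matrix_coeff_sum[OF assms(4,3,2)] by simp
  also have "\<dots> = (\<Sum>g\<in>carrier G. dotp Y (rep_act V g w) y * dotp Y (rep_act V (inv\<^bsub>G\<^esub> g) x) z)"
  proof (intro sum.cong refl arg_cong2[of _ _ _ _ "(*)"])
    fix g assume g: "g \<in> carrier G"
    show "dotp Y (rep_act V (inv\<^bsub>G\<^esub> g) y) w = dotp Y (rep_act V g w) y"
      using inv_left[OF g assms(2,3)] by (simp add: dotp_commute)
    show "dotp Y (rep_act V g z) x = dotp Y (rep_act V (inv\<^bsub>G\<^esub> g) x) z"
      using inv_left[OF g assms(1,4)] by (simp add: dotp_commute)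
  qed
  also have "\<dots> = (\<Sum>g\<in>carrier G. dotp Y (rep_act V (inv\<^bsub>G\<^esub> g) w) y * dotp Y (rep_act V g x) z)"
    using sum_inv[of "\<lambda>g. dotp Y (rep_act V (inv\<^bsub>G\<^esub> g) w) y * dotp Y (rep_act V g x) z"] by simp
  finally show ?thesis using matrix_coeff_sum[OF assms(1-3)] by (simp add: dotp_commute)
qed

text \<open>At w0 the products of matrix coefficients become squares, whose sum the locale assumes
  to be nonzero.\<close>

lemma schur_scalar_nonzero: "schur_scalar w0 w0 \<noteq> 0"
proof
  assume "schur_scalar w0 w0 = 0"
  then have "0 = (\<Sum>g\<in>carrier G. dotp Y (rep_act V (inv\<^bsub>G\<^esub> g) w0) w0 * dotp Y (rep_act V g w0) w0)"
    using matrix_coeff_sum[OF w0(1) w0(1) w0(1), of w0] by simp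
  also have "\<dots> = (\<Sum>g\<in>carrier G. dotp Y w0 (rep_act V g w0) ^ 2)"
    using inv_left[OF _ w0(1) w0(1)] dotp_commute[of Y _ w0]
    by (intro sum.cong refl) (metis power2_eq_square)
  finally show False using w0(3) by simp
qed

text \<open>The constant is |G| / dim V, computed here from w0 instead of a trace.\<close>

lemma schur_orthogonality:
  obtains c where "c \<noteq> 0" "\<And>x y w z. x \<in> rep_space V \<Longrightarrow> y \<in> rep_space V \<Longrightarrow> w \<in> rep_space V \<Longrightarrow>
    (\<Sum>g\<in>carrier G. dotp Y (rep_act V (inv\<^bsub>G\<^esub> g) w) y * dotp Y (rep_act V g x) z) = c * dotp Y x y * dotp Y w z"
proof -
  define c where "c = schur_scalar w0 w0 / dotp Y w0 w0"
  have "schur_scalar x y = c * dotp Y x y" if "x \<in> rep_space V" "y \<in> rep_space V" for x y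
    using schur_scalar_swap[OF that w0(1) w0(1)] w0(2) by (simp add: c_def field_simps)
  then show ?thesis using that[of c] matrix_coeff_sum schur_scalar_nonzero w0(2) by (simp add: c_def)
qed

context
  fixes H :: "('h, 'n) monoid_scheme" and \<iota> :: "'h \<Rightarrow> 'g"
  assumes H: "group H" and finH: "finite (carrier H)" and \<iota>: "\<iota> \<in> hom H G"
    and conj_inv: "\<And>g. g \<in> carrier G \<Longrightarrow> \<exists>h\<in>carrier H. inv\<^bsub>G\<^esub> g = \<iota> h \<otimes>\<^bsub>G\<^esub> g \<otimes>\<^bsub>G\<^esub> inv\<^bsub>G\<^esub> (\<iota> h)"
begin

interpretation H: group H by (rule H)

lemma iota_closed [simp]: "h \<in> carrier H \<Longrightarrow> \<iota> h \<in> carrier G"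
  and iota_mult: "h \<in> carrier H \<Longrightarrow> k \<in> carrier H \<Longrightarrow> \<iota> (h \<otimes>\<^bsub>H\<^esub> k) = \<iota> h \<otimes>\<^bsub>G\<^esub> \<iota> k"
  using \<iota> by (auto simp: hom_def)

lemma iota_inv: "h \<in> carrier H \<Longrightarrow> \<iota> (inv\<^bsub>H\<^esub> h) = inv\<^bsub>G\<^esub> (\<iota> h)"
  using group_hom.hom_inv[of H G \<iota> h] \<iota> by (simp add: group_hom_def group_hom_axioms_def group_axioms H)

text \<open>By orthogonality, c times the operator w |-> \<Sum>h. <w, h y> h x is the combination of
  the elements k of G with coefficients a k. The function a is constant on H-conjugates, and since k
  is H-conjugate to its inverse it is unchanged by inversion. As the form is invariant, such a
  combination is symmetric.\<close>

lemma averaged_symmetric: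
  assumes x: "x \<in> rep_space V" and y: "y \<in> rep_space V" and w: "w \<in> rep_space V" and z: "z \<in> rep_space V"
  shows "(\<Sum>h\<in>carrier H. dotp Y w (rep_act V (\<iota> h) y) * dotp Y (rep_act V (\<iota> h) x) z) =
    (\<Sum>h\<in>carrier H. dotp Y z (rep_act V (\<iota> h) y) * dotp Y (rep_act V (\<iota> h) x) w)"
proof -
  obtain c where c: "c \<noteq> 0" and schur_orthogonality: "\<And>x y w z. x \<in> rep_space V \<Longrightarrow> y \<in> rep_space V \<Longrightarrow> w \<in> rep_space V \<Longrightarrow>
    (\<Sum>g\<in>carrier G. dotp Y (rep_act V (inv\<^bsub>G\<^esub> g) w) y * dotp Y (rep_act V g x) z) = c * dotp Y x y * dotp Y w z"
    using schur_orthogonality by blast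
  define a where "a = (\<lambda>k. \<Sum>h\<in>carrier H. dotp Y (rep_act V (inv\<^bsub>G\<^esub> (\<iota> h) \<otimes>\<^bsub>G\<^esub> k \<otimes>\<^bsub>G\<^esub> \<iota> h) x) y)"
  have a_inv: "a (inv\<^bsub>G\<^esub> k) = a k" if k: "k \<in> carrier G" for k
  proof -
    obtain h0 where h0: "h0 \<in> carrier H" "inv\<^bsub>G\<^esub> k = \<iota> h0 \<otimes>\<^bsub>G\<^esub> k \<otimes>\<^bsub>G\<^esub> inv\<^bsub>G\<^esub> (\<iota> h0)"
      using conj_inv[OF k] by blast
    \<comment> \<open>Conjugation by h0 is absorbed in a translation of the summation over
      H.\<close>
    have "a (inv\<^bsub>G\<^esub> k) = (\<Sum>h\<in>carrier H. dotp Y (rep_act V (inv\<^bsub>G\<^esub> (\<iota> (inv\<^bsub>H\<^esub> h0 \<otimes>\<^bsub>H\<^esub> h)) \<otimes>\<^bsub>G\<^esub> k \<otimes>\<^bsub>G\<^esub> \<iota> (inv\<^bsub>H\<^esub> h0 \<otimes>\<^bsub>H\<^esub> h)) x) y)"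
      unfolding a_def h0(2)
      using h0(1) k by (intro sum.cong refl) (simp add: iota_mult iota_inv inv_mult_group m_assoc)
    also have "\<dots> = a k"
      unfolding a_def using h0(1)
      by (intro sum.reindex_bij_witness[of _ "\<lambda>h. h0 \<otimes>\<^bsub>H\<^esub> h" "\<lambda>h. inv\<^bsub>H\<^esub> h0 \<otimes>\<^bsub>H\<^esub> h"])
        (auto simp: H.m_assoc[symmetric])
    finally show ?thesis .
  qed
  \<comment> \<open>The orthogonality relations are applied with h x and h y in place of x and
    y.\<close>
  have S: "c * (\<Sum>h\<in>carrier H. dotp Y w (rep_act V (\<iota> h) y) * dotp Y (rep_act V (\<iota> h) x) z) =
      (\<Sum>k\<in>carrier G. a k * dotp Y (rep_act V k w) z)"
    if w: "w \<in> rep_space V" and z: "z \<in> rep_space V" for w z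
  proof -
    have "c * (\<Sum>h\<in>carrier H. dotp Y w (rep_act V (\<iota> h) y) * dotp Y (rep_act V (\<iota> h) x) z) =
        (\<Sum>h\<in>carrier H. \<Sum>k\<in>carrier G. dotp Y (rep_act V (inv\<^bsub>G\<^esub> k) (rep_act V (\<iota> h) x)) (rep_act V (\<iota> h) y) *
          dotp Y (rep_act V k w) z)"
      unfolding sum_distrib_left
      by (intro sum.cong refl) (simp add: schur_orthogonality w x y rep_closed[OF V])
    also have "\<dots> = (\<Sum>h\<in>carrier H. \<Sum>k\<in>carrier G.
        dotp Y (rep_act V (inv\<^bsub>G\<^esub> (\<iota> h) \<otimes>\<^bsub>G\<^esub> inv\<^bsub>G\<^esub> k \<otimes>\<^bsub>G\<^esub> \<iota> h) x) y * dotp Y (rep_act V k w) z)"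
      by (intro sum.cong refl) (simp add: inv_left[symmetric] x y rep_closed[OF V] rep_mult[OF V] m_assoc)
    also have "\<dots> = (\<Sum>k\<in>carrier G. a (inv\<^bsub>G\<^esub> k) * dotp Y (rep_act V k w) z)"
      unfolding a_def sum_distrib_right by (rule sum.swap)
    also have "\<dots> = (\<Sum>k\<in>carrier G. a k * dotp Y (rep_act V k w) z)"
      by (intro sum.cong refl) (simp add: a_inv)
    finally show ?thesis .
  qed
  have "(\<Sum>k\<in>carrier G. a k * dotp Y (rep_act V k w) z) = (\<Sum>k\<in>carrier G. a (inv\<^bsub>G\<^esub> k) * dotp Y (rep_act V (inv\<^bsub>G\<^esub> k) w) z)"
    using sum_inv[of "\<lambda>k. a k * dotp Y (rep_act V k w) z"] by simp
  also have "\<dots> = (\<Sum>k\<in>carrier G. a k * dotp Y (rep_act V k z) w)"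
    by (intro sum.cong refl) (simp add: a_inv inv_left w z dotp_commute[of Y w])
  finally have "c * (\<Sum>h\<in>carrier H. dotp Y w (rep_act V (\<iota> h) y) * dotp Y (rep_act V (\<iota> h) x) z) =
      c * (\<Sum>h\<in>carrier H. dotp Y z (rep_act V (\<iota> h) y) * dotp Y (rep_act V (\<iota> h) x) w)"
    unfolding S[OF w z] S[OF z w] .
  then show ?thesis using mult_left_cancel[OF c] by blast
qed

text \<open>The vectors g w0 resolve the identity: \<Sum>g. <v, g w0> g w0 is a nonzero multiple of
  v. Applying T and averaging over H writes T through the symmetric operators of
  \<open>averaged_symmetric\<close> with x = T (g w0) and y = g w0.\<close>

lemma endo_symmetric:
  assumes T: "ghom H (res_rep \<iota> V) (res_rep \<iota> V) T" and w: "w \<in> rep_space V" and z: "z \<in> rep_space V"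
  shows "dotp Y (T w) z = dotp Y w (T z)"
proof -
  have Tc: "T v \<in> rep_space V" if "v \<in> rep_space V" for v using ghom_closed[OF T] that by simp
  have Th: "T (rep_act V (\<iota> h) v) = rep_act V (\<iota> h) (T v)" if "h \<in> carrier H" "v \<in> rep_space V" for h v
    using ghom_act[OF T] that by simp
  have Tl: "linear_on (rep_space V) T" using ghom_linear[OF T] by simp
  note s = rep_subspace[OF V]
  have c: "rep_act V g w0 \<in> rep_space V" if "g \<in> carrier G" for g using rep_closed[OF V that w0(1)] .
  have T1: "cscale (schur_scalar w0 w0) (T v) =
      (\<Sum>g\<in>carrier G. cscale (dotp Y v (rep_act V g w0)) (T (rep_act V g w0)))" if v: "v \<in> rep_space V" for v
  proof -
    have "cscale (schur_scalar w0 w0) (T v) = T (cscale (schur_scalar w0 w0) v)" by (rule linear_on_scale[OF Tl v, symmetric])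
    also have "\<dots> = T (\<Sum>g\<in>carrier G. cscale (dotp Y (rep_act V (inv\<^bsub>G\<^esub> g) v) w0) (rep_act V g w0))"
      using schur_scalar[OF w0(1) w0(1) v] by simp
    also have "\<dots> = (\<Sum>g\<in>carrier G. T (cscale (dotp Y (rep_act V (inv\<^bsub>G\<^esub> g) v) w0) (rep_act V g w0)))"
      by (rule linear_on_sum[OF Tl s]) (use c cfun.subspace_scale[OF s] in auto)
    also have "\<dots> = (\<Sum>g\<in>carrier G. cscale (dotp Y v (rep_act V g w0)) (T (rep_act V g w0)))"
      by (intro sum.cong refl) (simp add: linear_on_scale[OF Tl] c inv_left v w0)
    finally show ?thesis .
  qed
  \<comment> \<open>T is unchanged by conjugation with an element of H, so the expansion holds for
    every h and may be summed.\<close>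
  have T2: "of_nat (card (carrier H)) * schur_scalar w0 w0 * dotp Y (T w) z = (\<Sum>g\<in>carrier G. \<Sum>h\<in>carrier H.
      dotp Y w (rep_act V (\<iota> h) (rep_act V g w0)) * dotp Y (rep_act V (\<iota> h) (T (rep_act V g w0))) z)"
    if w: "w \<in> rep_space V" and z: "z \<in> rep_space V" for w z
  proof -
    have "schur_scalar w0 w0 * dotp Y (T w) z = (\<Sum>g\<in>carrier G.
      dotp Y w (rep_act V (\<iota> h) (rep_act V g w0)) * dotp Y (rep_act V (\<iota> h) (T (rep_act V g w0))) z)"
      if h: "h \<in> carrier H" for h
    proof -
      let ?v = "rep_act V (inv\<^bsub>G\<^esub> (\<iota> h)) w" and ?z = "rep_act V (inv\<^bsub>G\<^esub> (\<iota> h)) z"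
      have v: "?v \<in> rep_space V" "?z \<in> rep_space V" using rep_closed[OF V] h w z by auto
      have "T w = rep_act V (\<iota> h) (T ?v)"
        using Th[OF h v(1)] rep_inv_act(2)[OF V iota_closed[OF h] w] by simp
      then have "dotp Y (T w) z = dotp Y (T ?v) ?z"
        using inv_left[OF iota_closed[OF h] z Tc[OF v(1)]] by (simp add: dotp_commute)
      then have "schur_scalar w0 w0 * dotp Y (T w) z = dotp Y (cscale (schur_scalar w0 w0) (T ?v)) ?z" by (simp add: dotp_scale)
      also have "\<dots> = (\<Sum>g\<in>carrier G. dotp Y ?v (rep_act V g w0) * dotp Y (T (rep_act V g w0)) ?z)"
        unfolding T1[OF v(1)] by (simp add: dotp_sum dotp_scale)
      also have "\<dots> = (\<Sum>g\<in>carrier G. dotp Y w (rep_act V (\<iota> h) (rep_act V g w0)) *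
          dotp Y (rep_act V (\<iota> h) (T (rep_act V g w0))) z)"
      proof (intro sum.cong refl arg_cong2[of _ _ _ _ "(*)"])
        fix g assume g: "g \<in> carrier G"
        show "dotp Y ?v (rep_act V g w0) = dotp Y w (rep_act V (\<iota> h) (rep_act V g w0))"
          by (rule inv_left[OF iota_closed[OF h] w c[OF g]])
        show "dotp Y (T (rep_act V g w0)) ?z = dotp Y (rep_act V (\<iota> h) (T (rep_act V g w0))) z"
          using inv_left[OF iota_closed[OF h] z Tc[OF c[OF g]]] by (simp add: dotp_commute)
      qed
      finally show ?thesis .
    qed
    then have "(\<Sum>h\<in>carrier H. schur_scalar w0 w0 * dotp Y (T w) z) = (\<Sum>h\<in>carrier H. \<Sum>g\<in>carrier G.
      dotp Y w (rep_act V (\<iota> h) (rep_act V g w0)) * dotp Y (rep_act V (\<iota> h) (T (rep_act V g w0))) z)"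
      by (rule sum.cong[OF refl])
    also have "\<dots> = (\<Sum>g\<in>carrier G. \<Sum>h\<in>carrier H.
      dotp Y w (rep_act V (\<iota> h) (rep_act V g w0)) * dotp Y (rep_act V (\<iota> h) (T (rep_act V g w0))) z)"
      by (rule sum.swap)
    finally show ?thesis by (simp add: mult.assoc)
  qed
  have "(\<Sum>g\<in>carrier G. \<Sum>h\<in>carrier H.
      dotp Y w (rep_act V (\<iota> h) (rep_act V g w0)) * dotp Y (rep_act V (\<iota> h) (T (rep_act V g w0))) z) =
    (\<Sum>g\<in>carrier G. \<Sum>h\<in>carrier H.
      dotp Y z (rep_act V (\<iota> h) (rep_act V g w0)) * dotp Y (rep_act V (\<iota> h) (T (rep_act V g w0))) w)"
    by (intro sum.cong refl averaged_symmetric) (use c Tc w z in auto)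
  then have "of_nat (card (carrier H)) * schur_scalar w0 w0 * dotp Y (T w) z = of_nat (card (carrier H)) * schur_scalar w0 w0 * dotp Y (T z) w"
    using T2[OF w z] T2[OF z w] by simp
  moreover have "card (carrier H) \<noteq> 0" using finH H.one_closed by auto
  ultimately show ?thesis using schur_scalar_nonzero by (simp add: dotp_commute)
qed

lemma multiplicity_one:
  assumes W: "representation H W"
    and schurW: "\<And>f. ghom H W W f \<Longrightarrow> \<exists>c. \<forall>v\<in>rep_space W. f v = cscale c v"
    and \<psi>1: "ghom H (res_rep \<iota> V) W \<psi>1" "\<psi>1 ` rep_space V = rep_space W"
    and \<psi>2: "ghom H (res_rep \<iota> V) W \<psi>2"
  shows "\<exists>c. \<forall>v\<in>rep_space V. \<psi>2 v = cscale c (\<psi>1 v)"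
proof -
  note rV = res_rep_representation[OF V H \<iota>]
  obtain s where s: "ghom H W (res_rep \<iota> V) s" "\<And>w. w \<in> rep_space W \<Longrightarrow> \<psi>1 (s w) = w"
    using ghom_section[OF rV W finH \<psi>1(1)] \<psi>1(2) by auto
  \<comment> \<open>The scalar is read off on the image of the section s, so that the difference
    \<psi> formed below vanishes there.\<close>
  obtain c where c: "\<And>v. v \<in> rep_space W \<Longrightarrow> \<psi>2 (s v) = cscale c v"
    using schurW[OF ghom_comp[OF s(1) \<psi>2]] by blast
  define \<psi> where "\<psi> = (\<lambda>v. \<psi>2 v - cscale c (\<psi>1 v))"
  have \<psi>: "ghom H (res_rep \<iota> V) W \<psi>"
    unfolding \<psi>_def by (rule ghom_diff[OF W \<psi>2 ghom_scale[OF W \<psi>1(1)]])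
  have sc: "s w \<in> rep_space V" if "w \<in> rep_space W" for w using ghom_closed[OF s(1) that] by simp
  have \<psi>s: "\<psi> (s w) = 0" if "w \<in> rep_space W" for w
    unfolding \<psi>_def using c s(2) that by simp
  have \<psi>c: "\<psi> v \<in> rep_space W" "\<psi>1 v \<in> rep_space W" if "v \<in> rep_space V" for v
    using ghom_closed[OF \<psi>] ghom_closed[OF \<psi>1(1)] that by auto
  have E: "ghom H (res_rep \<iota> V) (res_rep \<iota> V) (\<lambda>v. s (\<psi>1 v))" by (rule ghom_comp[OF \<psi>1(1) s(1)])
  have N: "ghom H (res_rep \<iota> V) (res_rep \<iota> V) (\<lambda>v. s (\<psi> v))" by (rule ghom_comp[OF \<psi> s(1)])
  have s0: "s 0 = 0" using linear_on_zero[OF ghom_linear[OF s(1)] rep_subspace[OF W]] .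
  have "\<psi> x = 0" if x: "x \<in> rep_space V" for x
  proof -
    \<comment> \<open>With E = s \<psi>1 and N = s \<psi>, moving E and then N across the form gives
      <N x, z> = <E N x, z> = <N x, E z> = <x, N E z> = 0.\<close>
    have "dotp Y (s (\<psi> x)) z = 0" if z: "z \<in> rep_space V" for z
    proof -
      have "dotp Y (s (\<psi> x)) z = dotp Y (s (\<psi>1 (s (\<psi> x)))) z" using s(2) \<psi>c x by simp
      also have "\<dots> = dotp Y (s (\<psi> x)) (s (\<psi>1 z))"
        by (rule endo_symmetric[OF E]) (use sc \<psi>c x z in auto)
      also have "\<dots> = dotp Y x (s (\<psi> (s (\<psi>1 z))))"
        by (rule endo_symmetric[OF N]) (use sc \<psi>c x z in auto)
      also have "\<dots> = 0" using \<psi>s \<psi>c z s0 by simp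
      finally show ?thesis .
    qed
    then have "s (\<psi> x) = 0" using nondeg sc \<psi>c x by blast
    then have "\<psi>1 0 = \<psi> x" using s(2)[OF \<psi>c(1)[OF x]] by simp
    then show ?thesis using linear_on_zero[OF ghom_linear[OF \<psi>1(1)]] rep_subspace[OF V] by simp
  qed
  then show ?thesis unfolding \<psi>_def by (metis eq_iff_diff_eq_0)
qed

end

end

section \<open>Combinatorics of tableaux and tabloids\<close>

definition tabloid_act :: "(nat \<Rightarrow> nat) \<Rightarrow> (nat \<Rightarrow> nat set) \<Rightarrow> nat \<Rightarrow> nat set"
  where "tabloid_act \<sigma> T = (\<lambda>i. \<sigma> ` T i)"

text \<open>Here r is an arbitrary assignment of rows, so the rows may have any lengths; the minimal
  assignment used later is sought among all of these.\<close>

definition row_tabloid :: "nat \<Rightarrow> (nat \<Rightarrow> nat) \<Rightarrow> nat \<Rightarrow> nat set"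
  where "row_tabloid N r = (\<lambda>i. {b \<in> {1..N}. r b = i})"

definition row_of :: "nat list \<Rightarrow> (nat \<times> nat \<Rightarrow> nat) \<Rightarrow> nat \<Rightarrow> nat"
  where "row_of \<alpha> t b = fst (inv_into (young_diagram \<alpha>) t b)"

definition col_of :: "nat list \<Rightarrow> (nat \<times> nat \<Rightarrow> nat) \<Rightarrow> nat \<Rightarrow> nat"
  where "col_of \<alpha> t b = snd (inv_into (young_diagram \<alpha>) t b)"

text \<open>The sum of the first k parts, as compared in the dominance order. Counting boxes gives
  it a meaning for k beyond the number of rows.\<close>

definition psum :: "nat list \<Rightarrow> nat \<Rightarrow> nat"
  where "psum \<alpha> k = card {p \<in> young_diagram \<alpha>. fst p < k}"

lemma tabloid_act_comp: "tabloid_act (\<sigma> \<circ> \<tau>) T = tabloid_act \<sigma> (tabloid_act \<tau> T)"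
  by (auto simp: tabloid_act_def image_comp)

lemma tabloid_act_id [simp]: "tabloid_act id T = T"
  by (simp add: tabloid_act_def)

lemma tabloid_act_inv:
  assumes "bij \<sigma>" shows "tabloid_act (inv' \<sigma>) (tabloid_act \<sigma> T) = T" "tabloid_act \<sigma> (tabloid_act (inv' \<sigma>) T) = T"
proof -
  have "inv' \<sigma> \<circ> \<sigma> = id" "\<sigma> \<circ> inv' \<sigma> = id"
    using assms by (auto simp: bij_is_inj surj_iff[symmetric] bij_is_surj)
  then show "tabloid_act (inv' \<sigma>) (tabloid_act \<sigma> T) = T" "tabloid_act \<sigma> (tabloid_act (inv' \<sigma>) T) = T"
    by (metis tabloid_act_comp tabloid_act_id)+
qed

lemma tabloid_act_row_tabloid:
  assumes "\<sigma> permutes {1..N}" shows "tabloid_act \<sigma> (row_tabloid N r) = row_tabloid N (r \<circ> inv' \<sigma>)"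
proof
  fix i
  have "b \<in> \<sigma> ` {b \<in> {1..N}. r b = i} \<longleftrightarrow> b \<in> {1..N} \<and> r (inv' \<sigma> b) = i" for b
    using permutes_in_image[OF assms] permutes_inverses[OF assms]
    by (smt (verit, ccfv_threshold) image_iff mem_Collect_eq)
  then show "tabloid_act \<sigma> (row_tabloid N r) i = row_tabloid N (r \<circ> inv' \<sigma>) i" by (auto simp: tabloid_act_def row_tabloid_def)
qed

lemma row_tabloid_eq_iff: "row_tabloid N r = row_tabloid N s \<longleftrightarrow> (\<forall>b\<in>{1..N}. r b = s b)"
proof
  assume e: "row_tabloid N r = row_tabloid N s"
  show "\<forall>b\<in>{1..N}. r b = s b"
  proof
    fix b assume "b \<in> {1..N}"
    then have "b \<in> row_tabloid N r (r b)" by (simp add: row_tabloid_def)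
    then show "r b = s b" unfolding e by (simp add: row_tabloid_def)
  qed
qed (auto simp: row_tabloid_def fun_eq_iff)

lemma young_diagram_Sigma: "young_diagram \<alpha> = (SIGMA i:{..<length \<alpha>}. {..<\<alpha> ! i})"
  by (auto simp: young_diagram_def)

lemma finite_young: "finite (young_diagram \<alpha>)"
  by (simp add: young_diagram_Sigma)

lemma card_young: "card (young_diagram \<alpha>) = sum_list \<alpha>"
  by (simp add: young_diagram_Sigma sum_list_sum_nth atLeast0LessThan)

lemma tableau_exists: obtains t where "tableau \<alpha> t"
  using finite_same_card_bij[OF finite_young, of "{1..sum_list \<alpha>}" \<alpha>] card_young
  unfolding tableau_def by auto

lemma
  assumes t: "tableau \<alpha> t"
  shows tableau_pos: "b \<in> {1..sum_list \<alpha>} \<Longrightarrow> (row_of \<alpha> t b, col_of \<alpha> t b) \<in> young_diagram \<alpha>"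
    and tableau_at_pos: "b \<in> {1..sum_list \<alpha>} \<Longrightarrow> t (row_of \<alpha> t b, col_of \<alpha> t b) = b"
    and tableau_in: "p \<in> young_diagram \<alpha> \<Longrightarrow> t p \<in> {1..sum_list \<alpha>}"
    and row_of_at: "p \<in> young_diagram \<alpha> \<Longrightarrow> row_of \<alpha> t (t p) = fst p"
    and col_of_at: "p \<in> young_diagram \<alpha> \<Longrightarrow> col_of \<alpha> t (t p) = snd p"
proof -
  have b: "bij_betw t (young_diagram \<alpha>) {1..sum_list \<alpha>}" using t by (simp add: tableau_def)
  show "b \<in> {1..sum_list \<alpha>} \<Longrightarrow> (row_of \<alpha> t b, col_of \<alpha> t b) \<in> young_diagram \<alpha>"
    "b \<in> {1..sum_list \<alpha>} \<Longrightarrow> t (row_of \<alpha> t b, col_of \<alpha> t b) = b"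
    using b by (auto simp: row_of_def col_of_def bij_betw_def inv_into_into f_inv_into_f)
  show "p \<in> young_diagram \<alpha> \<Longrightarrow> t p \<in> {1..sum_list \<alpha>}" using b bij_betwE by blast
  show "p \<in> young_diagram \<alpha> \<Longrightarrow> row_of \<alpha> t (t p) = fst p" "p \<in> young_diagram \<alpha> \<Longrightarrow> col_of \<alpha> t (t p) = snd p"
    using bij_betw_inv_into_left[OF b] by (simp_all add: row_of_def col_of_def)
qed

lemma tabloid_of_row_tabloid:
  assumes "tableau \<alpha> t" shows "tabloid_of \<alpha> t = row_tabloid (sum_list \<alpha>) (row_of \<alpha> t)"
proof
  fix i show "tabloid_of \<alpha> t i = row_tabloid (sum_list \<alpha>) (row_of \<alpha> t) i"
  proof (intro subset_antisym subsetI)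
    fix b assume "b \<in> tabloid_of \<alpha> t i"
    then show "b \<in> row_tabloid (sum_list \<alpha>) (row_of \<alpha> t) i"
      using tableau_in[OF assms] row_of_at[OF assms] by (fastforce simp: tabloid_of_def row_tabloid_def)
  next
    fix b assume "b \<in> row_tabloid (sum_list \<alpha>) (row_of \<alpha> t) i"
    then show "b \<in> tabloid_of \<alpha> t i"
      using tableau_pos[OF assms] tableau_at_pos[OF assms]
      by (force simp: tabloid_of_def row_tabloid_def intro!: image_eqI[of b t "(row_of \<alpha> t b, col_of \<alpha> t b)"])
  qed
qed

section \<open>Column stabilizers and relabelling of tableaux\<close>

lemma column_stabilizer_iff:
  assumes t: "tableau \<alpha> t"
  shows "\<pi> \<in> column_stabilizer \<alpha> t \<longleftrightarrow> \<pi> permutes {1..sum_list \<alpha>} \<and>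
    (\<forall>b\<in>{1..sum_list \<alpha>}. col_of \<alpha> t (\<pi> b) = col_of \<alpha> t b)"
proof -
  let ?N = "{1..sum_list \<alpha>}"
  define C where "C = (\<lambda>j. t ` {b \<in> young_diagram \<alpha>. snd b = j})"
  have C: "C j = {b \<in> ?N. col_of \<alpha> t b = j}" for j
  proof (intro subset_antisym subsetI)
    fix b assume "b \<in> C j"
    then show "b \<in> {b \<in> ?N. col_of \<alpha> t b = j}"
      using tableau_in[OF t] col_of_at[OF t] unfolding C_def by fastforce
  next
    fix b assume "b \<in> {b \<in> ?N. col_of \<alpha> t b = j}"
    then show "b \<in> C j"
      using tableau_pos[OF t] tableau_at_pos[OF t] unfolding C_def
      by (intro image_eqI[of b t "(row_of \<alpha> t b, col_of \<alpha> t b)"]) auto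
  qed
  have "(\<forall>j. \<pi> ` C j = C j) \<longleftrightarrow> (\<forall>b\<in>?N. col_of \<alpha> t (\<pi> b) = col_of \<alpha> t b)" if p: "\<pi> permutes ?N"
  proof
    assume e: "\<forall>j. \<pi> ` C j = C j"
    show "\<forall>b\<in>?N. col_of \<alpha> t (\<pi> b) = col_of \<alpha> t b"
    proof
      fix b assume "b \<in> ?N"
      then have "b \<in> C (col_of \<alpha> t b)" unfolding C by simp
      then have "\<pi> b \<in> C (col_of \<alpha> t b)" using e by blast
      then show "col_of \<alpha> t (\<pi> b) = col_of \<alpha> t b" unfolding C by simp
    qed
  next
    assume e: "\<forall>b\<in>?N. col_of \<alpha> t (\<pi> b) = col_of \<alpha> t b"
    show "\<forall>j. \<pi> ` C j = C j"
    proof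
      fix j
      have "\<pi> ` C j \<subseteq> C j" using e permutes_in_image[OF p] unfolding C by auto
      moreover have "finite (C j)" unfolding C by simp
      ultimately show "\<pi> ` C j = C j"
        using permutes_inj_on[OF p, of "C j"] by (simp add: endo_inj_surj)
    qed
  qed
  then show ?thesis unfolding column_stabilizer_def C_def by auto
qed

lemma
  assumes t: "tableau \<alpha> t"
  shows colstab_id: "id \<in> column_stabilizer \<alpha> t"
    and colstab_comp: "\<pi> \<in> column_stabilizer \<alpha> t \<Longrightarrow> \<rho> \<in> column_stabilizer \<alpha> t \<Longrightarrow> \<pi> \<circ> \<rho> \<in> column_stabilizer \<alpha> t"
    and colstab_inv: "\<pi> \<in> column_stabilizer \<alpha> t \<Longrightarrow> inv' \<pi> \<in> column_stabilizer \<alpha> t"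
    and colstab_perm: "\<pi> \<in> column_stabilizer \<alpha> t \<Longrightarrow> \<pi> permutes {1..sum_list \<alpha>}"
    and colstab_finite: "finite (column_stabilizer \<alpha> t)"
    and colstab_transpose: "a \<in> {1..sum_list \<alpha>} \<Longrightarrow> b \<in> {1..sum_list \<alpha>} \<Longrightarrow> col_of \<alpha> t a = col_of \<alpha> t b \<Longrightarrow>
      transpose a b \<in> column_stabilizer \<alpha> t"
proof -
  let ?N = "{1..sum_list \<alpha>}"
  note iff = column_stabilizer_iff[OF t]
  show "id \<in> column_stabilizer \<alpha> t" unfolding iff by (simp add: permutes_id)
  show "\<pi> \<circ> \<rho> \<in> column_stabilizer \<alpha> t" if "\<pi> \<in> column_stabilizer \<alpha> t" "\<rho> \<in> column_stabilizer \<alpha> t"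
  proof -
    have "\<rho> b \<in> ?N" if "b \<in> ?N" for b
      using permutes_in_image[of \<rho> ?N b] that \<open>\<rho> \<in> _\<close> unfolding iff by blast
    then show ?thesis using that permutes_compose[of \<rho> ?N \<pi>] unfolding iff by (auto simp del: atLeastAtMost_iff)
  qed
  show "inv' \<pi> \<in> column_stabilizer \<alpha> t" if "\<pi> \<in> column_stabilizer \<alpha> t"
  proof -
    have p: "\<pi> permutes ?N" using that unfolding iff by blast
    have "col_of \<alpha> t (inv' \<pi> b) = col_of \<alpha> t b" if b: "b \<in> ?N" for b
    proof -
      have "inv' \<pi> b \<in> ?N" using permutes_in_image[OF permutes_inv[OF p]] b by blast
      then have "col_of \<alpha> t (\<pi> (inv' \<pi> b)) = col_of \<alpha> t (inv' \<pi> b)" using \<open>\<pi> \<in> _\<close> unfolding iff by blast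
      then show ?thesis using permutes_inverses(1)[OF p] by simp
    qed
    then show ?thesis unfolding iff using permutes_inv[OF p] by blast
  qed
  show "\<pi> \<in> column_stabilizer \<alpha> t \<Longrightarrow> \<pi> permutes ?N" unfolding iff by blast
  show "finite (column_stabilizer \<alpha> t)"
    by (rule finite_subset[OF _ finite_permutations[of ?N]]) (auto simp: iff)
  show "a \<in> ?N \<Longrightarrow> b \<in> ?N \<Longrightarrow> col_of \<alpha> t a = col_of \<alpha> t b \<Longrightarrow> transpose a b \<in> column_stabilizer \<alpha> t"
    unfolding iff using permutes_swap_id[of a ?N b] by (auto simp: transpose_def)
qed

lemma
  assumes t: "tableau \<alpha> t" and g: "g permutes {1..sum_list \<alpha>}"
  shows tableau_comp: "tableau \<alpha> (g \<circ> t)"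
    and col_of_comp: "b \<in> {1..sum_list \<alpha>} \<Longrightarrow> col_of \<alpha> (g \<circ> t) (g b) = col_of \<alpha> t b"
    and row_of_comp: "b \<in> {1..sum_list \<alpha>} \<Longrightarrow> row_of \<alpha> (g \<circ> t) (g b) = row_of \<alpha> t b"
    and colstab_conj: "column_stabilizer \<alpha> (g \<circ> t) = (\<lambda>\<pi>. g \<circ> \<pi> \<circ> inv' g) ` column_stabilizer \<alpha> t"
proof -
  let ?N = "{1..sum_list \<alpha>}"
  show gt: "tableau \<alpha> (g \<circ> t)"
    using t permutes_imp_bij[OF g] unfolding tableau_def by (rule bij_betw_trans)
  show c: "col_of \<alpha> (g \<circ> t) (g b) = col_of \<alpha> t b" if "b \<in> ?N" for b
    using col_of_at[OF gt tableau_pos[OF t that]] tableau_at_pos[OF t that] by simp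
  show "row_of \<alpha> (g \<circ> t) (g b) = row_of \<alpha> t b" if "b \<in> ?N" for b
    using row_of_at[OF gt tableau_pos[OF t that]] tableau_at_pos[OF t that] by simp
  have gN: "g b \<in> ?N \<longleftrightarrow> b \<in> ?N" for b using permutes_in_image[OF g] .
  have gi: "inv' g b \<in> ?N \<longleftrightarrow> b \<in> ?N" for b using permutes_in_image[OF permutes_inv[OF g]] .
  have c': "col_of \<alpha> (g \<circ> t) b = col_of \<alpha> t (inv' g b)" if "b \<in> ?N" for b
    using c[of "inv' g b"] gi that permutes_inverses(1)[OF g] by simp
  have m: "g \<circ> \<pi> \<circ> inv' g \<in> column_stabilizer \<alpha> (g \<circ> t)" if p: "\<pi> \<in> column_stabilizer \<alpha> t" for \<pi>
  proof -
    have pp: "\<pi> permutes ?N" using p column_stabilizer_iff[OF t] by blast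
    have "g \<circ> \<pi> \<circ> inv' g permutes ?N" using permutes_compose pp g permutes_inv by metis
    moreover have "col_of \<alpha> (g \<circ> t) (g (\<pi> (inv' g b))) = col_of \<alpha> (g \<circ> t) b" if b: "b \<in> ?N" for b
    proof -
      have i: "inv' g b \<in> ?N" "\<pi> (inv' g b) \<in> ?N" using gi b permutes_in_image[OF pp] by blast+
      then have "col_of \<alpha> (g \<circ> t) (g (\<pi> (inv' g b))) = col_of \<alpha> t (\<pi> (inv' g b))" using c by blast
      also have "\<dots> = col_of \<alpha> t (inv' g b)" using p i column_stabilizer_iff[OF t] by blast
      finally show ?thesis using c'[OF b] by simp
    qed
    ultimately show ?thesis unfolding column_stabilizer_iff[OF gt] by simp
  qed
  show "column_stabilizer \<alpha> (g \<circ> t) = (\<lambda>\<pi>. g \<circ> \<pi> \<circ> inv' g) ` column_stabilizer \<alpha> t"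
  proof (intro subset_antisym subsetI)
    fix \<rho> assume r: "\<rho> \<in> column_stabilizer \<alpha> (g \<circ> t)"
    have rp: "\<rho> permutes ?N" using r column_stabilizer_iff[OF gt] by blast
    have "inv' g \<circ> \<rho> \<circ> g permutes ?N" using permutes_compose rp g permutes_inv by metis
    moreover have "col_of \<alpha> t (inv' g (\<rho> (g b))) = col_of \<alpha> t b" if b: "b \<in> ?N" for b
    proof -
      have i: "g b \<in> ?N" "\<rho> (g b) \<in> ?N" using gN b permutes_in_image[OF rp] by blast+
      have "col_of \<alpha> t (inv' g (\<rho> (g b))) = col_of \<alpha> (g \<circ> t) (\<rho> (g b))" using c'[OF i(2)] by simp
      also have "\<dots> = col_of \<alpha> (g \<circ> t) (g b)" using r i column_stabilizer_iff[OF gt] by blast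
      finally show ?thesis using c[OF b] by simp
    qed
    ultimately have "inv' g \<circ> \<rho> \<circ> g \<in> column_stabilizer \<alpha> t" unfolding column_stabilizer_iff[OF t] by simp
    moreover have "g \<circ> (inv' g \<circ> \<rho> \<circ> g) \<circ> inv' g = \<rho>"
      using permutes_inverses[OF g] by (simp add: fun_eq_iff)
    ultimately show "\<rho> \<in> (\<lambda>\<pi>. g \<circ> \<pi> \<circ> inv' g) ` column_stabilizer \<alpha> t" by (metis imageI)
  qed (use m in auto)
qed

lemma tableau_transitive:
  assumes "tableau \<alpha> t" "tableau \<alpha> t'"
  obtains g where "g permutes {1..sum_list \<alpha>}" "\<And>p. p \<in> young_diagram \<alpha> \<Longrightarrow> t' p = g (t p)"
proof -
  let ?N = "{1..sum_list \<alpha>}"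
  define g where "g = (\<lambda>b. if b \<in> ?N then t' (inv_into (young_diagram \<alpha>) t b) else b)"
  have "bij_betw (\<lambda>b. t' (inv_into (young_diagram \<alpha>) t b)) ?N ?N"
    using bij_betw_trans[OF bij_betw_inv_into] assms unfolding tableau_def comp_def by blast
  moreover have "bij_betw g ?N ?N \<longleftrightarrow> bij_betw (\<lambda>b. t' (inv_into (young_diagram \<alpha>) t b)) ?N ?N"
    by (rule bij_betw_cong) (simp add: g_def)
  ultimately have "bij_betw g ?N ?N" by simp
  then have "g permutes ?N" by (rule bij_imp_permutes) (auto simp: g_def)
  moreover have "t' p = g (t p)" if "p \<in> young_diagram \<alpha>" for p
    using that tableau_in[OF assms(1) that] assms(1)
    by (simp add: g_def tableau_def bij_betw_inv_into_left)
  ultimately show ?thesis using that by blast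
qed

text \<open>A tableau is a function on all pairs; its values outside the diagram must not matter
  when two tableaux are compared.\<close>

lemma tableau_cong:
  assumes "\<And>p. p \<in> young_diagram \<alpha> \<Longrightarrow> t p = t' p"
  shows "tabloid_of \<alpha> t = tabloid_of \<alpha> t'" "column_stabilizer \<alpha> t = column_stabilizer \<alpha> t'"
proof -
  have "t ` {b \<in> young_diagram \<alpha>. P b} = t' ` {b \<in> young_diagram \<alpha>. P b}" for P
    using assms by auto
  then show "tabloid_of \<alpha> t = tabloid_of \<alpha> t'" "column_stabilizer \<alpha> t = column_stabilizer \<alpha> t'"
    by (simp_all add: tabloid_of_def column_stabilizer_def)
qed

lemma psum_row_of:
  assumes t: "tableau \<alpha> t"
  shows "card {b \<in> {1..sum_list \<alpha>}. row_of \<alpha> t b < k} = psum \<alpha> k"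
proof -
  have "bij_betw t {p \<in> young_diagram \<alpha>. fst p < k} {b \<in> {1..sum_list \<alpha>}. row_of \<alpha> t b < k}"
  proof (rule bij_betw_imageI)
    show "inj_on t {p \<in> young_diagram \<alpha>. fst p < k}"
      using t unfolding tableau_def bij_betw_def by (auto intro: inj_on_subset)
    show "t ` {p \<in> young_diagram \<alpha>. fst p < k} = {b \<in> {1..sum_list \<alpha>}. row_of \<alpha> t b < k}"
    proof (intro subset_antisym subsetI)
      fix b assume "b \<in> t ` {p \<in> young_diagram \<alpha>. fst p < k}"
      then show "b \<in> {b \<in> {1..sum_list \<alpha>}. row_of \<alpha> t b < k}"
        using tableau_in[OF t] row_of_at[OF t] by fastforce
    next
      fix b assume "b \<in> {b \<in> {1..sum_list \<alpha>}. row_of \<alpha> t b < k}"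
      then show "b \<in> t ` {p \<in> young_diagram \<alpha>. fst p < k}"
        using tableau_pos[OF t] tableau_at_pos[OF t]
        by (intro image_eqI[of b t "(row_of \<alpha> t b, col_of \<alpha> t b)"]) auto
    qed
  qed
  then show ?thesis unfolding psum_def by (simp add: bij_betw_same_card)
qed

lemma down_closed_nat:
  assumes "finite A" "\<And>i j :: nat. i \<in> A \<Longrightarrow> j \<le> i \<Longrightarrow> j \<in> A"
  shows "A = {..<card A}"
proof -
  have ex: "\<exists>n. n \<notin> A" using assms(1) ex_new_if_finite infinite_UNIV_nat by blast
  define m where "m = (LEAST n. n \<notin> A)"
  have "m \<notin> A" unfolding m_def using LeastI_ex[OF ex] .
  then have "A = {..<m}"
    using assms(2) not_less_Least[of _ "\<lambda>n. n \<notin> A"] unfolding m_def[symmetric]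
    by (metis (no_types, lifting) lessThan_iff linorder_not_less subsetI subset_antisym)
  then show ?thesis by simp
qed

text \<open>
  Entries with equal \<open>s\<close> lie in different columns, so the column of length \<open>h\<close> contains at most
  \<open>min k h\<close> entries with \<open>s < k\<close>, just as many as it has boxes in the first \<open>k\<close> rows.
\<close>

lemma column_count:
  assumes \<alpha>: "is_partition \<alpha>" and t: "tableau \<alpha> t"
    and s: "\<forall>a\<in>{1..sum_list \<alpha>}. \<forall>b\<in>{1..sum_list \<alpha>}. a \<noteq> b \<longrightarrow> s a = s b \<longrightarrow>
      col_of \<alpha> t a \<noteq> col_of \<alpha> t b"
  shows "card {b \<in> {1..sum_list \<alpha>}. s b < k} \<le> psum \<alpha> k"
    and "(\<And>k. card {b \<in> {1..sum_list \<alpha>}. s b < k} = psum \<alpha> k) \<Longrightarrow> b \<in> {1..sum_list \<alpha>} \<Longrightarrow>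
      (s b, col_of \<alpha> t b) \<in> young_diagram \<alpha>"
proof -
  let ?N = "{1..sum_list \<alpha>}" and ?r = "row_of \<alpha> t" and ?c = "col_of \<alpha> t"
  define A where "A = (\<lambda>j. {b \<in> ?N. ?c b = j})"
  define h where "h = (\<lambda>j. card (A j))"
  have finA: "finite (A j)" for j by (simp add: A_def)
  have rinj: "inj_on ?r (A j)" for j
    unfolding A_def using tableau_at_pos[OF t] by (auto intro!: inj_onI) metis
  have rA: "?r ` A j = {i. (i, j) \<in> young_diagram \<alpha>}" for j
  proof (intro subset_antisym subsetI)
    fix i assume "i \<in> ?r ` A j" then show "i \<in> {i. (i, j) \<in> young_diagram \<alpha>}"
      using tableau_pos[OF t] unfolding A_def by auto
  next
    fix i assume "i \<in> {i. (i, j) \<in> young_diagram \<alpha>}"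
    then have "t (i, j) \<in> A j" "?r (t (i, j)) = i"
      using tableau_in[OF t] col_of_at[OF t] row_of_at[OF t] unfolding A_def by force+
    then show "i \<in> ?r ` A j" by force
  qed
  \<comment> \<open>Weakly decreasing row lengths make the rows that meet column j an initial
    segment, of length h j.\<close>
  have "?r ` A j = {..<card (?r ` A j)}" for j
  proof (rule down_closed_nat)
    fix i i' assume "i \<in> ?r ` A j" "i' \<le> i"
    moreover have "\<alpha> ! i \<le> \<alpha> ! i'" if "i < length \<alpha>"
      using \<alpha> \<open>i' \<le> i\<close> that unfolding is_partition_def
      by (cases "i' = i") (auto simp: sorted_wrt_iff_nth_less)
    ultimately show "i' \<in> ?r ` A j" unfolding rA young_diagram_def by auto
  qed (simp add: finA)
  then have r_h: "?r ` A j = {..<h j}" for j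
    by (simp add: h_def card_image[OF rinj])
  then have Y: "(i, j) \<in> young_diagram \<alpha> \<longleftrightarrow> i < h j" for i j
    using rA[of j] by auto
  have sinj: "inj_on s (A j)" for j
    unfolding A_def inj_on_def using s by (metis (mono_tags, lifting) mem_Collect_eq)
  define M where "M = (\<Union>b\<in>?N. {?c b})"
  have finM: "finite M" by (simp add: M_def)
  have split: "card {b \<in> ?N. f b < k} = (\<Sum>j\<in>M. card {b \<in> A j. f b < k})" for f :: "nat \<Rightarrow> nat" and k
  proof -
    have "{b \<in> ?N. f b < k} = (\<Union>j\<in>M. {b \<in> A j. f b < k})" by (auto simp: M_def A_def)
    also have "card \<dots> = (\<Sum>j\<in>M. card {b \<in> A j. f b < k})"
      by (rule card_UN_disjoint) (use finM in \<open>auto simp: A_def\<close>)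
    finally show ?thesis .
  qed
  have rc: "card {b \<in> A j. ?r b < k} = min k (h j)" for j k
  proof -
    have "?r ` {b \<in> A j. ?r b < k} = ?r ` A j \<inter> {..<k}" by auto
    also have "\<dots> = {..<min k (h j)}" unfolding r_h by auto
    finally have "?r ` {b \<in> A j. ?r b < k} = {..<min k (h j)}" .
    then show ?thesis using card_image[OF inj_on_subset[OF rinj, of "{b \<in> A j. ?r b < k}" j]] by simp
  qed
  have sc: "card {b \<in> A j. s b < k} \<le> min k (h j)" for j k
  proof -
    have "card (s ` {b \<in> A j. s b < k}) \<le> card {..<k}" by (intro card_mono) auto
    moreover have "card (s ` {b \<in> A j. s b < k}) = card {b \<in> A j. s b < k}"
      by (rule card_image[OF inj_on_subset[OF sinj]]) auto
    moreover have "card {b \<in> A j. s b < k} \<le> h j" unfolding h_def by (intro card_mono finA) auto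
    ultimately show ?thesis by simp
  qed
  have p: "psum \<alpha> k = (\<Sum>j\<in>M. min k (h j))" for k
    using psum_row_of[OF t, of k] split[of ?r k] by (simp add: rc)
  show "card {b \<in> ?N. s b < k} \<le> psum \<alpha> k"
    unfolding p split by (intro sum_mono sc)
  assume eq: "\<And>k. card {b \<in> ?N. s b < k} = psum \<alpha> k" and b: "b \<in> ?N"
  define j where "j = ?c b"
  have j: "j \<in> M" "b \<in> A j" using b by (auto simp: j_def M_def A_def)
  \<comment> \<open>Equal totals force equality in every column. Taking k to be the column length h
    j puts all values of s on this column below h j.\<close>
  have "card {b \<in> A j. s b < h j} = min (h j) (h j)"
    using sum_mono_inv[of "\<lambda>j'. card {b \<in> A j'. s b < h j}" M "\<lambda>j'. min (h j) (h j')" j] sc j(1) finM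
      eq[of "h j"] unfolding p split by blast
  then have "card {b \<in> A j. s b < h j} = card (A j)" by (simp add: h_def)
  then have "{b \<in> A j. s b < h j} = A j" by (intro card_subset_eq finA) auto
  then show "(s b, ?c b) \<in> young_diagram \<alpha>" using j Y j_def by blast
qed

text \<open>Move each entry b inside its column to the box in row s b. The box exists by
  \<open>column_count\<close>, and entries with equal s lie in different columns, so this is a
  permutation; its inverse carries the rows of t to those prescribed by s.\<close>

lemma column_permutation:
  assumes \<alpha>: "is_partition \<alpha>" and t: "tableau \<alpha> t"
    and s: "\<forall>a\<in>{1..sum_list \<alpha>}. \<forall>b\<in>{1..sum_list \<alpha>}. a \<noteq> b \<longrightarrow> s a = s b \<longrightarrow>
      col_of \<alpha> t a \<noteq> col_of \<alpha> t b"
    and eq: "\<And>k. card {b \<in> {1..sum_list \<alpha>}. s b < k} = psum \<alpha> k"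
  obtains \<pi> where "\<pi> \<in> column_stabilizer \<alpha> t" "row_tabloid (sum_list \<alpha>) s = tabloid_act \<pi> (tabloid_of \<alpha> t)"
proof -
  let ?N = "{1..sum_list \<alpha>}" and ?r = "row_of \<alpha> t" and ?c = "col_of \<alpha> t"
  note Y = column_count(2)[OF \<alpha> t s eq]
  define \<psi> where "\<psi> = (\<lambda>b. if b \<in> ?N then t (s b, ?c b) else b)"
  have rc: "?r (\<psi> b) = s b" "?c (\<psi> b) = ?c b" "\<psi> b \<in> ?N" if "b \<in> ?N" for b
    using that row_of_at[OF t Y[OF that]] col_of_at[OF t Y[OF that]] tableau_in[OF t Y[OF that]]
    by (simp_all add: \<psi>_def)
  have "inj_on \<psi> ?N"
  proof (rule inj_onI)
    fix a b assume ab: "a \<in> ?N" "b \<in> ?N" "\<psi> a = \<psi> b"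
    then have "s a = s b" "?c a = ?c b" using rc by metis+
    then show "a = b" using s ab by blast
  qed
  moreover have "\<psi> ` ?N \<subseteq> ?N" using rc(3) by blast
  ultimately have "bij_betw \<psi> ?N ?N" by (simp add: bij_betw_def endo_inj_surj)
  then have p: "\<psi> permutes ?N" by (rule bij_imp_permutes) (auto simp: \<psi>_def)
  have "\<psi> \<in> column_stabilizer \<alpha> t" unfolding column_stabilizer_iff[OF t] using p rc(2) by blast
  then have "inv' \<psi> \<in> column_stabilizer \<alpha> t" using colstab_inv[OF t] by blast
  moreover have "tabloid_act (inv' \<psi>) (tabloid_of \<alpha> t) = row_tabloid (sum_list \<alpha>) (?r \<circ> \<psi>)"
    unfolding tabloid_of_row_tabloid[OF t] tabloid_act_row_tabloid[OF permutes_inv[OF p]] using permutes_inv_inv[OF p] by simp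
  moreover have "row_tabloid (sum_list \<alpha>) (?r \<circ> \<psi>) = row_tabloid (sum_list \<alpha>) s"
    unfolding row_tabloid_eq_iff using rc(1) by simp
  ultimately show ?thesis using that by metis
qed

lemma psum_inj:
  assumes "is_partition \<alpha>" "is_partition \<beta>" "\<And>k. psum \<alpha> k = psum \<beta> k"
  shows "\<alpha> = \<beta>"
proof -
  define l where "l = (\<lambda>\<alpha> i. if i < length \<alpha> then \<alpha> ! i else (0 :: nat))"
  have l: "psum \<gamma> (Suc i) = psum \<gamma> i + l \<gamma> i" for \<gamma> i
  proof -
    have "{p \<in> young_diagram \<gamma>. fst p < Suc i} = {p \<in> young_diagram \<gamma>. fst p < i} \<union> {p \<in> young_diagram \<gamma>. fst p = i}"
      by auto
    moreover have "{p \<in> young_diagram \<gamma>. fst p = i} = Pair i ` {..<l \<gamma> i}"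
      by (auto simp: young_diagram_def l_def)
    moreover have "card (Pair i ` {..<l \<gamma> i}) = l \<gamma> i" by (simp add: card_image inj_on_def)
    moreover have "card ({p \<in> young_diagram \<gamma>. fst p < i} \<union> {p \<in> young_diagram \<gamma>. fst p = i}) =
        card {p \<in> young_diagram \<gamma>. fst p < i} + card {p \<in> young_diagram \<gamma>. fst p = i}"
      by (rule card_Un_disjoint) (auto simp: finite_young)
    ultimately show ?thesis unfolding psum_def by simp
  qed
  have e: "l \<alpha> i = l \<beta> i" for i using l[of \<alpha> i] l[of \<beta> i] assms(3) by simp
  have len: "i < length \<gamma> \<longleftrightarrow> l \<gamma> i \<noteq> 0" if "is_partition \<gamma>" for \<gamma> i
    using that nth_mem[of i \<gamma>] unfolding l_def is_partition_def by metis
  have "i < length \<alpha> \<longleftrightarrow> i < length \<beta>" for i using len assms(1,2) e by metis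
  then have "length \<alpha> = length \<beta>" by (metis linorder_neqE_nat order.irrefl)
  then show ?thesis using e by (intro nth_equalityI) (auto simp: l_def split: if_splits, metis)
qed

section \<open>Specht modules are irreducible and pairwise non-isomorphic\<close>

definition perm_act :: "(nat \<Rightarrow> nat) \<Rightarrow> ((nat \<Rightarrow> nat set) \<Rightarrow> complex) \<Rightarrow> (nat \<Rightarrow> nat set) \<Rightarrow> complex"
  where "perm_act \<sigma> v = (\<lambda>T. v (tabloid_act (inv' \<sigma>) T))"

definition delta :: "(nat \<Rightarrow> nat set) \<Rightarrow> (nat \<Rightarrow> nat set) \<Rightarrow> complex"
  where "delta T = (\<lambda>S. if S = T then 1 else 0)"

definition tabloids :: "nat list \<Rightarrow> (nat \<Rightarrow> nat set) set"
  where "tabloids \<alpha> = {tabloid_of \<alpha> t | t. tableau \<alpha> t}"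

text \<open>The permutation module on tabloids. It contains the Specht module and has the indicators
  of tabloids as a basis, on which the antisymmetrizers can be computed.\<close>

definition tabloid_rep :: "nat list \<Rightarrow> (nat \<Rightarrow> nat, nat \<Rightarrow> nat set) rep"
  where "tabloid_rep \<alpha> = \<lparr>rep_space = {u. \<forall>T. T \<notin> tabloids \<alpha> \<longrightarrow> u T = 0}, rep_act = perm_act\<rparr>"

text \<open>The signed column sum of Young's theory. The action a is a parameter because the same
  sum is applied in tabloid modules of another shape and in targets of homomorphisms.\<close>

definition column_antisym :: "((nat \<Rightarrow> nat) \<Rightarrow> ('x \<Rightarrow> complex) \<Rightarrow> 'x \<Rightarrow> complex) \<Rightarrow> nat list \<Rightarrow> (nat \<times> nat \<Rightarrow> nat) \<Rightarrow>
    ('x \<Rightarrow> complex) \<Rightarrow> 'x \<Rightarrow> complex"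
  where "column_antisym a \<alpha> t v = (\<Sum>\<pi>\<in>column_stabilizer \<alpha> t. cscale (of_int (sign \<pi>)) (a \<pi> v))"

lemma specht_act: "rep_act (specht \<alpha>) = perm_act"
  by (simp add: specht_def perm_act_def tabloid_act_def fun_eq_iff)

lemma specht_space: "rep_space (specht \<alpha>) = cfun.span {polytabloid \<alpha> t | t. tableau \<alpha> t}"
  by (simp add: specht_def)

lemma perm_act_linear: "linear_on V (perm_act \<sigma>)"
  by (simp add: linear_on_def perm_act_def pointwise)

lemma perm_act_comp: "bij \<sigma> \<Longrightarrow> bij \<tau> \<Longrightarrow> perm_act (\<sigma> \<circ> \<tau>) v = perm_act \<sigma> (perm_act \<tau> v)"
  by (simp add: perm_act_def o_inv_distrib tabloid_act_comp)

lemma perm_act_id [simp]: "perm_act id v = v"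
  by (simp add: perm_act_def inv_id)

lemma perm_act_delta:
  assumes "bij \<sigma>" shows "perm_act \<sigma> (delta T) = delta (tabloid_act \<sigma> T)"
proof -
  have "tabloid_act (inv' \<sigma>) S = T \<longleftrightarrow> S = tabloid_act \<sigma> T" for S
    using tabloid_act_inv(1)[OF assms, of T] tabloid_act_inv(2)[OF assms, of S] by auto
  then show ?thesis by (simp add: perm_act_def delta_def)
qed

lemma tabloid_of_comp: "tabloid_of \<alpha> (g \<circ> t) = tabloid_act g (tabloid_of \<alpha> t)"
  by (simp add: tabloid_of_def tabloid_act_def image_comp)

lemma tabloids_tabloid_act:
  assumes "g permutes {1..sum_list \<alpha>}"
  shows "T \<in> tabloids \<alpha> \<Longrightarrow> tabloid_act g T \<in> tabloids \<alpha>"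
  unfolding tabloids_def using tableau_comp[OF _ assms] tabloid_of_comp[of \<alpha> g, symmetric] by blast

lemma tabloids_tabloid_act_iff:
  assumes "g permutes {1..sum_list \<alpha>}"
  shows "tabloid_act g T \<in> tabloids \<alpha> \<longleftrightarrow> T \<in> tabloids \<alpha>"
  using tabloids_tabloid_act[OF assms] tabloids_tabloid_act[OF permutes_inv[OF assms]] tabloid_act_inv(1)[OF permutes_bij[OF assms]]
  by metis

text \<open>A tabloid is determined by the restriction of its row function to the entries, which
  takes finitely many values.\<close>

lemma finite_tabloids: "finite (tabloids \<alpha>)"
proof (rule finite_subset)
  let ?N = "{1..sum_list \<alpha>}"
  show "tabloids \<alpha> \<subseteq> row_tabloid (sum_list \<alpha>) ` (\<Pi>\<^sub>E b\<in>?N. {..<length \<alpha>})"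
  proof
    fix T assume "T \<in> tabloids \<alpha>"
    then obtain t where t: "tableau \<alpha> t" "T = tabloid_of \<alpha> t" unfolding tabloids_def by blast
    have "T = row_tabloid (sum_list \<alpha>) (restrict (row_of \<alpha> t) ?N)"
      unfolding t(2) tabloid_of_row_tabloid[OF t(1)] row_tabloid_eq_iff by simp
    moreover have "restrict (row_of \<alpha> t) ?N \<in> (\<Pi>\<^sub>E b\<in>?N. {..<length \<alpha>})"
      using tableau_pos[OF t(1)] by (auto simp: young_diagram_def)
    ultimately show "T \<in> row_tabloid (sum_list \<alpha>) ` (\<Pi>\<^sub>E b\<in>?N. {..<length \<alpha>})" by blast
  qed
qed (simp add: finite_PiE)

lemma perm_act_tabloid_rep:
  assumes "g permutes {1..sum_list \<alpha>}" "u \<in> rep_space (tabloid_rep \<alpha>)"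
  shows "perm_act g u \<in> rep_space (tabloid_rep \<alpha>)"
  using assms tabloids_tabloid_act_iff[OF permutes_inv[OF assms(1)]] by (simp add: tabloid_rep_def perm_act_def)

lemma tabloid_rep_expand:
  assumes "u \<in> rep_space (tabloid_rep \<alpha>)" shows "u = (\<Sum>T\<in>tabloids \<alpha>. cscale (u T) (delta T))"
proof
  fix S
  show "u S = (\<Sum>T\<in>tabloids \<alpha>. cscale (u T) (delta T)) S"
    using assms finite_tabloids[of \<alpha>]
    by (simp add: tabloid_rep_def delta_def cfun_sum_apply cscale_def if_distrib cong: if_cong)
qed

lemma tabloid_rep_rep: "representation (sym_group (sum_list \<alpha>)) (tabloid_rep \<alpha>)"
  unfolding representation_iff
proof (intro conjI ballI)
  show "group (sym_group (sum_list \<alpha>))" by (rule sym_group_is_group)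
  show "cfun.subspace (rep_space (tabloid_rep \<alpha>))" by (rule cfun.subspaceI) (auto simp: tabloid_rep_def pointwise)
  have "u \<in> cfun.span (delta ` tabloids \<alpha>)" if "u \<in> rep_space (tabloid_rep \<alpha>)" for u
    by (subst tabloid_rep_expand[OF that]) (intro cfun.span_sum cfun.span_scale cfun.span_base imageI)
  then show "findim (rep_space (tabloid_rep \<alpha>))"
    unfolding findim_def using finite_tabloids by (intro exI[of _ "delta ` tabloids \<alpha>"]) auto
next
  fix g v assume "g \<in> carrier (sym_group (sum_list \<alpha>))" "v \<in> rep_space (tabloid_rep \<alpha>)"
  then show "rep_act (tabloid_rep \<alpha>) g v \<in> rep_space (tabloid_rep \<alpha>)"
    using perm_act_tabloid_rep by (simp add: sym_group_carrier tabloid_rep_def)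
qed (auto simp: tabloid_rep_def perm_act_linear sym_group_one sym_group_mult sym_group_carrier perm_act_comp permutes_bij)

lemma dotp_perm_act:
  assumes "g permutes {1..sum_list \<alpha>}"
  shows "dotp (tabloids \<alpha>) (perm_act g u) (perm_act g v) = dotp (tabloids \<alpha>) u v"
proof -
  have b: "bij g" using permutes_bij[OF assms] .
  show ?thesis
    unfolding dotp_def perm_act_def
    by (rule sum.reindex_bij_witness[of _ "tabloid_act g" "tabloid_act (inv' g)"])
      (use tabloids_tabloid_act_iff[OF assms] tabloids_tabloid_act_iff[OF permutes_inv[OF assms]] tabloid_act_inv[OF b] in auto)
qed

lemma polytabloid_column_antisym: "polytabloid \<alpha> t = column_antisym perm_act \<alpha> t (delta (tabloid_of \<alpha> t))"
proof
  fix T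
  have "column_antisym perm_act \<alpha> t (delta (tabloid_of \<alpha> t)) T =
      (\<Sum>\<pi>\<in>column_stabilizer \<alpha> t. of_int (sign \<pi>) * perm_act \<pi> (delta (tabloid_of \<alpha> t)) T)"
    by (simp add: column_antisym_def pointwise)
  also have "\<dots> = polytabloid \<alpha> t T"
    unfolding polytabloid_def
  proof (intro sum.cong refl)
    fix \<pi> assume "\<pi> \<in> column_stabilizer \<alpha> t"
    then have "bij \<pi>" using permutes_bij by (auto simp: column_stabilizer_def)
    then show "of_int (sign \<pi>) * perm_act \<pi> (delta (tabloid_of \<alpha> t)) T =
        of_int (sign \<pi>) * (if T = tabloid_of \<alpha> (\<pi> \<circ> t) then 1 else 0)"
      by (simp add: perm_act_delta tabloid_of_comp, simp add: delta_def)
  qed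
  finally show "polytabloid \<alpha> t T = column_antisym perm_act \<alpha> t (delta (tabloid_of \<alpha> t)) T" ..
qed

section \<open>Column antisymmetrizers in an arbitrary representation\<close>

context
  fixes K :: "(nat \<Rightarrow> nat, 'x) rep" and \<alpha> t
  assumes K: "representation (sym_group (sum_list \<alpha>)) K" and t: "tableau \<alpha> t"
begin

private abbreviation "C \<equiv> column_stabilizer \<alpha> t"

lemma colstab_carrier: "\<pi> \<in> C \<Longrightarrow> \<pi> \<in> carrier (sym_group (sum_list \<alpha>))"
  using colstab_perm[OF t] by (simp add: sym_group_carrier)

lemma act_comp:
  "g permutes {1..sum_list \<alpha>} \<Longrightarrow> h permutes {1..sum_list \<alpha>} \<Longrightarrow> v \<in> rep_space K \<Longrightarrow>
    rep_act K (g \<circ> h) v = rep_act K g (rep_act K h v)"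
  using rep_mult[OF K] by (simp add: sym_group_carrier sym_group_mult)

lemma act_closed: "g permutes {1..sum_list \<alpha>} \<Longrightarrow> v \<in> rep_space K \<Longrightarrow> rep_act K g v \<in> rep_space K"
  using rep_closed[OF K] by (simp add: sym_group_carrier)

lemma column_antisym_summand:
  "\<pi> \<in> C \<Longrightarrow> v \<in> rep_space K \<Longrightarrow> cscale (of_int (sign \<pi>)) (rep_act K \<pi> v) \<in> rep_space K"
  using rep_closed[OF K colstab_carrier] cfun.subspace_scale[OF rep_subspace[OF K]] by blast

lemma column_antisym_closed: "v \<in> rep_space K \<Longrightarrow> column_antisym (rep_act K) \<alpha> t v \<in> rep_space K"
  unfolding column_antisym_def by (intro cfun.subspace_sum[OF rep_subspace[OF K]] column_antisym_summand)

lemma column_antisym_linear: "linear_on (rep_space K) (column_antisym (rep_act K) \<alpha> t)"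
  unfolding linear_on_def column_antisym_def
  using linear_on_add[OF rep_linear[OF K colstab_carrier]] linear_on_scale[OF rep_linear[OF K colstab_carrier]]
  by (simp add: cscale_sum sum.distrib cfun.scale_right_distrib mult.commute)

lemma column_antisym_act:
  assumes "\<sigma> \<in> C" "v \<in> rep_space K"
  shows "column_antisym (rep_act K) \<alpha> t (rep_act K \<sigma> v) = cscale (of_int (sign \<sigma>)) (column_antisym (rep_act K) \<alpha> t v)"
proof -
  have p: "\<pi> permutes {1..sum_list \<alpha>}" if "\<pi> \<in> C" for \<pi> using colstab_perm[OF t that] .
  have perm: "permutation \<pi>" if "\<pi> \<in> C" for \<pi> using p[OF that] permutation_permutes by blast
  have "column_antisym (rep_act K) \<alpha> t (rep_act K \<sigma> v) =
      (\<Sum>\<pi>\<in>C. cscale (of_int (sign \<sigma>)) (cscale (of_int (sign (\<pi> \<circ> \<sigma>))) (rep_act K (\<pi> \<circ> \<sigma>) v)))"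
    unfolding column_antisym_def
  proof (intro sum.cong refl)
    fix \<pi> assume \<pi>: "\<pi> \<in> C"
    have "of_int (sign \<sigma>) * of_int (sign (\<pi> \<circ> \<sigma>)) = (of_int (sign \<pi>) :: complex)"
      using sign_compose[OF perm[OF \<pi>] perm[OF assms(1)]]
      by (metis (no_types, lifting) mult.commute of_int_mult sign_left_idempotent)
    then show "cscale (of_int (sign \<pi>)) (rep_act K \<pi> (rep_act K \<sigma> v)) =
        cscale (of_int (sign \<sigma>)) (cscale (of_int (sign (\<pi> \<circ> \<sigma>))) (rep_act K (\<pi> \<circ> \<sigma>) v))"
      using act_comp[OF p[OF \<pi>] p[OF assms(1)] assms(2)] by simp
  qed
  also have "\<dots> = cscale (of_int (sign \<sigma>)) (\<Sum>\<pi>\<in>C. cscale (of_int (sign (\<pi> \<circ> \<sigma>))) (rep_act K (\<pi> \<circ> \<sigma>) v))"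
    by (rule cscale_sum[symmetric])
  also have "(\<Sum>\<pi>\<in>C. cscale (of_int (sign (\<pi> \<circ> \<sigma>))) (rep_act K (\<pi> \<circ> \<sigma>) v)) = column_antisym (rep_act K) \<alpha> t v"
    unfolding column_antisym_def
  proof (rule sum.reindex_bij_witness[of _ "\<lambda>\<pi>. \<pi> \<circ> inv' \<sigma>" "\<lambda>\<pi>. \<pi> \<circ> \<sigma>"])
    fix \<pi> assume "\<pi> \<in> C"
    then show "\<pi> \<circ> inv' \<sigma> \<in> C" "\<pi> \<circ> \<sigma> \<in> C"
      using assms(1) colstab_comp[OF t] colstab_inv[OF t] by blast+
  qed (simp_all add: comp_assoc permutes_inv_o[OF p[OF assms(1)]])
  finally show ?thesis .
qed

text \<open>The antisymmetrizer absorbs each signed column permutation and so is |C| times an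
  idempotent. Polytabloids and their images under homomorphisms are therefore eigenvectors for
  |C|.\<close>

lemma column_antisym_column_antisym:
  assumes v: "v \<in> rep_space K"
  shows "column_antisym (rep_act K) \<alpha> t (column_antisym (rep_act K) \<alpha> t v) = cscale (of_nat (card C)) (column_antisym (rep_act K) \<alpha> t v)"
proof -
  let ?k = "column_antisym (rep_act K) \<alpha> t"
  have "?k (?k v) = (\<Sum>\<pi>\<in>C. ?k (cscale (of_int (sign \<pi>)) (rep_act K \<pi> v)))"
    unfolding column_antisym_def[of _ _ _ v]
    by (rule linear_on_sum[OF column_antisym_linear rep_subspace[OF K]]) (use column_antisym_summand v in auto)
  also have "\<dots> = (\<Sum>\<pi>\<in>C. ?k v)"
  proof (intro sum.cong refl)
    fix \<pi> assume \<pi>: "\<pi> \<in> C"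
    have "of_int (sign \<pi>) * of_int (sign \<pi>) = (1 :: complex)"
      by (metis of_int_1 of_int_mult sign_idempotent)
    then show "?k (cscale (of_int (sign \<pi>)) (rep_act K \<pi> v)) = ?k v"
      using linear_on_scale[OF column_antisym_linear rep_closed[OF K colstab_carrier[OF \<pi>] v]] column_antisym_act[OF \<pi> v] by simp
  qed
  also have "\<dots> = cscale (of_nat (card C)) (?k v)" by (simp add: pointwise)
  finally show ?thesis .
qed

lemma colstab_card: "of_nat (card C) \<noteq> (0 :: complex)"
  using colstab_id[OF t] colstab_finite[OF t] by auto

lemma column_antisym_ghom:
  assumes f: "ghom (sym_group (sum_list \<alpha>)) K Q f" and v: "v \<in> rep_space K"
  shows "f (column_antisym (rep_act K) \<alpha> t v) = column_antisym (rep_act Q) \<alpha> t (f v)"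
proof -
  have "f (column_antisym (rep_act K) \<alpha> t v) = (\<Sum>\<pi>\<in>C. f (cscale (of_int (sign \<pi>)) (rep_act K \<pi> v)))"
    unfolding column_antisym_def
    by (rule linear_on_sum[OF ghom_linear[OF f] rep_subspace[OF K]]) (use column_antisym_summand v in auto)
  also have "\<dots> = column_antisym (rep_act Q) \<alpha> t (f v)"
    unfolding column_antisym_def
    by (intro sum.cong refl)
      (simp add: linear_on_scale[OF ghom_linear[OF f]] rep_closed[OF K colstab_carrier] v
        ghom_act[OF f colstab_carrier])
  finally show ?thesis .
qed

text \<open>The transposition of a and b is an odd column permutation that fixes v, so the
  antisymmetrized vector equals its own negative.\<close>

lemma column_antisym_zero:
  assumes v: "v \<in> rep_space K" and ab: "a \<in> {1..sum_list \<alpha>}" "b \<in> {1..sum_list \<alpha>}" "a \<noteq> b"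
    and c: "col_of \<alpha> t a = col_of \<alpha> t b" and fx: "rep_act K (transpose a b) v = v"
  shows "column_antisym (rep_act K) \<alpha> t v = 0"
proof -
  have "column_antisym (rep_act K) \<alpha> t v = cscale (- 1) (column_antisym (rep_act K) \<alpha> t v)"
    using column_antisym_act[OF colstab_transpose[OF t ab(1,2) c] v] fx ab(3) by (simp add: sign_swap_id)
  then show ?thesis by (simp add: pointwise)
qed

lemma column_antisym_translate:
  assumes g: "g permutes {1..sum_list \<alpha>}" and v: "v \<in> rep_space K"
  shows "rep_act K g (column_antisym (rep_act K) \<alpha> t v) = column_antisym (rep_act K) \<alpha> (g \<circ> t) (rep_act K g v)"
proof -
  have gc: "g \<in> carrier (sym_group (sum_list \<alpha>))" using g by (simp add: sym_group_carrier)
  have p: "\<pi> permutes {1..sum_list \<alpha>}" if "\<pi> \<in> C" for \<pi> using colstab_perm[OF t that] .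
  have "rep_act K g (column_antisym (rep_act K) \<alpha> t v) = (\<Sum>\<pi>\<in>C. rep_act K g (cscale (of_int (sign \<pi>)) (rep_act K \<pi> v)))"
    unfolding column_antisym_def
    by (rule linear_on_sum[OF rep_linear[OF K gc] rep_subspace[OF K]]) (use column_antisym_summand v in auto)
  also have "\<dots> = (\<Sum>\<pi>\<in>C. cscale (of_int (sign (g \<circ> \<pi> \<circ> inv' g))) (rep_act K (g \<circ> \<pi> \<circ> inv' g) (rep_act K g v)))"
  proof (intro sum.cong refl)
    fix \<pi> assume \<pi>: "\<pi> \<in> C"
    have gi: "inv' g permutes {1..sum_list \<alpha>}" using permutes_inv[OF g] .
    have perm: "permutation g" "permutation \<pi>" "permutation (inv' g)" "permutation (g \<circ> \<pi>)"
      using g p[OF \<pi>] gi permutes_compose permutation_permutes by blast+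
    have "sign (g \<circ> \<pi> \<circ> inv' g) = sign \<pi>"
      using sign_compose[OF perm(4,3)] sign_compose[OF perm(1,2)] sign_inverse[OF perm(1)] by simp
    moreover have "rep_act K (g \<circ> \<pi> \<circ> inv' g) (rep_act K g v) = rep_act K g (rep_act K \<pi> v)"
    proof -
      have "rep_act K (g \<circ> \<pi> \<circ> inv' g) (rep_act K g v) = rep_act K (g \<circ> \<pi> \<circ> inv' g \<circ> g) v"
        using act_comp[OF permutes_compose[OF gi permutes_compose[OF p[OF \<pi>] g]] g v] by simp
      also have "g \<circ> \<pi> \<circ> inv' g \<circ> g = g \<circ> \<pi>" using permutes_inv_o[OF g] by (simp add: comp_assoc)
      also have "rep_act K (g \<circ> \<pi>) v = rep_act K g (rep_act K \<pi> v)" by (rule act_comp[OF g p[OF \<pi>] v])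
      finally show ?thesis .
    qed
    ultimately show "rep_act K g (cscale (of_int (sign \<pi>)) (rep_act K \<pi> v)) =
        cscale (of_int (sign (g \<circ> \<pi> \<circ> inv' g))) (rep_act K (g \<circ> \<pi> \<circ> inv' g) (rep_act K g v))"
      using linear_on_scale[OF rep_linear[OF K gc] act_closed[OF p[OF \<pi>] v]] by simp
  qed
  also have "\<dots> = column_antisym (rep_act K) \<alpha> (g \<circ> t) (rep_act K g v)"
  proof -
    have "inj_on (\<lambda>\<pi>. g \<circ> \<pi> \<circ> inv' g) C"
    proof (rule inj_onI)
      fix \<pi> \<rho> assume "g \<circ> \<pi> \<circ> inv' g = g \<circ> \<rho> \<circ> inv' g"
      then have "inv' g \<circ> (g \<circ> \<pi> \<circ> inv' g) \<circ> g = inv' g \<circ> (g \<circ> \<rho> \<circ> inv' g) \<circ> g" by simp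
      then show "\<pi> = \<rho>" using permutes_inverses[OF g] by (simp add: fun_eq_iff)
    qed
    then show ?thesis unfolding column_antisym_def colstab_conj[OF t g] by (simp add: sum.reindex)
  qed
  finally show ?thesis .
qed

end

section \<open>Specht modules inside the tabloid modules\<close>

lemma tabloid_rep_act [simp]: "rep_act (tabloid_rep \<alpha>) = perm_act"
  by (simp add: tabloid_rep_def)

lemma delta_tabloid_rep: "T \<in> tabloids \<alpha> \<Longrightarrow> delta T \<in> rep_space (tabloid_rep \<alpha>)"
  by (auto simp: tabloid_rep_def delta_def)

lemma tabloid_in: "tableau \<alpha> t \<Longrightarrow> tabloid_of \<alpha> t \<in> tabloids \<alpha>"
  by (auto simp: tabloids_def)

lemma polytabloid_tabloid_rep: "tableau \<alpha> t \<Longrightarrow> polytabloid \<alpha> t \<in> rep_space (tabloid_rep \<alpha>)"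
  unfolding polytabloid_column_antisym
  using column_antisym_closed[OF tabloid_rep_rep, of \<alpha> t "delta (tabloid_of \<alpha> t)"] delta_tabloid_rep tabloid_in by simp

lemma specht_tabloid_rep: "rep_space (specht \<alpha>) \<subseteq> rep_space (tabloid_rep \<alpha>)"
  unfolding specht_space
  by (rule cfun.span_minimal) (use polytabloid_tabloid_rep rep_subspace[OF tabloid_rep_rep] in auto)

lemma polytabloid_specht: "tableau \<alpha> t \<Longrightarrow> polytabloid \<alpha> t \<in> rep_space (specht \<alpha>)"
  unfolding specht_space by (rule cfun.span_base) blast

lemma perm_act_polytabloid:
  assumes "tableau \<alpha> t" "g permutes {1..sum_list \<alpha>}"
  shows "perm_act g (polytabloid \<alpha> t) = polytabloid \<alpha> (g \<circ> t)"
  using column_antisym_translate[OF tabloid_rep_rep assms(1,2) delta_tabloid_rep[OF tabloid_in[OF assms(1)]]]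
    perm_act_delta[OF permutes_bij[OF assms(2)]]
  by (simp add: polytabloid_column_antisym tabloid_of_comp)

lemma specht_rep: "representation (sym_group (sum_list \<alpha>)) (specht \<alpha>)"
  unfolding representation_iff specht_act
proof (intro conjI ballI)
  show "cfun.subspace (rep_space (specht \<alpha>))" by (simp add: specht_space)
  show "findim (rep_space (specht \<alpha>))" using findim_subset[OF rep_findim[OF tabloid_rep_rep] specht_tabloid_rep] .
next
  fix g v assume "g \<in> carrier (sym_group (sum_list \<alpha>))" and v: "v \<in> rep_space (specht \<alpha>)"
  then have g: "g permutes {1..sum_list \<alpha>}" by (simp add: sym_group_carrier)
  show "perm_act g v \<in> rep_space (specht \<alpha>)"
    using v unfolding specht_space
  proof (induction rule: span_induct_member)
    case zero
    have "perm_act g 0 = 0" by (simp add: perm_act_def pointwise)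
    then show ?case using cfun.span_zero by simp
  next
    case (step c x y)
    then obtain t where t: "tableau \<alpha> t" "x = polytabloid \<alpha> t" by blast
    have "perm_act g x \<in> cfun.span {polytabloid \<alpha> t |t. tableau \<alpha> t}"
      unfolding t(2) perm_act_polytabloid[OF t(1) g] using tableau_comp[OF t(1) g] by (intro cfun.span_base) blast
    moreover have "perm_act g (cscale c x + y) = cscale c (perm_act g x) + perm_act g y"
      by (simp add: perm_act_def pointwise)
    ultimately show ?case using step by (simp add: cfun.span_add cfun.span_scale)
  qed
qed (auto simp: sym_group_is_group perm_act_linear sym_group_one sym_group_mult sym_group_carrier perm_act_comp permutes_bij)

lemma polytabloid_transitive:
  assumes "tableau \<alpha> t" "tableau \<alpha> t'"
  obtains g where "g permutes {1..sum_list \<alpha>}" "polytabloid \<alpha> t' = perm_act g (polytabloid \<alpha> t)"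
proof -
  obtain g where g: "g permutes {1..sum_list \<alpha>}" "\<And>p. p \<in> young_diagram \<alpha> \<Longrightarrow> t' p = g (t p)"
    using tableau_transitive[OF assms] by blast
  have "polytabloid \<alpha> t' = polytabloid \<alpha> (g \<circ> t)"
    using tableau_cong[of \<alpha> t' "g \<circ> t"] g(2) by (simp add: polytabloid_column_antisym column_antisym_def)
  then show ?thesis using that[OF g(1)] perm_act_polytabloid[OF assms(1) g(1)] by simp
qed

text \<open>Two entries sharing a row of T and a column of t would be exchanged by a transposition
  that fixes T, and the antisymmetrizer would kill T.\<close>

lemma column_antisym_delta_nonzero:
  assumes t: "tableau \<alpha> t" and T: "T = row_tabloid (sum_list \<alpha>) s" and K: "representation (sym_group (sum_list \<alpha>)) K"
    and act: "rep_act K = perm_act" and m: "delta T \<in> rep_space K" and nz: "column_antisym perm_act \<alpha> t (delta T) \<noteq> 0"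
  shows "\<forall>a\<in>{1..sum_list \<alpha>}. \<forall>b\<in>{1..sum_list \<alpha>}. a \<noteq> b \<longrightarrow> s a = s b \<longrightarrow> col_of \<alpha> t a \<noteq> col_of \<alpha> t b"
proof (intro ballI impI notI)
  fix a b assume ab: "a \<in> {1..sum_list \<alpha>}" "b \<in> {1..sum_list \<alpha>}" "a \<noteq> b" "s a = s b" "col_of \<alpha> t a = col_of \<alpha> t b"
  have p: "transpose a b permutes {1..sum_list \<alpha>}" using ab by (intro permutes_swap_id)
  have "s \<circ> inv' (transpose a b) = s" using ab(4) by (auto simp: transpose_def fun_eq_iff)
  then have "perm_act (transpose a b) (delta T) = delta T"
    using perm_act_delta[OF permutes_bij[OF p]] tabloid_act_row_tabloid[OF p, of s] T by simp
  then have "column_antisym perm_act \<alpha> t (delta T) = 0"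
    using column_antisym_zero[OF K t m ab(1-3,5)] act by simp
  then show False using nz by simp
qed

lemma tabloid_rows:
  assumes "T \<in> tabloids \<beta>"
  obtains s where "T = row_tabloid (sum_list \<beta>) s" "\<And>k. card {b \<in> {1..sum_list \<beta>}. s b < k} = psum \<beta> k"
  using assms tabloid_of_row_tabloid psum_row_of unfolding tabloids_def by blast

lemma column_antisym_tabloid_rep_sum:
  assumes t: "tableau \<alpha> t" and u: "u \<in> rep_space (tabloid_rep \<beta>)" and N: "sum_list \<beta> = sum_list \<alpha>"
  shows "column_antisym perm_act \<alpha> t u = (\<Sum>T\<in>tabloids \<beta>. cscale (u T) (column_antisym perm_act \<alpha> t (delta T)))"
proof -
  have K: "representation (sym_group (sum_list \<alpha>)) (tabloid_rep \<beta>)" using tabloid_rep_rep[of \<beta>] N by simp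
  note l = column_antisym_linear[OF K t, simplified]
  have d: "delta T \<in> rep_space (tabloid_rep \<beta>)" if "T \<in> tabloids \<beta>" for T using delta_tabloid_rep[OF that] .
  have "column_antisym perm_act \<alpha> t u = column_antisym perm_act \<alpha> t (\<Sum>T\<in>tabloids \<beta>. cscale (u T) (delta T))"
    using tabloid_rep_expand[OF u] by simp
  also have "\<dots> = (\<Sum>T\<in>tabloids \<beta>. column_antisym perm_act \<alpha> t (cscale (u T) (delta T)))"
    by (rule linear_on_sum[OF l rep_subspace[OF K]]) (use d cfun.subspace_scale[OF rep_subspace[OF K]] in auto)
  also have "\<dots> = (\<Sum>T\<in>tabloids \<beta>. cscale (u T) (column_antisym perm_act \<alpha> t (delta T)))"
    by (intro sum.cong refl linear_on_scale[OF l d])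
  finally show ?thesis .
qed

text \<open>The antisymmetrizer has rank one on tabloids of its own shape: a tabloid that survives
  spreads each of its rows over different columns of t, hence is the image of the tabloid of t under
  a column permutation.\<close>

lemma column_antisym_tabloid_rep:
  assumes \<alpha>: "is_partition \<alpha>" and t: "tableau \<alpha> t" and u: "u \<in> rep_space (tabloid_rep \<alpha>)"
  shows "\<exists>c. column_antisym perm_act \<alpha> t u = cscale c (polytabloid \<alpha> t)"
proof -
  have "\<exists>c. column_antisym perm_act \<alpha> t (delta T) = cscale c (polytabloid \<alpha> t)" if T: "T \<in> tabloids \<alpha>" for T
  proof (cases "column_antisym perm_act \<alpha> t (delta T) = 0")
    case True
    then show ?thesis by (intro exI[of _ 0]) simp
  next
    case False
    obtain s where s: "T = row_tabloid (sum_list \<alpha>) s" "\<And>k. card {b \<in> {1..sum_list \<alpha>}. s b < k} = psum \<alpha> k"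
      using tabloid_rows[OF T] by blast
    obtain \<pi> where \<pi>: "\<pi> \<in> column_stabilizer \<alpha> t" "T = tabloid_act \<pi> (tabloid_of \<alpha> t)"
      using column_permutation[OF \<alpha> t column_antisym_delta_nonzero[OF t s(1) tabloid_rep_rep tabloid_rep_act delta_tabloid_rep[OF T] False] s(2)]
        s(1) by metis
    have "delta T = perm_act \<pi> (delta (tabloid_of \<alpha> t))"
      unfolding \<pi>(2) using perm_act_delta[OF permutes_bij[OF colstab_perm[OF t \<pi>(1)]]] by simp
    then have "column_antisym perm_act \<alpha> t (delta T) = cscale (of_int (sign \<pi>)) (polytabloid \<alpha> t)"
      using column_antisym_act[OF tabloid_rep_rep t \<pi>(1) delta_tabloid_rep[OF tabloid_in[OF t]]] by (simp add: polytabloid_column_antisym)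
    then show ?thesis by blast
  qed
  then obtain c where c: "\<And>T. T \<in> tabloids \<alpha> \<Longrightarrow> column_antisym perm_act \<alpha> t (delta T) = cscale (c T) (polytabloid \<alpha> t)"
    by metis
  have "column_antisym perm_act \<alpha> t u = (\<Sum>T\<in>tabloids \<alpha>. cscale (u T * c T) (polytabloid \<alpha> t))"
    unfolding column_antisym_tabloid_rep_sum[OF t u refl] by (intro sum.cong refl) (simp add: c)
  also have "\<dots> = cscale (\<Sum>T\<in>tabloids \<alpha>. u T * c T) (polytabloid \<alpha> t)"
    by (simp add: pointwise sum_distrib_right)
  finally show ?thesis by blast
qed

text \<open>Some tabloid of shape \<beta> survives the antisymmetrizer, so its rows spread over
  different columns of t, and \<open>column_count\<close> bounds their partial sums.\<close>

lemma column_antisym_dominance: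
  assumes \<alpha>: "is_partition \<alpha>" and t: "tableau \<alpha> t" and u: "u \<in> rep_space (tabloid_rep \<beta>)"
    and N: "sum_list \<beta> = sum_list \<alpha>" and nz: "column_antisym perm_act \<alpha> t u \<noteq> 0"
  shows "psum \<beta> k \<le> psum \<alpha> k"
proof -
  obtain T where T: "T \<in> tabloids \<beta>" "column_antisym perm_act \<alpha> t (delta T) \<noteq> 0"
  proof (rule ccontr)
    assume "\<not> thesis"
    then have "column_antisym perm_act \<alpha> t u = (\<Sum>T\<in>tabloids \<beta>. 0)"
      unfolding column_antisym_tabloid_rep_sum[OF t u N] using that by (intro sum.cong refl) force
    then show False using nz by simp
  qed
  obtain s where s: "T = row_tabloid (sum_list \<beta>) s" "\<And>k. card {b \<in> {1..sum_list \<beta>}. s b < k} = psum \<beta> k"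
    using tabloid_rows[OF T(1)] by blast
  have K: "representation (sym_group (sum_list \<alpha>)) (tabloid_rep \<beta>)" using tabloid_rep_rep[of \<beta>] N by simp
  have "card {b \<in> {1..sum_list \<alpha>}. s b < k} \<le> psum \<alpha> k"
    by (rule column_count(1)[OF \<alpha> t column_antisym_delta_nonzero[OF t _ K tabloid_rep_act delta_tabloid_rep[OF T(1)] T(2)]])
      (use s(1) N in simp)
  then show ?thesis using s(2) N by simp
qed

text \<open>The column stabilizer is closed under inversion, and a permutation has the same sign as
  its inverse.\<close>

lemma column_antisym_adjoint:
  assumes t: "tableau \<alpha> t"
  shows "dotp (tabloids \<alpha>) (column_antisym perm_act \<alpha> t u) v = dotp (tabloids \<alpha>) u (column_antisym perm_act \<alpha> t v)"
proof -
  let ?C = "column_stabilizer \<alpha> t"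
  have p: "\<pi> permutes {1..sum_list \<alpha>}" if "\<pi> \<in> ?C" for \<pi> using colstab_perm[OF t that] .
  have "dotp (tabloids \<alpha>) (column_antisym perm_act \<alpha> t u) v = (\<Sum>\<pi>\<in>?C. of_int (sign \<pi>) * dotp (tabloids \<alpha>) (perm_act \<pi> u) v)"
    by (simp add: column_antisym_def dotp_sum dotp_scale)
  also have "\<dots> = (\<Sum>\<pi>\<in>?C. of_int (sign (inv' \<pi>)) * dotp (tabloids \<alpha>) u (perm_act (inv' \<pi>) v))"
  proof (intro sum.cong refl arg_cong2[of _ _ _ _ "(*)"])
    fix \<pi> assume \<pi>: "\<pi> \<in> ?C"
    show "of_int (sign \<pi>) = (of_int (sign (inv' \<pi>)) :: complex)"
      using sign_inverse[of \<pi>] p[OF \<pi>] permutation_permutes by fastforce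
    have "perm_act \<pi> (perm_act (inv' \<pi>) v) = v"
      using perm_act_comp[of \<pi> "inv' \<pi>" v] permutes_bij[OF p[OF \<pi>]] permutes_bij[OF permutes_inv[OF p[OF \<pi>]]]
        permutes_inv_o(1)[OF p[OF \<pi>]] by simp
    then show "dotp (tabloids \<alpha>) (perm_act \<pi> u) v = dotp (tabloids \<alpha>) u (perm_act (inv' \<pi>) v)"
      using dotp_perm_act[OF p[OF \<pi>], of u "perm_act (inv' \<pi>) v"] by simp
  qed
  also have "\<dots> = (\<Sum>\<pi>\<in>?C. of_int (sign \<pi>) * dotp (tabloids \<alpha>) u (perm_act \<pi> v))"
    by (rule sum.reindex_bij_witness[of _ inv' inv'])
      (use colstab_inv[OF t] permutes_inv_inv[OF p] in auto)
  also have "\<dots> = dotp (tabloids \<alpha>) u (column_antisym perm_act \<alpha> t v)"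
    by (simp add: column_antisym_def dotp_sum dotp_scale)
  finally show ?thesis .
qed

section \<open>Real values, irreducibility and Schur's lemma\<close>

lemma polytabloid_real: "polytabloid \<alpha> t T \<in> \<real>"
  unfolding polytabloid_def by (intro sum_in_Reals Reals_mult) auto

text \<open>Only the identity preserves every row and every column of t.\<close>

lemma polytabloid_at: "tableau \<alpha> t \<Longrightarrow> polytabloid \<alpha> t (tabloid_of \<alpha> t) = 1"
proof -
  assume t: "tableau \<alpha> t"
  let ?C = "column_stabilizer \<alpha> t" and ?N = "{1..sum_list \<alpha>}"
  have "\<pi> = id" if \<pi>: "\<pi> \<in> ?C" and e: "tabloid_of \<alpha> t = tabloid_of \<alpha> (\<pi> \<circ> t)" for \<pi>
  proof -
    have p: "\<pi> permutes ?N" using colstab_perm[OF t \<pi>] .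
    have "row_tabloid (sum_list \<alpha>) (row_of \<alpha> t) = row_tabloid (sum_list \<alpha>) (row_of \<alpha> t \<circ> inv' \<pi>)"
      using e tabloid_act_row_tabloid[OF p] by (simp add: tabloid_of_comp tabloid_of_row_tabloid[OF t])
    then have r: "row_of \<alpha> t b = row_of \<alpha> t (inv' \<pi> b)" if "b \<in> ?N" for b
      using that unfolding row_tabloid_eq_iff by simp
    have "\<pi> b = b" for b
    proof (cases "b \<in> ?N")
      case True
      then have pb: "\<pi> b \<in> ?N" using permutes_in_image[OF p] by blast
      then have "row_of \<alpha> t (\<pi> b) = row_of \<alpha> t b" using r[OF pb] permutes_inverses(2)[OF p] by simp
      moreover have "col_of \<alpha> t (\<pi> b) = col_of \<alpha> t b" using \<pi> True column_stabilizer_iff[OF t] by blast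
      ultimately show ?thesis using tableau_at_pos[OF t] True pb by metis
    qed (use permutes_not_in[OF p] in auto)
    then show ?thesis by auto
  qed
  then have "polytabloid \<alpha> t (tabloid_of \<alpha> t) = (\<Sum>\<pi>\<in>?C. if \<pi> = id then 1 else 0)"
    unfolding polytabloid_def by (intro sum.cong refl) auto
  then show ?thesis using colstab_id[OF t] colstab_finite[OF t] by simp
qed

lemma dotp_real_zero:
  assumes "\<And>T. u T \<in> \<real>" "dotp (tabloids \<alpha>) u u = 0" "T \<in> tabloids \<alpha>"
  shows "u T = 0"
proof -
  have "u T * u T = of_real ((Re (u T))\<^sup>2)" for T
    using assms(1)[of T] by (auto simp: Reals_def power2_eq_square)
  then have "of_real (\<Sum>T\<in>tabloids \<alpha>. (Re (u T))\<^sup>2) = (0 :: complex)"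
    using assms(2) unfolding dotp_def by simp
  then have "(\<Sum>T\<in>tabloids \<alpha>. (Re (u T))\<^sup>2) = 0" by (simp only: of_real_eq_0_iff)
  then have "Re (u T) = 0"
    using sum_nonneg_eq_0_iff[OF finite_tabloids, of \<alpha> "\<lambda>T. (Re (u T))\<^sup>2"] assms(3) by simp
  then show ?thesis using assms(1)[of T] by (auto simp: Reals_def)
qed

text \<open>The bilinear form is tested against the complex conjugate of u, which stays in the
  Specht module because the polytabloids spanning it are real.\<close>

lemma specht_nondegenerate:
  assumes u: "u \<in> rep_space (specht \<alpha>)" and z: "\<And>t. tableau \<alpha> t \<Longrightarrow> dotp (tabloids \<alpha>) u (polytabloid \<alpha> t) = 0"
  shows "u = 0"
proof -
  have z': "dotp (tabloids \<alpha>) u w = 0" if "w \<in> rep_space (specht \<alpha>)" for w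
    using that unfolding specht_space
    by (induction rule: span_induct_member) (use z in \<open>auto simp: dotp_add dotp_scale\<close>)
  have "(\<lambda>T. cnj (u T)) \<in> rep_space (specht \<alpha>)"
    using u unfolding specht_space
  proof (induction rule: span_induct_member)
    case zero
    have "(\<lambda>T. cnj ((0 :: (nat \<Rightarrow> nat set) \<Rightarrow> complex) T)) = 0" by (simp add: pointwise)
    then show ?case using cfun.span_zero by simp
  next
    case (step c x y)
    then obtain t where t: "x = polytabloid \<alpha> t" by blast
    have "(\<lambda>T. cnj ((cscale c x + y) T)) = cscale (cnj c) x + (\<lambda>T. cnj (y T))"
      using polytabloid_real[of \<alpha> t] Reals_cnj_iff unfolding t by (auto simp: pointwise)
    then show ?case using step by (simp add: cfun.span_add cfun.span_scale cfun.span_base)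
  qed
  from z'[OF this] have "(\<Sum>T\<in>tabloids \<alpha>. of_real ((cmod (u T))\<^sup>2)) = (0 :: complex)"
    unfolding dotp_def by (simp add: complex_norm_square del: of_real_power)
  then have "of_real (\<Sum>T\<in>tabloids \<alpha>. (cmod (u T))\<^sup>2) = (0 :: complex)" by simp
  then have "(\<Sum>T\<in>tabloids \<alpha>. (cmod (u T))\<^sup>2) = 0" by (simp only: of_real_eq_0_iff)
  then have "u T = 0" if "T \<in> tabloids \<alpha>" for T
    using sum_nonneg_eq_0_iff[OF finite_tabloids, of \<alpha> "\<lambda>T. (cmod (u T))\<^sup>2"] that by simp
  moreover have "u T = 0" if "T \<notin> tabloids \<alpha>" for T
    using u specht_tabloid_rep[of \<alpha>] that by (auto simp: tabloid_rep_def)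
  ultimately show ?thesis by (auto simp: pointwise)
qed

text \<open>If every antisymmetrizer killed u, adjointness would make u orthogonal to all
  polytabloids. So some antisymmetrizer sends u to a nonzero multiple of its polytabloid, and the
  translates of one polytabloid span the module.\<close>

lemma specht_irreducible:
  assumes \<alpha>: "is_partition \<alpha>" and U: "cfun.subspace U" "U \<subseteq> rep_space (specht \<alpha>)"
    and inv: "\<And>g u. g permutes {1..sum_list \<alpha>} \<Longrightarrow> u \<in> U \<Longrightarrow> perm_act g u \<in> U"
    and u: "u \<in> U" "u \<noteq> 0"
  shows "U = rep_space (specht \<alpha>)"
proof -
  obtain t where t: "tableau \<alpha> t" "column_antisym perm_act \<alpha> t u \<noteq> 0"
  proof (rule ccontr)
    assume "\<not> thesis"
    then have z: "column_antisym perm_act \<alpha> t u = 0" if "tableau \<alpha> t" for t using that \<open>\<And>t. tableau \<alpha> t \<Longrightarrow> _ \<Longrightarrow> thesis\<close> by blast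
    have "dotp (tabloids \<alpha>) u (polytabloid \<alpha> t) = 0" if "tableau \<alpha> t" for t
      unfolding polytabloid_column_antisym column_antisym_adjoint[OF that, symmetric] z[OF that] by simp
    then have "u = 0" using specht_nondegenerate u(1) U(2) by blast
    then show False using u(2) by blast
  qed
  have um: "u \<in> rep_space (tabloid_rep \<alpha>)" using u(1) U(2) specht_tabloid_rep by blast
  obtain c where c: "column_antisym perm_act \<alpha> t u = cscale c (polytabloid \<alpha> t)" using column_antisym_tabloid_rep[OF \<alpha> t(1) um] by blast
  have "column_antisym perm_act \<alpha> t u \<in> U"
    unfolding column_antisym_def
    using inv colstab_perm[OF t(1)] u(1) by (intro cfun.subspace_sum[OF U(1)] cfun.subspace_scale[OF U(1)]) auto
  then have "cscale (1 / c) (column_antisym perm_act \<alpha> t u) \<in> U" using cfun.subspace_scale[OF U(1)] by blast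
  moreover have "c \<noteq> 0" using t(2) c by auto
  ultimately have e: "polytabloid \<alpha> t \<in> U" using c by simp
  have "polytabloid \<alpha> t' \<in> U" if "tableau \<alpha> t'" for t'
    using polytabloid_transitive[OF t(1) that] inv e by metis
  then have "rep_space (specht \<alpha>) \<subseteq> U" unfolding specht_space by (intro cfun.span_minimal U(1)) auto
  then show ?thesis using U(2) by blast
qed

text \<open>The kernel is an invariant subspace that misses v, hence zero by irreducibility.\<close>

lemma specht_hom_inj:
  assumes \<alpha>: "is_partition \<alpha>" and f: "ghom (sym_group (sum_list \<alpha>)) (specht \<alpha>) Q f"
    and v: "v \<in> rep_space (specht \<alpha>)" "f v \<noteq> 0"
    and Q: "\<And>g. g \<in> carrier (sym_group (sum_list \<alpha>)) \<Longrightarrow> rep_act Q g 0 = 0"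
  shows "inj_on f (rep_space (specht \<alpha>))"
proof (rule inj_onI)
  let ?S = "rep_space (specht \<alpha>)"
  note s = rep_subspace[OF specht_rep, of \<alpha>] and l = ghom_linear[OF f]
  fix x y assume xy: "x \<in> ?S" "y \<in> ?S" "f x = f y"
  define U where "U = {u \<in> ?S. f u = 0}"
  have "cfun.subspace U"
    unfolding U_def
    by (rule cfun.subspaceI)
      (auto simp: linear_on_zero[OF l s] linear_on_add[OF l] linear_on_scale[OF l] cfun.subspace_0[OF s]
        cfun.subspace_add[OF s] cfun.subspace_scale[OF s])
  moreover have "U \<subseteq> ?S" by (auto simp: U_def)
  moreover have "perm_act g u \<in> U" if "g permutes {1..sum_list \<alpha>}" "u \<in> U" for g u
    using that ghom_act[OF f, of g u] Q[of g] rep_closed[OF specht_rep, of g \<alpha> u]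
    by (auto simp: U_def sym_group_carrier specht_act)
  moreover have "U \<noteq> ?S" using v by (auto simp: U_def)
  ultimately have "\<And>u. u \<in> U \<Longrightarrow> u = 0" using specht_irreducible[OF \<alpha>, of U] by blast
  moreover have "x - y \<in> U" using xy linear_on_diff[OF l s] cfun.subspace_diff[OF s] by (simp add: U_def)
  ultimately show "x = y" by (metis eq_iff_diff_eq_0)
qed

lemma column_antisym_polytabloid:
  "tableau \<alpha> t \<Longrightarrow> column_antisym perm_act \<alpha> t (polytabloid \<alpha> t) = cscale (of_nat (card (column_stabilizer \<alpha> t))) (polytabloid \<alpha> t)"
  using column_antisym_column_antisym[OF tabloid_rep_rep _ delta_tabloid_rep[OF tabloid_in]] by (simp add: polytabloid_column_antisym)

lemma specht_hom_column_antisym: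
  assumes t: "tableau \<alpha> t" and f: "ghom (sym_group (sum_list \<alpha>)) (specht \<alpha>) Q f"
  shows "column_antisym (rep_act Q) \<alpha> t (f (polytabloid \<alpha> t)) =
    cscale (of_nat (card (column_stabilizer \<alpha> t))) (f (polytabloid \<alpha> t))"
  using column_antisym_ghom[OF specht_rep t f polytabloid_specht[OF t]] column_antisym_polytabloid[OF t]
    linear_on_scale[OF ghom_linear[OF f] polytabloid_specht[OF t]] by (simp add: specht_act)

text \<open>The image of a polytabloid is an eigenvector of its antisymmetrizer, whose range on
  tabloids of shape \<alpha> is the line of that polytabloid. Transitivity on tableaux spreads the
  scalar to all polytabloids.\<close>

lemma specht_schur:
  assumes \<alpha>: "is_partition \<alpha>" and f: "ghom (sym_group (sum_list \<alpha>)) (specht \<alpha>) (specht \<alpha>) f"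
  shows "\<exists>c. \<forall>v\<in>rep_space (specht \<alpha>). f v = cscale c v"
proof -
  obtain t where t: "tableau \<alpha> t" using tableau_exists .
  let ?n = "of_nat (card (column_stabilizer \<alpha> t)) :: complex"
  note nz = colstab_card[OF tabloid_rep_rep t]
  have "f (polytabloid \<alpha> t) \<in> rep_space (tabloid_rep \<alpha>)"
    using ghom_closed[OF f polytabloid_specht[OF t]] specht_tabloid_rep by blast
  then obtain c where "column_antisym perm_act \<alpha> t (f (polytabloid \<alpha> t)) = cscale c (polytabloid \<alpha> t)"
    using column_antisym_tabloid_rep[OF \<alpha> t] by blast
  then have "cscale (1 / ?n) (cscale ?n (f (polytabloid \<alpha> t))) = cscale (1 / ?n) (cscale c (polytabloid \<alpha> t))"
    using specht_hom_column_antisym[OF t f] by (simp add: specht_act)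
  then have c: "f (polytabloid \<alpha> t) = cscale (c / ?n) (polytabloid \<alpha> t)" using nz by simp
  have "f (polytabloid \<alpha> t') = cscale (c / ?n) (polytabloid \<alpha> t')" if t': "tableau \<alpha> t'" for t'
  proof -
    obtain g where g: "g permutes {1..sum_list \<alpha>}" "polytabloid \<alpha> t' = perm_act g (polytabloid \<alpha> t)"
      using polytabloid_transitive[OF t t'] by blast
    then show ?thesis
      using ghom_act[OF f _ polytabloid_specht[OF t], of g] c linear_on_scale[OF perm_act_linear, of "polytabloid \<alpha> t" UNIV]
      by (simp add: sym_group_carrier specht_act)
  qed
  then have "f v = cscale (c / ?n) v" if "v \<in> rep_space (specht \<alpha>)" for v
    using linear_on_eq_span[of "{polytabloid \<alpha> t |t. tableau \<alpha> t}" f "cscale (c / ?n)" v]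
      ghom_linear[OF f] that unfolding specht_space
    by (auto simp: linear_on_def cfun.scale_right_distrib mult.commute)
  then show ?thesis by blast
qed

text \<open>Some polytabloid has a nonzero image, and this image survives the antisymmetrizer of a
  tableau of shape \<alpha> although it lives on tabloids of shape \<beta>.\<close>

lemma specht_hom_dominance:
  assumes \<alpha>: "is_partition \<alpha>" and N: "sum_list \<beta> = sum_list \<alpha>"
    and f: "ghom (sym_group (sum_list \<alpha>)) (specht \<alpha>) (specht \<beta>) f"
    and v: "v \<in> rep_space (specht \<alpha>)" "f v \<noteq> 0"
  shows "psum \<beta> k \<le> psum \<alpha> k"
proof -
  obtain t where t: "tableau \<alpha> t" "f (polytabloid \<alpha> t) \<noteq> 0"
  proof (rule ccontr)
    assume "\<not> thesis"
    then have "f (polytabloid \<alpha> t) = 0" if "tableau \<alpha> t" for t using that \<open>\<And>t. tableau \<alpha> t \<Longrightarrow> _ \<Longrightarrow> thesis\<close> by blast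
    then have "f v = 0"
      using linear_on_eq_span[of "{polytabloid \<alpha> t |t. tableau \<alpha> t}" f "\<lambda>_. 0" v] ghom_linear[OF f] v(1)
      unfolding specht_space by (auto simp: linear_on_def)
    then show False using v(2) by blast
  qed
  have "column_antisym perm_act \<alpha> t (f (polytabloid \<alpha> t)) \<noteq> 0"
    using specht_hom_column_antisym[OF t(1) f] t(2) colstab_card[OF tabloid_rep_rep t(1)] by (simp add: specht_act)
  moreover have "f (polytabloid \<alpha> t) \<in> rep_space (tabloid_rep \<beta>)"
    using ghom_closed[OF f polytabloid_specht[OF t(1)]] specht_tabloid_rep by blast
  ultimately show ?thesis using column_antisym_dominance[OF \<alpha> t(1) _ N] by blast
qed

lemma finite_sym_group: "finite (carrier (sym_group n))"
  using finite_permutations[of "{1..n}"] by (simp add: sym_group_def)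

lemma act_zero: "representation G Q \<Longrightarrow> g \<in> carrier G \<Longrightarrow> rep_act Q g 0 = 0"
  using linear_on_zero[OF rep_linear rep_subspace] .

text \<open>A retraction supplies a nonzero homomorphism in the other direction, so the two shapes
  dominate each other.\<close>

lemma specht_hom_eq:
  assumes \<alpha>: "is_partition \<alpha>" and \<beta>: "is_partition \<beta>" and N: "sum_list \<beta> = sum_list \<alpha>"
    and f: "ghom (sym_group (sum_list \<alpha>)) (specht \<alpha>) (specht \<beta>) f"
    and v: "v \<in> rep_space (specht \<alpha>)" "f v \<noteq> 0"
  shows "\<alpha> = \<beta>"
proof -
  have rb: "representation (sym_group (sum_list \<alpha>)) (specht \<beta>)" using specht_rep[of \<beta>] N by simp
  have inj: "inj_on f (rep_space (specht \<alpha>))"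
    using specht_hom_inj[OF \<alpha> f v act_zero[OF rb]] .
  obtain r where r: "ghom (sym_group (sum_list \<beta>)) (specht \<beta>) (specht \<alpha>) r"
    "\<And>w. w \<in> rep_space (specht \<alpha>) \<Longrightarrow> r (f w) = w"
    using ghom_retraction[OF specht_rep rb finite_sym_group f inj] N by metis
  have "v \<noteq> 0" using v linear_on_zero[OF ghom_linear[OF f] rep_subspace[OF specht_rep]] by blast
  then have "psum \<alpha> k \<le> psum \<beta> k" for k
    using specht_hom_dominance[OF \<beta> N[symmetric] r(1) ghom_closed[OF f v(1)]] r(2)[OF v(1)] by simp
  moreover have "psum \<beta> k \<le> psum \<alpha> k" for k using specht_hom_dominance[OF \<alpha> N f v] .
  ultimately show ?thesis using psum_inj[OF \<alpha> \<beta>] by (meson le_antisym)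
qed

lemma specht_real_type:
  assumes \<alpha>: "is_partition \<alpha>" and t: "tableau \<alpha> t"
  shows "real_type (sym_group (sum_list \<alpha>)) (specht \<alpha>) (tabloids \<alpha>) (polytabloid \<alpha> t)"
proof
  let ?G = "sym_group (sum_list \<alpha>)" and ?e = "polytabloid \<alpha> t" and ?Y = "tabloids \<alpha>"
  show "representation ?G (specht \<alpha>)" "finite (carrier ?G)" by (fact specht_rep finite_sym_group)+
  show "dotp ?Y (rep_act (specht \<alpha>) g x) (rep_act (specht \<alpha>) g y) = dotp ?Y x y" if "g \<in> carrier ?G" for g x y
    using that dotp_perm_act by (simp add: specht_act sym_group_carrier)
  show "x = 0" if "x \<in> rep_space (specht \<alpha>)" "\<And>y. y \<in> rep_space (specht \<alpha>) \<Longrightarrow> dotp ?Y x y = 0" for x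
    using specht_nondegenerate that polytabloid_specht by blast
  show "\<exists>c. \<forall>v\<in>rep_space (specht \<alpha>). f v = cscale c v" if "ghom ?G (specht \<alpha>) (specht \<alpha>) f" for f
    using specht_schur[OF \<alpha> that] .
  show "?e \<in> rep_space (specht \<alpha>)" using polytabloid_specht[OF t] .
  show ee: "dotp ?Y ?e ?e \<noteq> 0"
    using dotp_real_zero[OF polytabloid_real _ tabloid_in[OF t]] polytabloid_at[OF t] by fastforce
  have real: "dotp ?Y ?e (perm_act g ?e) \<in> \<real>" for g
    unfolding dotp_def perm_act_def by (intro sum_in_Reals Reals_mult polytabloid_real)
  have "dotp ?Y ?e (perm_act g ?e) ^ 2 = of_real ((Re (dotp ?Y ?e (perm_act g ?e)))\<^sup>2)" for g
    using real[of g] by (auto simp: Reals_def)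
  then have s: "(\<Sum>g\<in>carrier ?G. dotp ?Y ?e (perm_act g ?e) ^ 2) = of_real (\<Sum>g\<in>carrier ?G. (Re (dotp ?Y ?e (perm_act g ?e)))\<^sup>2)"
    by simp
  \<comment> \<open>All matrix coefficients are real, so the sum of their squares is positive once
    the term of the identity is nonzero.\<close>
  have "Re (dotp ?Y ?e (perm_act id ?e)) \<noteq> 0" using ee real[of id] by (auto simp: Reals_def)
  moreover have "id \<in> carrier ?G" by (simp add: sym_group_carrier permutes_id)
  ultimately have "0 < (\<Sum>g\<in>carrier ?G. (Re (dotp ?Y ?e (perm_act g ?e)))\<^sup>2)"
    by (intro sum_pos2[OF finite_sym_group]) auto
  then show "(\<Sum>g\<in>carrier ?G. dotp ?Y ?e (rep_act (specht \<alpha>) g ?e) ^ 2) \<noteq> 0"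
    unfolding specht_act s of_real_eq_0_iff by linarith
qed

section \<open>Every representation of the symmetric group contains a Specht module\<close>

text \<open>The Young subgroup of the set partition of the entries by their rows.\<close>

definition row_stabilizer :: "nat \<Rightarrow> (nat \<Rightarrow> nat) \<Rightarrow> (nat \<Rightarrow> nat) set"
  where "row_stabilizer N r = {g. g permutes {1..N} \<and> (\<forall>b\<in>{1..N}. r (g b) = r b)}"

lemma row_stabilizer_id: "id \<in> row_stabilizer N r"
  by (simp add: row_stabilizer_def permutes_id)

lemma row_stabilizer_finite: "finite (row_stabilizer N r)"
  by (rule finite_subset[OF _ finite_permutations[of "{1..N}"]]) (auto simp: row_stabilizer_def)

lemma row_stabilizer_inv:
  assumes "g \<in> row_stabilizer N r" shows "inv' g \<in> row_stabilizer N r" "b \<in> {1..N} \<Longrightarrow> r (inv' g b) = r b"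
proof -
  have g: "g permutes {1..N}" using assms by (simp add: row_stabilizer_def)
  show i: "r (inv' g b) = r b" if "b \<in> {1..N}" for b
  proof -
    have "inv' g b \<in> {1..N}" using permutes_in_image[OF permutes_inv[OF g]] that by blast
    then have "r (g (inv' g b)) = r (inv' g b)" using assms unfolding row_stabilizer_def by blast
    then show ?thesis using permutes_inverses(1)[OF g] by simp
  qed
  then show "inv' g \<in> row_stabilizer N r" using permutes_inv[OF g] by (simp add: row_stabilizer_def)
qed

lemma row_stabilizer_comp: "g \<in> row_stabilizer N r \<Longrightarrow> h \<in> row_stabilizer N r \<Longrightarrow> g \<circ> h \<in> row_stabilizer N r"
proof -
  assume g: "g \<in> row_stabilizer N r" and h: "h \<in> row_stabilizer N r"
  have hp: "h permutes {1..N}" using h by (simp add: row_stabilizer_def)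
  have "r (g (h b)) = r b" if "b \<in> {1..N}" for b
  proof -
    have "h b \<in> {1..N}" using permutes_in_image[OF hp] that by blast
    then show ?thesis using g h that unfolding row_stabilizer_def by auto
  qed
  then show ?thesis using g h permutes_compose unfolding row_stabilizer_def by auto
qed

lemma tabloid_act_row_stabilizer: "g permutes {1..N} \<Longrightarrow> tabloid_act g (row_tabloid N r) = row_tabloid N r \<longleftrightarrow> g \<in> row_stabilizer N r"
proof -
  assume g: "g permutes {1..N}"
  have "tabloid_act g (row_tabloid N r) = row_tabloid N r \<longleftrightarrow> inv' g \<in> row_stabilizer N r"
    unfolding tabloid_act_row_tabloid[OF g] row_tabloid_eq_iff using permutes_inv[OF g] by (simp add: row_stabilizer_def)
  also have "\<dots> \<longleftrightarrow> g \<in> row_stabilizer N r" using row_stabilizer_inv(1) permutes_inv_inv[OF g] by metis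
  finally show ?thesis .
qed

definition fixed_vector :: "(nat \<Rightarrow> nat, 'x) rep \<Rightarrow> nat \<Rightarrow> (nat \<Rightarrow> nat) \<Rightarrow> ('x \<Rightarrow> complex) \<Rightarrow> bool"
  where "fixed_vector K N r v \<longleftrightarrow> v \<in> rep_space K \<and> (\<forall>g\<in>row_stabilizer N r. rep_act K g v = v)"

text \<open>Weakly decreasing row lengths have an initial segment of nonzero values, which is the
  partition; listing each fibre of r along its row gives the tableau.\<close>

lemma tableau_of_rows:
  fixes r :: "nat \<Rightarrow> nat" and N :: nat
  defines "n \<equiv> \<lambda>i. card {b \<in> {1..N}. r b = i}"
  assumes anti: "\<And>i. n (Suc i) \<le> n i"
  obtains \<alpha> t where "is_partition \<alpha>" "sum_list \<alpha> = N" "tableau \<alpha> t" "\<And>b. b \<in> {1..N} \<Longrightarrow> row_of \<alpha> t b = r b"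
proof -
  have anti': "i \<le> j \<Longrightarrow> n j \<le> n i" for i j by (rule lift_Suc_antimono_le[of n]) (use anti in auto)
  have "\<exists>i. n i = 0"
  proof (intro exI)
    \<comment> \<open>No value of r on the entries exceeds the sum of all of them, so this row is
      empty.\<close>
    show "n (Suc (\<Sum>b\<in>{1..N}. r b)) = 0"
      unfolding n_def using member_le_sum[of _ "{1..N}" r] by fastforce
  qed
  define L where "L = (LEAST i. n i = 0)"
  have L0: "n L = 0" unfolding L_def using LeastI_ex[OF \<open>\<exists>i. n i = 0\<close>] .
  have L: "n i \<noteq> 0 \<longleftrightarrow> i < L" for i
    using not_less_Least[of i "\<lambda>i. n i = 0"] anti'[of L i] L0 unfolding L_def[symmetric]
    by (metis le_zero_eq linorder_not_less)
  define \<alpha> where "\<alpha> = map n [0..<L]"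
  have \<alpha>: "length \<alpha> = L" "\<And>i. i < L \<Longrightarrow> \<alpha> ! i = n i" by (auto simp: \<alpha>_def)
  have Y: "(i, j) \<in> young_diagram \<alpha> \<longleftrightarrow> j < n i" for i j
    using L[of i] \<alpha> by (auto simp: young_diagram_def)
  have part: "is_partition \<alpha>"
    unfolding is_partition_def using L anti'
    by (auto simp: \<alpha>_def sorted_wrt_map sorted_wrt_iff_nth_less) (metis less_irrefl)
  define R where "R = (\<lambda>i. {b \<in> {1..N}. r b = i})"
  have "\<exists>f. bij_betw f {..<n i} (R i)" for i
    by (rule finite_same_card_bij) (auto simp: R_def n_def)
  then obtain f where f: "\<And>i. bij_betw (f i) {..<n i} (R i)" by metis
  define t where "t = (\<lambda>(i, j). f i j)"
  have b: "bij_betw t (young_diagram \<alpha>) {1..N}"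
  proof (rule bij_betw_imageI)
    show "inj_on t (young_diagram \<alpha>)"
    proof (rule inj_onI)
      fix p q assume p: "p \<in> young_diagram \<alpha>" and q: "q \<in> young_diagram \<alpha>" and e: "t p = t q"
      obtain i j i' j' where pq: "p = (i, j)" "q = (i', j')" by (metis surj_pair)
      have j: "j \<in> {..<n i}" "j' \<in> {..<n i'}" using p q Y pq by auto
      then have "f i j \<in> R i" "f i' j' \<in> R i'" using bij_betwE[OF f] by blast+
      then have "i = i'" using e pq by (auto simp: t_def R_def)
      then show "p = q" using e pq j f[of i] by (auto simp: t_def bij_betw_def dest: inj_onD)
    qed
    show "t ` young_diagram \<alpha> = {1..N}"
    proof (intro subset_antisym subsetI)
      fix b assume "b \<in> t ` young_diagram \<alpha>"
      then obtain i j where "b = f i j" "j \<in> {..<n i}" using Y by (auto simp: t_def)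
      then have "b \<in> R i" using bij_betwE[OF f] by blast
      then show "b \<in> {1..N}" by (simp add: R_def)
    next
      fix b assume "b \<in> {1..N}"
      then have "b \<in> f (r b) ` {..<n (r b)}" using f[of "r b"] by (simp add: bij_betw_def R_def)
      then obtain j where "j < n (r b)" "b = f (r b) j" by auto
      then show "b \<in> t ` young_diagram \<alpha>" using Y by (intro image_eqI[of b t "(r b, j)"]) (auto simp: t_def)
    qed
  qed
  have N: "sum_list \<alpha> = N" using bij_betw_same_card[OF b] card_young[of \<alpha>] by simp
  have t: "tableau \<alpha> t" using b N by (simp add: tableau_def)
  have "row_of \<alpha> t b = r b" if b: "b \<in> {1..N}" for b
  proof -
    let ?i = "row_of \<alpha> t b" and ?j = "col_of \<alpha> t b"
    have "(?i, ?j) \<in> young_diagram \<alpha>" "t (?i, ?j) = b" using tableau_pos[OF t] tableau_at_pos[OF t] b N by auto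
    then have "?j \<in> {..<n ?i}" "f ?i ?j = b" using Y by (auto simp: t_def)
    then have "b \<in> R ?i" using bij_betwE[OF f[of ?i]] by metis
    then show ?thesis by (simp add: R_def)
  qed
  then show ?thesis using that part N t by blast
qed

text \<open>
  Let \<open>r\<close> be a row function with smallest row sum whose Young subgroup fixes a nonzero vector \<open>v\<close> of \<open>K\<close>.
  By minimality \<open>r\<close> is the row function of a tableau of partition shape, and the map \<open>\<Phi>\<close> from tabloids
  to \<open>K\<close> which sends the tabloid of \<open>r\<close> to \<open>v\<close> kills every sum \<open>\<rho>\<close> of tabloids invariant under the Young
  subgroup of a row function with smaller row sum; so does the pairing with the Specht module.  Modulo
  such sums the symmetrization of any tabloid is a multiple of the tabloid of \<open>r\<close>.
\<close>

locale minimal_row =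
  fixes K :: "(nat \<Rightarrow> nat, 'x) rep" and N :: nat and r :: "nat \<Rightarrow> nat" and v :: "'x \<Rightarrow> complex"
    and \<alpha> :: "nat list" and t :: "nat \<times> nat \<Rightarrow> nat"
  assumes K: "representation (sym_group N) K" and v: "fixed_vector K N r v" "v \<noteq> 0"
    and minimal: "\<And>r' u. (\<Sum>b\<in>{1..N}. r' b) < (\<Sum>b\<in>{1..N}. r b) \<Longrightarrow> fixed_vector K N r' u \<Longrightarrow> u = 0"
    and \<alpha>: "is_partition \<alpha>" and N: "sum_list \<alpha> = N" and t: "tableau \<alpha> t"
    and rt: "\<And>b. b \<in> {1..N} \<Longrightarrow> row_of \<alpha> t b = r b"
begin

abbreviation "G \<equiv> carrier (sym_group N)"

lemma G_iff: "g \<in> G \<longleftrightarrow> g permutes {1..N}"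
  by (rule sym_group_carrier)

lemma tabloid_t: "tabloid_of \<alpha> t = row_tabloid N r"
  unfolding tabloid_of_row_tabloid[OF t] N row_tabloid_eq_iff using rt by blast

lemma vK: "v \<in> rep_space K"
  using v(1) by (simp add: fixed_vector_def)

text \<open>Up to a factor, the equivariant map that sends the tabloid of r to v. Summing over all g
  instead of cosets of the Young subgroup avoids representatives and multiplies by the order of that
  subgroup.\<close>

definition Phi :: "((nat \<Rightarrow> nat set) \<Rightarrow> complex) \<Rightarrow> 'x \<Rightarrow> complex"
  where "Phi u = (\<Sum>g\<in>G. cscale (u (tabloid_act g (row_tabloid N r))) (rep_act K g v))"

lemma Phi_closed: "Phi u \<in> rep_space K"
  unfolding Phi_def
  by (intro cfun.subspace_sum[OF rep_subspace[OF K]] cfun.subspace_scale[OF rep_subspace[OF K]] rep_closed[OF K] vK)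

lemma Phi_add: "Phi (u + w) = Phi u + Phi w" and Phi_scale: "Phi (cscale c u) = cscale c (Phi u)"
  by (simp_all add: Phi_def plus_fun_apply cfun.scale_left_distrib sum.distrib cscale_sum)
    (simp_all add: cscale_def)

lemma Phi_zero [simp]: "Phi 0 = 0"
  using Phi_scale[of 0 0] by simp

lemma Phi_sum: "Phi (\<Sum>i\<in>A. u i) = (\<Sum>i\<in>A. Phi (u i))"
  by (induction A rule: infinite_finite_induct) (simp_all add: Phi_add)

lemma Phi_perm_act:
  assumes h: "h \<in> G" shows "Phi (perm_act h u) = rep_act K h (Phi u)"
proof -
  have hp: "h permutes {1..N}" using h G_iff by blast
  have c: "rep_act K g v \<in> rep_space K" if "g \<in> G" for g using rep_closed[OF K that vK] .
  have "rep_act K h (Phi u) = (\<Sum>g\<in>G. rep_act K h (cscale (u (tabloid_act g (row_tabloid N r))) (rep_act K g v)))"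
    unfolding Phi_def
    by (rule linear_on_sum[OF rep_linear[OF K h] rep_subspace[OF K]])
      (use c cfun.subspace_scale[OF rep_subspace[OF K]] in auto)
  also have "\<dots> = (\<Sum>g\<in>G. cscale (u (tabloid_act g (row_tabloid N r))) (rep_act K (h \<circ> g) v))"
    using rep_mult[OF K h _ vK] linear_on_scale[OF rep_linear[OF K h] c]
    by (intro sum.cong refl) (simp add: sym_group_mult)
  also have "\<dots> = (\<Sum>g\<in>G. cscale (u (tabloid_act (inv' h \<circ> g) (row_tabloid N r))) (rep_act K g v))"
    by (rule sum.reindex_bij_witness[of _ "\<lambda>g. inv' h \<circ> g" "\<lambda>g. h \<circ> g"])
      (use permutes_compose permutes_inv[OF hp] permutes_inv_o[OF hp] hp in
        \<open>auto simp: G_iff o_assoc\<close>)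
  also have "\<dots> = Phi (perm_act h u)" by (simp add: Phi_def perm_act_def tabloid_act_comp)
  finally show ?thesis ..
qed

lemma Phi_delta: "Phi (delta (row_tabloid N r)) = cscale (of_nat (card (row_stabilizer N r))) v"
proof -
  have "Phi (delta (row_tabloid N r)) = (\<Sum>g\<in>G. if g \<in> row_stabilizer N r then v else 0)"
    unfolding Phi_def
    using v(1) tabloid_act_row_stabilizer[of _ N r] by (intro sum.cong refl) (auto simp: delta_def G_iff fixed_vector_def)
  also have "\<dots> = (\<Sum>g\<in>row_stabilizer N r. v)"
    by (rule sum.mono_neutral_cong_right) (auto simp: finite_sym_group G_iff row_stabilizer_def)
  finally show ?thesis by (simp add: pointwise)
qed

text \<open>Calculating modulo J treats \<open>Phi\<close> and the pairing with the Specht module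
  together. In \<open>hom_nonzero\<close> a single congruence is first read through
  \<open>Phi\<close> and then through the pairing.\<close>

definition J :: "((nat \<Rightarrow> nat set) \<Rightarrow> complex) set"
  where "J = {u. Phi u = 0 \<and> (\<forall>w\<in>rep_space (specht \<alpha>). dotp (tabloids \<alpha>) u w = 0)}"

text \<open>The unnormalized row symmetrizer of the tabloid of r.\<close>

definition sym :: "((nat \<Rightarrow> nat set) \<Rightarrow> complex) \<Rightarrow> (nat \<Rightarrow> nat set) \<Rightarrow> complex"
  where "sym u = (\<Sum>h\<in>row_stabilizer N r. perm_act h u)"

lemma J_subspace: "cfun.subspace J"
  by (rule cfun.subspaceI) (auto simp: J_def Phi_add Phi_scale dotp_add dotp_scale)

lemma perm_act_J:
  assumes h: "h \<in> G" and u: "u \<in> J" shows "perm_act h u \<in> J"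
proof -
  have hp: "h permutes {1..sum_list \<alpha>}" using h G_iff N by blast
  have "dotp (tabloids \<alpha>) (perm_act h u) w = 0" if w: "w \<in> rep_space (specht \<alpha>)" for w
  proof -
    have hi: "inv' h \<in> carrier (sym_group (sum_list \<alpha>))" using permutes_inv[OF hp] by (simp add: sym_group_carrier)
    have "perm_act h (perm_act (inv' h) w) = w"
      using perm_act_comp[of h "inv' h" w] permutes_bij[OF hp] permutes_bij[OF permutes_inv[OF hp]]
        permutes_inv_o(1)[OF hp] by simp
    then have "dotp (tabloids \<alpha>) (perm_act h u) w = dotp (tabloids \<alpha>) u (perm_act (inv' h) w)"
      using dotp_perm_act[OF hp, of u "perm_act (inv' h) w"] by simp
    then show ?thesis using u rep_closed[OF specht_rep hi w] by (simp add: J_def specht_act)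
  qed
  then show ?thesis
    using u Phi_perm_act[OF h] act_zero[OF K h] by (simp add: J_def)
qed

lemma sym_J: "u \<in> J \<Longrightarrow> sym u \<in> J"
  unfolding sym_def by (intro cfun.subspace_sum[OF J_subspace] perm_act_J) (auto simp: row_stabilizer_def G_iff)

lemma sym_add: "sym (u + w) = sym u + sym w" and sym_scale: "sym (cscale c u) = cscale c (sym u)"
  by (simp_all add: sym_def perm_act_def pointwise sum.distrib sum_distrib_left)

lemma sym_sum: "sym (\<Sum>i\<in>A. u i) = (\<Sum>i\<in>A. sym (u i))"
proof -
  have "sym 0 = 0" by (simp add: sym_def perm_act_def pointwise)
  then show ?thesis by (induction A rule: infinite_finite_induct) (simp_all add: sym_add)
qed

lemma sym_perm_act: "h \<in> row_stabilizer N r \<Longrightarrow> sym (perm_act h u) = sym u"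
proof -
  assume h: "h \<in> row_stabilizer N r"
  have b: "bij g" if "g \<in> row_stabilizer N r" for g using that permutes_bij by (auto simp: row_stabilizer_def)
  have hp: "h permutes {1..N}" using h by (simp add: row_stabilizer_def)
  have "sym (perm_act h u) = (\<Sum>g\<in>row_stabilizer N r. perm_act (g \<circ> h) u)"
    unfolding sym_def using perm_act_comp b h by (intro sum.cong refl) auto
  also have "\<dots> = sym u"
    unfolding sym_def
    by (rule sum.reindex_bij_witness[of _ "\<lambda>g. g \<circ> inv' h" "\<lambda>g. g \<circ> h"])
      (use row_stabilizer_comp row_stabilizer_inv(1) h permutes_inv_o[OF hp] in \<open>auto simp: comp_assoc\<close>)
  finally show ?thesis .
qed

lemma Phi_sym: "Phi u = 0 \<Longrightarrow> Phi (sym u) = 0"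
  unfolding sym_def Phi_sum
  by (intro sum.neutral ballI) (auto simp: Phi_perm_act G_iff row_stabilizer_def act_zero[OF K])

text \<open>The rearrangements of r: their tabloids have shape \<alpha>, and their row sums agree
  with that of r.\<close>

definition orbit_row :: "(nat \<Rightarrow> nat) \<Rightarrow> bool"
  where "orbit_row s \<longleftrightarrow> (\<exists>g. g permutes {1..N} \<and> s = r \<circ> g)"

lemma orbit_row_comp: "orbit_row s \<Longrightarrow> g permutes {1..N} \<Longrightarrow> orbit_row (s \<circ> g)"
  unfolding orbit_row_def using permutes_compose by (metis comp_assoc)

lemma orbit_row_tabloid:
  assumes "orbit_row s" shows "row_tabloid N s \<in> tabloids \<alpha>"
proof -
  obtain g where g: "g permutes {1..N}" "s = r \<circ> g" using assms unfolding orbit_row_def by blast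
  have "row_tabloid N s = tabloid_act (inv' g) (tabloid_of \<alpha> t)"
    unfolding tabloid_t tabloid_act_row_tabloid[OF permutes_inv[OF g(1)]] g(2) permutes_inv_inv[OF g(1)] ..
  then show ?thesis using tabloids_tabloid_act[of "inv' g" \<alpha>] tabloid_in[OF t] permutes_inv[OF g(1)] N by simp
qed

lemma orbit_row_sum: "orbit_row s \<Longrightarrow> (\<Sum>b\<in>{1..N}. s b) = (\<Sum>b\<in>{1..N}. r b)"
  unfolding orbit_row_def using sum.permute[of _ "{1..N}" r] by force

lemma orbit_row_psum:
  assumes "orbit_row s" shows "card {b \<in> {1..N}. s b < k} = psum \<alpha> k"
proof -
  obtain s' where s': "row_tabloid N s = row_tabloid (sum_list \<alpha>) s'" "\<And>k. card {b \<in> {1..sum_list \<alpha>}. s' b < k} = psum \<alpha> k"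
    using tabloid_rows[OF orbit_row_tabloid[OF assms]] by blast
  then have "{b \<in> {1..N}. s b < k} = {b \<in> {1..sum_list \<alpha>}. s' b < k}" unfolding N row_tabloid_eq_iff by auto
  then show ?thesis using s'(2) by simp
qed

context
  fixes s b i
  assumes s: "orbit_row s" and b: "b \<in> {1..N}" and i: "i < s b"
begin

definition "r' = s(b := i)"

text \<open>The assignment r' moves b up to row i and so has a smaller row sum. Moving any one entry
  of row i, and not only b, back to row s b gives a sum that is invariant under the Young subgroup
  of r'.\<close>

definition "rho = (\<Sum>x\<in>{x \<in> {1..N}. r' x = i}. delta (row_tabloid N (r'(x := s b))))"

text \<open>Moving b itself back restores s; moving back another entry x of row i amounts to
  exchanging x and b in s.\<close>

lemma rho_expand: "rho = delta (row_tabloid N s) + (\<Sum>x\<in>{x \<in> {1..N}. s x = i}. delta (row_tabloid N (s \<circ> transpose x b)))"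
proof -
  have "{x \<in> {1..N}. r' x = i} = insert b {x \<in> {1..N}. s x = i}" using b by (auto simp: r'_def)
  moreover have "b \<notin> {x \<in> {1..N}. s x = i}" using i by simp
  ultimately have "rho = delta (row_tabloid N (r'(b := s b))) + (\<Sum>x\<in>{x \<in> {1..N}. s x = i}. delta (row_tabloid N (r'(x := s b))))"
    unfolding rho_def by simp
  moreover have "r'(b := s b) = s" by (simp add: r'_def)
  moreover have "r'(x := s b) = s \<circ> transpose x b" if "s x = i" for x
    using that i by (auto simp: r'_def fun_eq_iff transpose_def)
  ultimately show ?thesis by simp
qed

lemma rho_tabloid_rep: "rho \<in> rep_space (tabloid_rep \<alpha>)"
  unfolding rho_expand
proof (intro cfun.subspace_add cfun.subspace_sum rep_subspace[OF tabloid_rep_rep] delta_tabloid_rep orbit_row_tabloid s)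
  fix x assume "x \<in> {x \<in> {1..N}. s x = i}"
  then show "orbit_row (s \<circ> transpose x b)" using b by (intro orbit_row_comp s permutes_swap_id) auto
qed

lemma rho_invariant:
  assumes h: "h \<in> row_stabilizer N r'" shows "perm_act h rho = rho"
proof -
  have hp: "h permutes {1..N}" using h by (simp add: row_stabilizer_def)
  have "perm_act h rho = (\<Sum>x\<in>{x \<in> {1..N}. r' x = i}. perm_act h (delta (row_tabloid N (r'(x := s b)))))"
    by (simp add: rho_def perm_act_def pointwise)
  also have "\<dots> = (\<Sum>x\<in>{x \<in> {1..N}. r' x = i}. delta (row_tabloid N (r'(h x := s b))))"
  proof (intro sum.cong refl)
    fix x assume x: "x \<in> {x \<in> {1..N}. r' x = i}"
    have "(r'(x := s b)) (inv' h y) = (r'(h x := s b)) y" if y: "y \<in> {1..N}" for y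
      using row_stabilizer_inv(2)[OF h y] permutes_inverses[OF hp] by (auto simp: fun_upd_def)
    then show "perm_act h (delta (row_tabloid N (r'(x := s b)))) = delta (row_tabloid N (r'(h x := s b)))"
      unfolding perm_act_delta[OF permutes_bij[OF hp]] tabloid_act_row_tabloid[OF hp]
      by (intro arg_cong[of _ _ delta]) (simp add: row_tabloid_eq_iff)
  qed
  also have "\<dots> = rho"
    unfolding rho_def
  proof (rule sum.reindex_bij_witness[of _ "inv' h" h])
    fix x assume x: "x \<in> {x \<in> {1..N}. r' x = i}"
    show "h x \<in> {x \<in> {1..N}. r' x = i}"
      using x h permutes_in_image[OF hp, of x] unfolding row_stabilizer_def by auto
    show "inv' h x \<in> {x \<in> {1..N}. r' x = i}"
      using x row_stabilizer_inv(2)[OF h, of x] permutes_in_image[OF permutes_inv[OF hp], of x] by auto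
  qed (use permutes_inverses[OF hp] in auto)
  finally show ?thesis .
qed

text \<open>\<open>Phi\<close> sends rho to a vector fixed by the Young subgroup of r', and
  minimality makes it zero. For the pairing, r' has one entry too many in the rows up to i, so two
  entries share a row of r' and a column of any given tableau; their transposition fixes rho, and
  the antisymmetrizer kills it.\<close>

lemma rho_J: "rho \<in> J"
proof -
  have "(\<Sum>x\<in>{1..N}. r' x) < (\<Sum>x\<in>{1..N}. s x)"
    using b i by (intro sum_strict_mono_ex1) (auto simp: r'_def)
  moreover have "fixed_vector K N r' (Phi rho)"
    unfolding fixed_vector_def
  proof (intro conjI ballI Phi_closed)
    fix g assume g: "g \<in> row_stabilizer N r'"
    then show "rep_act K g (Phi rho) = Phi rho"
      using Phi_perm_act[of g rho] rho_invariant[OF g] by (simp add: G_iff row_stabilizer_def)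
  qed
  ultimately have "Phi rho = 0" using minimal orbit_row_sum[OF s] by simp
  moreover have "dotp (tabloids \<alpha>) rho w = 0" if "w \<in> rep_space (specht \<alpha>)" for w
  proof -
    have "dotp (tabloids \<alpha>) rho (polytabloid \<alpha> \<tau>) = 0" if \<tau>: "tableau \<alpha> \<tau>" for \<tau>
    proof -
      \<comment> \<open>Rows 0 to i gain exactly the entry b, whose old row lies beyond i.\<close>
      have "{x \<in> {1..N}. r' x < Suc i} = insert b {x \<in> {1..N}. s x < Suc i}" using b by (auto simp: r'_def)
      then have "card {x \<in> {1..N}. r' x < Suc i} = Suc (psum \<alpha> (Suc i))"
        using i orbit_row_psum[OF s, of "Suc i"] by simp
      then obtain x y where xy: "x \<in> {1..N}" "y \<in> {1..N}" "x \<noteq> y" "r' x = r' y" "col_of \<alpha> \<tau> x = col_of \<alpha> \<tau> y"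
        using column_count(1)[OF \<alpha> \<tau>, of r' "Suc i"] unfolding N by force
      have "transpose x y \<in> row_stabilizer N r'"
        unfolding row_stabilizer_def using xy permutes_swap_id[of x "{1..N}" y] by (auto simp: transpose_def)
      then have "column_antisym perm_act \<alpha> \<tau> rho = 0"
        using column_antisym_zero[OF tabloid_rep_rep \<tau> rho_tabloid_rep, of x y] xy rho_invariant unfolding N by simp
      then show ?thesis unfolding polytabloid_column_antisym column_antisym_adjoint[OF \<tau>, symmetric] by simp
    qed
    then have z: "dotp (tabloids \<alpha>) rho x = 0" if "x \<in> {polytabloid \<alpha> t |t. tableau \<alpha> t}" for x
      using that by blast
    show ?thesis
      using that unfolding specht_space
      by (induction rule: span_induct_member) (simp_all add: z dotp_add dotp_scale)
  qed
  ultimately show ?thesis by (simp add: J_def)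
qed

end

text \<open>Induction on the number of entries that are not in their row under r. An entry b with r
  b < s b gives the relation rho with i = r b. Exchanging b with an entry x of that row is absorbed
  by the symmetrizer if x belongs there, and otherwise leaves fewer misplaced entries.\<close>

lemma sym_delta:
  assumes "orbit_row s"
  shows "\<exists>c. sym (delta (row_tabloid N s)) - cscale c (delta (row_tabloid N r)) \<in> J"
  using assms
proof (induction "card {x \<in> {1..N}. s x \<noteq> r x}" arbitrary: s rule: less_induct)
  case less
  note s = less.prems
  show ?case
  proof (cases "\<forall>b\<in>{1..N}. s b \<le> r b")
    case True
    \<comment> \<open>The assignments s and r have equal sums, so s \<le> r forces equality.\<close>
    have "\<not> (\<exists>b\<in>{1..N}. s b < r b)"
    proof
      assume "\<exists>b\<in>{1..N}. s b < r b"
      then have "(\<Sum>b\<in>{1..N}. s b) < (\<Sum>b\<in>{1..N}. r b)" using True by (intro sum_strict_mono_ex1) auto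
      then show False using orbit_row_sum[OF s] by simp
    qed
    then have "row_tabloid N s = row_tabloid N r" unfolding row_tabloid_eq_iff using True by force
    moreover have "sym (delta (row_tabloid N r)) = cscale (of_nat (card (row_stabilizer N r))) (delta (row_tabloid N r))"
    proof -
      have "perm_act h (delta (row_tabloid N r)) = delta (row_tabloid N r)" if "h \<in> row_stabilizer N r" for h
        using that tabloid_act_row_stabilizer[of h N r] perm_act_delta[OF permutes_bij] by (auto simp: row_stabilizer_def)
      then show ?thesis unfolding sym_def by (simp add: pointwise)
    qed
    ultimately show ?thesis
      using cfun.subspace_0[OF J_subspace] by (intro exI[of _ "of_nat (card (row_stabilizer N r))"]) simp
  next
    case False
    then obtain b where b: "b \<in> {1..N}" "r b < s b" by force
    define A1 where "A1 = {x \<in> {1..N}. s x = r b \<and> r x = r b}"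
    define A2 where "A2 = {x \<in> {1..N}. s x = r b \<and> r x \<noteq> r b}"
    have fin: "finite A1" "finite A2" by (auto simp: A1_def A2_def)
    define e where "e = (\<lambda>x. sym (delta (row_tabloid N (s \<circ> transpose x b))))"
    define d where "d = delta (row_tabloid N r)"
    have tp: "transpose x b permutes {1..N}" if "x \<in> {1..N}" for x
      using that b by (intro permutes_swap_id)
    have e1: "e x = sym (delta (row_tabloid N s))" if x: "x \<in> A1" for x
    proof -
      have xN: "x \<in> {1..N}" using x by (simp add: A1_def)
      have "transpose x b \<in> row_stabilizer N r" unfolding row_stabilizer_def using x tp[OF xN] by (auto simp: A1_def transpose_def)
      moreover have "perm_act (transpose x b) (delta (row_tabloid N s)) = delta (row_tabloid N (s \<circ> transpose x b))"
        using perm_act_delta[OF permutes_bij[OF tp[OF xN]]] tabloid_act_row_tabloid[OF tp[OF xN], of s] by simp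
      ultimately show ?thesis unfolding e_def using sym_perm_act by metis
    qed
    have "\<exists>c. e x - cscale c d \<in> J" if x: "x \<in> A2" for x
    proof -
      have xN: "x \<in> {1..N}" using x by (simp add: A2_def)
      have "{y \<in> {1..N}. (s \<circ> transpose x b) y \<noteq> r y} \<subset> {y \<in> {1..N}. s y \<noteq> r y}"
      proof
        show "{y \<in> {1..N}. (s \<circ> transpose x b) y \<noteq> r y} \<subseteq> {y \<in> {1..N}. s y \<noteq> r y}"
          using x b by (auto simp: A2_def transpose_def split: if_splits)
        have "b \<in> {y \<in> {1..N}. s y \<noteq> r y}" "b \<notin> {y \<in> {1..N}. (s \<circ> transpose x b) y \<noteq> r y}"
          using x b by (auto simp: A2_def)
        then show "{y \<in> {1..N}. (s \<circ> transpose x b) y \<noteq> r y} \<noteq> {y \<in> {1..N}. s y \<noteq> r y}" by blast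
      qed
      then have "card {y \<in> {1..N}. (s \<circ> transpose x b) y \<noteq> r y} < card {y \<in> {1..N}. s y \<noteq> r y}"
        by (intro psubset_card_mono) auto
      then show ?thesis unfolding e_def d_def by (rule less.hyps) (rule orbit_row_comp[OF s tp[OF xN]])
    qed
    then obtain c where c: "\<And>x. x \<in> A2 \<Longrightarrow> e x - cscale (c x) d \<in> J" by metis
    \<comment> \<open>Next to s itself, each x in A1 contributes one more copy of the symmetrized
      tabloid of s. The total coefficient 1 + |A1| is nonzero, so the relation can be solved for
      it.\<close>
    define m where "m = (of_nat (Suc (card A1)) :: complex)"
    have m: "m \<noteq> 0" unfolding m_def by (metis of_nat_eq_0_iff nat.distinct(1))
    have "{x \<in> {1..N}. s x = r b} = A1 \<union> A2" "A1 \<inter> A2 = {}" by (auto simp: A1_def A2_def)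
    then have "sym (rho s b (r b)) = sym (delta (row_tabloid N s)) + ((\<Sum>x\<in>A1. e x) + (\<Sum>x\<in>A2. e x))"
      unfolding rho_expand[OF s b] sym_add sym_sum e_def[symmetric] by (simp add: sum.union_disjoint fin)
    also have "(\<Sum>x\<in>A1. e x) = (\<Sum>x\<in>A1. sym (delta (row_tabloid N s)))" by (intro sum.cong refl e1)
    finally have rho: "sym (rho s b (r b)) = cscale m (sym (delta (row_tabloid N s))) + (\<Sum>x\<in>A2. e x)"
      by (simp add: m_def pointwise algebra_simps)
    have "sym (rho s b (r b)) - (\<Sum>x\<in>A2. e x - cscale (c x) d) \<in> J"
      by (intro cfun.subspace_diff[OF J_subspace] sym_J[OF rho_J[OF s b]] cfun.subspace_sum[OF J_subspace] c)
    then have "cscale (1 / m) (sym (rho s b (r b)) - (\<Sum>x\<in>A2. e x - cscale (c x) d)) \<in> J"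
      by (rule cfun.subspace_scale[OF J_subspace])
    also have "cscale (1 / m) (sym (rho s b (r b)) - (\<Sum>x\<in>A2. e x - cscale (c x) d)) =
        sym (delta (row_tabloid N s)) - cscale (- (\<Sum>x\<in>A2. c x) / m) d"
      unfolding rho using m
      by (simp add: pointwise sum_subtractf field_simps, simp add: sum_distrib_left mult.commute)
    finally show ?thesis unfolding d_def by blast
  qed
qed

text \<open>Modulo J the symmetrized polytabloid is a multiple a of the tabloid of r. If
  \<open>Phi\<close> killed the polytabloid, then a would be 0, as \<open>Phi\<close> sends this
  tabloid to a nonzero multiple of v. The symmetrized polytabloid would then be real and orthogonal
  to itself, hence vanish at the tabloid of r, where its value is the order of the Young
  subgroup.\<close>

lemma hom_nonzero: "Phi (polytabloid \<alpha> t) \<noteq> 0"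
proof
  let ?C = "column_stabilizer \<alpha> t" and ?d = "delta (row_tabloid N r)"
  assume z: "Phi (polytabloid \<alpha> t) = 0"
  have or: "orbit_row (r \<circ> inv' \<pi>)" if "\<pi> \<in> ?C" for \<pi>
    unfolding orbit_row_def using permutes_inv[OF colstab_perm[OF t that]] N by blast
  have rd: "perm_act \<pi> ?d = delta (row_tabloid N (r \<circ> inv' \<pi>))" if "\<pi> \<in> ?C" for \<pi>
    using colstab_perm[OF t that] N by (simp add: perm_act_delta permutes_bij tabloid_act_row_tabloid)
  have "\<exists>c. \<forall>\<pi>\<in>?C. sym (perm_act \<pi> ?d) - cscale (c \<pi>) ?d \<in> J"
    using sym_delta[OF or] rd by metis
  then obtain c where c: "\<And>\<pi>. \<pi> \<in> ?C \<Longrightarrow> sym (perm_act \<pi> ?d) - cscale (c \<pi>) ?d \<in> J" by blast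
  define a where "a = (\<Sum>\<pi>\<in>?C. of_int (sign \<pi>) * c \<pi>)"
  have "sym (polytabloid \<alpha> t) = (\<Sum>\<pi>\<in>?C. cscale (of_int (sign \<pi>)) (sym (perm_act \<pi> ?d)))"
    unfolding polytabloid_column_antisym tabloid_t column_antisym_def sym_sum sym_scale ..
  then have "sym (polytabloid \<alpha> t) - cscale a ?d = (\<Sum>\<pi>\<in>?C. cscale (of_int (sign \<pi>)) (sym (perm_act \<pi> ?d) - cscale (c \<pi>) ?d))"
    by (simp add: a_def pointwise sum_subtractf algebra_simps, simp add: sum_distrib_left mult_ac)
  also have "\<dots> \<in> J"
    by (intro cfun.subspace_sum[OF J_subspace] cfun.subspace_scale[OF J_subspace] c)
  finally have aJ: "sym (polytabloid \<alpha> t) - cscale a ?d \<in> J" .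
  have "Phi (sym (polytabloid \<alpha> t) - cscale a ?d) + Phi (cscale a ?d) = Phi (sym (polytabloid \<alpha> t))"
    by (simp only: Phi_add[symmetric] diff_add_cancel)
  then have "cscale a (Phi ?d) = 0"
    using aJ Phi_sym[OF z] unfolding J_def by (simp add: Phi_scale)
  then have "cscale (a * of_nat (card (row_stabilizer N r))) v = 0" unfolding Phi_delta by simp
  then have "a * of_nat (card (row_stabilizer N r)) = 0" using v(2) by simp
  moreover have cs: "card (row_stabilizer N r) \<noteq> 0" using row_stabilizer_id[of N r] row_stabilizer_finite[of N r] by auto
  ultimately have "a = 0" by simp
  then have sJ: "sym (polytabloid \<alpha> t) \<in> J" using aJ by simp
  have ss: "sym (polytabloid \<alpha> t) \<in> rep_space (specht \<alpha>)"
    unfolding sym_def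
    using rep_closed[OF specht_rep _ polytabloid_specht[OF t]] N
    by (intro cfun.subspace_sum[OF rep_subspace[OF specht_rep]])
      (auto simp: specht_act row_stabilizer_def sym_group_carrier)
  have "sym (polytabloid \<alpha> t) T \<in> \<real>" for T
    unfolding sym_def cfun_sum_apply perm_act_def by (intro sum_in_Reals polytabloid_real)
  moreover have "dotp (tabloids \<alpha>) (sym (polytabloid \<alpha> t)) (sym (polytabloid \<alpha> t)) = 0"
    using sJ ss by (simp add: J_def)
  ultimately have "sym (polytabloid \<alpha> t) (row_tabloid N r) = 0"
    using dotp_real_zero tabloid_in[OF t] tabloid_t by metis
  moreover have "perm_act h (polytabloid \<alpha> t) (row_tabloid N r) = 1" if h: "h \<in> row_stabilizer N r" for h
    using row_stabilizer_inv(1)[OF h] tabloid_act_row_stabilizer[of "inv' h" N r] polytabloid_at[OF t]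
    unfolding perm_act_def tabloid_t by (simp add: row_stabilizer_def)
  ultimately show False using cs unfolding sym_def cfun_sum_apply by simp
qed

lemma specht_hom: "ghom (sym_group N) (specht \<alpha>) K Phi" "polytabloid \<alpha> t \<in> rep_space (specht \<alpha>)"
  unfolding ghom_def linear_on_def specht_act
  using Phi_add Phi_scale Phi_closed Phi_perm_act polytabloid_specht[OF t] by auto

end

text \<open>The identity as row assignment has the trivial Young subgroup, so the given nonzero
  vector qualifies and a least row sum exists. If row i + 1 were longer than row i, exchanging the
  two labels would keep the Young subgroup and lower the sum; so the minimal rows have partition
  shape.\<close>

lemma specht_hom_exists:
  fixes K :: "(nat \<Rightarrow> nat, 'x) rep"
  assumes K: "representation (sym_group N) K" and u: "u \<in> rep_space K" "u \<noteq> 0"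
  obtains \<alpha> f v where "is_partition \<alpha>" "sum_list \<alpha> = N" "ghom (sym_group N) (specht \<alpha>) K f"
    "v \<in> rep_space (specht \<alpha>)" "f v \<noteq> 0"
proof -
  let ?P = "\<lambda>m. \<exists>r v. fixed_vector K N r v \<and> v \<noteq> 0 \<and> (\<Sum>b\<in>{1..N}. r b) = m"
  have "g = id" if "g \<in> row_stabilizer N id" for g
  proof
    fix b show "g b = id b"
      using that permutes_not_in[of g "{1..N}" b] by (cases "b \<in> {1..N}") (auto simp: row_stabilizer_def)
  qed
  moreover have "rep_act K id u = u" using rep_one[OF K u(1)] by (simp add: sym_group_one)
  ultimately have "fixed_vector K N id u" unfolding fixed_vector_def using u(1) by force
  then have "?P (\<Sum>b\<in>{1..N}. id b)" using u(2) by blast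
  then have ex: "?P (LEAST m. ?P m)" by (rule LeastI)
  then obtain r v where rv: "fixed_vector K N r v" "v \<noteq> 0" "(\<Sum>b\<in>{1..N}. r b) = (LEAST m. ?P m)" by blast
  have minimal: "w = 0" if "(\<Sum>b\<in>{1..N}. r' b) < (\<Sum>b\<in>{1..N}. r b)" "fixed_vector K N r' w" for r' w
    using not_less_Least[of "\<Sum>b\<in>{1..N}. r' b" ?P] that rv(3) by auto
  have "card {b \<in> {1..N}. r b = Suc i} \<le> card {b \<in> {1..N}. r b = i}" for i
  proof (rule ccontr)
    assume less: "\<not> ?thesis"
    define r' where "r' = (\<lambda>b. if r b = i then Suc i else if r b = Suc i then i else r b)"
    have "r' b = r' c \<longleftrightarrow> r b = r c" for b c by (simp add: r'_def)
    then have "row_stabilizer N r' = row_stabilizer N r" by (simp add: row_stabilizer_def)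
    then have "fixed_vector K N r' v" using rv(1) by (simp add: fixed_vector_def)
    have c: "card {b \<in> {1..N}. r b = j} = (\<Sum>b\<in>{1..N}. if r b = j then 1 else 0)" for j
      by (simp add: sum.If_cases Int_def)
    \<comment> \<open>The exchange adds one for each entry of row i and subtracts one for each entry
      of row i + 1.\<close>
    have "(\<Sum>b\<in>{1..N}. r' b) + card {b \<in> {1..N}. r b = Suc i} = (\<Sum>b\<in>{1..N}. r b) + card {b \<in> {1..N}. r b = i}"
      unfolding c sum.distrib[symmetric] by (intro sum.cong refl) (simp add: r'_def)
    then have "(\<Sum>b\<in>{1..N}. r' b) < (\<Sum>b\<in>{1..N}. r b)" using less by linarith
    then show False using minimal[of r' v] \<open>fixed_vector K N r' v\<close> rv(2) by simp
  qed
  then obtain \<alpha> t where at: "is_partition \<alpha>" "sum_list \<alpha> = N" "tableau \<alpha> t"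
    "\<And>b. b \<in> {1..N} \<Longrightarrow> row_of \<alpha> t b = r b"
    using tableau_of_rows[of N r] by blast
  interpret minimal_row K N r v \<alpha> t
    by (rule minimal_row.intro[OF K rv(1,2) minimal at])
  show ?thesis using that[OF at(1,2) specht_hom hom_nonzero] .
qed

section \<open>A permutation is conjugate to its inverse\<close>

text \<open>
  Reverse every cycle: \<open>s (g\<^sup>n a) = g\<^bsup>-n\<^esup> c\<close> where \<open>a\<close> and \<open>c\<close> are chosen points of the cycle.  On a
  cycle containing \<open>x\<close> and \<open>y\<close> take \<open>a = x\<close> and \<open>c = y\<close>, so that \<open>s\<close> exchanges them.
\<close>

lemma permutation_conj_inverse:
  fixes g :: "'a :: wellorder \<Rightarrow> 'a"
  assumes g: "g permutes S" and fin: "finite S"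
  obtains s where "s permutes S" "\<And>p. s (g p) = inv' g (s p)" "s ` {x, y} = {x, y}"
proof -
  define \<gamma> where "\<gamma> = inv' g"
  have \<gamma>g: "\<gamma> (g p) = p" "g (\<gamma> p) = p" for p using permutes_inverses[OF g] by (auto simp: \<gamma>_def)
  have pw: "(\<gamma> ^^ n) ((g ^^ n) p) = p" "(g ^^ n) ((\<gamma> ^^ n) p) = p" for n p
    by (induction n arbitrary: p) (simp_all add: \<gamma>g funpow_swap1)
  have ginj: "(g ^^ n) p = (g ^^ n) q \<Longrightarrow> p = q" and \<gamma>inj: "(\<gamma> ^^ n) p = (\<gamma> ^^ n) q \<Longrightarrow> p = q" for n p q
    using pw by metis+
  \<comment> \<open>Since g has finite order, inverse powers are powers. Lying in the same cycle can
    thus be expressed by natural exponents and is still symmetric.\<close>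
  obtain M where M: "M > 0" "g ^^ M = id"
    using permutation_is_nilpotent[of g] g fin permutation_permutes by metis
  have gM: "(g ^^ (M * k)) p = p" for k p
    by (simp add: funpow_mult[symmetric] M(2))
  have \<gamma>pow: "(\<gamma> ^^ n) p = (g ^^ (M * n - n)) p" for n p
  proof (rule ginj[of n])
    have "n + (M * n - n) = M * n" using M(1) by simp
    then have "(g ^^ n) ((g ^^ (M * n - n)) p) = p" using gM[of n p] by (metis comp_apply funpow_add)
    then show "(g ^^ n) ((\<gamma> ^^ n) p) = (g ^^ n) ((g ^^ (M * n - n)) p)" using pw(2) by simp
  qed
  define same where "same = (\<lambda>p q. \<exists>n. q = (g ^^ n) p)"
  have same_refl: "same p p" for p unfolding same_def by (rule exI[of _ 0]) simp
  have same_trans: "same p q \<Longrightarrow> same q w \<Longrightarrow> same p w" for p q w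
    unfolding same_def by (metis comp_apply funpow_add)
  have same_sym: "same q p" if pq: "same p q" for p q
  proof -
    obtain n where "q = (g ^^ n) p" using pq unfolding same_def by blast
    then have "p = (\<gamma> ^^ n) q" using pw(1) by simp
    then show ?thesis using \<gamma>pow unfolding same_def by auto
  qed
  have same_g: "same p (g p)" for p unfolding same_def by (rule exI[of _ 1]) simp
  \<comment> \<open>A base point may depend only on the cycle. Preferring x and y controls the
    values of s there; the other cycles use their least element, which is why the type is
    well-ordered.\<close>
  define a where "a = (\<lambda>p. if same p x then x else if same p y then y else (LEAST q. same p q))"
  \<comment> \<open>On each cycle s sends a to c; these can differ only on a cycle that contains
    both x and y.\<close>
  define c where "c = (\<lambda>p. if same p x \<and> same x y then y else a p)"
  have same_eq: "same p = same q" if "same p q" for p q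
    using same_trans same_sym that by blast
  have const: "a p = a q" "c p = c q" if "same p q" for p q
    using same_eq[OF that] by (simp_all add: a_def c_def)
  have sa: "same p (a p)" for p
    unfolding a_def using LeastI[of "same p" p, OF same_refl] by simp
  have sc: "same p (c p)" for p
    unfolding c_def using sa same_trans by auto
  have ex: "\<exists>n. p = (g ^^ n) (a p)" for p using same_sym[OF sa] unfolding same_def .
  then obtain n where n: "\<And>p. p = (g ^^ n p) (a p)" by metis
  define s where "s = (\<lambda>p. (\<gamma> ^^ n p) (c p))"
  \<comment> \<open>The definition of s uses one chosen exponent. Powers of g that agree at one
    point of a cycle have inverses that agree at every point of it, so the choice is
    immaterial.\<close>
  have wd0: "(\<gamma> ^^ i) q = (\<gamma> ^^ j) q" if e: "(g ^^ i) p = (g ^^ j) p" and pq: "same p q" and ij: "i \<le> j" for i j p q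
  proof -
    obtain k where k: "q = (g ^^ k) p" using pq unfolding same_def by blast
    obtain d where d: "j = i + d" using ij le_iff_add by blast
    then have "(g ^^ i) ((g ^^ d) p) = (g ^^ i) p" using e by (simp add: funpow_add)
    then have "(g ^^ d) p = p" by (rule ginj)
    then have "(g ^^ d) q = q" unfolding k by (metis comp_apply funpow_add add.commute)
    then have "(\<gamma> ^^ d) q = q" using pw(1)[of d q] by simp
    then show ?thesis by (simp add: d funpow_add)
  qed
  have wd: "(\<gamma> ^^ i) q = (\<gamma> ^^ j) q" if "(g ^^ i) p = (g ^^ j) p" "same p q" for i j p q
    using wd0[of i p j q] wd0[of j p i q] that by (metis nat_le_linear)
  have s: "s ((g ^^ k) (a p)) = (\<gamma> ^^ k) (c p)" for k p
  proof -
    let ?q = "(g ^^ k) (a p)"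
    have pq: "same p ?q" using sa same_trans unfolding same_def by blast
    have "(g ^^ n ?q) (a p) = (g ^^ k) (a p)" using n[of ?q] const(1)[OF pq] by simp
    moreover have "same (a p) (c p)" using same_sym[OF sa] sc same_trans by blast
    ultimately show ?thesis unfolding s_def const(2)[OF pq, symmetric] by (rule wd)
  qed
  have sg: "s (g p) = \<gamma> (s p)" for p
  proof -
    have "s (g p) = s ((g ^^ Suc (n p)) (a p))" using n[of p] by simp
    also have "\<dots> = \<gamma> ((\<gamma> ^^ n p) (c p))" unfolding s by simp
    finally show ?thesis by (simp add: s_def)
  qed
  have ss: "same p (s p)" for p
    unfolding s_def \<gamma>pow using sc same_trans unfolding same_def by blast
  have inj: "inj s"
  proof (rule injI)
    fix p q assume e: "s p = s q"
    have pq: "same p q" using ss[of p] ss[of q] e same_sym same_trans by metis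
    have "(\<gamma> ^^ n p) (c p) = (\<gamma> ^^ n q) (c p)" using e const(2)[OF pq] by (simp add: s_def)
    moreover obtain k where k: "a p = (g ^^ k) (c p)"
      using same_trans[OF same_sym[OF sc[of p]] sa[of p]] unfolding same_def by blast
    ultimately have "(g ^^ n p) (a p) = (g ^^ n q) (a p)"
    proof -
      assume e: "(\<gamma> ^^ n p) (c p) = (\<gamma> ^^ n q) (c p)"
      have gg: "(g ^^ i) ((g ^^ j) z) = (g ^^ j) ((g ^^ i) z)" for i j z
        by (metis comp_apply funpow_add add.commute)
      have "(g ^^ n q) (c p) = (g ^^ n q) ((g ^^ n p) ((\<gamma> ^^ n p) (c p)))" using pw(2) by simp
      also have "\<dots> = (g ^^ n p) ((g ^^ n q) ((\<gamma> ^^ n q) (c p)))" unfolding e by (rule gg)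
      also have "\<dots> = (g ^^ n p) (c p)" using pw(2) by simp
      finally show ?thesis unfolding k by (simp add: gg[of _ k])
    qed
    then show "p = q" using n[of p] n[of q] const(1)[OF pq] by simp
  qed
  have gS: "(g ^^ i) p \<in> S \<longleftrightarrow> p \<in> S" for i p
    by (induction i) (use permutes_in_image[OF g] in auto)
  have sS: "s p \<in> S \<longleftrightarrow> p \<in> S" for p
    using ss[of p] gS unfolding same_def by metis
  have "s permutes S"
  proof (rule bij_imp_permutes)
    have "s ` S \<subseteq> S" using sS by blast
    then show "bij_betw s S S"
      using inj_on_subset[OF inj subset_UNIV, of S] fin by (simp add: bij_betw_def endo_inj_surj)
  next
    fix p assume "p \<notin> S"
    then have "(g ^^ i) p = p" for i by (induction i) (use permutes_not_in[OF g] in auto)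
    then show "s p = p" using ss[of p] unfolding same_def by metis
  qed
  moreover have "s ` {x, y} = {x, y}"
  proof (cases "same x y")
    case True
    have ax: "a x = x" "c x = y" using True same_refl by (auto simp: a_def c_def)
    have "s x = y" using s[of 0 x] ax by simp
    moreover obtain j where j: "y = (g ^^ j) x" using True unfolding same_def by blast
    moreover have "s y = x" using s[of j x] ax j pw(1) by simp
    ultimately show ?thesis by auto
  next
    case False
    have ny: "\<not> same y x" using False same_sym by blast
    have "a x = x" "c x = x" "a y = y" "c y = y" using False ny same_refl by (auto simp: a_def c_def)
    then have "s x = x" "s y = y" using s[of 0 x] s[of 0 y] by auto
    then show ?thesis by simp
  qed
  ultimately show ?thesis using that sg unfolding \<gamma>_def by blast
qed

text \<open>A permutation that stabilizes the second block also stabilizes the first; the components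
  are its restrictions, the second one shifted down by m.\<close>

lemma sym_embed_split:
  assumes s: "s permutes {1..m + k}" and img: "s ` {m + 1..m + k} = {m + 1..m + k}"
  obtains \<sigma> \<tau> where "\<sigma> permutes {1..m}" "\<tau> permutes {1..k}" "sym_embed m k (\<sigma>, \<tau>) = s"
proof -
  have low: "s ` {1..m} = {1..m}"
  proof -
    have "{1..m} = {1..m + k} - {m + 1..m + k}" by auto
    then have "s ` {1..m} = s ` {1..m + k} - s ` {m + 1..m + k}"
      using image_set_diff[OF permutes_inj[OF s]] by metis
    also have "\<dots> = {1..m + k} - {m + 1..m + k}" unfolding img permutes_image[OF s] ..
    finally show ?thesis by auto
  qed
  define \<sigma> where "\<sigma> = (\<lambda>i. if i \<in> {1..m} then s i else i)"
  define \<tau> where "\<tau> = (\<lambda>j. if j \<in> {1..k} then s (m + j) - m else j)"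
  have inj: "inj s" using permutes_inj[OF s] .
  have sm: "s i \<in> {1..m}" if "i \<in> {1..m}" for i using low that by blast
  have sk: "s (m + j) \<in> {m + 1..m + k}" if "j \<in> {1..k}" for j using img that by force
  have "\<sigma> permutes {1..m}"
  proof (rule bij_imp_permutes)
    have "inj_on \<sigma> {1..m}" using inj by (auto simp: inj_on_def \<sigma>_def)
    moreover have "\<sigma> ` {1..m} \<subseteq> {1..m}" using sm by (auto simp: \<sigma>_def)
    ultimately show "bij_betw \<sigma> {1..m} {1..m}" by (simp add: bij_betw_def endo_inj_surj)
  qed (auto simp: \<sigma>_def)
  moreover have "\<tau> permutes {1..k}"
  proof (rule bij_imp_permutes)
    have "inj_on \<tau> {1..k}"
    proof (rule inj_onI)
      fix i j assume ij: "i \<in> {1..k}" "j \<in> {1..k}" "\<tau> i = \<tau> j"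
      then have "s (m + i) = s (m + j)" using sk[OF ij(1)] sk[OF ij(2)] by (auto simp: \<tau>_def)
      then show "i = j" using injD[OF inj] by fastforce
    qed
    moreover have "\<tau> ` {1..k} \<subseteq> {1..k}" using sk by (force simp: \<tau>_def)
    ultimately show "bij_betw \<tau> {1..k} {1..k}" by (simp add: bij_betw_def endo_inj_surj)
  qed (auto simp: \<tau>_def)
  moreover have "sym_embed m k (\<sigma>, \<tau>) i = s i" for i
  proof (cases "i \<in> {m + 1..m + k}")
    case True
    then have "i - m \<in> {1..k}" "m + (i - m) = i" by auto
    then show ?thesis using True sk[of "i - m"] by (auto simp: sym_embed_def \<tau>_def)
  next
    case False
    then show ?thesis using permutes_not_in[OF s, of i] by (auto simp: sym_embed_def \<sigma>_def)
  qed
  ultimately show ?thesis using that by blast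
qed

lemma sym_embed_hom: "sym_embed m k \<in> hom (sym_group m \<times>\<times> sym_group k) (sym_group (m + k))"
proof (rule homI)
  fix x assume "x \<in> carrier (sym_group m \<times>\<times> sym_group k)"
  then show "sym_embed m k x \<in> carrier (sym_group (m + k))"
    using sym_embed_permutes by (auto simp: sym_group_carrier)
next
  fix x y assume "x \<in> carrier (sym_group m \<times>\<times> sym_group k)" "y \<in> carrier (sym_group m \<times>\<times> sym_group k)"
  then show "sym_embed m k (x \<otimes>\<^bsub>sym_group m \<times>\<times> sym_group k\<^esub> y) =
      sym_embed m k x \<otimes>\<^bsub>sym_group (m + k)\<^esub> sym_embed m k y"
    using sym_embed_comp by (auto simp: sym_group_carrier sym_group_mult)
qed

lemma sym_embed_conj_inverse:
  assumes k: "k \<le> 2" and g: "g \<in> carrier (sym_group (m + k))"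
  shows "\<exists>h\<in>carrier (sym_group m \<times>\<times> sym_group k). inv\<^bsub>sym_group (m + k)\<^esub> g =
    sym_embed m k h \<otimes>\<^bsub>sym_group (m + k)\<^esub> g \<otimes>\<^bsub>sym_group (m + k)\<^esub> inv\<^bsub>sym_group (m + k)\<^esub> (sym_embed m k h)"
proof -
  let ?G = "sym_group (m + k)"
  interpret group ?G by (rule sym_group_is_group)
  have gp: "g permutes {1..m + k}" using g by (simp add: sym_group_carrier)
  \<comment> \<open>For k = 1 and k = 2 the second block is {m + 1, y}, which is where the bound on
    k enters. For k = 0 the block is empty and the value of y is a default.\<close>
  define y where "y = (if k = 2 then m + 2 else m + 1)"
  obtain s where s: "s permutes {1..m + k}" "\<And>p. s (g p) = inv' g (s p)" "s ` {m + 1, y} = {m + 1, y}"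
    by (rule permutation_conj_inverse[OF gp finite_atLeastAtMost, of "m + 1" y]) blast
  have "s ` {m + 1..m + k} = {m + 1..m + k}"
  proof (cases "k = 0")
    case False
    then have "{m + 1..m + k} = {m + 1, y}" using k by (auto simp: y_def)
    then show ?thesis using s(3) by simp
  qed simp
  then obtain \<sigma> \<tau> where st: "\<sigma> permutes {1..m}" "\<tau> permutes {1..k}" "sym_embed m k (\<sigma>, \<tau>) = s"
    using sym_embed_split[OF s(1)] by blast
  have sG: "s \<in> carrier ?G" using s(1) by (simp add: sym_group_carrier)
  have gi: "inv' g \<in> carrier ?G" using permutes_inv[OF gp] by (simp add: sym_group_carrier)
  have "inv\<^bsub>?G\<^esub> g = inv' g"
    by (rule inv_equality[OF _ g gi]) (simp add: sym_group_mult sym_group_one permutes_inv_o[OF gp])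
  moreover have "s \<otimes>\<^bsub>?G\<^esub> g = inv' g \<otimes>\<^bsub>?G\<^esub> s" using s(2) by (auto simp: sym_group_mult)
  ultimately have "inv\<^bsub>?G\<^esub> g = s \<otimes>\<^bsub>?G\<^esub> g \<otimes>\<^bsub>?G\<^esub> inv\<^bsub>?G\<^esub> s"
    using m_assoc[OF gi sG inv_closed[OF sG]] r_inv[OF sG] r_one[OF gi] by metis
  then show ?thesis using st by (intro bexI[of _ "(\<sigma>, \<tau>)"]) (auto simp: sym_group_carrier)
qed

section \<open>Inducing a Specht module by one or two boxes\<close>

lemma finite_partitions: "finite {\<tau>. is_partition \<tau> \<and> sum_list \<tau> = n}"
proof (rule finite_subset)
  have "length \<tau> \<le> sum_list \<tau>" if "0 \<notin> set \<tau>" for \<tau> :: "nat list"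
    using that by (induction \<tau>) auto
  then show "{\<tau>. is_partition \<tau> \<and> sum_list \<tau> = n} \<subseteq> {\<tau>. set \<tau> \<subseteq> {..n} \<and> length \<tau> \<le> n}"
    by (auto simp: is_partition_def dest: member_le_sum_list)
qed (rule finite_lists_length_le, simp)

lemma subrep_representation:
  assumes W: "representation G W" and U: "cfun.subspace U" "U \<subseteq> rep_space W"
    and inv: "\<And>g u. g \<in> carrier G \<Longrightarrow> u \<in> U \<Longrightarrow> rep_act W g u \<in> U"
  shows "representation G (W\<lparr>rep_space := U\<rparr>)"
proof -
  have "linear_on U (rep_act W g)" if "g \<in> carrier G" for g
    using linear_on_subset[OF rep_linear[OF W that] U(2)] .
  moreover have "findim U" using findim_subset[OF rep_findim[OF W] U(2)] .
  moreover have "u \<in> rep_space W" if "u \<in> U" for u using U(2) that by blast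
  ultimately show ?thesis
    using U(1) inv rep_group[OF W] rep_one[OF W] rep_mult[OF W] unfolding representation_iff by simp
qed

lemma summand_imp_hom:
  assumes "summand G R W"
  obtains j where "ghom G R W j" "inj_on j (rep_space R)"
proof -
  obtain U U' where U: "rep_space W = {u + u' | u u'. u \<in> U \<and> u' \<in> U'}" "0 \<in> U'"
    "rep_iso G R (W\<lparr>rep_space := U\<rparr>)"
    using assms unfolding summand_def by blast
  then obtain f where f: "ghom G R (W\<lparr>rep_space := U\<rparr>) f" "bij_betw f (rep_space R) U"
    unfolding rep_iso_iff by auto
  have "u \<in> rep_space W" if "u \<in> U" for u
    unfolding U(1) using that U(2) add_0_right[of u, symmetric] by blast
  then have "ghom G R W f" using f(1) by (auto simp: ghom_def)
  then show ?thesis using that f(2) bij_betw_imp_inj_on by blast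
qed

text \<open>The complement of the image is the kernel of an equivariant retraction.\<close>

lemma hom_imp_summand:
  assumes R: "representation G R" and W: "representation G W" and fin: "finite (carrier G)"
    and j: "ghom G R W j" "inj_on j (rep_space R)"
  shows "summand G R W"
proof -
  obtain r where r: "ghom G W R r" "\<And>v. v \<in> rep_space R \<Longrightarrow> r (j v) = v"
    using ghom_retraction[OF R W fin j] by blast
  let ?U = "j ` rep_space R" and ?U' = "{w \<in> rep_space W. r w = 0}"
  have rU: "representation G (W\<lparr>rep_space := ?U\<rparr>)"
  proof (rule subrep_representation[OF W])
    show "cfun.subspace ?U" by (rule subspace_image[OF ghom_linear[OF j(1)] rep_subspace[OF R]])
    show "?U \<subseteq> rep_space W" using ghom_closed[OF j(1)] by blast
    fix g u assume g: "g \<in> carrier G" and "u \<in> ?U"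
    then show "rep_act W g u \<in> ?U" using ghom_act[OF j(1) g] rep_closed[OF R g] by force
  qed
  note rU
  moreover have "representation G (W\<lparr>rep_space := ?U'\<rparr>)"
  proof (rule subrep_representation[OF W])
    show "cfun.subspace ?U'"
      by (rule cfun.subspaceI)
        (auto simp: linear_on_zero[OF ghom_linear[OF r(1)] rep_subspace[OF W]]
          linear_on_add[OF ghom_linear[OF r(1)]] linear_on_scale[OF ghom_linear[OF r(1)]]
          cfun.subspace_0[OF rep_subspace[OF W]] cfun.subspace_add[OF rep_subspace[OF W]]
          cfun.subspace_scale[OF rep_subspace[OF W]])
  qed (use ghom_act[OF r(1)] rep_closed[OF W] act_zero[OF R] in auto)
  moreover have "rep_space W = {u + u' | u u'. u \<in> ?U \<and> u' \<in> ?U'}"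
  proof (intro subset_antisym subsetI)
    fix w assume w: "w \<in> rep_space W"
    have jr: "j (r w) \<in> rep_space W" using ghom_closed[OF j(1) ghom_closed[OF r(1) w]] .
    have "r (w - j (r w)) = 0"
      using linear_on_diff[OF ghom_linear[OF r(1)] rep_subspace[OF W] w jr] r(2)[OF ghom_closed[OF r(1) w]] by simp
    then have "w - j (r w) \<in> ?U'" using cfun.subspace_diff[OF rep_subspace[OF W] w jr] by simp
    moreover have "j (r w) \<in> ?U" using ghom_closed[OF r(1) w] by blast
    moreover have "w = j (r w) + (w - j (r w))" by simp
    ultimately show "w \<in> {u + u' | u u'. u \<in> ?U \<and> u' \<in> ?U'}" by blast
  next
    fix w assume "w \<in> {u + u' | u u'. u \<in> ?U \<and> u' \<in> ?U'}"
    then obtain v u' where "w = j v + u'" "v \<in> rep_space R" "u' \<in> rep_space W" by blast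
    then show "w \<in> rep_space W"
      using cfun.subspace_add[OF rep_subspace[OF W] ghom_closed[OF j(1)]] by simp
  qed
  moreover have "?U \<inter> ?U' = {0}"
  proof -
    have j0: "j 0 = 0" using linear_on_zero[OF ghom_linear[OF j(1)] rep_subspace[OF R]] .
    have "w = 0" if w: "w \<in> ?U \<inter> ?U'" for w
    proof -
      obtain v where v: "w = j v" "v \<in> rep_space R" "r w = 0" using w by blast
      then have "v = 0" using r(2)[OF v(2)] by simp
      then show ?thesis using v(1) j0 by simp
    qed
    moreover have "0 \<in> ?U" using j0 cfun.subspace_0[OF rep_subspace[OF R]] by (metis imageI)
    moreover have "0 \<in> ?U'"
      using linear_on_zero[OF ghom_linear[OF r(1)] rep_subspace[OF W]] cfun.subspace_0[OF rep_subspace[OF W]] by simp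
    ultimately show ?thesis by blast
  qed
  moreover have "rep_iso G R (W\<lparr>rep_space := ?U\<rparr>)"
  proof -
    have "ghom G R (W\<lparr>rep_space := ?U\<rparr>) j" using j(1) by (auto simp: ghom_def)
    moreover have "bij_betw j (rep_space R) ?U" using j(2) by (simp add: bij_betw_def)
    ultimately show ?thesis using R rU unfolding rep_iso_iff by auto
  qed
  ultimately show ?thesis using W unfolding summand_def by blast
qed

text \<open>The assumption \<open>mult\<close> says that the homomorphisms from a Specht module to W
  form a space of dimension at most one. The projections onto the Specht summands then separate
  points: otherwise their common kernel would contain a Specht module whose embedding is
  proportional to the chosen j, although p after j is the identity.\<close>

lemma multiplicity_free_is_sum:
  assumes W: "representation (sym_group n) W"
    and mult: "\<And>\<tau> f f' v. is_partition \<tau> \<Longrightarrow> sum_list \<tau> = n \<Longrightarrow> ghom (sym_group n) (specht \<tau>) W f \<Longrightarrow>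
      ghom (sym_group n) (specht \<tau>) W f' \<Longrightarrow> v \<in> rep_space (specht \<tau>) \<Longrightarrow> f v \<noteq> 0 \<Longrightarrow>
      \<exists>c. \<forall>v\<in>rep_space (specht \<tau>). f' v = cscale c (f v)"
  obtains p where "is_sum (sym_group n) {\<tau>. is_partition \<tau> \<and> sum_list \<tau> = n \<and> summand (sym_group n) (specht \<tau>) W} specht W p"
proof -
  let ?G = "sym_group n"
  define I where "I = {\<tau>. is_partition \<tau> \<and> sum_list \<tau> = n \<and> summand ?G (specht \<tau>) W}"
  have finI: "finite I" unfolding I_def by (rule finite_subset[OF _ finite_partitions[of n]]) auto
  have rS: "representation ?G (specht \<tau>)" if "\<tau> \<in> I" for \<tau>
    using specht_rep[of \<tau>] that by (simp add: I_def)
  have "\<exists>j p. ghom ?G (specht \<tau>) W j \<and> ghom ?G W (specht \<tau>) p \<and> (\<forall>v\<in>rep_space (specht \<tau>). p (j v) = v)"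
    if \<tau>: "\<tau> \<in> I" for \<tau>
  proof -
    have sm: "summand ?G (specht \<tau>) W" using \<tau> by (simp add: I_def)
    obtain j where j: "ghom ?G (specht \<tau>) W j" "inj_on j (rep_space (specht \<tau>))"
      using summand_imp_hom[OF sm] .
    obtain p where "ghom ?G W (specht \<tau>) p" "\<And>v. v \<in> rep_space (specht \<tau>) \<Longrightarrow> p (j v) = v"
      using ghom_retraction[OF rS[OF \<tau>] W finite_sym_group j] by blast
    then show ?thesis using j by blast
  qed
  then obtain j p where j: "\<And>\<tau>. \<tau> \<in> I \<Longrightarrow> ghom ?G (specht \<tau>) W (j \<tau>)"
    and p: "\<And>\<tau>. \<tau> \<in> I \<Longrightarrow> ghom ?G W (specht \<tau>) (p \<tau>)"
    and pj: "\<And>\<tau> v. \<tau> \<in> I \<Longrightarrow> v \<in> rep_space (specht \<tau>) \<Longrightarrow> p \<tau> (j \<tau> v) = v" by metis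
  \<comment> \<open>Composites between different shapes vanish, so the projections can be prescribed
    independently.\<close>
  have p0: "p \<sigma> (j \<tau> v) = 0" if st: "\<sigma> \<in> I" "\<tau> \<in> I" "\<sigma> \<noteq> \<tau>" and v: "v \<in> rep_space (specht \<tau>)" for \<sigma> \<tau> v
  proof (rule ccontr)
    assume nz: "p \<sigma> (j \<tau> v) \<noteq> 0"
    have "ghom ?G (specht \<tau>) (specht \<sigma>) (\<lambda>v. p \<sigma> (j \<tau> v))" by (rule ghom_comp[OF j[OF st(2)] p[OF st(1)]])
    then have "\<tau> = \<sigma>"
      using specht_hom_eq[of \<tau> \<sigma> "\<lambda>v. p \<sigma> (j \<tau> v)" v] st v nz by (auto simp: I_def)
    then show False using st by simp
  qed
  note lin = ghom_linear[OF p] and sW = rep_subspace[OF W]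
  have "is_sum ?G I specht W p"
  proof (rule is_sumI[OF W rS p])
    fix r assume r: "\<And>\<tau>. \<tau> \<in> I \<Longrightarrow> r \<tau> \<in> rep_space (specht \<tau>)"
    have jr: "j \<tau> (r \<tau>) \<in> rep_space W" if "\<tau> \<in> I" for \<tau> using ghom_closed[OF j[OF that] r[OF that]] .
    have "p \<sigma> (\<Sum>\<tau>\<in>I. j \<tau> (r \<tau>)) = r \<sigma>" if \<sigma>: "\<sigma> \<in> I" for \<sigma>
    proof -
      have "p \<sigma> (\<Sum>\<tau>\<in>I. j \<tau> (r \<tau>)) = (\<Sum>\<tau>\<in>I. p \<sigma> (j \<tau> (r \<tau>)))"
        by (rule linear_on_sum[OF lin[OF \<sigma>] sW jr])
      also have "\<dots> = (\<Sum>\<tau>\<in>I. if \<tau> = \<sigma> then r \<sigma> else 0)"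
        using p0[OF \<sigma>] pj r by (intro sum.cong refl) auto
      also have "\<dots> = r \<sigma>" using finI \<sigma> by simp
      finally show ?thesis .
    qed
    moreover have "(\<Sum>\<tau>\<in>I. j \<tau> (r \<tau>)) \<in> rep_space W" using jr by (intro cfun.subspace_sum[OF sW])
    ultimately show "\<exists>v\<in>rep_space W. \<forall>\<tau>\<in>I. p \<tau> v = r \<tau>" by blast
  next
    fix u v assume u: "u \<in> rep_space W" and v: "v \<in> rep_space W" and e: "\<And>\<tau>. \<tau> \<in> I \<Longrightarrow> p \<tau> u = p \<tau> v"
    define U where "U = {w \<in> rep_space W. \<forall>\<tau>\<in>I. p \<tau> w = 0}"
    have uvU: "u - v \<in> U"
      unfolding U_def using e linear_on_diff[OF lin sW u v] cfun.subspace_diff[OF sW u v] by simp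
    have rU: "representation ?G (W\<lparr>rep_space := U\<rparr>)"
    proof (rule subrep_representation[OF W])
      show "cfun.subspace U"
        by (rule cfun.subspaceI)
          (auto simp: U_def linear_on_zero[OF lin sW] linear_on_add[OF lin] linear_on_scale[OF lin]
            cfun.subspace_0[OF sW] cfun.subspace_add[OF sW] cfun.subspace_scale[OF sW])
    qed (use ghom_act[OF p] rep_closed[OF W] act_zero[OF rS] in \<open>auto simp: U_def\<close>)
    show "u = v"
    proof (rule ccontr)
      assume "u \<noteq> v"
      then have "u - v \<noteq> 0" by simp
      then obtain \<sigma> f x where \<sigma>: "is_partition \<sigma>" "sum_list \<sigma> = n"
        and f: "ghom ?G (specht \<sigma>) (W\<lparr>rep_space := U\<rparr>) f" and x: "x \<in> rep_space (specht \<sigma>)" "f x \<noteq> 0"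
        using specht_hom_exists[OF rU, of "u - v"] uvU by auto
      have fU: "f y \<in> U" if "y \<in> rep_space (specht \<sigma>)" for y using ghom_closed[OF f that] by simp
      then have fW: "ghom ?G (specht \<sigma>) W f" using f by (auto simp: ghom_def U_def)
      have rs: "representation ?G (specht \<sigma>)" using specht_rep[of \<sigma>] \<sigma> by simp
      have "inj_on f (rep_space (specht \<sigma>))"
        using specht_hom_inj[of \<sigma> W f x] \<sigma> fW x act_zero[OF W] by simp
      then have sI: "\<sigma> \<in> I"
        using hom_imp_summand[OF rs W finite_sym_group fW] \<sigma> by (simp add: I_def)
      obtain c where c: "\<And>y. y \<in> rep_space (specht \<sigma>) \<Longrightarrow> j \<sigma> y = cscale c (f y)"
        using mult[OF \<sigma> fW j[OF sI] x] by blast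
      have "p \<sigma> (j \<sigma> x) = cscale c (p \<sigma> (f x))"
        using c[OF x(1)] linear_on_scale[OF lin[OF sI] ghom_closed[OF fW x(1)]] by simp
      also have "\<dots> = 0" using fU[OF x(1)] sI by (simp add: U_def)
      finally have "x = 0" using pj[OF sI x(1)] by simp
      then show False using x(2) linear_on_zero[OF ghom_linear[OF fW] rep_subspace[OF rs]] by simp
    qed
  qed
  then show ?thesis using that unfolding I_def by blast
qed

lemma one_dim_rep:
  assumes "group G" "\<And>g h. g \<in> carrier G \<Longrightarrow> h \<in> carrier G \<Longrightarrow> \<chi> (g \<otimes>\<^bsub>G\<^esub> h) = \<chi> g * \<chi> h" "\<chi> \<one>\<^bsub>G\<^esub> = 1"
  shows "representation G (one_dim \<chi>)"
proof -
  have "v = cscale (v ()) (\<lambda>_. 1)" for v :: "unit \<Rightarrow> complex" by (simp add: pointwise)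
  then have "v \<in> cfun.span {\<lambda>_. 1}" for v :: "unit \<Rightarrow> complex"
    by (metis cfun.span_base cfun.span_scale insertI1)
  then have "findim (UNIV :: (unit \<Rightarrow> complex) set)" unfolding findim_def by (intro exI[of _ "{\<lambda>_. 1}"]) auto
  then show ?thesis
    unfolding representation_iff one_dim_def using assms
    by (auto simp: linear_on_def cfun.scale_right_distrib mult.commute)
qed

text \<open>By reciprocity, homomorphisms from a Specht module into the induced module correspond to
  H-homomorphisms into \<open>specht \<alpha> \<boxtimes> one_dim \<chi>\<close>, and the criterion
  for multiplicity one shows that these are proportional.\<close>

lemma is_sum_induced_specht:
  assumes \<alpha>: "is_partition \<alpha>" and k: "k \<le> 2"
    and \<chi>: "\<And>g h. g \<in> carrier (sym_group k) \<Longrightarrow> h \<in> carrier (sym_group k) \<Longrightarrow> \<chi> (g \<circ> h) = \<chi> g * \<chi> h" "\<chi> id = 1"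
  obtains p where "is_sum (sym_group (sum_list \<alpha> + k)) (ind_summands k \<chi> \<alpha>) specht
    (induced (sym_group (sum_list \<alpha> + k)) (sym_group (sum_list \<alpha>) \<times>\<times> sym_group k) (sym_embed (sum_list \<alpha>) k)
      (specht \<alpha> \<boxtimes> one_dim \<chi>)) p"
proof -
  define m where "m = sum_list \<alpha>"
  let ?G = "sym_group (m + k)" and ?H = "sym_group m \<times>\<times> sym_group k" and ?W = "specht \<alpha> \<boxtimes> one_dim \<chi>"
  let ?I = "induced ?G ?H (sym_embed m k) ?W"
  have rS: "representation (sym_group m) (specht \<alpha>)" using specht_rep by (simp add: m_def)
  have r1: "representation (sym_group k) (one_dim \<chi>)"
    by (rule one_dim_rep) (use \<chi> in \<open>simp_all add: sym_group_is_group sym_group_mult sym_group_one\<close>)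
  note rW = tensor_rep[OF rS r1]
  have H: "group ?H" by (rule DirProd_group[OF sym_group_is_group sym_group_is_group])
  have finH: "finite (carrier ?H)" by (simp add: finite_sym_group)
  have coind: "coinduced ?G ?H (sym_embed m k) ?W ?I (\<lambda>F x. F (\<one>\<^bsub>?G\<^esub>, x))"
    by (rule induced_coind[OF rW sym_group_is_group finite_sym_group sym_embed_hom])
  note rI = coind_rep(1)[OF coind]
  \<comment> \<open>As \<open>unit\<close> has a single point, \<open>sl\<close> and
    \<open>js\<close> identify the tensor product with the Specht module as vector spaces.\<close>
  define sl where "sl = (\<lambda>(F :: (nat \<Rightarrow> nat set) \<times> unit \<Rightarrow> complex) x. F (x, ()))"
  define js where "js = (\<lambda>(v :: (nat \<Rightarrow> nat set) \<Rightarrow> complex) (x, y :: unit). v x)"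
  have sl: "sl F \<in> rep_space (specht \<alpha>)" if "F \<in> rep_space ?W" for F
    unfolding sl_def by (rule tensor_slice1[OF rep_subspace[OF rS] that])
  have js: "js v \<in> rep_space ?W" if "v \<in> rep_space (specht \<alpha>)" for v
  proof -
    have "js v = ptensor v (\<lambda>_. 1)" by (simp add: js_def ptensor_def)
    then show ?thesis using ptensor_mem[OF that, of "\<lambda>_. 1" "one_dim \<chi>"] by (simp add: one_dim_def)
  qed
  have sljs [simp]: "sl (js v) = v" "js (sl F) = F" for v F by (auto simp: sl_def js_def)
  have act: "sl (rep_act ?W (g, h) F) = cscale (\<chi> h) (perm_act g (sl F))" for g h F
    by (simp add: ext_tensor_act tmap1_def tmap2_def sl_def one_dim_def specht_act cscale_def)
  have sl_lin: "linear_on V sl" for V by (simp add: linear_on_def sl_def pointwise)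
  have js_lin: "linear_on V js" for V by (auto simp: linear_on_def js_def pointwise)
  have id1: "id \<in> carrier (sym_group j)" for j by (simp add: sym_group_carrier permutes_id)
  have schurW: "\<exists>c. \<forall>F\<in>rep_space ?W. f F = cscale c F" if f: "ghom ?H ?W ?W f" for f
  proof -
    have "ghom (sym_group m) (specht \<alpha>) (specht \<alpha>) (\<lambda>v. sl (f (js v)))"
      unfolding ghom_def
    proof (intro conjI ballI)
      show "linear_on (rep_space (specht \<alpha>)) (\<lambda>v. sl (f (js v)))"
        by (rule linear_on_comp[OF linear_on_comp[OF js_lin _ ghom_linear[OF f]] _ sl_lin[of UNIV]])
          (use js in auto)
      fix v assume v: "v \<in> rep_space (specht \<alpha>)"
      show "sl (f (js v)) \<in> rep_space (specht \<alpha>)" using sl ghom_closed[OF f] js[OF v] by blast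
      fix g assume g: "g \<in> carrier (sym_group m)"
      have "js (perm_act g v) = rep_act ?W (g, id) (js v)"
        using arg_cong[OF act[of g id "js v"], of js] \<chi>(2) by simp
      then have "sl (f (js (perm_act g v))) = perm_act g (sl (f (js v)))"
        using ghom_act[OF f _ js[OF v], of "(g, id)"] g id1 act[of g id] \<chi>(2) by simp
      then show "sl (f (js (rep_act (specht \<alpha>) g v))) = rep_act (specht \<alpha>) g (sl (f (js v)))"
        by (simp add: specht_act)
    qed
    then obtain c where c: "\<And>v. v \<in> rep_space (specht \<alpha>) \<Longrightarrow> sl (f (js v)) = cscale c v"
      using specht_schur[OF \<alpha>] unfolding m_def by blast
    have "f F = cscale c F" if F: "F \<in> rep_space ?W" for F
    proof -
      have "js (sl (f (js (sl F)))) = js (cscale c (sl F))" using c[OF sl[OF F]] by simp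
      then show ?thesis using linear_on_scale[OF js_lin, of "sl F" UNIV c] by simp
    qed
    then show ?thesis by blast
  qed
  have mult: "\<exists>c. \<forall>v\<in>rep_space (specht \<tau>). f' v = cscale c (f v)"
    if \<tau>: "is_partition \<tau>" "sum_list \<tau> = m + k" and f: "ghom ?G (specht \<tau>) ?I f"
      and f': "ghom ?G (specht \<tau>) ?I f'" and v: "v \<in> rep_space (specht \<tau>)" "f v \<noteq> 0" for \<tau> f f' v
  proof -
    let ?e = "\<lambda>F x. F (\<one>\<^bsub>?G\<^esub>, x)"
    have rT: "representation ?G (specht \<tau>)" using specht_rep[of \<tau>] \<tau> by simp
    \<comment> \<open>Reciprocity: a homomorphism into the induced module is followed by evaluation
      at 1.\<close>
    have ef: "ghom ?H (res_rep (sym_embed m k) (specht \<tau>)) ?W (\<lambda>v. ?e (f v))" if "ghom ?G (specht \<tau>) ?I f" for f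
      using ghom_comp[of ?H "res_rep (sym_embed m k) (specht \<tau>)" "res_rep (sym_embed m k) ?I" f ?W ?e]
        coind_ghom[OF coind] that coind_carrier[OF coind] by (auto simp: ghom_def)
    have efg: "?e (rep_act ?I g (f w)) = ?e (f (rep_act (specht \<tau>) g w))"
      if "ghom ?G (specht \<tau>) ?I f" "g \<in> carrier ?G" "w \<in> rep_space (specht \<tau>)" for f g w
      using ghom_act[OF that] by simp
    have "\<exists>w\<in>rep_space (specht \<tau>). ?e (f w) \<noteq> 0"
    proof (rule ccontr)
      assume z: "\<not> ?thesis"
      have "f v = 0"
      proof (rule coind_unique[OF coind ghom_closed[OF f v(1)] cfun.subspace_0[OF rep_subspace[OF rI]]])
        fix g assume g: "g \<in> carrier ?G"
        have "?e (rep_act ?I g (f v)) = 0" using efg[OF f g v(1)] z rep_closed[OF rT g v(1)] by simp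
        moreover have "?e (rep_act ?I g 0) = 0" unfolding act_zero[OF rI g] by (simp add: pointwise)
        ultimately show "?e (rep_act ?I g (f v)) = ?e (rep_act ?I g 0)" by simp
      qed
      then show False using v(2) by simp
    qed
    then obtain w where w: "w \<in> rep_space (specht \<tau>)" "?e (f w) \<noteq> 0" by blast
    \<comment> \<open>The image is a nonzero subspace of an irreducible module. Invariance is tested
      on elements (g, id), where \<chi> is 1.\<close>
    have surj: "(\<lambda>v. ?e (f v)) ` rep_space (specht \<tau>) = rep_space ?W"
    proof -
      let ?U = "(\<lambda>v. ?e (f v)) ` rep_space (specht \<tau>)"
      have UW: "?U \<subseteq> rep_space ?W" using ghom_closed[OF ef[OF f]] by auto
      have sU: "cfun.subspace ?U"
        using subspace_image[OF ghom_linear[OF ef[OF f]]] rep_subspace[OF rT] by simp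
      have "sl ` ?U = rep_space (specht \<alpha>)"
      proof (rule specht_irreducible[OF \<alpha>])
        show "cfun.subspace (sl ` ?U)" by (rule subspace_image[OF sl_lin sU])
        show "sl ` ?U \<subseteq> rep_space (specht \<alpha>)" using sl UW by blast
        show "sl (?e (f w)) \<in> sl ` ?U" using w(1) by blast
        show "sl (?e (f w)) \<noteq> 0"
        proof
          assume "sl (?e (f w)) = 0"
          then have "js (sl (?e (f w))) = 0" by (auto simp: js_def pointwise)
          then show False using w(2) by simp
        qed
        fix g u assume g: "g permutes {1..sum_list \<alpha>}" and "u \<in> sl ` ?U"
        then obtain x where x: "x \<in> rep_space (specht \<tau>)" "u = sl (?e (f x))" by blast
        have gH: "(g, id) \<in> carrier ?H" using g id1 by (simp add: sym_group_carrier m_def)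
        have "?e (f (rep_act (specht \<tau>) (sym_embed m k (g, id)) x)) = rep_act ?W (g, id) (?e (f x))"
          using ghom_act[OF ef[OF f] gH] x(1) by simp
        then have "perm_act g u = sl (?e (f (rep_act (specht \<tau>) (sym_embed m k (g, id)) x)))"
          using act[of g id "?e (f x)"] \<chi>(2) x(2) by simp
        then show "perm_act g u \<in> sl ` ?U"
          using rep_closed[OF rT coind_carrier[OF coind gH] x(1)] by blast
      qed
      then have "F \<in> ?U" if "F \<in> rep_space ?W" for F
        using sl[OF that] sljs(2) by (metis (no_types, lifting) imageE)
      then show ?thesis using UW by blast
    qed
    obtain t where t: "tableau \<tau> t" using tableau_exists .
    interpret rt: real_type ?G "specht \<tau>" "tabloids \<tau>" "polytabloid \<tau> t"
      using specht_real_type[OF \<tau>(1) t] \<tau>(2) by simp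
    obtain c where c: "\<And>x. x \<in> rep_space (specht \<tau>) \<Longrightarrow> ?e (f' x) = cscale c (?e (f x))"
      using rt.multiplicity_one[OF H finH sym_embed_hom sym_embed_conj_inverse[OF k] rW schurW ef[OF f] surj ef[OF f']]
      by blast
    \<comment> \<open>Proportionality after evaluation at 1 spreads to every g by
      equivariance.\<close>
    have "f' x = cscale c (f x)" if x: "x \<in> rep_space (specht \<tau>)" for x
    proof (rule coind_unique[OF coind ghom_closed[OF f' x]])
      show "cscale c (f x) \<in> rep_space ?I"
        using cfun.subspace_scale[OF rep_subspace[OF rI] ghom_closed[OF f x]] .
      fix g assume g: "g \<in> carrier ?G"
      have "?e (rep_act ?I g (f' x)) = cscale c (?e (rep_act ?I g (f x)))"
        using efg[OF f' g x] efg[OF f g x] c[OF rep_closed[OF rT g x]] by simp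
      also have "\<dots> = ?e (cscale c (rep_act ?I g (f x)))" by (simp add: cscale_def)
      also have "cscale c (rep_act ?I g (f x)) = rep_act ?I g (cscale c (f x))"
        using linear_on_scale[OF rep_linear[OF rI g] ghom_closed[OF f x]] by simp
      finally show "?e (rep_act ?I g (f' x)) = ?e (rep_act ?I g (cscale c (f x)))" .
    qed
    then show ?thesis by blast
  qed
  have "ind_summands k \<chi> \<alpha> = {\<tau>. is_partition \<tau> \<and> sum_list \<tau> = m + k \<and> summand ?G (specht \<tau>) ?I}"
    by (simp add: ind_summands_def Let_def m_def)
  moreover obtain p where "is_sum ?G {\<tau>. is_partition \<tau> \<and> sum_list \<tau> = m + k \<and> summand ?G (specht \<tau>) ?I} specht ?I p"
    by (rule multiplicity_free_is_sum[OF rI mult])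
  ultimately show ?thesis using that by (simp add: m_def)
qed

section \<open>Representations of wreath products\<close>

definition group_char :: "('f, 'm) monoid_scheme \<Rightarrow> ('f \<Rightarrow> complex) \<Rightarrow> bool"
  where "group_char F D \<longleftrightarrow> (\<forall>x\<in>carrier F. \<forall>y\<in>carrier F. D (x \<otimes>\<^bsub>F\<^esub> y) = D x * D y) \<and> D \<one>\<^bsub>F\<^esub> = 1"

lemma wreath_carrier: "(f, \<sigma>) \<in> carrier (wreath F m) \<longleftrightarrow> f \<in> (\<Pi>\<^sub>E i\<in>{1..m}. carrier F) \<and> \<sigma> permutes {1..m}"
  by (simp add: wreath_def Let_def sym_group_carrier)

lemma wreath_mult: "(f, \<sigma>) \<otimes>\<^bsub>wreath F m\<^esub> (g, \<tau>) =
    (\<lambda>i\<in>{1..m}. f i \<otimes>\<^bsub>F\<^esub> (\<lambda>i\<in>{1..m}. g (inv' \<sigma> i)) i, \<sigma> \<circ> \<tau>)"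
  by (simp add: wreath_def Let_def sym_group_mult)

lemma wreath_one: "\<one>\<^bsub>wreath F m\<^esub> = (\<lambda>i\<in>{1..m}. \<one>\<^bsub>F\<^esub>, id)"
  by (simp add: wreath_def Let_def sym_group_one)

lemma wreath_rep_space [simp]: "rep_space (wreath_rep m D E) = rep_space E"
  by (simp add: wreath_rep_def)

lemma wreath_rep_act: "rep_act (wreath_rep m D E) (f, \<sigma>) v = cscale (\<Prod>i=1..m. D (f i)) (rep_act E \<sigma> v)"
  by (simp add: wreath_rep_def)

text \<open>The product of the D (f i) does not change when the coordinates are permuted, so it
  gives a character of the whole wreath product by which the action of the symmetric group is
  twisted.\<close>

lemma wreath_rep_rep:
  assumes F: "group F" and D: "group_char F D" and E: "representation (sym_group m) E"
  shows "representation (wreath F m) (wreath_rep m D E)"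
  unfolding representation_iff wreath_rep_space
proof (intro conjI ballI)
  show "group (wreath F m)" using wreath_group[OF F] .
  show "cfun.subspace (rep_space E)" "findim (rep_space E)" using rep_subspace[OF E] rep_findim[OF E] .
next
  fix x assume x: "x \<in> carrier (wreath F m)"
  obtain f \<sigma> where fs: "x = (f, \<sigma>)" by force
  then have s: "\<sigma> \<in> carrier (sym_group m)" using x by (simp add: wreath_carrier sym_group_carrier)
  show "linear_on (rep_space E) (rep_act (wreath_rep m D E) x)"
    unfolding fs linear_on_def wreath_rep_act
    using linear_on_add[OF rep_linear[OF E s]] linear_on_scale[OF rep_linear[OF E s]]
    by (simp add: cfun.scale_right_distrib mult.commute)
  show "rep_act (wreath_rep m D E) x v \<in> rep_space E" if "v \<in> rep_space E" for v
    unfolding fs wreath_rep_act using cfun.subspace_scale[OF rep_subspace[OF E]] rep_closed[OF E s that] by blast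
next
  fix v assume v: "v \<in> rep_space E"
  have "(\<Prod>i=1..m. D ((\<lambda>i\<in>{1..m}. \<one>\<^bsub>F\<^esub>) i)) = 1" using D by (simp add: group_char_def)
  then show "rep_act (wreath_rep m D E) \<one>\<^bsub>wreath F m\<^esub> v = v"
    unfolding wreath_one wreath_rep_act using rep_one[OF E v] by (simp add: sym_group_one)
  fix x y assume x: "x \<in> carrier (wreath F m)" and y: "y \<in> carrier (wreath F m)"
  obtain f \<sigma> g \<tau> where fg: "x = (f, \<sigma>)" "y = (g, \<tau>)" by force
  have c: "\<And>i. i \<in> {1..m} \<Longrightarrow> f i \<in> carrier F" "\<And>i. i \<in> {1..m} \<Longrightarrow> g i \<in> carrier F"
    "\<sigma> permutes {1..m}" "\<tau> permutes {1..m}"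
    using x y by (auto simp: fg wreath_carrier)
  have si: "inv' \<sigma> permutes {1..m}" using permutes_inv[OF c(3)] .
  have "(\<Prod>i=1..m. D ((\<lambda>i\<in>{1..m}. f i \<otimes>\<^bsub>F\<^esub> (\<lambda>i\<in>{1..m}. g (inv' \<sigma> i)) i) i)) =
      (\<Prod>i=1..m. D (f i) * D (g (inv' \<sigma> i)))"
  proof (intro prod.cong refl)
    fix i assume i: "i \<in> {1..m}"
    then have "inv' \<sigma> i \<in> {1..m}" using permutes_in_image[OF si] by blast
    then show "D ((\<lambda>i\<in>{1..m}. f i \<otimes>\<^bsub>F\<^esub> (\<lambda>i\<in>{1..m}. g (inv' \<sigma> i)) i) i) = D (f i) * D (g (inv' \<sigma> i))"
      using D c(1)[OF i] c(2) i by (simp add: group_char_def)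
  qed
  also have "\<dots> = (\<Prod>i=1..m. D (f i)) * (\<Prod>i=1..m. D (g i))"
    using prod.permute[OF si, of "\<lambda>i. D (g i)"] by (simp add: prod.distrib comp_def)
  finally have p: "(\<Prod>i=1..m. D ((\<lambda>i\<in>{1..m}. f i \<otimes>\<^bsub>F\<^esub> (\<lambda>i\<in>{1..m}. g (inv' \<sigma> i)) i) i)) =
      (\<Prod>i=1..m. D (f i)) * (\<Prod>i=1..m. D (g i))" .
  have st: "\<sigma> \<in> carrier (sym_group m)" "\<tau> \<in> carrier (sym_group m)" using c by (auto simp: sym_group_carrier)
  show "rep_act (wreath_rep m D E) (x \<otimes>\<^bsub>wreath F m\<^esub> y) v =
      rep_act (wreath_rep m D E) x (rep_act (wreath_rep m D E) y v)"
    unfolding fg wreath_mult wreath_rep_act p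
    using rep_mult[OF E st v] linear_on_scale[OF rep_linear[OF E st(1)] rep_closed[OF E st(2) v]]
    by (simp add: sym_group_mult)
qed

lemma is_sum_wreath:
  assumes F: "group F" and D: "group_char F D" and E: "is_sum (sym_group m) I S E p"
  shows "is_sum (wreath F m) I (\<lambda>i. wreath_rep m D (S i)) (wreath_rep m D E) p"
proof (rule is_sumI)
  show "representation (wreath F m) (wreath_rep m D E)"
    by (rule wreath_rep_rep[OF F D is_sum_rep(1)[OF E]])
  fix i assume i: "i \<in> I"
  show "representation (wreath F m) (wreath_rep m D (S i))"
    by (rule wreath_rep_rep[OF F D is_sum_rep(2)[OF E i]])
  note pi = is_sum_ghom[OF E i]
  have "p i (rep_act (wreath_rep m D E) x v) = rep_act (wreath_rep m D (S i)) x (p i v)"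
    if x: "x \<in> carrier (wreath F m)" and v: "v \<in> rep_space E" for x v
  proof -
    obtain f \<sigma> where fs: "x = (f, \<sigma>)" by force
    then have s: "\<sigma> \<in> carrier (sym_group m)" using x by (simp add: wreath_carrier sym_group_carrier)
    show ?thesis
      unfolding fs wreath_rep_act
      using linear_on_scale[OF ghom_linear[OF pi] rep_closed[OF is_sum_rep(1)[OF E] s v]] ghom_act[OF pi s v] by simp
  qed
  then show "ghom (wreath F m) (wreath_rep m D E) (wreath_rep m D (S i)) (p i)"
    using ghom_linear[OF pi] ghom_closed[OF pi] by (simp add: ghom_def)
next
  fix r assume "\<And>i. i \<in> I \<Longrightarrow> r i \<in> rep_space (wreath_rep m D (S i))"
  then show "\<exists>v\<in>rep_space (wreath_rep m D E). \<forall>i\<in>I. p i v = r i"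
    using is_sum_ex1[OF E, of r] by auto
next
  fix u v assume "u \<in> rep_space (wreath_rep m D E)" "v \<in> rep_space (wreath_rep m D E)" "\<And>i. i \<in> I \<Longrightarrow> p i u = p i v"
  then show "u = v" using is_sum_unique[OF E] by simp
qed

lemma wreath_embed_prod:
  "(\<Prod>i=1..a + k. D (fst (wreath_embed a k ((f, \<sigma>), (g, \<tau>))) i)) = (\<Prod>i=1..a. D (f i)) * (\<Prod>i=1..k. D (g i))"
proof -
  let ?h = "fst (wreath_embed a k ((f, \<sigma>), (g, \<tau>)))"
  have "(\<Prod>i=1..a + k. D (?h i)) = (\<Prod>i=1..a. D (?h i)) * (\<Prod>i=a + 1..a + k. D (?h i))"
    by (rule prod.ub_add_nat) simp
  also have "(\<Prod>i=1..a. D (?h i)) = (\<Prod>i=1..a. D (f i))"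
    by (intro prod.cong refl) (simp add: wreath_embed_def)
  also have "(\<Prod>i=a + 1..a + k. D (?h i)) = (\<Prod>i=1..k. D (g i))"
    by (rule prod.reindex_bij_witness[of _ "\<lambda>i. a + i" "\<lambda>i. i - a"]) (auto simp: wreath_embed_def)
  finally show ?thesis .
qed

lemma wreath_tensor_act:
  assumes F: "group F" and D: "group_char F D"
    and R: "representation (sym_group a) R" and Q: "representation (sym_group k) Q"
    and h: "((f, \<sigma>), (g, \<tau>)) \<in> carrier (wreath F a \<times>\<times> wreath F k)" and v: "v \<in> rep_space (R \<boxtimes> Q)"
  shows "rep_act (wreath_rep a D R \<boxtimes> wreath_rep k D Q) ((f, \<sigma>), (g, \<tau>)) v =
    cscale ((\<Prod>i=1..a. D (f i)) * (\<Prod>i=1..k. D (g i))) (rep_act (R \<boxtimes> Q) (\<sigma>, \<tau>) v)"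
proof -
  obtain B c where B: "B \<subseteq> rep_space Q" "\<And>b. b \<in> B \<Longrightarrow> c b \<in> rep_space R" "v = tsum B c (\<lambda>b. b)"
    using tensor_rep_expand[OF R Q v] by metis
  have st: "\<sigma> \<in> carrier (sym_group a)" "\<tau> \<in> carrier (sym_group k)"
    and fg: "(f, \<sigma>) \<in> carrier (wreath F a)" "(g, \<tau>) \<in> carrier (wreath F k)"
    using h by (auto simp: wreath_carrier sym_group_carrier)
  have "rep_act (wreath_rep a D R \<boxtimes> wreath_rep k D Q) ((f, \<sigma>), (g, \<tau>)) v =
      tsum B (\<lambda>b. rep_act (wreath_rep a D R) (f, \<sigma>) (c b)) (\<lambda>b. rep_act (wreath_rep k D Q) (g, \<tau>) b)"
    unfolding B(3)
    by (rule act_tsum[OF wreath_rep_rep[OF F D R] wreath_rep_rep[OF F D Q] fg]) (use B in auto)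
  also have "\<dots> = cscale ((\<Prod>i=1..a. D (f i)) * (\<Prod>i=1..k. D (g i)))
      (tsum B (\<lambda>b. rep_act R \<sigma> (c b)) (\<lambda>b. rep_act Q \<tau> b))"
    unfolding wreath_rep_act by (auto simp: tsum_def cscale_def fun_eq_iff sum_distrib_left mult_ac)
  also have "tsum B (\<lambda>b. rep_act R \<sigma> (c b)) (\<lambda>b. rep_act Q \<tau> b) = rep_act (R \<boxtimes> Q) (\<sigma>, \<tau>) v"
    unfolding B(3) by (rule act_tsum[OF R Q st, symmetric]) (use B in auto)
  finally show ?thesis .
qed

text \<open>The base group lies in the image of the subgroup, so an equivariant function on the
  wreath product is determined by its values on the copy of the symmetric group with trivial F-part.
  There its equivariance is the one known for E, so the same evaluation map e serves.\<close>

lemma coind_wreath: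
  assumes F: "group F" and D: "group_char F D"
    and R: "representation (sym_group a) R" and Q: "representation (sym_group k) Q"
    and E: "coinduced (sym_group (a + k)) (sym_group a \<times>\<times> sym_group k) (sym_embed a k) (R \<boxtimes> Q) E e"
  shows "coinduced (wreath F (a + k)) (wreath F a \<times>\<times> wreath F k) (wreath_embed a k)
    (wreath_rep a D R \<boxtimes> wreath_rep k D Q) (wreath_rep (a + k) D E) e"
proof (rule coinducedI)
  interpret F: group F by fact
  let ?G = "wreath F (a + k)" and ?H = "wreath F a \<times>\<times> wreath F k" and ?V = "wreath_rep a D R \<boxtimes> wreath_rep k D Q"
  let ?W = "wreath_rep (a + k) D E"
  note rE = coind_rep(1)[OF E] and rRQ = coind_rep(2)[OF E]
  have sp: "rep_space ?V = rep_space (R \<boxtimes> Q)" by (simp add: ext_tensor_space)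
  show rW: "representation ?G ?W" by (rule wreath_rep_rep[OF F D rE])
  show "representation ?H ?V" by (rule tensor_rep[OF wreath_rep_rep[OF F D R] wreath_rep_rep[OF F D Q]])
  show hom: "wreath_embed a k \<in> hom ?H ?G" by (rule wreath_embed_inj_hom(1)[OF F])
  have Vact: "rep_act ?V ((f, \<sigma>), (g, \<tau>)) v = cscale (\<Prod>i=1..a + k. D (fst (wreath_embed a k ((f, \<sigma>), (g, \<tau>))) i))
      (rep_act (R \<boxtimes> Q) (\<sigma>, \<tau>) v)"
    if "((f, \<sigma>), (g, \<tau>)) \<in> carrier ?H" "v \<in> rep_space (R \<boxtimes> Q)" for f \<sigma> g \<tau> v
    unfolding wreath_tensor_act[OF F D R Q that] wreath_embed_prod ..
  have e_scale: "e (cscale c (rep_act E \<sigma> w)) = cscale c (e (rep_act E \<sigma> w))"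
    if "\<sigma> \<in> carrier (sym_group (a + k))" "w \<in> rep_space E" for c \<sigma> w
    using linear_on_scale[OF coind_linear[OF E] rep_closed[OF rE that]] .
  show "ghom ?H (res_rep (wreath_embed a k) ?W) ?V e"
    unfolding ghom_def res_rep_simps
  proof (intro conjI ballI)
    show "linear_on (rep_space ?W) e" using coind_linear[OF E] by simp
    fix w assume w: "w \<in> rep_space ?W"
    then show "e w \<in> rep_space ?V" using coind_closed[OF E] sp by simp
    fix h assume h: "h \<in> carrier ?H"
    obtain f \<sigma> g \<tau> where hh: "h = ((f, \<sigma>), (g, \<tau>))" by (metis surj_pair)
    have st: "(\<sigma>, \<tau>) \<in> carrier (sym_group a \<times>\<times> sym_group k)"
      using h by (auto simp: hh wreath_carrier sym_group_carrier)
    have em: "wreath_embed a k h = (fst (wreath_embed a k h), sym_embed a k (\<sigma>, \<tau>))"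
      by (simp add: hh wreath_embed_def)
    have "e (rep_act ?W (wreath_embed a k h) w) =
        cscale (\<Prod>i=1..a + k. D (fst (wreath_embed a k h) i)) (e (rep_act E (sym_embed a k (\<sigma>, \<tau>)) w))"
      by (subst em) (use e_scale[OF coind_carrier[OF E st]] w in \<open>simp add: wreath_rep_act\<close>)
    also have "\<dots> = rep_act ?V h (e w)"
      using Vact[of f \<sigma> g \<tau> "e w"] h w coind_closed[OF E] coind_act[OF E st] unfolding hh by simp
    finally show "e (rep_act ?W (wreath_embed a k h) w) = rep_act ?V h (e w)" .
  qed
  interpret W: group ?G by (rule wreath_group[OF F])
  define one where "one = (\<lambda>n. \<lambda>i\<in>{1..n :: nat}. \<one>\<^bsub>F\<^esub>)"
  have one_c: "(one n, \<sigma>) \<in> carrier (wreath F n) \<longleftrightarrow> \<sigma> permutes {1..n}" for n \<sigma>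
    by (auto simp: wreath_carrier one_def)
  have one_prod: "(\<Prod>i=1..n. D (one n i)) = 1" for n using D by (simp add: one_def group_char_def)
  have one_mult: "(one n, \<sigma>) \<otimes>\<^bsub>wreath F n\<^esub> (one n, \<tau>) = (one n, \<sigma> \<circ> \<tau>)" if "\<sigma> permutes {1..n}" for n \<sigma> \<tau>
  proof -
    have "inv' \<sigma> i \<in> {1..n}" if "i \<in> {1..n}" for i
      using permutes_in_image[OF permutes_inv[OF \<open>\<sigma> permutes {1..n}\<close>]] that by blast
    then have "(\<lambda>i\<in>{1..n}. (\<lambda>i\<in>{1..n}. \<one>\<^bsub>F\<^esub>) i \<otimes>\<^bsub>F\<^esub> (\<lambda>i\<in>{1..n}. (\<lambda>i\<in>{1..n}. \<one>\<^bsub>F\<^esub>) (inv' \<sigma> i)) i) = (\<lambda>i\<in>{1..n}. \<one>\<^bsub>F\<^esub>)"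
      by (intro restrict_ext) simp
    then show ?thesis unfolding wreath_mult one_def by (simp only:)
  qed
  have one_embed: "wreath_embed a k ((one a, \<sigma>), (one k, \<tau>)) = (one (a + k), sym_embed a k (\<sigma>, \<tau>))" for \<sigma> \<tau>
    by (auto simp: wreath_embed_def one_def intro!: restrict_ext)
  {
    fix \<phi> assume \<phi>: "equivariant ?G ?H (wreath_embed a k) ?V \<phi>"
    have \<phi>V: "\<phi> x \<in> rep_space (R \<boxtimes> Q)" if "x \<in> carrier ?G" for x
      using \<phi> that sp unfolding equivariant_def by auto
    have "equivariant (sym_group (a + k)) (sym_group a \<times>\<times> sym_group k) (sym_embed a k) (R \<boxtimes> Q) (\<lambda>\<sigma>. \<phi> (one (a + k), \<sigma>))"
      unfolding equivariant_def
    proof (intro conjI ballI)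
      fix \<rho> assume "\<rho> \<in> carrier (sym_group (a + k))"
      then have \<rho>: "(one (a + k), \<rho>) \<in> carrier ?G" by (simp add: one_c sym_group_carrier)
      then show \<phi>\<rho>: "\<phi> (one (a + k), \<rho>) \<in> rep_space (R \<boxtimes> Q)" by (rule \<phi>V)
      fix h assume h: "h \<in> carrier (sym_group a \<times>\<times> sym_group k)"
      obtain \<sigma> \<tau> where st: "h = (\<sigma>, \<tau>)" by force
      let ?h = "((one a, \<sigma>), (one k, \<tau>))"
      have hc: "?h \<in> carrier ?H" using h by (simp add: st one_c sym_group_carrier)
      have sp: "sym_embed a k h permutes {1..a + k}"
        using coind_carrier[OF E h] by (simp add: sym_group_carrier)
      have "\<phi> (wreath_embed a k ?h \<otimes>\<^bsub>?G\<^esub> (one (a + k), \<rho>)) = rep_act ?V ?h (\<phi> (one (a + k), \<rho>))"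
        using \<phi> hc \<rho> unfolding equivariant_def by blast
      also have "\<dots> = rep_act (R \<boxtimes> Q) h (\<phi> (one (a + k), \<rho>))"
        unfolding Vact[OF hc \<phi>\<rho>] one_embed fst_conv one_prod st by simp
      finally show "\<phi> (one (a + k), sym_embed a k h \<otimes>\<^bsub>sym_group (a + k)\<^esub> \<rho>) = rep_act (R \<boxtimes> Q) h (\<phi> (one (a + k), \<rho>))"
        using one_mult[OF sp] by (simp add: one_embed st sym_group_mult)
    qed
    then obtain w where w: "w \<in> rep_space E"
      "\<And>\<sigma>. \<sigma> \<in> carrier (sym_group (a + k)) \<Longrightarrow> e (rep_act E \<sigma> w) = \<phi> (one (a + k), \<sigma>)"
      using coind_obtain[OF E] by blast
    have "e (rep_act ?W x w) = \<phi> x" if x: "x \<in> carrier ?G" for x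
    proof -
      obtain f \<sigma> where fs: "x = (f, \<sigma>)" by force
      have f: "f \<in> (\<Pi>\<^sub>E i\<in>{1..a + k}. carrier F)" and s: "\<sigma> permutes {1..a + k}"
        using x by (auto simp: fs wreath_carrier)
      have sc: "\<sigma> \<in> carrier (sym_group (a + k))" using s by (simp add: sym_group_carrier)
      \<comment> \<open>The F-part of x, cut at a, is an element of the subgroup, and x is its image
        times an element with trivial F-part.\<close>
      let ?h = "((\<lambda>i\<in>{1..a}. f i, id), (\<lambda>i\<in>{1..k}. f (a + i), id))"
      have hc: "?h \<in> carrier ?H" using f by (auto simp: wreath_carrier permutes_id PiE_iff)
      have emb: "wreath_embed a k ?h = (f, id)"
      proof -
        have "(\<lambda>i\<in>{1..a + k}. if i \<le> a then (\<lambda>i\<in>{1..a}. f i) i else (\<lambda>i\<in>{1..k}. f (a + i)) (i - a)) = f"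
          by (rule extensionalityI[of _ "{1..a + k}"]) (use f in \<open>auto simp: PiE_iff\<close>)
        moreover have "sym_embed a k (id, id) = id" by (auto simp: sym_embed_def fun_eq_iff)
        ultimately show ?thesis by (simp only: wreath_embed_def split)
      qed
      have oc: "(one (a + k), \<sigma>) \<in> carrier ?G" using s by (simp add: one_c)
      have "(f, id) \<otimes>\<^bsub>?G\<^esub> (one (a + k), \<sigma>) = x"
        unfolding wreath_mult fs
        using f by (auto simp: one_def PiE_iff inv_id intro!: extensionalityI[of _ "{1..a + k}"])
      then have "\<phi> x = rep_act ?V ?h (\<phi> (one (a + k), \<sigma>))"
        using \<phi> hc oc emb unfolding equivariant_def by metis
      also have "\<dots> = cscale (\<Prod>i=1..a + k. D (f i)) (rep_act (R \<boxtimes> Q) (id, id) (\<phi> (one (a + k), \<sigma>)))"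
        unfolding Vact[OF hc \<phi>V[OF oc]] emb by simp
      also have "rep_act (R \<boxtimes> Q) (id, id) (\<phi> (one (a + k), \<sigma>)) = \<phi> (one (a + k), \<sigma>)"
        using rep_one[OF rRQ \<phi>V[OF oc]] by (simp add: sym_group_one)
      finally show ?thesis
        unfolding fs wreath_rep_act using e_scale[OF sc w(1)] w(2)[OF sc] by simp
    qed
    then show "\<exists>w\<in>rep_space ?W. \<forall>x\<in>carrier ?G. e (rep_act ?W x w) = \<phi> x"
      using w(1) by (intro bexI[of _ w] ballI) simp_all
  next
    fix v w assume vw: "v \<in> rep_space ?W" "w \<in> rep_space ?W"
      and eq: "\<And>x. x \<in> carrier ?G \<Longrightarrow> e (rep_act ?W x v) = e (rep_act ?W x w)"
    show "v = w"
    proof (rule coind_unique[OF E])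
      fix \<sigma> assume "\<sigma> \<in> carrier (sym_group (a + k))"
      then have "(one (a + k), \<sigma>) \<in> carrier ?G" by (simp add: one_c sym_group_carrier)
      from eq[OF this] show "e (rep_act E \<sigma> v) = e (rep_act E \<sigma> w)"
        unfolding wreath_rep_act one_prod by simp
    qed (use vw in auto)
  }
qed

section \<open>Exchanging the middle factors\<close>

text \<open>The factors are treated one at a time, with a swap before and after the second.\<close>

lemma coind_both:
  assumes L: "coinduced G (G1 \<times>\<times> G2) \<iota> (U1 \<boxtimes> U2) L e"
    and U1: "coinduced G1 H1 \<iota>1 V1 U1 e1" and U2: "coinduced G2 H2 \<iota>2 V2 U2 e2"
  obtains e' where "coinduced G (H1 \<times>\<times> H2) (\<lambda>(h1, h2). \<iota> (\<iota>1 h1, \<iota>2 h2)) (V1 \<boxtimes> V2) L e'"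
proof -
  note r1 = coind_rep[OF U1] and r2 = coind_rep[OF U2]
  have A: "coinduced G (H1 \<times>\<times> G2) (\<lambda>h. \<iota> ((\<lambda>(h, k). (\<iota>1 h, k)) h)) (V1 \<boxtimes> U2) L (\<lambda>w. tmap1 e1 (e w))"
    by (rule coind_trans[OF L coind_tensor[OF U1 r2(1)]])
  note B = coind_swap[OF A r1(2) r2(1)]
  note C = coind_trans[OF B coind_tensor[OF U2 r1(2)]]
  note D = coind_swap[OF C r2(2) r1(2)]
  have "(\<lambda>(k, h). (\<lambda>h. (\<lambda>(k, h). \<iota> ((\<lambda>(h, k). (\<iota>1 h, k)) (h, k))) ((\<lambda>(h, k). (\<iota>2 h, k)) h)) (h, k)) =
      (\<lambda>(h1, h2). \<iota> (\<iota>1 h1, \<iota>2 h2))" by auto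
  then show ?thesis using that D by (simp only:) 
qed

text \<open>The exchange of the two middle tensor factors, the counterpart of
  \<open>block_perm\<close> on the modules.\<close>

definition mswap :: "(('x \<times> 'y) \<times> ('z \<times> 'w) \<Rightarrow> complex) \<Rightarrow> ('x \<times> 'z) \<times> ('y \<times> 'w) \<Rightarrow> complex"
  where "mswap F = (\<lambda>((x, z), (y, w)). F ((x, y), (z, w)))"

lemma mswap_mswap [simp]: "mswap (mswap F) = F"
  by (auto simp: mswap_def)

lemma mswap_linear: "linear_on V mswap"
  by (auto simp: linear_on_def mswap_def pointwise)

lemma ptensor_span:
  fixes u :: "'x \<Rightarrow> complex" and v :: "'y \<Rightarrow> complex"
  assumes u: "u \<in> cfun.span A" and v: "v \<in> cfun.span B"
  shows "ptensor u v \<in> cfun.span {ptensor a b | a b. a \<in> A \<and> b \<in> B}"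
  using u
proof (induction rule: span_induct_member)
  case zero
  have "ptensor (0 :: 'x \<Rightarrow> complex) v = 0" by (auto simp: ptensor_def pointwise)
  then show ?case using cfun.span_zero by metis
next
  case (step c x y)
  have "ptensor x v \<in> cfun.span {ptensor a b | a b. a \<in> A \<and> b \<in> B}"
    using v
  proof (induction rule: span_induct_member)
    case zero
    have "ptensor x (0 :: 'y \<Rightarrow> complex) = 0" by (auto simp: ptensor_def pointwise)
    then show ?case using cfun.span_zero by metis
  next
    case (step d z w)
    have "ptensor x (cscale d z + w) = cscale d (ptensor x z) + ptensor x w"
      by (auto simp: ptensor_def pointwise algebra_simps)
    moreover have "ptensor x z \<in> cfun.span {ptensor a b | a b. a \<in> A \<and> b \<in> B}"
      using step(1) \<open>x \<in> A\<close> by (intro cfun.span_base) blast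
    ultimately show ?case using step by (simp add: cfun.span_add cfun.span_scale)
  qed
  moreover have "ptensor (cscale c x + y) v = cscale c (ptensor x v) + ptensor y v"
    by (auto simp: ptensor_def pointwise algebra_simps)
  ultimately show ?case using step by (simp add: cfun.span_add cfun.span_scale)
qed

text \<open>Reduces membership and equivariance under \<open>mswap\<close> to fourfold pure tensors,
  where both can be read off.\<close>

lemma quad_span:
  "rep_space ((R1 \<boxtimes> R2) \<boxtimes> (R3 \<boxtimes> R4)) = cfun.span {ptensor (ptensor v1 v2) (ptensor v3 v4) | v1 v2 v3 v4.
    v1 \<in> rep_space R1 \<and> v2 \<in> rep_space R2 \<and> v3 \<in> rep_space R3 \<and> v4 \<in> rep_space R4}" (is "_ = cfun.span ?Q")
proof (intro subset_antisym)
  let ?A = "{ptensor v w |v w. v \<in> rep_space R1 \<and> w \<in> rep_space R2}"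
  let ?B = "{ptensor v w |v w. v \<in> rep_space R3 \<and> w \<in> rep_space R4}"
  have "{ptensor a b | a b. a \<in> ?A \<and> b \<in> ?B} \<subseteq> ?Q" by blast
  then have "ptensor v w \<in> cfun.span ?Q" if "v \<in> cfun.span ?A" "w \<in> cfun.span ?B" for v w
    using ptensor_span[OF that] cfun.span_mono by blast
  then show "rep_space ((R1 \<boxtimes> R2) \<boxtimes> (R3 \<boxtimes> R4)) \<subseteq> cfun.span ?Q"
    unfolding ext_tensor_space by (intro cfun.span_minimal) auto
  show "cfun.span ?Q \<subseteq> rep_space ((R1 \<boxtimes> R2) \<boxtimes> (R3 \<boxtimes> R4))"
    by (intro cfun.span_minimal ext_tensor_subspace) (auto intro!: ptensor_mem)
qed

lemma mswap_quad: "mswap (ptensor (ptensor v1 v2) (ptensor v3 v4)) = ptensor (ptensor v1 v3) (ptensor v2 v4)"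
  by (auto simp: mswap_def ptensor_def mult_ac)

lemma mswap_mem:
  assumes "F \<in> rep_space ((R1 \<boxtimes> R2) \<boxtimes> (R3 \<boxtimes> R4))"
  shows "mswap F \<in> rep_space ((R1 \<boxtimes> R3) \<boxtimes> (R2 \<boxtimes> R4))"
proof -
  let ?S = "rep_space ((R1 \<boxtimes> R3) \<boxtimes> (R2 \<boxtimes> R4))"
  note s = ext_tensor_subspace[of "R1 \<boxtimes> R3" "R2 \<boxtimes> R4"]
  show ?thesis
    using assms unfolding quad_span[of R1 R2]
  proof (induction rule: span_induct_member)
    case zero
    show ?case using linear_on_zero[OF mswap_linear[of UNIV]] cfun.subspace_UNIV cfun.subspace_0[OF s] by metis
  next
    case (step c F F')
    then have "mswap F \<in> ?S" by (auto simp: mswap_quad intro!: ptensor_mem)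
    moreover have "mswap (cscale c F + F') = cscale c (mswap F) + mswap F'"
      by (auto simp: mswap_def pointwise)
    ultimately show ?case using step cfun.subspace_add[OF s cfun.subspace_scale[OF s]] by simp
  qed
qed

lemma act_ptensor:
  assumes "representation G R" "representation H Q" "g \<in> carrier G" "h \<in> carrier H" "v \<in> rep_space R" "w \<in> rep_space Q"
  shows "rep_act (R \<boxtimes> Q) (g, h) (ptensor v w) = ptensor (rep_act R g v) (rep_act Q h w)"
proof -
  have t: "ptensor v w = tsum {()} (\<lambda>_. v) (\<lambda>_. w)" for v :: "'z \<Rightarrow> complex" and w :: "'u \<Rightarrow> complex"
    by (simp add: tsum_eq_sum)
  show ?thesis unfolding t by (rule act_tsum[OF assms(1-4)]) (use assms(5,6) in auto)
qed

lemma mswap_act: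
  assumes R1: "representation G1 R1" and R2: "representation G2 R2" and R3: "representation G3 R3"
    and R4: "representation G4 R4"
    and g: "g1 \<in> carrier G1" "g2 \<in> carrier G2" "g3 \<in> carrier G3" "g4 \<in> carrier G4"
    and F: "F \<in> rep_space ((R1 \<boxtimes> R2) \<boxtimes> (R3 \<boxtimes> R4))"
  shows "mswap (rep_act ((R1 \<boxtimes> R2) \<boxtimes> (R3 \<boxtimes> R4)) ((g1, g2), (g3, g4)) F) =
    rep_act ((R1 \<boxtimes> R3) \<boxtimes> (R2 \<boxtimes> R4)) ((g1, g3), (g2, g4)) (mswap F)"
proof -
  let ?L = "(R1 \<boxtimes> R2) \<boxtimes> (R3 \<boxtimes> R4)" and ?R = "(R1 \<boxtimes> R3) \<boxtimes> (R2 \<boxtimes> R4)"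
  note rL = tensor_rep[OF tensor_rep[OF R1 R2] tensor_rep[OF R3 R4]]
  note rR = tensor_rep[OF tensor_rep[OF R1 R3] tensor_rep[OF R2 R4]]
  have gL: "((g1, g2), (g3, g4)) \<in> carrier ((G1 \<times>\<times> G2) \<times>\<times> (G3 \<times>\<times> G4))"
    and gR: "((g1, g3), (g2, g4)) \<in> carrier ((G1 \<times>\<times> G3) \<times>\<times> (G2 \<times>\<times> G4))" using g by auto
  have l1: "linear_on (rep_space ?L) (\<lambda>F. mswap (rep_act ?L ((g1, g2), (g3, g4)) F))"
    by (rule linear_on_comp[OF rep_linear[OF rL gL] _ mswap_linear[of UNIV]]) auto
  have l2: "linear_on (rep_space ?L) (\<lambda>F. rep_act ?R ((g1, g3), (g2, g4)) (mswap F))"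
    by (rule linear_on_comp[OF mswap_linear _ rep_linear[OF rR gR]]) (use mswap_mem in blast)
  show ?thesis
  proof (rule linear_on_eq_span[OF l1[unfolded quad_span[of R1 R2]] l2[unfolded quad_span[of R1 R2]] _ F[unfolded quad_span[of R1 R2]]])
    fix b assume "b \<in> {ptensor (ptensor v1 v2) (ptensor v3 v4) | v1 v2 v3 v4.
      v1 \<in> rep_space R1 \<and> v2 \<in> rep_space R2 \<and> v3 \<in> rep_space R3 \<and> v4 \<in> rep_space R4}"
    then obtain v1 v2 v3 v4 where b: "b = ptensor (ptensor v1 v2) (ptensor v3 v4)"
      and v: "v1 \<in> rep_space R1" "v2 \<in> rep_space R2" "v3 \<in> rep_space R3" "v4 \<in> rep_space R4" by blast
    have "rep_act ?L ((g1, g2), (g3, g4)) b = ptensor (rep_act (R1 \<boxtimes> R2) (g1, g2) (ptensor v1 v2)) (rep_act (R3 \<boxtimes> R4) (g3, g4) (ptensor v3 v4))"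
      unfolding b by (rule act_ptensor[OF tensor_rep[OF R1 R2] tensor_rep[OF R3 R4]]) (use g v ptensor_mem in auto)
    moreover have "rep_act ?R ((g1, g3), (g2, g4)) (mswap b) =
        ptensor (rep_act (R1 \<boxtimes> R3) (g1, g3) (ptensor v1 v3)) (rep_act (R2 \<boxtimes> R4) (g2, g4) (ptensor v2 v4))"
      unfolding b mswap_quad
      by (rule act_ptensor[OF tensor_rep[OF R1 R3] tensor_rep[OF R2 R4]]) (use g v ptensor_mem in auto)
    ultimately show "mswap (rep_act ?L ((g1, g2), (g3, g4)) b) = rep_act ?R ((g1, g3), (g2, g4)) (mswap b)"
      using act_ptensor[OF R1 R2 g(1,2) v(1,2)] act_ptensor[OF R3 R4 g(3,4) v(3,4)]
        act_ptensor[OF R1 R3 g(1,3) v(1,3)] act_ptensor[OF R2 R4 g(2,4) v(2,4)]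
      by (simp add: mswap_quad)
  qed
qed

text \<open>Carries blocks of lengths a, k, b, in this order, to the order a, b, k and fixes
  everything else. Its inverse is the same function with k and b exchanged.\<close>

definition block_perm :: "nat \<Rightarrow> nat \<Rightarrow> nat \<Rightarrow> nat \<Rightarrow> nat"
  where "block_perm a k b j = (if j \<le> a then j else if j \<le> a + k then j + b else if j \<le> a + k + b then j - k else j)"

lemma block_perm_inverse: "block_perm a b k (block_perm a k b j) = j"
  by (auto simp: block_perm_def)

lemma block_perm_permutes: "block_perm a k b permutes {1..a + k + b + l}"
proof (rule bij_imp_permutes)
  have "inj (block_perm a k b)" using block_perm_inverse by (metis injI)
  moreover have "block_perm a k b ` {1..a + k + b + l} \<subseteq> {1..a + k + b + l}" by (auto simp: block_perm_def)
  ultimately show "bij_betw (block_perm a k b) {1..a + k + b + l} {1..a + k + b + l}"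
    using inj_on_subset[OF _ subset_UNIV, of "block_perm a k b" "{1..a + k + b + l}"]
    by (simp add: bij_betw_def endo_inj_surj)
qed (auto simp: block_perm_def)

text \<open>The symmetric group part of the relation \<iota> h c = c \<iota>' (\<theta> h) that
  \<open>coind_iso\<close> asks for.\<close>

lemma block_perm_sym_embed:
  assumes "\<sigma>1 permutes {1..a}" "\<sigma>2 permutes {1..b}" "\<sigma>3 permutes {1..k}" "\<sigma>4 permutes {1..l}"
  shows "sym_embed (a + b) (k + l) (sym_embed a b (\<sigma>1, \<sigma>2), sym_embed k l (\<sigma>3, \<sigma>4)) \<circ> block_perm a k b =
    block_perm a k b \<circ> sym_embed (a + k) (b + l) (sym_embed a k (\<sigma>1, \<sigma>3), sym_embed b l (\<sigma>2, \<sigma>4))"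
proof
  fix j
  have i1: "\<sigma>1 i \<in> {1..a}" if "i \<in> {1..a}" for i using permutes_in_image[OF assms(1)] that by blast
  have i2: "\<sigma>2 i \<in> {1..b}" if "i \<in> {1..b}" for i using permutes_in_image[OF assms(2)] that by blast
  have i3: "\<sigma>3 i \<in> {1..k}" if "i \<in> {1..k}" for i using permutes_in_image[OF assms(3)] that by blast
  have i4: "\<sigma>4 i \<in> {1..l}" if "i \<in> {1..l}" for i using permutes_in_image[OF assms(4)] that by blast
  \<comment> \<open>One case for each block; at 0 and beyond the last block both sides are the
    identity.\<close>
  consider "j = 0" | "j \<in> {1..a}" | i where "j = a + i" "i \<in> {1..k}" | i where "j = a + k + i" "i \<in> {1..b}"
    | i where "j = a + k + b + i" "i \<in> {1..l}" | "j > a + k + b + l"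
  proof -
    have "j = 0 \<or> j \<in> {1..a} \<or> (j = a + (j - a) \<and> j - a \<in> {1..k}) \<or>
        (j = a + k + (j - (a + k)) \<and> j - (a + k) \<in> {1..b}) \<or>
        (j = a + k + b + (j - (a + k + b)) \<and> j - (a + k + b) \<in> {1..l}) \<or> j > a + k + b + l"
      unfolding atLeastAtMost_iff by arith
    then show ?thesis using that by blast
  qed
  then show "(sym_embed (a + b) (k + l) (sym_embed a b (\<sigma>1, \<sigma>2), sym_embed k l (\<sigma>3, \<sigma>4)) \<circ> block_perm a k b) j =
    (block_perm a k b \<circ> sym_embed (a + k) (b + l) (sym_embed a k (\<sigma>1, \<sigma>3), sym_embed b l (\<sigma>2, \<sigma>4))) j"
  proof cases
    case 2 then show ?thesis using i1[OF 2] by (simp add: sym_embed_def block_perm_def)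
  next
    case 3 then show ?thesis using i3[OF 3(2)] by (simp add: sym_embed_def block_perm_def)
  next
    case 4 then show ?thesis using i2[OF 4(2)] by (simp add: sym_embed_def block_perm_def)
  next
    case 5 then show ?thesis using i4[OF 5(2)] by (simp add: sym_embed_def block_perm_def)
  qed (simp_all add: sym_embed_def block_perm_def)
qed

lemma block_perm_wreath_embed:
  assumes F: "group F"
    and h: "(f1, \<sigma>1) \<in> carrier (wreath F a)" "(f2, \<sigma>2) \<in> carrier (wreath F b)"
      "(f3, \<sigma>3) \<in> carrier (wreath F k)" "(f4, \<sigma>4) \<in> carrier (wreath F l)"
  defines "n \<equiv> a + b + (k + l)"
  defines "c \<equiv> (\<lambda>i\<in>{1..n}. \<one>\<^bsub>F\<^esub>, block_perm a k b)"
  shows "wreath_embed (a + b) (k + l) (wreath_embed a b ((f1, \<sigma>1), (f2, \<sigma>2)), wreath_embed k l ((f3, \<sigma>3), (f4, \<sigma>4))) \<otimes>\<^bsub>wreath F n\<^esub> c =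
    c \<otimes>\<^bsub>wreath F n\<^esub> wreath_embed (a + k) (b + l) (wreath_embed a k ((f1, \<sigma>1), (f3, \<sigma>3)), wreath_embed b l ((f2, \<sigma>2), (f4, \<sigma>4)))"
proof -
  interpret F: group F by fact
  have p: "\<sigma>1 permutes {1..a}" "\<sigma>2 permutes {1..b}" "\<sigma>3 permutes {1..k}" "\<sigma>4 permutes {1..l}"
    and f: "\<And>i. i \<in> {1..a} \<Longrightarrow> f1 i \<in> carrier F" "\<And>i. i \<in> {1..b} \<Longrightarrow> f2 i \<in> carrier F"
      "\<And>i. i \<in> {1..k} \<Longrightarrow> f3 i \<in> carrier F" "\<And>i. i \<in> {1..l} \<Longrightarrow> f4 i \<in> carrier F"
    using h by (auto simp: wreath_carrier)
  define s1 where "s1 = sym_embed (a + b) (k + l) (sym_embed a b (\<sigma>1, \<sigma>2), sym_embed k l (\<sigma>3, \<sigma>4))"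
  define s2 where "s2 = sym_embed (a + k) (b + l) (sym_embed a k (\<sigma>1, \<sigma>3), sym_embed b l (\<sigma>2, \<sigma>4))"
  \<comment> \<open>The F-parts of the two embeddings, concatenated in the two orders of the blocks;
    \<open>g12\<close> states that the block permutation converts one into the other.\<close>
  define g1 where "g1 = (\<lambda>i. if i \<le> a then f1 i else if i \<le> a + b then f2 (i - a)
    else if i \<le> a + b + k then f3 (i - (a + b)) else f4 (i - (a + b) - k))"
  define g2 where "g2 = (\<lambda>i. if i \<le> a then f1 i else if i \<le> a + k then f3 (i - a)
    else if i \<le> a + k + b then f2 (i - (a + k)) else f4 (i - (a + k) - b))"
  have n': "a + k + (b + l) = n" by (simp add: n_def)
  have e1: "wreath_embed (a + b) (k + l) (wreath_embed a b ((f1, \<sigma>1), (f2, \<sigma>2)), wreath_embed k l ((f3, \<sigma>3), (f4, \<sigma>4))) =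
      (\<lambda>i\<in>{1..n}. g1 i, s1)"
    by (auto simp: wreath_embed_def s1_def g1_def n_def fun_eq_iff)
  have e2: "wreath_embed (a + k) (b + l) (wreath_embed a k ((f1, \<sigma>1), (f3, \<sigma>3)), wreath_embed b l ((f2, \<sigma>2), (f4, \<sigma>4))) =
      (\<lambda>i\<in>{1..n}. g2 i, s2)"
    by (auto simp: wreath_embed_def s2_def g2_def n_def fun_eq_iff)
  have s1p: "s1 permutes {1..n}"
    unfolding s1_def n_def by (intro sym_embed_permutes p)
  have bp: "block_perm a k b permutes {1..n}" using block_perm_permutes[of a k b l] by (simp add: n_def ac_simps)
  have bi: "inv' (block_perm a k b) = block_perm a b k"
    using block_perm_inverse by (metis inv_equality)
  have g1c: "g1 i \<in> carrier F" if "i \<in> {1..n}" for i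
  proof -
    consider "i \<le> a" | "a < i" "i \<le> a + b" | "a + b < i" "i \<le> a + b + k" | "a + b + k < i" by linarith
    then show ?thesis
    proof cases
      case 1 then show ?thesis using that f(1)[of i] by (simp add: g1_def)
    next
      case 2
      then have "i - a \<in> {1..b}" by auto
      then show ?thesis using 2 f(2) by (simp add: g1_def)
    next
      case 3
      then have "i - (a + b) \<in> {1..k}" by auto
      then show ?thesis using 3 f(3) by (simp add: g1_def)
    next
      case 4
      then have "i - (a + b) - k \<in> {1..l}" using that by (auto simp: n_def)
      then show ?thesis using 4 f(4) by (simp add: g1_def)
    qed
  qed
  have g12: "g2 (block_perm a b k i) = g1 i" for i
    by (auto simp: g1_def g2_def block_perm_def ac_simps)
  have ib: "block_perm a b k i \<in> {1..n}" if "i \<in> {1..n}" for i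
    using permutes_in_image[OF permutes_inv[OF bp]] that bi by metis
  have is1: "inv' s1 i \<in> {1..n}" if "i \<in> {1..n}" for i
    using permutes_in_image[OF permutes_inv[OF s1p]] that by blast
  have "s1 \<circ> block_perm a k b = block_perm a k b \<circ> s2"
    unfolding s1_def s2_def by (rule block_perm_sym_embed[OF p])
  moreover have "(\<lambda>i\<in>{1..n}. (\<lambda>i\<in>{1..n}. g1 i) i \<otimes>\<^bsub>F\<^esub> (\<lambda>i\<in>{1..n}. (\<lambda>i\<in>{1..n}. \<one>\<^bsub>F\<^esub>) (inv' s1 i)) i) = (\<lambda>i\<in>{1..n}. g1 i)"
    using g1c is1 by (intro restrict_ext) simp
  moreover have "(\<lambda>i\<in>{1..n}. (\<lambda>i\<in>{1..n}. \<one>\<^bsub>F\<^esub>) i \<otimes>\<^bsub>F\<^esub> (\<lambda>i\<in>{1..n}. (\<lambda>i\<in>{1..n}. g2 i) (inv' (block_perm a k b) i)) i) = (\<lambda>i\<in>{1..n}. g1 i)"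
    using g1c ib g12 unfolding bi by (intro restrict_ext) simp
  ultimately show ?thesis unfolding e1 e2 c_def wreath_mult by simp
qed

section \<open>Inducing products of the modules of two partitions\<close>

lemma hyperoctahedral_group: "group (hyperoctahedral m)"
  unfolding hyperoctahedral_def by (intro wreath_group group_integer_mod_group)

lemma finite_hyperoctahedral: "finite (carrier (hyperoctahedral m))"
proof -
  have "finite (\<Pi>\<^sub>E i\<in>{1..m}. carrier (integer_mod_group 2))"
    by (intro finite_PiE) (auto simp: carrier_integer_mod_group)
  moreover have "carrier (hyperoctahedral m) = (\<Pi>\<^sub>E i\<in>{1..m}. carrier (integer_mod_group 2)) \<times> carrier (sym_group m)"
    by (simp add: hyperoctahedral_def wreath_def Let_def)
  ultimately show ?thesis by (simp add: finite_sym_group)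
qed

lemma triv_char_group_char: "group_char (integer_mod_group 2) triv_char"
  by (simp add: group_char_def triv_char_def)

lemma sign_char_group_char: "group_char (integer_mod_group 2) sign_char"
proof -
  have c: "x = 0 \<or> x = 1" if "x \<in> carrier (integer_mod_group 2)" for x
    using that by (auto simp: carrier_integer_mod_group)
  have "sign_char ((x + y) mod 2) = sign_char x * sign_char y"
    if "x \<in> carrier (integer_mod_group 2)" "y \<in> carrier (integer_mod_group 2)" for x y
    using c[OF that(1)] c[OF that(2)] by (elim disjE) (simp_all add: sign_char_def)
  then show ?thesis by (simp add: group_char_def) (simp add: sign_char_def)
qed

lemma hyp_wreath_rep:
  assumes "group_char (integer_mod_group 2) D" "representation (sym_group m) E"
  shows "representation (hyperoctahedral m) (wreath_rep m D E)"
  unfolding hyperoctahedral_def by (rule wreath_rep_rep[OF group_integer_mod_group assms])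

lemma ind_hyp_coind:
  assumes "representation (hyperoctahedral a) R" "representation (hyperoctahedral b) Q"
  shows "coinduced (hyperoctahedral (a + b)) (hyperoctahedral a \<times>\<times> hyperoctahedral b) (wreath_embed a b)
    (R \<boxtimes> Q) (ind_hyp a b R Q) (\<lambda>F x. F (\<one>\<^bsub>hyperoctahedral (a + b)\<^esub>, x))"
  unfolding ind_hyp_def
  by (rule induced_coind[OF tensor_rep[OF assms] hyperoctahedral_group finite_hyperoctahedral])
    (simp add: hyperoctahedral_def wreath_embed_inj_hom(1))

lemma bispecht_coind:
  assumes "sum_list \<alpha> = a" "sum_list \<beta> = b"
  shows "coinduced (hyperoctahedral (a + b)) (hyperoctahedral a \<times>\<times> hyperoctahedral b) (wreath_embed a b)
    (wreath_rep a triv_char (specht \<alpha>) \<boxtimes> wreath_rep b sign_char (specht \<beta>)) (bispecht \<alpha> \<beta>)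
    (\<lambda>F x. F (\<one>\<^bsub>hyperoctahedral (a + b)\<^esub>, x))"
  using ind_hyp_coind[OF hyp_wreath_rep[OF triv_char_group_char specht_rep[of \<alpha>]] hyp_wreath_rep[OF sign_char_group_char specht_rep[of \<beta>]]] assms
  by (simp add: bispecht_def)

definition ind_sym :: "nat \<Rightarrow> nat \<Rightarrow> (nat \<Rightarrow> nat, 'x) rep \<Rightarrow> (nat \<Rightarrow> nat, 'y) rep \<Rightarrow>
    (nat \<Rightarrow> nat, (nat \<Rightarrow> nat) \<times> 'x \<times> 'y) rep"
  where "ind_sym a k R Q = induced (sym_group (a + k)) (sym_group a \<times>\<times> sym_group k) (sym_embed a k) (R \<boxtimes> Q)"

lemma ind_sym_coind:
  assumes "representation (sym_group a) R" "representation (sym_group k) Q"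
  shows "coinduced (sym_group (a + k)) (sym_group a \<times>\<times> sym_group k) (sym_embed a k) (R \<boxtimes> Q) (ind_sym a k R Q)
    (\<lambda>F x. F (\<one>\<^bsub>sym_group (a + k)\<^esub>, x))"
  unfolding ind_sym_def
  by (rule induced_coind[OF tensor_rep[OF assms] sym_group_is_group finite_sym_group sym_embed_hom])

text \<open>The sum is split in the first tensor factor and, after a swap, in the second; the two
  index sets combine to a product.\<close>

lemma bispecht_is_sum:
  assumes E1: "is_sum (sym_group a) I specht E1 p" and E2: "is_sum (sym_group b) J specht E2 q"
    and I: "\<And>\<tau>. \<tau> \<in> I \<Longrightarrow> sum_list \<tau> = a" and J: "\<And>\<rho>. \<rho> \<in> J \<Longrightarrow> sum_list \<rho> = b"
  obtains P where "is_sum (hyperoctahedral (a + b)) (I \<times> J) (\<lambda>(\<tau>, \<rho>). bispecht \<tau> \<rho>)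
    (ind_hyp a b (wreath_rep a triv_char E1) (wreath_rep b sign_char E2)) P"
proof -
  let ?B = hyperoctahedral and ?Z1 = "wreath_rep a triv_char E1" and ?Z2 = "wreath_rep b sign_char E2"
  let ?W = "\<lambda>\<tau>. ind_hyp a b (wreath_rep a triv_char (specht \<tau>)) ?Z2"
  have Z1: "is_sum (?B a) I (\<lambda>\<tau>. wreath_rep a triv_char (specht \<tau>)) ?Z1 p"
    unfolding hyperoctahedral_def by (rule is_sum_wreath[OF group_integer_mod_group triv_char_group_char E1])
  have Z2: "is_sum (?B b) J (\<lambda>\<rho>. wreath_rep b sign_char (specht \<rho>)) ?Z2 q"
    unfolding hyperoctahedral_def by (rule is_sum_wreath[OF group_integer_mod_group sign_char_group_char E2])
  note r1 = is_sum_rep[OF Z1] and r2 = is_sum_rep[OF Z2]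
  obtain P1 where P1: "is_sum (?B (a + b)) I ?W (ind_hyp a b ?Z1 ?Z2) P1"
    by (rule coind_is_sum[OF ind_hyp_coind[OF r1(1) r2(1)] is_sum_tensor[OF Z1 r2(1)] ind_hyp_coind[OF r1(2) r2(1)]])
  have "\<exists>P. is_sum (?B (a + b)) J (\<lambda>\<rho>. bispecht \<tau> \<rho>) (?W \<tau>) P" if \<tau>: "\<tau> \<in> I" for \<tau>
  proof -
    have c: "coinduced (?B (a + b)) (?B b \<times>\<times> ?B a) (\<lambda>(k, h). wreath_embed a b (h, k))
        (wreath_rep b sign_char (specht \<rho>) \<boxtimes> wreath_rep a triv_char (specht \<tau>)) (bispecht \<tau> \<rho>)
        (\<lambda>w. tswap (\<lambda>x. w (\<one>\<^bsub>?B (a + b)\<^esub>, x)))" if \<rho>: "\<rho> \<in> J" for \<rho>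
      by (rule coind_swap[OF bispecht_coind[OF I[OF \<tau>] J[OF \<rho>]] r1(2)[OF \<tau>] r2(2)[OF \<rho>]])
    show ?thesis
      using coind_is_sum[OF coind_swap[OF ind_hyp_coind[OF r1(2)[OF \<tau>] r2(1)] r1(2)[OF \<tau>] r2(1)]
          is_sum_tensor[OF Z2 r1(2)[OF \<tau>]] c] by blast
  qed
  then obtain P2 where "\<And>\<tau>. \<tau> \<in> I \<Longrightarrow> is_sum (?B (a + b)) J (\<lambda>\<rho>. bispecht \<tau> \<rho>) (?W \<tau>) (P2 \<tau>)" by metis
  from is_sum_trans[OF P1 this] show ?thesis using that by blast
qed

lemma ind_bispecht_iso:
  assumes sums: "sum_list \<alpha> = a" "sum_list \<beta> = b" "sum_list \<gamma> = k" "sum_list \<delta> = l"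
  shows "rep_iso (hyperoctahedral (a + b + (k + l)))
    (ind_hyp (a + b) (k + l) (bispecht \<alpha> \<beta>) (bispecht \<gamma> \<delta>))
    (ind_hyp (a + k) (b + l) (wreath_rep (a + k) triv_char (ind_sym a k (specht \<alpha>) (specht \<gamma>)))
      (wreath_rep (b + l) sign_char (ind_sym b l (specht \<beta>) (specht \<delta>))))"
proof -
  let ?B = hyperoctahedral and ?F = "integer_mod_group 2"
  define n where "n = a + b + (k + l)"
  let ?A1 = "wreath_rep a triv_char (specht \<alpha>)" and ?A2 = "wreath_rep b sign_char (specht \<beta>)"
    and ?A3 = "wreath_rep k triv_char (specht \<gamma>)" and ?A4 = "wreath_rep l sign_char (specht \<delta>)"
  have s: "representation (sym_group a) (specht \<alpha>)" "representation (sym_group b) (specht \<beta>)"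
    "representation (sym_group k) (specht \<gamma>)" "representation (sym_group l) (specht \<delta>)"
    using specht_rep sums by blast+
  note r1 = hyp_wreath_rep[OF triv_char_group_char s(1)] and r2 = hyp_wreath_rep[OF sign_char_group_char s(2)]
    and r3 = hyp_wreath_rep[OF triv_char_group_char s(3)] and r4 = hyp_wreath_rep[OF sign_char_group_char s(4)]
  let ?Z1 = "wreath_rep (a + k) triv_char (ind_sym a k (specht \<alpha>) (specht \<gamma>))"
    and ?Z2 = "wreath_rep (b + l) sign_char (ind_sym b l (specht \<beta>) (specht \<delta>))"
  note U1 = bispecht_coind[OF sums(1,2)] and U2 = bispecht_coind[OF sums(3,4)]
  have Z1: "coinduced (?B (a + k)) (?B a \<times>\<times> ?B k) (wreath_embed a k) (?A1 \<boxtimes> ?A3) ?Z1 (\<lambda>F x. F (\<one>\<^bsub>sym_group (a + k)\<^esub>, x))"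
    unfolding hyperoctahedral_def
    by (rule coind_wreath[OF group_integer_mod_group triv_char_group_char s(1,3) ind_sym_coind[OF s(1,3)]])
  have Z2: "coinduced (?B (b + l)) (?B b \<times>\<times> ?B l) (wreath_embed b l) (?A2 \<boxtimes> ?A4) ?Z2 (\<lambda>F x. F (\<one>\<^bsub>sym_group (b + l)\<^esub>, x))"
    unfolding hyperoctahedral_def
    by (rule coind_wreath[OF group_integer_mod_group sign_char_group_char s(2,4) ind_sym_coind[OF s(2,4)]])
  let ?L = "ind_hyp (a + b) (k + l) (bispecht \<alpha> \<beta>) (bispecht \<gamma> \<delta>)"
    and ?R = "ind_hyp (a + k) (b + l) ?Z1 ?Z2"
  have n': "a + k + (b + l) = n" by (simp add: n_def)
  obtain e1 where L: "coinduced (?B n) ((?B a \<times>\<times> ?B b) \<times>\<times> (?B k \<times>\<times> ?B l))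
      (\<lambda>(h1, h2). wreath_embed (a + b) (k + l) (wreath_embed a b h1, wreath_embed k l h2))
      ((?A1 \<boxtimes> ?A2) \<boxtimes> (?A3 \<boxtimes> ?A4)) ?L e1"
    using coind_both[OF ind_hyp_coind[OF coind_rep(1)[OF U1] coind_rep(1)[OF U2]] U1 U2] unfolding n_def by blast
  obtain e2 where R: "coinduced (?B n) ((?B a \<times>\<times> ?B k) \<times>\<times> (?B b \<times>\<times> ?B l))
      (\<lambda>(h1, h2). wreath_embed (a + k) (b + l) (wreath_embed a k h1, wreath_embed b l h2))
      ((?A1 \<boxtimes> ?A3) \<boxtimes> (?A2 \<boxtimes> ?A4)) ?R e2"
    using coind_both[OF ind_hyp_coind[OF coind_rep(1)[OF Z1] coind_rep(1)[OF Z2]] Z1 Z2] unfolding n' by blast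
  define \<theta> :: "(((nat \<Rightarrow> int) \<times> (nat \<Rightarrow> nat)) \<times> ((nat \<Rightarrow> int) \<times> (nat \<Rightarrow> nat))) \<times>
      (((nat \<Rightarrow> int) \<times> (nat \<Rightarrow> nat)) \<times> ((nat \<Rightarrow> int) \<times> (nat \<Rightarrow> nat))) \<Rightarrow> _"
    where "\<theta> = (\<lambda>((x, y), (z, w)). ((x, z), (y, w)))"
  have "rep_iso (?B n) ?L ?R"
  \<comment> \<open>Both sides are coinduced from the same four groups in two orders. The
    conjugating element is the block permutation with trivial F-part, and \<open>mswap\<close>
    identifies the modules.\<close>
  proof (rule coind_iso[OF L R])
    show "(\<lambda>i\<in>{1..n}. \<one>\<^bsub>?F\<^esub>, block_perm a k b) \<in> carrier (?B n)"
      using block_perm_permutes[of a k b l]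
      by (auto simp: hyperoctahedral_def wreath_carrier n_def ac_simps)
    show "\<theta> ` carrier ((?B a \<times>\<times> ?B b) \<times>\<times> (?B k \<times>\<times> ?B l)) = carrier ((?B a \<times>\<times> ?B k) \<times>\<times> (?B b \<times>\<times> ?B l))"
      by (force simp: \<theta>_def image_iff)
    show "linear_on (rep_space ((?A1 \<boxtimes> ?A2) \<boxtimes> (?A3 \<boxtimes> ?A4))) mswap" by (rule mswap_linear)
    show "bij_betw mswap (rep_space ((?A1 \<boxtimes> ?A2) \<boxtimes> (?A3 \<boxtimes> ?A4))) (rep_space ((?A1 \<boxtimes> ?A3) \<boxtimes> (?A2 \<boxtimes> ?A4)))"
      by (rule bij_betw_byWitness[of _ mswap]) (use mswap_mem in auto)
  next
    fix h assume "h \<in> carrier ((?B a \<times>\<times> ?B b) \<times>\<times> (?B k \<times>\<times> ?B l))"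
    then obtain f1 s1 f2 s2 f3 s3 f4 s4 where h: "h = (((f1, s1), (f2, s2)), ((f3, s3), (f4, s4)))"
      and c: "(f1, s1) \<in> carrier (?B a)" "(f2, s2) \<in> carrier (?B b)" "(f3, s3) \<in> carrier (?B k)" "(f4, s4) \<in> carrier (?B l)"
      by auto
    show "(\<lambda>(h1, h2). wreath_embed (a + b) (k + l) (wreath_embed a b h1, wreath_embed k l h2)) h \<otimes>\<^bsub>?B n\<^esub>
        (\<lambda>i\<in>{1..n}. \<one>\<^bsub>?F\<^esub>, block_perm a k b) =
      (\<lambda>i\<in>{1..n}. \<one>\<^bsub>?F\<^esub>, block_perm a k b) \<otimes>\<^bsub>?B n\<^esub>
        (\<lambda>(h1, h2). wreath_embed (a + k) (b + l) (wreath_embed a k h1, wreath_embed b l h2)) (\<theta> h)"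
      unfolding h \<theta>_def split n_def hyperoctahedral_def
      by (rule block_perm_wreath_embed[OF group_integer_mod_group c[unfolded hyperoctahedral_def]])
    fix v assume v: "v \<in> rep_space ((?A1 \<boxtimes> ?A2) \<boxtimes> (?A3 \<boxtimes> ?A4))"
    show "mswap (rep_act ((?A1 \<boxtimes> ?A2) \<boxtimes> (?A3 \<boxtimes> ?A4)) h v) = rep_act ((?A1 \<boxtimes> ?A3) \<boxtimes> (?A2 \<boxtimes> ?A4)) (\<theta> h) (mswap v)"
      unfolding h \<theta>_def split by (rule mswap_act[OF r1 r2 r3 r4 c v])
  qed
  then show ?thesis unfolding n_def .
qed

section \<open>One-dimensional Specht modules\<close>

lemma one_dim_iso:
  assumes R: "representation G R" and \<chi>: "representation G (one_dim \<chi>)"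
    and u: "rep_space R = cfun.span {u}" "u \<noteq> 0" and act: "\<And>g. g \<in> carrier G \<Longrightarrow> rep_act R g u = cscale (\<chi> g) u"
  shows "rep_iso G (one_dim \<chi>) R"
proof -
  define f where "f = (\<lambda>v :: unit \<Rightarrow> complex. cscale (v ()) u)"
  have uR: "u \<in> rep_space R" unfolding u(1) by (simp add: cfun.span_base)
  have "linear_on UNIV f" by (simp add: linear_on_def f_def pointwise algebra_simps)
  moreover have "f v \<in> rep_space R" for v
    unfolding f_def using uR cfun.subspace_scale[OF rep_subspace[OF R]] by blast
  moreover have "f (cscale (\<chi> g) v) = rep_act R g (f v)" if "g \<in> carrier G" for g v
    unfolding f_def linear_on_scale[OF rep_linear[OF R that] uR] act[OF that]
    by (simp add: cscale_def mult_ac)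
  ultimately have "ghom G (one_dim \<chi>) R f" by (simp add: ghom_def one_dim_def)
  moreover have "inj f"
  proof (rule injI)
    fix v w assume "f v = f w"
    then have "v () = w ()" using u(2) by (simp add: f_def)
    then show "v = w" by (simp add: fun_eq_iff)
  qed
  moreover have "w \<in> range f" if w: "w \<in> rep_space R" for w
  proof -
    obtain c where "w = cscale c u" using w unfolding u(1) by (auto simp: cfun.span_singleton)
    then have "w = f (\<lambda>_. c)" by (simp add: f_def)
    then show ?thesis by blast
  qed
  ultimately have "ghom G (one_dim \<chi>) R f" "bij_betw f (rep_space (one_dim \<chi>)) (rep_space R)"
    unfolding bij_betw_def using ghom_closed by (fastforce simp: one_dim_def)+
  then show ?thesis using R \<chi> unfolding rep_iso_iff by blast
qed

lemma specht_one_dim: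
  assumes t: "tableau \<gamma> t" and act: "\<And>g. g permutes {1..sum_list \<gamma>} \<Longrightarrow> perm_act g (polytabloid \<gamma> t) = cscale (\<chi> g) (polytabloid \<gamma> t)"
    and \<chi>: "representation (sym_group (sum_list \<gamma>)) (one_dim \<chi>)"
  shows "rep_iso (sym_group (sum_list \<gamma>)) (one_dim \<chi>) (specht \<gamma>)"
proof (rule one_dim_iso[OF specht_rep \<chi>])
  have "polytabloid \<gamma> t' \<in> cfun.span {polytabloid \<gamma> t}" if t': "tableau \<gamma> t'" for t'
    using polytabloid_transitive[OF t t'] act cfun.span_scale[OF cfun.span_base[of "polytabloid \<gamma> t" "{polytabloid \<gamma> t}"]]
    by (metis insertI1)
  then have "rep_space (specht \<gamma>) \<subseteq> cfun.span {polytabloid \<gamma> t}"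
    unfolding specht_space by (intro cfun.span_minimal) auto
  moreover have "cfun.span {polytabloid \<gamma> t} \<subseteq> rep_space (specht \<gamma>)"
    using polytabloid_specht[OF t] rep_subspace[OF specht_rep] by (intro cfun.span_minimal) auto
  ultimately show "rep_space (specht \<gamma>) = cfun.span {polytabloid \<gamma> t}" by blast
  show "polytabloid \<gamma> t \<noteq> 0" using polytabloid_at[OF t] by (auto simp: zero_fun_apply)
qed (use act in \<open>simp add: specht_act sym_group_carrier\<close>)

lemma sym_char_rep:
  assumes "\<And>g h. g permutes {1..k} \<Longrightarrow> h permutes {1..k} \<Longrightarrow> \<chi> (g \<circ> h) = \<chi> g * \<chi> h" "\<chi> id = 1"
  shows "representation (sym_group k) (one_dim \<chi>)"
  by (rule one_dim_rep) (use assms in \<open>simp_all add: sym_group_is_group sym_group_mult sym_group_one sym_group_carrier\<close>)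

text \<open>With at most one row the column stabilizer is trivial and there is a single tabloid. The
  bound on the length covers (2), (1) and the empty partition together.\<close>

lemma specht_one_row:
  assumes "length \<gamma> \<le> 1"
  shows "rep_iso (sym_group (sum_list \<gamma>)) (one_dim (\<lambda>_. 1)) (specht \<gamma>)"
proof -
  obtain t where t: "tableau \<gamma> t" using tableau_exists .
  have row: "row_of \<gamma> t b = 0" if "tableau \<gamma> t" "b \<in> {1..sum_list \<gamma>}" for t b
    using tableau_pos[OF that] assms by (auto simp: young_diagram_def)
  have C: "column_stabilizer \<gamma> t = {id}" if t: "tableau \<gamma> t" for t
  proof -
    have "\<pi> = id" if p: "\<pi> \<in> column_stabilizer \<gamma> t" for \<pi>
    proof
      fix b
      have pp: "\<pi> permutes {1..sum_list \<gamma>}" using colstab_perm[OF t p] .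
      show "\<pi> b = id b"
      proof (cases "b \<in> {1..sum_list \<gamma>}")
        case True
        then have pb: "\<pi> b \<in> {1..sum_list \<gamma>}" using permutes_in_image[OF pp] by blast
        have "col_of \<gamma> t (\<pi> b) = col_of \<gamma> t b" using p True column_stabilizer_iff[OF t] by blast
        then show ?thesis using tableau_at_pos[OF t True] tableau_at_pos[OF t pb] row[OF t True] row[OF t pb] by simp
      qed (use permutes_not_in[OF pp] in simp)
    qed
    then show ?thesis using colstab_id[OF t] by blast
  qed
  have e: "polytabloid \<gamma> t = delta (row_tabloid (sum_list \<gamma>) (\<lambda>_. 0))" if t: "tableau \<gamma> t" for t
  proof -
    have "tabloid_of \<gamma> t = row_tabloid (sum_list \<gamma>) (\<lambda>_. 0)" unfolding tabloid_of_row_tabloid[OF t] row_tabloid_eq_iff using row[OF t] by blast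
    then show ?thesis unfolding polytabloid_column_antisym column_antisym_def C[OF t] by simp
  qed
  have "perm_act g (polytabloid \<gamma> t) = polytabloid \<gamma> t" if "g permutes {1..sum_list \<gamma>}" for g
    unfolding perm_act_polytabloid[OF t that] using e[OF t] e[OF tableau_comp[OF t that]] by simp
  then show ?thesis by (intro specht_one_dim[OF t]) (auto intro: sym_char_rep)
qed

text \<open>In a single column every permutation is a column permutation, so the antisymmetrizer is
  the same for all tableaux and absorbs g at the cost of its sign.\<close>

lemma specht_sign: "rep_iso (sym_group 2) (one_dim (\<lambda>\<sigma>. of_int (sign \<sigma>))) (specht [1, 1])"
proof -
  let ?\<gamma> = "[1, 1] :: nat list"
  have two: "sum_list ?\<gamma> = 2" by simp
  obtain t where t: "tableau ?\<gamma> t" using tableau_exists .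
  have Y: "j = 0" if "(i, j) \<in> young_diagram ?\<gamma>" for i j
    using that by (auto simp: young_diagram_def less_Suc_eq nth_Cons split: nat.splits)
  have C: "column_stabilizer ?\<gamma> t = {\<pi>. \<pi> permutes {1..sum_list ?\<gamma>}}" if t: "tableau ?\<gamma> t" for t
  proof -
    have "col_of ?\<gamma> t b = 0" if "b \<in> {1..sum_list ?\<gamma>}" for b using Y tableau_pos[OF t that] by blast
    then have "\<pi> \<in> column_stabilizer ?\<gamma> t" if "\<pi> permutes {1..sum_list ?\<gamma>}" for \<pi>
      unfolding column_stabilizer_iff[OF t] using that permutes_in_image[OF that] by simp
    then show ?thesis using colstab_perm[OF t] by blast
  qed
  have "perm_act g (polytabloid ?\<gamma> t) = cscale (of_int (sign g)) (polytabloid ?\<gamma> t)"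
    if g: "g permutes {1..sum_list ?\<gamma>}" for g
  proof -
    let ?d = "delta (tabloid_of ?\<gamma> t)"
    have d: "?d \<in> rep_space (tabloid_rep ?\<gamma>)" using delta_tabloid_rep[OF tabloid_in[OF t]] .
    have "perm_act g (polytabloid ?\<gamma> t) = column_antisym perm_act ?\<gamma> (g \<circ> t) (perm_act g ?d)"
      using column_antisym_translate[OF tabloid_rep_rep t g d] by (simp add: polytabloid_column_antisym)
    also have "\<dots> = column_antisym perm_act ?\<gamma> t (perm_act g ?d)"
      unfolding column_antisym_def using C[OF t] C[OF tableau_comp[OF t g]] by simp
    also have "\<dots> = cscale (of_int (sign g)) (polytabloid ?\<gamma> t)"
      using column_antisym_act[OF tabloid_rep_rep t _ d, of g] g C[OF t] by (simp add: polytabloid_column_antisym)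
    finally show ?thesis .
  qed
  moreover have "representation (sym_group (sum_list ?\<gamma>)) (one_dim (\<lambda>\<sigma>. of_int (sign \<sigma>)))"
  proof (rule sym_char_rep)
    fix g h :: "nat \<Rightarrow> nat" assume "g permutes {1..sum_list ?\<gamma>}" "h permutes {1..sum_list ?\<gamma>}"
    then have "permutation g" "permutation h" using permutation_permutes by blast+
    then show "complex_of_int (sign (g \<circ> h)) = of_int (sign g) * of_int (sign h)" by (simp add: sign_compose)
  qed simp
  ultimately have "rep_iso (sym_group (sum_list ?\<gamma>)) (one_dim (\<lambda>\<sigma>. of_int (sign \<sigma>))) (specht ?\<gamma>)"
    by (rule specht_one_dim[OF t])
  then show ?thesis unfolding two .
qed

text \<open>Composing the evaluation map with the isomorphism shows that the module induced with Q
  also has the universal property for Q'.\<close>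

lemma ind_sym_cong:
  assumes R: "representation (sym_group a) R" and Q: "rep_iso (sym_group k) Q Q'"
  shows "rep_iso (sym_group (a + k)) (ind_sym a k R Q) (ind_sym a k R Q')"
proof -
  have rQ: "representation (sym_group k) Q" "representation (sym_group k) Q'" using Q unfolding rep_iso_iff by auto
  obtain f where f: "ghom (sym_group k) Q Q' f" "bij_betw f (rep_space Q) (rep_space Q')"
    using Q unfolding rep_iso_iff by blast
  have "ghom (sym_group a) R R (\<lambda>v. v)" by (simp add: ghom_def linear_on_def)
  then have "coinduced (sym_group a) (sym_group a) (\<lambda>g. g) R R (\<lambda>v. v)"
    by (rule coind_ghom_bij[OF R R]) (simp add: bij_betw_def inj_on_def)
  from coind_both[OF ind_sym_coind[OF R rQ(1)] this coind_ghom_bij[OF rQ f]]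
  obtain e where "coinduced (sym_group (a + k)) (sym_group a \<times>\<times> sym_group k) (sym_embed a k) (R \<boxtimes> Q') (ind_sym a k R Q) e"
    by (auto simp: case_prod_unfold)
  from coind_same[OF this ind_sym_coind[OF R rQ(2)]] show ?thesis .
qed

text \<open>Bridges the two descriptions of the second factor: a character in
  \<open>ind_summands\<close>, a Specht module in \<open>bispecht\<close>.\<close>

lemma is_sum_ind_specht:
  assumes \<alpha>: "is_partition \<alpha>" and \<gamma>: "sum_list \<gamma> \<le> 2"
    and iso: "rep_iso (sym_group (sum_list \<gamma>)) (one_dim \<chi>) (specht \<gamma>)"
    and \<chi>: "\<And>g h. g permutes {1..sum_list \<gamma>} \<Longrightarrow> h permutes {1..sum_list \<gamma>} \<Longrightarrow> \<chi> (g \<circ> h) = \<chi> g * \<chi> h" "\<chi> id = 1"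
  obtains p where "is_sum (sym_group (sum_list \<alpha> + sum_list \<gamma>)) (ind_summands (sum_list \<gamma>) \<chi> \<alpha>) specht
    (ind_sym (sum_list \<alpha>) (sum_list \<gamma>) (specht \<alpha>) (specht \<gamma>)) p"
proof -
  have c: "\<chi> (g \<circ> h) = \<chi> g * \<chi> h" if "g \<in> carrier (sym_group (sum_list \<gamma>))" "h \<in> carrier (sym_group (sum_list \<gamma>))" for g h
    using \<chi>(1) that by (simp add: sym_group_carrier)
  obtain p where "is_sum (sym_group (sum_list \<alpha> + sum_list \<gamma>)) (ind_summands (sum_list \<gamma>) \<chi> \<alpha>) specht
    (ind_sym (sum_list \<alpha>) (sum_list \<gamma>) (specht \<alpha>) (one_dim \<chi>)) p"
    unfolding ind_sym_def by (rule is_sum_induced_specht[OF \<alpha> \<gamma> c \<chi>(2)])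
  then show ?thesis
    using is_sum_iso[OF _ rep_iso_sym[OF ind_sym_cong[OF specht_rep iso]]] that by blast
qed

text \<open>With an empty second factor, S^\<alpha> itself has the universal property of the induced
  module, the evaluation map being v |-> v \<otimes> 1.\<close>

lemma is_sum_ind_empty:
  obtains p where "is_sum (sym_group (sum_list \<alpha> + 0)) {\<alpha>} specht (ind_sym (sum_list \<alpha>) 0 (specht \<alpha>) (specht [])) p"
proof -
  define m where "m = sum_list \<alpha>"
  let ?Q = "one_dim (\<lambda>_ :: nat \<Rightarrow> nat. 1)"
  have rS: "representation (sym_group m) (specht \<alpha>)" using specht_rep by (simp add: m_def)
  have rQ: "representation (sym_group 0) ?Q" by (rule sym_char_rep) auto
  let ?e = "\<lambda>v :: (nat \<Rightarrow> nat set) \<Rightarrow> complex. ptensor v (\<lambda>_ :: unit. 1)"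
  have e: "?e v \<in> rep_space (specht \<alpha> \<boxtimes> ?Q)" if "v \<in> rep_space (specht \<alpha>)" for v
    using ptensor_mem[OF that, of "\<lambda>_. 1" ?Q] by (simp add: one_dim_def)
  have emb: "sym_embed m 0 (\<sigma>, \<tau>) = \<sigma>" if "\<sigma> permutes {1..m}" for \<sigma> \<tau>
    using permutes_not_in[OF that] by (auto simp: sym_embed_def fun_eq_iff)
  have eact: "?e (perm_act \<sigma> v) = rep_act (specht \<alpha> \<boxtimes> ?Q) (\<sigma>, \<tau>) (?e v)"
    if "\<sigma> \<in> carrier (sym_group m)" "\<tau> \<in> carrier (sym_group 0)" "v \<in> rep_space (specht \<alpha>)" for \<sigma> \<tau> v
    using act_ptensor[OF rS rQ that(1,2,3), of "\<lambda>_. 1"] by (simp add: specht_act one_dim_def)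
  have "coinduced (sym_group (m + 0)) (sym_group m \<times>\<times> sym_group 0) (sym_embed m 0) (specht \<alpha> \<boxtimes> ?Q) (specht \<alpha>) ?e"
  proof (rule coinducedI)
    show "representation (sym_group (m + 0)) (specht \<alpha>)" using rS by simp
    show "representation (sym_group m \<times>\<times> sym_group 0) (specht \<alpha> \<boxtimes> ?Q)" by (rule tensor_rep[OF rS rQ])
    show "sym_embed m 0 \<in> hom (sym_group m \<times>\<times> sym_group 0) (sym_group (m + 0))" by (rule sym_embed_hom)
    show "ghom (sym_group m \<times>\<times> sym_group 0) (res_rep (sym_embed m 0) (specht \<alpha>)) (specht \<alpha> \<boxtimes> ?Q) ?e"
      unfolding ghom_def res_rep_simps
    proof (intro conjI ballI)
      show "linear_on (rep_space (specht \<alpha>)) ?e" by (simp add: linear_on_def ptensor_def pointwise)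
      fix v assume v: "v \<in> rep_space (specht \<alpha>)"
      show "?e v \<in> rep_space (specht \<alpha> \<boxtimes> ?Q)" using e[OF v] .
      fix h assume "h \<in> carrier (sym_group m \<times>\<times> sym_group 0)"
      then obtain \<sigma> \<tau> where h: "h = (\<sigma>, \<tau>)" "\<sigma> \<in> carrier (sym_group m)" "\<tau> \<in> carrier (sym_group 0)" by auto
      show "?e (rep_act (specht \<alpha>) (sym_embed m 0 h) v) = rep_act (specht \<alpha> \<boxtimes> ?Q) h (?e v)"
        using eact[OF h(2,3) v] emb[of \<sigma> \<tau>] h(2) unfolding h(1) by (simp add: specht_act sym_group_carrier)
    qed
    fix \<phi> assume \<phi>: "equivariant (sym_group (m + 0)) (sym_group m \<times>\<times> sym_group 0) (sym_embed m 0) (specht \<alpha> \<boxtimes> ?Q) \<phi>"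
    have id: "id \<in> carrier (sym_group j)" for j by (simp add: sym_group_carrier permutes_id)
    let ?w = "\<lambda>x. \<phi> id (x, ())"
    have w: "?w \<in> rep_space (specht \<alpha>)"
      using tensor_slice1[OF rep_subspace[OF rS], of "\<phi> id" ?Q "()"] \<phi> id unfolding equivariant_def by simp
    have ew: "?e ?w = \<phi> id" by (auto simp: ptensor_def)
    have "?e (rep_act (specht \<alpha>) g ?w) = \<phi> g" if g: "g \<in> carrier (sym_group (m + 0))" for g
    proof -
      have gm: "g \<in> carrier (sym_group m)" using g by simp
      have "\<phi> (sym_embed m 0 (g, id) \<otimes>\<^bsub>sym_group (m + 0)\<^esub> id) = rep_act (specht \<alpha> \<boxtimes> ?Q) (g, id) (\<phi> id)"
        using \<phi> gm id unfolding equivariant_def by auto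
      then show ?thesis
        using eact[OF gm id w] ew emb[of g id] gm by (simp add: specht_act sym_group_mult sym_group_carrier)
    qed
    then show "\<exists>w\<in>rep_space (specht \<alpha>). \<forall>g\<in>carrier (sym_group (m + 0)). ?e (rep_act (specht \<alpha>) g w) = \<phi> g"
      using w by (intro bexI[of _ ?w] ballI)
  next
    fix v w assume v: "v \<in> rep_space (specht \<alpha>)" "w \<in> rep_space (specht \<alpha>)"
      and eq: "\<And>g. g \<in> carrier (sym_group (m + 0)) \<Longrightarrow> ?e (rep_act (specht \<alpha>) g v) = ?e (rep_act (specht \<alpha>) g w)"
    have "?e v = ?e w" using eq[of id] by (simp add: sym_group_carrier permutes_id specht_act)
    then show "v = w" by (auto simp: ptensor_def fun_eq_iff)
  qed
  from coind_same[OF ind_sym_coind[OF rS rQ] this]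
  have iso: "rep_iso (sym_group (m + 0)) (ind_sym m 0 (specht \<alpha>) (specht [])) (specht \<alpha>)"
    using rep_iso_trans rep_iso_sym[OF ind_sym_cong[OF rS, of 0 ?Q "specht []"]] specht_one_row[of "[]"] by simp
  have "is_sum (sym_group (m + 0)) {\<alpha>} specht (specht \<alpha>) (\<lambda>_ v. v)"
    by (rule is_sumI) (use rS in \<open>auto simp: ghom_def linear_on_def\<close>)
  then show ?thesis using is_sum_iso[OF _ iso] that unfolding m_def by blast
qed

lemma ind_summands_facts:
  "finite (ind_summands k \<chi> \<alpha>)" "\<tau> \<in> ind_summands k \<chi> \<alpha> \<Longrightarrow> sum_list \<tau> = sum_list \<alpha> + k"
  by (rule finite_subset[OF _ finite_partitions[of "sum_list \<alpha> + k"]])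
    (auto simp: ind_summands_def Let_def)

section \<open>Assembly of the five decompositions\<close>

lemma ind_bispecht_is_sum:
  assumes sums: "sum_list \<alpha> = a" "sum_list \<beta> = b" "sum_list \<gamma> = k" "sum_list \<delta> = l"
    and E1: "is_sum (sym_group (a + k)) I specht (ind_sym a k (specht \<alpha>) (specht \<gamma>)) p"
    and E2: "is_sum (sym_group (b + l)) J specht (ind_sym b l (specht \<beta>) (specht \<delta>)) q"
    and I: "\<And>\<tau>. \<tau> \<in> I \<Longrightarrow> sum_list \<tau> = a + k" and J: "\<And>\<rho>. \<rho> \<in> J \<Longrightarrow> sum_list \<rho> = b + l"
  obtains P where "is_sum (hyperoctahedral (a + b + (k + l))) (I \<times> J) (\<lambda>(\<tau>, \<rho>). bispecht \<tau> \<rho>)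
    (ind_hyp (a + b) (k + l) (bispecht \<alpha> \<beta>) (bispecht \<gamma> \<delta>)) P"
proof -
  obtain P where "is_sum (hyperoctahedral (a + k + (b + l))) (I \<times> J) (\<lambda>(\<tau>, \<rho>). bispecht \<tau> \<rho>)
    (ind_hyp (a + k) (b + l) (wreath_rep (a + k) triv_char (ind_sym a k (specht \<alpha>) (specht \<gamma>)))
      (wreath_rep (b + l) sign_char (ind_sym b l (specht \<beta>) (specht \<delta>)))) P"
    by (rule bispecht_is_sum[OF E1 E2 I J])
  moreover have "a + k + (b + l) = a + b + (k + l)" by simp
  ultimately show ?thesis using is_sum_iso[OF _ ind_bispecht_iso[OF sums]] that by metis
qed

text \<open>Serves to drop the singleton factor from index sets such as I \<times>
  {\<beta>}.\<close>

lemma is_sum_reindex: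
  assumes V: "is_sum G I R V p" and f: "bij_betw f I' I"
  shows "is_sum G I' (\<lambda>i. R (f i)) V (\<lambda>i. p (f i))"
proof (rule is_sumI[OF is_sum_rep(1)[OF V]])
  have fI: "\<And>i. i \<in> I' \<Longrightarrow> f i \<in> I" using f bij_betwE by blast
  fix i assume "i \<in> I'"
  then show "representation G (R (f i))" "ghom G V (R (f i)) (p (f i))"
    using is_sum_rep(2)[OF V] is_sum_ghom[OF V] fI by auto
next
  fix r assume r: "\<And>i. i \<in> I' \<Longrightarrow> r i \<in> rep_space (R (f i))"
  let ?g = "the_inv_into I' f"
  have g: "?g i \<in> I'" "f (?g i) = i" if "i \<in> I" for i
    using that f bij_betwE[OF bij_betw_the_inv_into[OF f]] f_the_inv_into_f_bij_betw[OF f] by auto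
  have gf: "?g (f i) = i" if "i \<in> I'" for i using f that by (metis bij_betw_imp_inj_on the_inv_into_f_f)
  have "r (?g i) \<in> rep_space (R i)" if "i \<in> I" for i using r[OF g(1)[OF that]] g(2)[OF that] by simp
  then obtain v where "v \<in> rep_space V" "\<forall>i\<in>I. p i v = r (?g i)"
    using is_sum_ex1[OF V, of "\<lambda>i. r (?g i)"] by blast
  then show "\<exists>v\<in>rep_space V. \<forall>i\<in>I'. p (f i) v = r i"
    using f gf bij_betwE by (intro bexI[of _ v]) fastforce+
next
  fix u v assume u: "u \<in> rep_space V" and v: "v \<in> rep_space V" and e: "\<And>i. i \<in> I' \<Longrightarrow> p (f i) u = p (f i) v"
  show "u = v"
  proof (rule is_sum_unique[OF V u v])
    fix i assume "i \<in> I"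
    then obtain j where "j \<in> I'" "i = f j" using f unfolding bij_betw_def by blast
    then show "p i u = p i v" using e by blast
  qed
qed

theorem lemma7p5:
  fixes n :: nat and \<alpha> \<beta> :: "nat list"
  assumes "n \<ge> 4"
    and "is_partition \<alpha>" and "is_partition \<beta>"
    and "sum_list \<alpha> + sum_list \<beta> = n - 2"
  shows "rep_iso (hyperoctahedral n)
           (ind_hyp (n - 2) 2 (bispecht \<alpha> \<beta>) (bispecht [2] []))
           (direct_sum (bar_bar \<alpha>) (\<lambda>\<tau>. bispecht \<tau> \<beta>))
       \<and> rep_iso (hyperoctahedral n)
           (ind_hyp (n - 2) 2 (bispecht \<alpha> \<beta>) (bispecht [1, 1] []))
           (direct_sum (tilde_bar \<alpha>) (\<lambda>\<tau>. bispecht \<tau> \<beta>))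
       \<and> rep_iso (hyperoctahedral n)
           (ind_hyp (n - 2) 2 (bispecht \<alpha> \<beta>) (bispecht [1] [1]))
           (direct_sum (bar \<alpha> \<times> bar \<beta>) (\<lambda>(\<tau>, \<rho>). bispecht \<tau> \<rho>))
       \<and> rep_iso (hyperoctahedral n)
           (ind_hyp (n - 2) 2 (bispecht \<alpha> \<beta>) (bispecht [] [1, 1]))
           (direct_sum (tilde_bar \<beta>) (\<lambda>\<rho>. bispecht \<alpha> \<rho>))
       \<and> rep_iso (hyperoctahedral n)
           (ind_hyp (n - 2) 2 (bispecht \<alpha> \<beta>) (bispecht [] [2]))
           (direct_sum (bar_bar \<beta>) (\<lambda>\<rho>. bispecht \<alpha> \<rho>))"
proof -
  let ?a = "sum_list \<alpha>" and ?b = "sum_list \<beta>"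
  have n: "n - 2 = ?a + ?b" "n = ?a + ?b + 2" using assms(1,4) by auto
  have sgn: "complex_of_int (sign (g \<circ> h)) = of_int (sign g) * of_int (sign h)"
    if "g permutes {1..k}" "h permutes {1..k}" for g h :: "nat \<Rightarrow> nat" and k
    using that sign_compose[of g h] permutation_permutes by (metis finite_atLeastAtMost of_int_mult)
  have two: "\<exists>p. is_sum (sym_group (sum_list \<gamma> + 2)) (bar_bar \<gamma>) specht (ind_sym (sum_list \<gamma>) 2 (specht \<gamma>) (specht [2])) p"
    if \<gamma>: "is_partition \<gamma>" for \<gamma>
    using is_sum_ind_specht[OF \<gamma>, of "[2]" "\<lambda>_. 1"] specht_one_row[of "[2]"] unfolding bar_bar_def by auto
  have sign: "\<exists>p. is_sum (sym_group (sum_list \<gamma> + 2)) (tilde_bar \<gamma>) specht (ind_sym (sum_list \<gamma>) 2 (specht \<gamma>) (specht [1, 1])) p"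
    if \<gamma>: "is_partition \<gamma>" for \<gamma>
  proof -
    have s2: "sum_list [1, 1 :: nat] = 2" by simp
    obtain p where "is_sum (sym_group (sum_list \<gamma> + sum_list [1, 1])) (ind_summands (sum_list [1, 1]) (\<lambda>\<sigma>. of_int (sign \<sigma>)) \<gamma>) specht
        (ind_sym (sum_list \<gamma>) (sum_list [1, 1]) (specht \<gamma>) (specht [1, 1])) p"
    proof (rule is_sum_ind_specht[OF \<gamma>, of "[1, 1]" "\<lambda>\<sigma>. of_int (sign \<sigma>)"])
      show "rep_iso (sym_group (sum_list [1, 1])) (one_dim (\<lambda>\<sigma>. of_int (sign \<sigma>))) (specht [1, 1])"
        unfolding s2 by (rule specht_sign)
    qed (use sgn in auto)
    then show ?thesis unfolding tilde_bar_def s2 by blast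
  qed
  have one: "\<exists>p. is_sum (sym_group (sum_list \<gamma> + 1)) (bar \<gamma>) specht (ind_sym (sum_list \<gamma>) 1 (specht \<gamma>) (specht [1])) p"
    if \<gamma>: "is_partition \<gamma>" for \<gamma>
    using is_sum_ind_specht[OF \<gamma>, of "[1]" "\<lambda>_. 1"] specht_one_row[of "[1]"] unfolding bar_def by auto
  have zero: "\<exists>p. is_sum (sym_group (sum_list \<gamma> + 0)) {\<gamma>} specht (ind_sym (sum_list \<gamma>) 0 (specht \<gamma>) (specht [])) p" for \<gamma>
    using is_sum_ind_empty by blast
  have card: "sum_list \<tau> = sum_list \<gamma> + 2" if "\<tau> \<in> bar_bar \<gamma>" for \<tau> \<gamma> using ind_summands_facts(2)[OF that[unfolded bar_bar_def]] .
  have card': "sum_list \<tau> = sum_list \<gamma> + 2" if "\<tau> \<in> tilde_bar \<gamma>" for \<tau> \<gamma> using ind_summands_facts(2)[OF that[unfolded tilde_bar_def]] .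
  have card1: "sum_list \<tau> = sum_list \<gamma> + 1" if "\<tau> \<in> bar \<gamma>" for \<tau> \<gamma> using ind_summands_facts(2)[OF that[unfolded bar_def]] .
  have fin: "finite (bar_bar \<gamma>)" "finite (tilde_bar \<gamma>)" "finite (bar \<gamma>)" for \<gamma>
    unfolding bar_bar_def tilde_bar_def bar_def by (rule ind_summands_facts(1))+
  \<comment> \<open>The cases in which the second partition of the added pair is empty, so that
    \<beta> is unchanged.\<close>
  have left: "rep_iso (hyperoctahedral n) (ind_hyp (n - 2) 2 (bispecht \<alpha> \<beta>) (bispecht \<gamma> [])) (direct_sum I (\<lambda>\<tau>. bispecht \<tau> \<beta>))"
    if "sum_list \<gamma> = 2" "\<exists>p. is_sum (sym_group (?a + 2)) I specht (ind_sym ?a 2 (specht \<alpha>) (specht \<gamma>)) p"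
      "\<And>\<tau>. \<tau> \<in> I \<Longrightarrow> sum_list \<tau> = ?a + 2" "finite I" for \<gamma> I
  proof -
    obtain p q where p: "is_sum (sym_group (?a + 2)) I specht (ind_sym ?a 2 (specht \<alpha>) (specht \<gamma>)) p"
      and q: "is_sum (sym_group (?b + 0)) {\<beta>} specht (ind_sym ?b 0 (specht \<beta>) (specht [])) q"
      using \<open>\<exists>p. is_sum (sym_group (?a + 2)) I specht (ind_sym ?a 2 (specht \<alpha>) (specht \<gamma>)) p\<close> zero by blast
    obtain P where P: "is_sum (hyperoctahedral (?a + ?b + (2 + 0))) (I \<times> {\<beta>}) (\<lambda>(\<tau>, \<rho>). bispecht \<tau> \<rho>)
      (ind_hyp (?a + ?b) (2 + 0) (bispecht \<alpha> \<beta>) (bispecht \<gamma> [])) P"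
      by (rule ind_bispecht_is_sum[OF refl refl _ _ p q]) (use \<open>sum_list \<gamma> = 2\<close> \<open>\<And>\<tau>. \<tau> \<in> I \<Longrightarrow> _\<close> in auto)
    have bij: "bij_betw (\<lambda>\<tau>. (\<tau>, \<beta>)) I (I \<times> {\<beta>})" by (auto simp: bij_betw_def inj_on_def)
    from is_sum_reindex[OF P bij] have "is_sum (hyperoctahedral (?a + ?b + 2)) I (\<lambda>\<tau>. bispecht \<tau> \<beta>)
      (ind_hyp (?a + ?b) 2 (bispecht \<alpha> \<beta>) (bispecht \<gamma> [])) (\<lambda>i. P ((\<lambda>\<tau>. (\<tau>, \<beta>)) i))"
      by (simp only: add_0_left add_0_right split)
    from is_sum_direct_sum[OF this \<open>finite I\<close>] show ?thesis unfolding n(1) unfolding n(2) .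
  qed
  \<comment> \<open>The mirror image, in which \<alpha> is unchanged.\<close>
  have right: "rep_iso (hyperoctahedral n) (ind_hyp (n - 2) 2 (bispecht \<alpha> \<beta>) (bispecht [] \<gamma>)) (direct_sum I (\<lambda>\<rho>. bispecht \<alpha> \<rho>))"
    if "sum_list \<gamma> = 2" "\<exists>p. is_sum (sym_group (?b + 2)) I specht (ind_sym ?b 2 (specht \<beta>) (specht \<gamma>)) p"
      "\<And>\<tau>. \<tau> \<in> I \<Longrightarrow> sum_list \<tau> = ?b + 2" "finite I" for \<gamma> I
  proof -
    obtain p q where p: "is_sum (sym_group (?b + 2)) I specht (ind_sym ?b 2 (specht \<beta>) (specht \<gamma>)) p"
      and q: "is_sum (sym_group (?a + 0)) {\<alpha>} specht (ind_sym ?a 0 (specht \<alpha>) (specht [])) q"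
      using \<open>\<exists>p. is_sum (sym_group (?b + 2)) I specht (ind_sym ?b 2 (specht \<beta>) (specht \<gamma>)) p\<close> zero by blast
    obtain P where P: "is_sum (hyperoctahedral (?a + ?b + (0 + 2))) ({\<alpha>} \<times> I) (\<lambda>(\<tau>, \<rho>). bispecht \<tau> \<rho>)
      (ind_hyp (?a + ?b) (0 + 2) (bispecht \<alpha> \<beta>) (bispecht [] \<gamma>)) P"
      by (rule ind_bispecht_is_sum[OF refl refl _ _ q p]) (use \<open>sum_list \<gamma> = 2\<close> \<open>\<And>\<tau>. \<tau> \<in> I \<Longrightarrow> _\<close> in auto)
    have bij: "bij_betw (\<lambda>\<rho>. (\<alpha>, \<rho>)) I ({\<alpha>} \<times> I)" by (auto simp: bij_betw_def inj_on_def)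
    from is_sum_reindex[OF P bij] have "is_sum (hyperoctahedral (?a + ?b + 2)) I (\<lambda>\<rho>. bispecht \<alpha> \<rho>)
      (ind_hyp (?a + ?b) 2 (bispecht \<alpha> \<beta>) (bispecht [] \<gamma>)) (\<lambda>i. P ((\<lambda>\<rho>. (\<alpha>, \<rho>)) i))"
      by (simp only: add_0_left add_0_right split)
    from is_sum_direct_sum[OF this \<open>finite I\<close>] show ?thesis unfolding n(1) unfolding n(2) .
  qed
  have mid: "rep_iso (hyperoctahedral n) (ind_hyp (n - 2) 2 (bispecht \<alpha> \<beta>) (bispecht [1] [1]))
      (direct_sum (bar \<alpha> \<times> bar \<beta>) (\<lambda>(\<tau>, \<rho>). bispecht \<tau> \<rho>))"
  proof -
    obtain p q where p: "is_sum (sym_group (?a + 1)) (bar \<alpha>) specht (ind_sym ?a 1 (specht \<alpha>) (specht [1])) p"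
      and q: "is_sum (sym_group (?b + 1)) (bar \<beta>) specht (ind_sym ?b 1 (specht \<beta>) (specht [1])) q"
      using one assms(2,3) by blast
    obtain P where "is_sum (hyperoctahedral (?a + ?b + (1 + 1))) (bar \<alpha> \<times> bar \<beta>) (\<lambda>(\<tau>, \<rho>). bispecht \<tau> \<rho>)
      (ind_hyp (?a + ?b) (1 + 1) (bispecht \<alpha> \<beta>) (bispecht [1] [1])) P"
      by (rule ind_bispecht_is_sum[OF refl refl _ _ p q]) (use card1 in auto)
    then have "is_sum (hyperoctahedral n) (bar \<alpha> \<times> bar \<beta>) (\<lambda>(\<tau>, \<rho>). bispecht \<tau> \<rho>)
      (ind_hyp (n - 2) 2 (bispecht \<alpha> \<beta>) (bispecht [1] [1])) P"
      unfolding n(1) unfolding n(2) one_add_one .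
    then show ?thesis by (rule is_sum_direct_sum) (use fin in auto)
  qed
  show ?thesis
    using left[of "[2]" "bar_bar \<alpha>"] left[of "[1, 1]" "tilde_bar \<alpha>"] mid
      right[of "[1, 1]" "tilde_bar \<beta>"] right[of "[2]" "bar_bar \<beta>"]
      two[OF assms(2)] sign[OF assms(2)] two[OF assms(3)] sign[OF assms(3)] card card' fin
    by auto
qed

end
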